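(* Let $p\in(0,1)$ and let $f_\rho,f_\pi:U\to(0,\infty)$ be two probability densities satisfying the density assumption with exponent $p$ (see context). Let $T$ be the Knothe–Rosenblatt transport pushing forward $\rho$ to $\pi$, and set $b_j:=\max\{\|\psi_{\rho,j}\|_X,\|\psi_{\pi,j}\|_Y\}$, $j\in\mathbb{N}$. There exist $\alpha>0$ and $C>0$ such that the following holds. For $j\in\mathbb{N}$ set $\varrho_j:=1+\frac{\alpha}{b_j}$, and for $\varepsilon>0$ define $$\Lambda_{\varepsilon,k}:=\{\nu\in\mathbb{N}_0^k:\gamma(\varrho,\nu)\ge\varepsilon\}\quad\forall k\in\mathbb{N},\qquad \gamma(\varrho,\nu):=\varrho_k^{-\max\{1,\nu_k\}}\prod_{j=1}^{k-1}\varrho_j^{-\nu_j}\quad(\nu\in\mathbb{N}_0^k).$$ For every $\varepsilon>0$ and each $k\in\mathbb{N}$ there exists a polynomial $p_k=p_{\varepsilon,k}\in\mathbb{P}_{\Lambda_{\varepsilon,k}}$ such that, with $$\tilde T_{\varepsilon,k}(y):=-1+2\,\frac{\int_{-1}^{y_k}(p_{\varepsilon,k}(y_{[k-1]},t)+1)^2\,d\mu(t)}{\int_{-1}^{1}(p_{\varepsilon,k}(y_{[k-1]},t)+1)^2\,d\mu(t)},\qquad y\in U_k,$$ the map $\tilde T_\varepsilon=(\tilde T_{\varepsilon,k})_{k\in\mathbb{N}}:U\to U$ is a monotone triangular bijection. For all $\varepsilon>0$ it holds that $N_\varepsilon:=\sum_{k\in\mathbb{N}}|\Lambda_{\varepsilon,k}|<\infty$,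 $$\sum_{k\in\mathbb{N}}\|T_k-\tilde T_{\varepsilon,k}\|_{L^\infty(U_k)}\le CN_\varepsilon^{-\frac1p+1}\qquad\text{and}\qquad\sum_{k\in\mathbb{N}}\|\partial_kT_k-\partial_k\tilde T_{\varepsilon,k}\|_{L^\infty(U_k)}\le CN_\varepsilon^{-\frac1p+1}.$$
   Context: Notation. $\mathbb{N}=\{1,2,\dots\}$, $\mathbb{N}_0=\{0,1,\dots\}$, $U_k=[-1,1]^k$, $U=[-1,1]^{\mathbb{N}}$ with the product topology. $\lambda$ is Lebesgue measure on $[-1,1]$, $\mu=\bigotimes_{j\in\mathbb{N}}\frac\lambda2$ on $U$ (and $\mu=\bigotimes_{j=1}^k\frac\lambda2$ on $U_k$). $y_{[k]}=(y_1,\dots,y_k)$. $\mathbb{P}_\Lambda=\mathrm{span}\{y^\nu:\nu\in\Lambda\}$ for $\Lambda\subseteq\mathbb{N}_0^k$, $\mathbb{P}_\emptyset=\{0\}$. Conventions: if $b_j=0$ then $\varrho_j=\infty$, with $\infty^{-m}=0$ for $m\ge1$ and $\infty^0=1$; if $N_\varepsilon=0$ the right-hand sides $CN_\varepsilon^{-1/p+1}$ are read as $+\infty$. A map $T=(T_k)_k:U\to U$ is triangular if $T_k$ depends only on $x_1,\dots,x_k$, and monotone if $x_k\mapsto T_k(x_1,\dots,x_k)$ is monotonically increasing for all $k$ and all $x_1,\dots,x_{k-1}$. Density assumption with exponent $p\in(0,1)$: there are real Banach spaces $X,Y$ with complexifications $X_{\mathbb{C}},Y_{\mathbb{C}}$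 and constants $0<M\le L<\infty$, and for each $( *,Z)\in\{(\rho,X),(\pi,Y)\}$ a sequence $(\psi_{*,j})_{j\in\mathbb{N}}\subseteq Z$, an open set $O_*\subseteq Z_{\mathbb{C}}$ and a (complex) differentiable function $\mathfrak{f}_*:O_*\to\mathbb{C}$ such that: (a) $\sum_j\|\psi_{*,j}\|_Z^p<\infty$; (b) $\sum_jy_j\psi_{*,j}\in O_*$ for all $y\in U$; (c) $\mathfrak{f}_*(\sum_jy_j\psi_{*,j})\in\mathbb{R}$ for all $y\in U$; (d) $M\le|\mathfrak{f}_*(\psi)|\le L$ for all $\psi\in O_*$; and $f_*(y)=\mathfrak{f}_*(\sum_jy_j\psi_{*,j})$, $\int_Uf_*\,d\mu=1$. The measures $\rho,\pi$ on $U$ have $\mu$-densities $f_\rho,f_\pi$. Knothe–Rosenblatt transport. For $*\in\{\rho,\pi\}$ set $\hat f_{*,0}=1$, $\hat f_{*,k}(y_{[k]})=\int_Uf_*(y_{[k]},t)\,d\mu(t)$, $f_{*,k}(y_{[k]})=\hat f_{*,k}(y_{[k]})/\hat f_{*,k-1}(y_{[k-1]})$. Let $\rho_1,\pi_1$ be the measures on $U_1$ with $\mu$-densities $\hat f_{\rho,1},\hat f_{\pi,1}$, and $\rho_{k+1}^{y_{[k]}},\pi_{k+1}^{y_{[k]}}$ those with $\mu$-densities $f_{\rho,k+1}(y_{[k]},\cdot),f_{\pi,k+1}(y_{[k]},\cdot)$. $T_1:U_1\to U_1$ is the unique monotonically increasing map with $(T_1)_\sharp\rho_1=\pi_1$,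 and inductively, with $T_{[k]}=(T_j)_{j=1}^k$, $T_{k+1}(y_{[k]},\cdot):U_1\to U_1$ is the unique monotonically increasing map with $(T_{k+1}(y_{[k]},\cdot))_\sharp\rho_{k+1}^{y_{[k]}}=\pi_{k+1}^{T_{[k]}(y_{[k]})}$. $T=(T_k)_{k\in\mathbb{N}}$. *)

theory Defs
  imports "HOL-Probability.Probability"
begin

text \<open>
  Coordinates are numbered from \<open>0\<close>: index \<open>k :: nat\<close> stands for the \<open>(k+1)\<close>-st coordinate in the
  numbering by \<open>{1, 2, \<dots>}\<close>. A point of \<open>[-1,1]\<^sup>k\<close> is an extensional function on \<open>{..<k}\<close>, and the
  component \<open>T k\<close> of a triangular map is a function on \<open>cube (Suc k)\<close>, i.e. of the coordinates
  \<open>0, \<dots>, k\<close>. For \<open>y \<in> cube k\<close> and \<open>t \<in> {-1..1}\<close> the point \<open>(y, t)\<close> of \<open>cube (Suc k)\<close> is \<open>y(k := t)\<close>.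
\<close>

definition cube :: "nat \<Rightarrow> (nat \<Rightarrow> real) set" where
  "cube k = (\<Pi>\<^sub>E j\<in>{..<k}. {-1..1})"

definition cube_inf :: "(nat \<Rightarrow> real) set" where
  "cube_inf = (\<Pi>\<^sub>E j\<in>UNIV. {-1..1})"

definition mu1 :: "real measure" where
  "mu1 = uniform_measure (restrict_space lborel {-1..1}) {-1..1}"

definition mu_fin :: "nat \<Rightarrow> (nat \<Rightarrow> real) measure" where
  "mu_fin k = (\<Pi>\<^sub>M j\<in>{..<k}. mu1)"

definition mu :: "(nat \<Rightarrow> real) measure" where
  "mu = (\<Pi>\<^sub>M j\<in>UNIV. mu1)"

definition Linf_norm :: "nat \<Rightarrow> ((nat \<Rightarrow> real) \<Rightarrow> real) \<Rightarrow> ennreal" where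
  "Linf_norm k g = esssup (mu_fin k) (\<lambda>y. ennreal \<bar>g y\<bar>)"


text \<open>
  The complexification of a real Banach space \<open>'a\<close> is represented by \<open>'a \<times> 'a\<close>, with \<open>(u, v)\<close>
  standing for \<open>u + \<i> v\<close>. The product norm of \<open>'a \<times> 'a\<close> is in general only equivalent to a
  complexification norm such as \<open>sup\<^sub>t \<parallel>cos t u - sin t v\<parallel>\<close>; this is immaterial for openness and
  differentiability, the only notions that refer to it here.
\<close>

definition cplx_scale :: "complex \<Rightarrow> 'a::real_vector \<times> 'a \<Rightarrow> 'a \<times> 'a" where
  "cplx_scale c z = (Re c *\<^sub>R fst z - Im c *\<^sub>R snd z, Re c *\<^sub>R snd z + Im c *\<^sub>R fst z)"

definition cplx_differentiable_on ::
    "('a::real_normed_vector \<times> 'a \<Rightarrow> complex) \<Rightarrow> ('a \<times> 'a) set \<Rightarrow> bool" where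
  "cplx_differentiable_on F S \<longleftrightarrow>
     (\<forall>z\<in>S. \<exists>D. (F has_derivative D) (at z) \<and> (\<forall>c v. D (cplx_scale c v) = c * D v))"

definition density_assumption ::
    "real \<Rightarrow> real \<Rightarrow> real \<Rightarrow> (nat \<Rightarrow> 'a::banach) \<Rightarrow> ('a \<times> 'a) set \<Rightarrow> ('a \<times> 'a \<Rightarrow> complex) \<Rightarrow>
     ((nat \<Rightarrow> real) \<Rightarrow> real) \<Rightarrow> bool" where
  "density_assumption p M L \<psi> S F f \<longleftrightarrow>
     open S \<and> cplx_differentiable_on F S \<and>
     summable (\<lambda>j. norm (\<psi> j) powr p) \<and>
     (\<forall>y\<in>cube_inf. (\<Sum>j. y j *\<^sub>R \<psi> j, 0) \<in> S) \<and>
     (\<forall>y\<in>cube_inf. F (\<Sum>j. y j *\<^sub>R \<psi> j, 0) \<in> \<real>) \<and>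
     (\<forall>z\<in>S. M \<le> cmod (F z) \<and> cmod (F z) \<le> L) \<and>
     (\<forall>y\<in>cube_inf. f y = Re (F (\<Sum>j. y j *\<^sub>R \<psi> j, 0))) \<and>
     (LINT y|mu. f y) = 1"


definition marginal_density :: "((nat \<Rightarrow> real) \<Rightarrow> real) \<Rightarrow> nat \<Rightarrow> (nat \<Rightarrow> real) \<Rightarrow> real" where
  "marginal_density f k y = (if k = 0 then 1 else (LINT t|mu. f (comb_seq k y t)))"

text \<open>
  The distribution of coordinate \<open>k\<close> given the coordinates \<open>y \<in> cube k\<close>; for \<open>k = 0\<close> it is the
  marginal distribution of the first coordinate.
\<close>

definition conditional_measure ::
    "((nat \<Rightarrow> real) \<Rightarrow> real) \<Rightarrow> nat \<Rightarrow> (nat \<Rightarrow> real) \<Rightarrow> real measure" where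
  "conditional_measure f k y =
     density mu1 (\<lambda>t. ennreal (marginal_density f (Suc k) (y(k := t)) / marginal_density f k y))"

definition initial_map ::
    "(nat \<Rightarrow> (nat \<Rightarrow> real) \<Rightarrow> real) \<Rightarrow> nat \<Rightarrow> (nat \<Rightarrow> real) \<Rightarrow> (nat \<Rightarrow> real)" where
  "initial_map T k y = (\<lambda>j\<in>{..<k}. T j (restrict y {..j}))"

definition knothe_rosenblatt ::
    "((nat \<Rightarrow> real) \<Rightarrow> real) \<Rightarrow> ((nat \<Rightarrow> real) \<Rightarrow> real) \<Rightarrow>
     (nat \<Rightarrow> (nat \<Rightarrow> real) \<Rightarrow> real) \<Rightarrow> bool" where
  "knothe_rosenblatt f g T \<longleftrightarrow>
     (\<forall>k. \<forall>y\<in>cube k.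
        (\<lambda>t. T k (y(k := t))) \<in> {-1..1} \<rightarrow> {-1..1} \<and>
        mono_on {-1..1} (\<lambda>t. T k (y(k := t))) \<and>
        distr (conditional_measure f k y) mu1 (\<lambda>t. T k (y(k := t))) =
          conditional_measure g k (initial_map T k y))"


text \<open>
  Since \<open>1 / 0 = \<infinity>\<close> in \<^typ>\<open>ennreal\<close>, \<open>b j = 0\<close> gives \<open>weight \<alpha> b j = \<infinity>\<close> for \<open>\<alpha> > 0\<close>, and powers and
  inverses obey \<open>\<infinity>\<^sup>0 = 1\<close> and \<open>inverse (\<infinity>\<^sup>m) = 0\<close> for \<open>m \<ge> 1\<close>.
\<close>

definition weight :: "real \<Rightarrow> (nat \<Rightarrow> real) \<Rightarrow> nat \<Rightarrow> ennreal" where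
  "weight \<alpha> b j = 1 + ennreal \<alpha> / ennreal (b j)"

definition gamma_weight :: "(nat \<Rightarrow> ennreal) \<Rightarrow> nat \<Rightarrow> (nat \<Rightarrow> nat) \<Rightarrow> ennreal" where
  "gamma_weight r k \<nu> = inverse (r k ^ max 1 (\<nu> k)) * (\<Prod>j<k. inverse (r j ^ \<nu> j))"

definition Lambda :: "(nat \<Rightarrow> ennreal) \<Rightarrow> real \<Rightarrow> nat \<Rightarrow> (nat \<Rightarrow> nat) set" where
  "Lambda r \<epsilon> k = {\<nu>. (\<forall>j>k. \<nu> j = 0) \<and> gamma_weight r k \<nu> \<ge> ennreal \<epsilon>}"

text \<open>The cardinalities are summed in the extended reals, so finiteness is a genuine claim.\<close>

definition N_card :: "(nat \<Rightarrow> ennreal) \<Rightarrow> real \<Rightarrow> ennreal" where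
  "N_card r \<epsilon> = (\<Sum>k. emeasure (count_space UNIV) (Lambda r \<epsilon> k))"

definition rate :: "real \<Rightarrow> real \<Rightarrow> ennreal \<Rightarrow> ennreal" where
  "rate C p N = (if N = 0 then \<infinity> else ennreal (C * enn2real N powr (- 1 / p + 1)))"

definition poly_span :: "nat \<Rightarrow> (nat \<Rightarrow> nat) set \<Rightarrow> ((nat \<Rightarrow> real) \<Rightarrow> real) set" where
  "poly_span k \<Lambda> =
     {\<lambda>y. \<Sum>\<nu>\<in>A. c \<nu> * (\<Prod>j<k. y j ^ \<nu> j) | A c. finite A \<and> A \<subseteq> \<Lambda>}"

definition approx_component ::
    "(nat \<Rightarrow> (nat \<Rightarrow> real) \<Rightarrow> real) \<Rightarrow> nat \<Rightarrow> (nat \<Rightarrow> real) \<Rightarrow> real" where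
  "approx_component P k y =
     - 1 + 2 * ((LINT t:{-1..y k}|mu1. (P k (y(k := t)) + 1)\<^sup>2) /
                (LINT t:{-1..1}|mu1. (P k (y(k := t)) + 1)\<^sup>2))"


definition full_map ::
    "(nat \<Rightarrow> (nat \<Rightarrow> real) \<Rightarrow> real) \<Rightarrow> (nat \<Rightarrow> real) \<Rightarrow> (nat \<Rightarrow> real)" where
  "full_map T y = (\<lambda>k. T k (restrict y {..k}))"

definition triangular :: "((nat \<Rightarrow> real) \<Rightarrow> (nat \<Rightarrow> real)) \<Rightarrow> bool" where
  "triangular F \<longleftrightarrow>
     (\<forall>k. \<forall>x\<in>cube_inf. \<forall>y\<in>cube_inf. (\<forall>j\<le>k. x j = y j) \<longrightarrow> F x k = F y k)"

definition coordinate_monotone :: "((nat \<Rightarrow> real) \<Rightarrow> (nat \<Rightarrow> real)) \<Rightarrow> bool" where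
  "coordinate_monotone F \<longleftrightarrow>
     (\<forall>k. \<forall>x\<in>cube_inf. mono_on {-1..1} (\<lambda>t. F (x(k := t)) k))"

text \<open>Partial derivatives are one-sided at the end points of \<open>[-1,1]\<close>.\<close>

definition has_partial :: "nat \<Rightarrow> ((nat \<Rightarrow> real) \<Rightarrow> real) \<Rightarrow> bool" where
  "has_partial k g \<longleftrightarrow>
     (\<forall>y\<in>cube (Suc k). (\<lambda>t. g (y(k := t))) differentiable (at (y k) within {-1..1}))"

definition partial_deriv :: "nat \<Rightarrow> ((nat \<Rightarrow> real) \<Rightarrow> real) \<Rightarrow> (nat \<Rightarrow> real) \<Rightarrow> real" where
  "partial_deriv k g y =
     vector_derivative (\<lambda>t. g (y(k := t))) (at (y k) within {-1..1})"

end

theory Submission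
  imports Defs "HOL-Complex_Analysis.Complex_Analysis"
begin

text \<open>The \<open>k\<close>-th component of the transport solves an equation between conditional distribution functions, which extend
  holomorphically to a neighbourhood of the cube measured by \<open>\<Sum>j. b j * norm (z j - x j)\<close>. A simplified Newton
  iteration is a contraction there, so the components extend holomorphically one after the other; a discrete Gronwall
  argument keeps the size of the neighbourhood independent of \<open>k\<close>. Hence the root \<open>sqrt (\<partial>\<^sub>k T\<^sub>k) - 1\<close> is holomorphic on
  the product of the ellipse neighbourhoods of radii \<open>\<zeta> j\<close> whenever \<open>\<Sum>j. b j * \<zeta> j < \<delta>'\<close>, and Cauchy's estimate bounds its
  Chebyshev coefficients by \<open>\<Prod>j. (1 + \<zeta> j) powi (- \<nu> j)\<close>. Optimising \<open>\<zeta>\<close> for each multi-index turns the bounds into a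
  multinomial series, whose summability gives \<open>\<ell>\<^sup>p\<close>-summability; indices with \<open>\<nu> k = 0\<close> gain a factor \<open>b k\<close>, since the
  \<open>k\<close>-th component differs from the identity by \<open>O (b k)\<close>. Truncating the Chebyshev series to \<open>\<Lambda>\<close>
  gives the rate by Stechkin's argument, because the map that sends a root to a transport is exact at
  \<open>sqrt (\<partial>\<^sub>k T\<^sub>k) - 1\<close> and Lipschitz; where the truncation error is too large to keep the root positive, the zero
  polynomial serves.\<close>

section \<open>Integration over the interval and one-dimensional Chebyshev expansions\<close>

text \<open>Approximating the root instead of \<open>T\<close> makes the shape constraints
  automatic: for any polynomial \<open>P\<close> with \<open>P + 1 > 0\<close>, squaring
  \<open>P + 1\<close>, integrating and normalising gives an increasing bijection of the interval in
  the last variable. The weight is split as \<open>b j = b j powr p * b j powr (1 - p)\<close>. The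
  second factor is at most a constant times the share of coordinate \<open>j\<close> in
  \<open>\<gamma> powr (1 - p)\<close>; the first is summable and feeds the multinomial series. That
  series needs weights of sum below 1, which only a tail \<open>j \<ge> J\<close> can offer. The
  first \<open>J\<close> coordinates get a fixed geometric ratio instead, and
  \<open>\<alpha>\<close> is chosen small for their sake. Summability over \<open>k\<close> needs
  more than bounds uniform in \<open>k\<close>. The indices with \<open>\<nu> k > 0\<close> are
  sorted by their last nonzero entry, hence disjoint for different \<open>k\<close>, and share one
  series; those with \<open>\<nu> k = 0\<close> recur for every larger \<open>k\<close> and are paid
  for by the factor \<open>b k\<close>. Chebyshev products suit the sup norm, as each normalised
  factor is at most 2, and they expand into monomials with smaller exponents, which stay in the
  downward closed set \<open>\<Lambda>\<close>.\<close>

lemma space_mu1 [simp]: "space mu1 = {-1..1}"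
  by (simp add: mu1_def space_restrict_space)

lemma sets_mu1 [measurable_cong]: "sets mu1 = sets (restrict_space borel {-1..1})"
  unfolding mu1_def by (simp add: sets_restrict_space)

lemma emeasure_lborel_seg: "emeasure (restrict_space lborel {-1..1::real}) {-1..1} = 2"
  by (subst emeasure_restrict_space) auto

lemma prob_space_mu1: "prob_space mu1"
  unfolding mu1_def
  by (rule prob_space_uniform_measure) (auto simp: emeasure_lborel_seg)

interpretation mu1: prob_space mu1
  by (rule prob_space_mu1)

lemma mu1_eq_density: "mu1 = density (restrict_space lborel {-1..1}) (\<lambda>x. ennreal (1/2))"
proof -
  have *: "(1::ennreal) / 2 = ennreal (1/2)"
    by (metis divide_ennreal ennreal_1 ennreal_numeral zero_le_one zero_less_numeral zero_le_numeral)
  show ?thesis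
    unfolding mu1_def uniform_measure_def emeasure_lborel_seg
    by (rule density_cong)
      (auto simp: * space_restrict_space intro!: AE_I2 borel_measurable_divide_ennreal
        borel_measurable_indicator' measurable_restrict_space1)
qed

lemma LINT_mu1:
  fixes g :: "real \<Rightarrow> 'a::{banach, second_countable_topology}"
  assumes "g \<in> borel_measurable mu1"
  shows "(LINT s|mu1. g s) = (1/2) *\<^sub>R set_lebesgue_integral lborel {-1..1} g"
proof -
  have "g \<in> borel_measurable (restrict_space lborel {-1..1})"
    using assms by (simp cong: measurable_cong_sets add: sets_mu1 sets_restrict_space)
  then have "(LINT s|mu1. g s) = (LINT s|restrict_space lborel {-1..1}. (1/2) *\<^sub>R g s)"
    unfolding mu1_eq_density by (intro integral_density) auto
  then show ?thesis
    by (simp add: integral_restrict_space set_lebesgue_integral_def)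
qed

lemma borel_measurable_mu1I:
  fixes g :: "real \<Rightarrow> 'a::topological_space"
  assumes "continuous_on {-1..1} g"
  shows "g \<in> borel_measurable mu1"
  using borel_measurable_continuous_on_restrict[OF assms]
  by (simp cong: measurable_cong_sets add: sets_mu1)

lemma integrable_mu1I:
  fixes g :: "real \<Rightarrow> 'a::{banach, second_countable_topology}"
  assumes "g \<in> borel_measurable mu1" "\<And>s. s \<in> {-1..1} \<Longrightarrow> norm (g s) \<le> B"
  shows "integrable mu1 g"
  using assms by (intro mu1.integrable_const_bound[of _ B]) auto

lemma norm_LINT_le_const:
  fixes g :: "'c \<Rightarrow> 'a::{banach, second_countable_topology}"
  assumes "prob_space M" "\<And>s. s \<in> space M \<Longrightarrow> norm (g s) \<le> B" "0 \<le> B"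
  shows "norm (LINT s|M. g s) \<le> B"
proof (cases "integrable M g")
  case True
  interpret prob_space M by fact
  have "norm (LINT s|M. g s) \<le> (LINT s|M. norm (g s))"
    by (rule integral_norm_bound)
  also have "\<dots> \<le> (LINT s|M. B)"
    using assms True by (intro integral_mono) auto
  also have "\<dots> = B" by (simp add: prob_space)
  finally show ?thesis .
\<comment> \<open>A function that is not integrable has integral 0, so the bound holds by
  \<open>0 \<le> B\<close>.\<close>
qed (use assms in \<open>auto simp: not_integrable_integral_eq\<close>)

lemma LINT_mu1_FTC:
  fixes g :: "real \<Rightarrow> 'a::euclidean_space"
  assumes "\<And>s. s \<in> {-1..1} \<Longrightarrow> (G has_vector_derivative g s) (at s within {-1..1})"
    and "continuous_on {-1..1} g"
  shows "(LINT s|mu1. g s) = (1/2) *\<^sub>R (G 1 - G (-1))"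
proof -
  have "(LBINT s:{-1..1}. g s) = G 1 - G (-1)"
    unfolding set_lebesgue_integral_def using assms by (intro integral_FTC_atLeastAtMost) auto
  then show ?thesis
    using assms(2) by (simp add: LINT_mu1 borel_measurable_mu1I)
qed

text \<open>On the half ball Cauchy's estimate bounds the derivative by \<open>2 * B / R\<close>;
  outside it the trivial bound \<open>2 * B\<close> is already linear in the distance. The explicit
  constant serves twice: as a majorant of difference quotients under an integral and for the
  Lipschitz constant of the densities.\<close>

lemma holomorphic_lipschitz:
  assumes h: "h holomorphic_on ball z0 R" and B: "\<And>z. z \<in> ball z0 R \<Longrightarrow> norm (h z) \<le> B"
    and z: "z \<in> ball z0 R"
  shows "norm (h z - h z0) \<le> 4 * B / R * norm (z - z0)"
proof -
  have R: "R > 0" using z by (auto intro: order.strict_trans1[OF zero_le_dist])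
  have B0: "0 \<le> B" using B[OF z] norm_ge_zero order_trans by blast
  show ?thesis
  proof (cases "norm (z - z0) < R/2")
    case False
    then have "1 \<le> 2 * norm (z - z0) / R" using R by (simp add: field_simps)
    then have "2 * B * 1 \<le> 2 * B * (2 * norm (z - z0) / R)" using B0 by (intro mult_left_mono) auto
    moreover have "norm (h z - h z0) \<le> 2 * B"
      using B[OF z] B[of z0] R norm_triangle_ineq4[of "h z" "h z0"] by auto
    ultimately show ?thesis by (simp add: field_simps)
  next
    case True
    have der: "norm (deriv h w) \<le> B / (R/2)" if "w \<in> ball z0 (R/2)" for w
    proof (rule field_le_epsilon)
      fix e :: real assume "e > 0"
      have sub: "cball w r \<subseteq> ball z0 R" if "r < R/2" for r
      proof
        fix u assume "u \<in> cball w r"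
        then show "u \<in> ball z0 R" using \<open>w \<in> ball z0 (R/2)\<close> that dist_triangle[of z0 u w] by auto
      qed
      have *: "norm (deriv h w) \<le> B / r" if r: "0 < r" "r < R/2" for r
      proof -
        have "norm ((deriv ^^ 1) h w) \<le> fact 1 * B / r ^ 1"
        proof (rule Cauchy_inequality)
          show "h holomorphic_on ball w r"
            using h sub[OF r(2)] ball_subset_cball holomorphic_on_subset by blast
          show "continuous_on (cball w r) h"
            using h sub[OF r(2)] holomorphic_on_imp_continuous_on holomorphic_on_subset by blast
          show "norm (h x) \<le> B" if "norm (w - x) = r" for x
            using sub[OF r(2)] that by (intro B) (auto simp: dist_norm subset_iff)
        qed (use r in auto)
        then show ?thesis by simp
      qed
      \<comment> \<open>Closed discs of radius \<open>r < R/2\<close> about \<open>w\<close> lie in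
        the open ball; the radius \<open>R/2\<close> itself is reached in the limit.\<close>
      have "((\<lambda>r. B / r) \<longlongrightarrow> B / (R/2)) (at_left (R/2))"
        using R by (intro tendsto_intros) auto
      moreover have "eventually (\<lambda>r. norm (deriv h w) \<le> B / r) (at_left (R/2))"
        using R eventually_at_left_field[of _ "R/2"] * by (metis half_gt_zero)
      ultimately have "norm (deriv h w) \<le> B / (R/2)"
        by (intro tendsto_lowerbound[of _ "B / (R/2)" "at_left (R/2)"]) auto
      then show "norm (deriv h w) \<le> B / (R/2) + e" using \<open>e > 0\<close> by linarith
    qed
    have "norm (h z - h z0) \<le> B / (R/2) * norm (z - z0)"
    proof (rule field_differentiable_bound[of "ball z0 (R/2)" h "deriv h"])
      show "(h has_field_derivative deriv h w) (at w within ball z0 (R/2))" if "w \<in> ball z0 (R/2)" for w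
        using h that R by (intro holomorphic_derivI[of h "ball z0 R"]) auto
    qed (use True R der in \<open>auto simp: dist_norm norm_minus_commute\<close>)
    also have "\<dots> \<le> 4 * B / R * norm (z - z0)"
      using B0 R by (intro mult_right_mono) (auto simp: field_simps)
    finally show ?thesis .
  qed
qed

text \<open>Differentiation under the integral along sequences: the Lipschitz bound at
  \<open>z0\<close> dominates the difference quotients, and the derivative is measurable in
  \<open>t\<close> as their pointwise limit.\<close>

lemma holomorphic_on_LINT:
  fixes f :: "complex \<Rightarrow> 'c \<Rightarrow> complex"
  assumes M: "prob_space M" and S: "open S"
    and hol: "\<And>t. t \<in> space M \<Longrightarrow> (\<lambda>s. f s t) holomorphic_on S"
    and bd: "\<And>s t. s \<in> S \<Longrightarrow> t \<in> space M \<Longrightarrow> norm (f s t) \<le> B"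
    and meas: "\<And>s. s \<in> S \<Longrightarrow> (\<lambda>t. f s t) \<in> borel_measurable M"
  shows "(\<lambda>s. LINT t|M. f s t) holomorphic_on S"
  unfolding holomorphic_on_open[OF S]
proof
  interpret prob_space M by fact
  fix z0 assume z0: "z0 \<in> S"
  then obtain R where R: "R > 0" "ball z0 R \<subseteq> S" using S openE by blast
  define D where "D = (LINT t|M. deriv (\<lambda>s. f s t) z0)"
  have int: "integrable M (f s)" if "s \<in> S" for s
    using that bd meas by (intro integrable_const_bound[of _ B]) auto
  have "((\<lambda>z. ((LINT t|M. f z t) - (LINT t|M. f z0 t)) / (z - z0)) \<longlongrightarrow> D) (at z0 within ball z0 R)"
    unfolding tendsto_at_iff_sequentially
  proof (intro allI impI)
    fix X assume X: "\<forall>i. X i \<in> ball z0 R - {z0}" "X \<longlonglongrightarrow> z0"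
    have XS: "X i \<in> S" "X i \<noteq> z0" for i using X R by auto
    define q where "q i t = (f (X i) t - f z0 t) / (X i - z0)" for i t
    have lim: "(\<lambda>i. q i t) \<longlonglongrightarrow> deriv (\<lambda>s. f s t) z0" if t: "t \<in> space M" for t
    proof -
      have "((\<lambda>s. f s t) has_field_derivative deriv (\<lambda>s. f s t) z0) (at z0)"
        using hol[OF t] S z0 holomorphic_derivI by blast
      then have "((\<lambda>z. (f z t - f z0 t) / (z - z0)) \<longlongrightarrow> deriv (\<lambda>s. f s t) z0) (at z0)"
        by (simp add: has_field_derivative_iff)
      then show ?thesis
        using X unfolding tendsto_at_iff_sequentially q_def by (auto simp: o_def)
    qed
    have "(\<lambda>i. LINT t|M. q i t) \<longlonglongrightarrow> D"
      unfolding D_def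
    proof (rule integral_dominated_convergence[where w="\<lambda>_. 4 * B / R"])
      show q: "q i \<in> borel_measurable M" for i
        unfolding q_def using meas[OF XS(1)] meas[OF z0] by measurable
      show "(\<lambda>t. deriv (\<lambda>s. f s t) z0) \<in> borel_measurable M"
        by (rule borel_measurable_LIMSEQ_metric[OF q lim])
      show "AE t in M. norm (q i t) \<le> 4 * B / R" for i
      proof (rule AE_I2)
        fix t assume t: "t \<in> space M"
        have "norm (f (X i) t - f z0 t) \<le> 4 * B / R * norm (X i - z0)"
          using R X t bd hol[OF t] by (intro holomorphic_lipschitz[where h="\<lambda>s. f s t"]) (auto intro: holomorphic_on_subset)
        then show "norm (q i t) \<le> 4 * B / R"
          using XS(2)[of i] by (simp add: q_def norm_divide field_simps)
      qed
    qed (auto intro: AE_I2 lim)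
    moreover have "(LINT t|M. q i t) = ((LINT t|M. f (X i) t) - (LINT t|M. f z0 t)) / (X i - z0)" for i
      unfolding q_def using int[OF XS(1)] int[OF z0] by simp
    ultimately show "((\<lambda>z. ((LINT t|M. f z t) - (LINT t|M. f z0 t)) / (z - z0)) \<circ> X) \<longlonglongrightarrow> D"
      by (simp add: o_def)
  qed
  then have "((\<lambda>s. LINT t|M. f s t) has_field_derivative D) (at z0)"
    using R by (simp add: has_field_derivative_iff at_within_open[of z0 "ball z0 R"])
  then show "\<exists>f'. ((\<lambda>s. LINT t|M. f s t) has_field_derivative f') (at z0)" by blast
qed

lemma sums_LINT:
  fixes f :: "nat \<Rightarrow> 'c \<Rightarrow> complex"
  assumes M: "prob_space M" and meas: "\<And>m. f m \<in> borel_measurable M"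
    and bd: "\<And>m t. t \<in> space M \<Longrightarrow> norm (f m t) \<le> B m" and B: "summable B"
  shows "(\<lambda>m. LINT t|M. f m t) sums (LINT t|M. (\<Sum>m. f m t))"
proof -
  interpret prob_space M by fact
  have int: "integrable M (f m)" for m
    using bd meas by (intro integrable_const_bound[of _ "B m"]) auto
  have "summable (\<lambda>m. LINT t|M. norm (f m t))"
  proof (rule summable_comparison_test'[OF B])
    fix m
    obtain t where "t \<in> space M" using not_empty by auto
    then have "0 \<le> B m" using bd norm_ge_zero order_trans by blast
    then show "norm (LINT t|M. norm (f m t)) \<le> B m"
      using bd by (intro norm_LINT_le_const M) auto
  qed
  moreover have "AE t in M. summable (\<lambda>m. norm (f m t))"
    using bd by (intro AE_I2 summable_comparison_test'[OF B]) auto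
  ultimately show ?thesis using int by (intro sums_integral) auto
qed

section \<open>Neighbourhoods of the interval, Bernstein ellipses and Chebyshev series in one
  variable\<close>

definition segment_nbhd :: "real \<Rightarrow> complex set" where
  "segment_nbhd c = (\<Union>x\<in>{-1..1}. ball (complex_of_real x) c)"

lemma open_segment_nbhd: "open (segment_nbhd c)"
  by (auto simp: segment_nbhd_def)

lemma mem_segment_nbhd: "z \<in> segment_nbhd c \<longleftrightarrow> (\<exists>x\<in>{-1..1}. norm (z - of_real x) < c)"
  by (auto simp: segment_nbhd_def dist_norm norm_minus_commute)

lemma of_real_mem_segment_nbhd: "x \<in> {-1..1} \<Longrightarrow> c > 0 \<Longrightarrow> of_real x \<in> segment_nbhd c"
  unfolding mem_segment_nbhd by (metis cancel_comm_monoid_add_class.diff_cancel norm_zero)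

text \<open>Convexity supplies primitives of holomorphic functions, from which Cauchy's formula on
  the ellipses is derived.\<close>

lemma convex_segment_nbhd: "convex (segment_nbhd c)"
proof (rule convexI)
  fix x y :: complex and u v :: real
  assume "x \<in> segment_nbhd c" "y \<in> segment_nbhd c" and uv: "0 \<le> u" "0 \<le> v" "u + v = 1"
  then obtain a b where ab: "a \<in> {-1..1}" "b \<in> {-1..1}" "norm (x - of_real a) < c" "norm (y - of_real b) < c"
    by (auto simp: mem_segment_nbhd)
  have "norm ((u *\<^sub>R x + v *\<^sub>R y) - of_real (u * a + v * b)) = norm (u *\<^sub>R (x - of_real a) + v *\<^sub>R (y - of_real b))"
    by (simp add: algebra_simps scaleR_conv_of_real)
  also have "\<dots> \<le> u * norm (x - of_real a) + v * norm (y - of_real b)"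
    using norm_triangle_ineq[of "u *\<^sub>R (x - of_real a)" "v *\<^sub>R (y - of_real b)"] uv by simp
  also have "\<dots> < c"
    using convex_bound_lt[OF ab(3,4) uv] .
  finally show "u *\<^sub>R x + v *\<^sub>R y \<in> segment_nbhd c"
    using convexD_alt[of "{-1..1::real}" a b v] ab uv convexD[of "{-1..1::real}" a b u v]
    unfolding mem_segment_nbhd by (intro bexI[of _ "u * a + v * b"]) auto
qed

fun cheb :: "nat \<Rightarrow> real poly" where
  "cheb 0 = 1"
| "cheb (Suc 0) = [:0, 1:]"
| "cheb (Suc (Suc n)) = [:0, 2:] * cheb (Suc n) - cheb n"

lemma degree_cheb: "degree (cheb n) \<le> n"
proof (induction n rule: cheb.induct)
  case (3 n)
  have "degree ([:0, 2:] * cheb (Suc n)) \<le> Suc (Suc n)"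
    using degree_mult_le[of "[:0, 2::real:]" "cheb (Suc n)"] 3 by simp
  then show ?case using 3 by (auto intro: degree_diff_le)
qed auto

lemma poly_cheb_cos: "poly (cheb n) (cos t) = cos (real n * t)"
proof (induction n rule: cheb.induct)
  case (3 n)
  have "cos (real (Suc n) * t + t) + cos (real (Suc n) * t - t) = 2 * cos t * cos (real (Suc n) * t)"
    by (simp add: cos_add cos_diff)
  moreover have "real (Suc n) * t - t = real n * t" "real (Suc n) * t + t = real (Suc (Suc n)) * t"
    by (simp_all add: algebra_simps)
  ultimately show ?case using 3 by simp
qed auto

lemma abs_cheb_le: "x \<in> {-1..1} \<Longrightarrow> \<bar>poly (cheb n) x\<bar> \<le> 1"
  using poly_cheb_cos[of n "arccos x"] by simp

definition cheb_factor :: "nat \<Rightarrow> real" where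
  "cheb_factor m = (if m = 0 then 1 else 2)"

text \<open>Maps the unit circle onto \<open>[-1, 1]\<close> and the circle of radius
  \<open>r > 1\<close> onto the Bernstein ellipse with foci -1 and 1.\<close>

definition joukowski :: "complex \<Rightarrow> complex" where
  "joukowski u = (u + inverse u) / 2"

text \<open>The point at angle \<open>t\<close> is compared with \<open>cos t\<close>, its
  counterpart for radius 1; the distance is at most \<open>((r - 1) + (1 - 1 / r)) / 2\<close>,
  hence at most \<open>r - 1\<close>.\<close>

lemma joukowski_mem:
  assumes "1 \<le> norm u" "norm u - 1 < c"
  shows "joukowski u \<in> segment_nbhd c"
proof -
  define r t where "r = norm u" and "t = Arg u"
  have u: "u = of_real r * exp (\<i> * of_real t)"
    by (metis r_def t_def rcis_cmod_Arg rcis_def cis_conv_exp)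
  have r: "r \<ge> 1" "r - 1 < c" using assms by (auto simp: r_def)
  have "joukowski u - of_real (cos t) = (of_real (r - 1) * exp (\<i> * of_real t) + of_real (inverse r - 1) * exp (- (\<i> * of_real t))) / 2"
    unfolding joukowski_def u using r by (simp add: cos_of_real[symmetric] cos_exp_eq exp_minus field_simps)
  also have "norm \<dots> \<le> (\<bar>r - 1\<bar> + \<bar>inverse r - 1\<bar>) / 2"
    unfolding norm_divide
    by (rule order.trans[OF divide_right_mono[OF norm_triangle_ineq]]) (auto simp: norm_mult simp flip: of_real_diff)
  also have "\<dots> \<le> r - 1"
  proof -
    have "inverse r \<le> 1" using r by (simp add: field_simps)
    moreover have "1 - inverse r = (r - 1) * inverse r" using r by (simp add: field_simps)
    moreover have "(r - 1) * inverse r \<le> (r - 1) * 1"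
      using r calculation(1) by (intro mult_left_mono) auto
    ultimately show ?thesis using r by simp
  qed
  finally have "norm (joukowski u - of_real (cos t)) < c" using r by simp
  then show ?thesis unfolding mem_segment_nbhd by (intro bexI[of _ "cos t"]) auto
qed

text \<open>The Fourier coefficient of \<open>\<lambda>s. h (cos (pi * s))\<close>. It lacks the factor \<open>2\<close> that is usual for \<open>m > 0\<close>;
  that factor is \<open>cheb_factor\<close> and is part of \<open>cheb_prod\<close>.\<close>

definition cheb_coeff :: "nat \<Rightarrow> (complex \<Rightarrow> complex) \<Rightarrow> complex" where
  "cheb_coeff m h = (LINT s|mu1. h (of_real (cos (pi * s))) * exp (- (\<i> * of_real (real m * pi * s))))"

lemma LINT_mu1_exp:
  assumes "m \<noteq> 0"
  shows "(LINT s|mu1. exp (\<i> * of_real (of_int m * pi * s))) = 0"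
proof -
  define a where "a = \<i> * of_real (of_int m * pi)"
  have a: "a \<noteq> 0" using assms by (simp add: a_def)
  have *: "(LINT s|mu1. exp (a * of_real s)) = (1/2) *\<^sub>R (exp (a * of_real 1) / a - exp (a * of_real (-1)) / a)"
  proof (rule LINT_mu1_FTC)
    fix s :: real
    have "((\<lambda>z. exp (a * z) / a) has_field_derivative exp (a * of_real s)) (at (of_real s))"
      using a by (auto intro!: derivative_eq_intros)
    then show "((\<lambda>s. exp (a * of_real s) / a) has_vector_derivative exp (a * of_real s)) (at s within {-1..1})"
      by (rule has_vector_derivative_real_field)
  qed (intro continuous_intros)
  have "a * of_real 1 = a * of_real (-1) + of_int (2 * m) * of_real pi * \<i>"
    by (simp add: a_def algebra_simps)
  then have "exp (a * of_real 1) = exp (a * of_real (-1)) * exp (of_int (2 * m) * of_real pi * \<i>)"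
    by (simp only: exp_add)
  also have "exp (of_int (2 * m) * of_real pi * \<i>) = 1"
    by (subst exp_eq_1) (auto intro!: exI[of _ m])
  finally have E: "exp (a * of_real 1) = exp (a * of_real (-1))" by (simp only: mult_1_right)
  have "(LINT s|mu1. exp (a * of_real s)) = 0" unfolding * E by simp
  then show ?thesis by (simp add: a_def mult_ac)
qed

text \<open>Orthogonality of the cosines. \<open>Re\<close> turns the real polynomial into a
  function on the complex plane; \<open>cheb_coeff\<close> samples it at real points.\<close>

lemma cheb_coeff_cheb:
  "cheb_coeff n (\<lambda>z. of_real (poly (cheb m) (Re z))) = (if m = n then of_real (inverse (cheb_factor m)) else 0)"
proof -
  have eq: "complex_of_real (cos (real m * (pi * s))) * exp (- (\<i> * of_real (real n * pi * s)))
      = (exp (\<i> * of_real (of_int (int m - int n) * pi * s)) + exp (\<i> * of_real (of_int (- int m - int n) * pi * s))) / 2" for s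
    by (simp add: cos_of_real[symmetric] cos_exp_eq field_simps flip: exp_add)
  have int: "integrable mu1 (\<lambda>s. exp (\<i> * of_real (of_int k * pi * s)))" for k
    by (intro integrable_mu1I[of _ 1] borel_measurable_mu1I continuous_intros) (simp add: norm_exp_i_times)
  have "cheb_coeff n (\<lambda>z. of_real (poly (cheb m) (Re z)))
     = ((LINT s|mu1. exp (\<i> * of_real (of_int (int m - int n) * pi * s))) + (LINT s|mu1. exp (\<i> * of_real (of_int (- int m - int n) * pi * s)))) / 2"
    unfolding cheb_coeff_def Re_complex_of_real poly_cheb_cos eq
    using Bochner_Integration.integral_add[OF int[of "int m - int n"] int[of "- int m - int n"]] by simp
  moreover have "(LINT s|mu1. exp (\<i> * of_real (of_int (int m - int n) * pi * s))) = (if m = n then 1 else 0)"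
    using LINT_mu1_exp[of "int m - int n"] by (auto simp: mu1.prob_space[simplified])
  moreover have "(LINT s|mu1. exp (\<i> * of_real (of_int (- int m - int n) * pi * s))) = (if m = 0 \<and> n = 0 then 1 else 0)"
    using LINT_mu1_exp[of "- int m - int n"] by (auto simp: mu1.prob_space[simplified])
  ultimately show ?thesis by (auto simp: cheb_factor_def)
qed

text \<open>With \<open>x\<close> the Joukowski image of \<open>w\<close> on the unit circle, twice
  the \<open>m\<close>-th Chebyshev polynomial at \<open>x\<close> is
  \<open>w ^ m + inverse w ^ m\<close>, so the series is a sum of two geometric ones. The limit is
  the Cauchy kernel \<open>1 / (z - x)\<close> at \<open>z = joukowski u\<close>, times
  \<open>u\<close> and the derivative of \<open>joukowski\<close>, the factor that comes from
  parametrising the ellipse by the angle.\<close>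

lemma cheb_generating:
  fixes w u :: complex and x :: real
  assumes w: "norm w = 1" and u: "norm u > 1" and x: "of_real x = (w + inverse w) / 2"
  shows "(\<lambda>m. of_real (cheb_factor m * poly (cheb m) x) * inverse u ^ m) sums
           ((u - inverse u) / 2 / (joukowski u - of_real x))"
proof -
  have w0: "w \<noteq> 0" "u \<noteq> 0" using w u by auto
  have winv: "norm (inverse w) = 1" using w by (simp add: norm_inverse)
  have cis: "w = cis (Arg w)" using w by (metis rcis_cmod_Arg rcis_def mult_1 of_real_1)
  have "inverse w = cnj w" using w by (metis complex_norm_square complex_div_cnj divide_complex_def inverse_eq_divide mult.commute mult_1 of_real_1 power_one div_by_1)
  then have "complex_of_real x = of_real (Re w)" using x by (simp add: complex_add_cnj)
  then have xr: "x = Re w" by (simp only: of_real_eq_iff)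
  have xc: "x = cos (Arg w)" using xr cis by (metis cis.sel(1))
  have T: "of_real (poly (cheb m) x) = (w ^ m + inverse w ^ m) / 2" for m
  proof -
    have "of_real (poly (cheb m) x) = (cis (real m * Arg w) + cis (- (real m * Arg w))) / 2"
      unfolding xc poly_cheb_cos by (simp add: complex_eq_iff)
    also have "\<dots> = (w ^ m + inverse w ^ m) / 2"
      by (subst (3 4) cis) (simp add: Complex.DeMoivre)
    finally show ?thesis .
  qed
  have lt: "norm (w * inverse u) < 1" "norm (inverse w * inverse u) < 1"
    using w winv u by (simp_all only: norm_mult norm_inverse) (auto intro: inverse_less_1_iff[THEN iffD2])
  \<comment> \<open>At \<open>m = 0\<close> the two series count the constant term twice, while
    \<open>cheb_factor 0 = 1\<close>; hence the correction by 1.\<close>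
  have "(\<lambda>m. (w * inverse u) ^ m + (inverse w * inverse u) ^ m - (if m = 0 then 1 else 0)) sums
     (1 / (1 - w * inverse u) + 1 / (1 - inverse w * inverse u) - 1)"
    by (intro sums_diff sums_add geometric_sums lt sums_single[of 0 "\<lambda>_. 1", simplified])
  moreover have "(w * inverse u) ^ m + (inverse w * inverse u) ^ m - (if m = 0 then 1 else 0) =
      of_real (cheb_factor m * poly (cheb m) x) * inverse u ^ m" for m
    by (simp add: T cheb_factor_def power_mult_distrib algebra_simps)
  moreover have "1 / (1 - w * inverse u) + 1 / (1 - inverse w * inverse u) - 1 =
      (u - inverse u) / 2 / (joukowski u - of_real x)"
  proof -
    have ne: "u - w \<noteq> 0" "u - inverse w \<noteq> 0" using w winv u by auto
    have "1 - w * inverse u = (u - w) / u" "1 - inverse w * inverse u = (u - inverse w) / u"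
      using w0 by (simp_all add: field_simps)
    moreover have "joukowski u - of_real x = (u - w) * (u - inverse w) / (2 * u)"
      unfolding joukowski_def x using w0 by (simp add: field_simps)
    moreover have cancel: "(a / (2 * u)) / (b / (2 * u)) = a / b" for a b using w0 by simp
    moreover have "(u - inverse u) / 2 = (u * u - 1) / (2 * u)" using w0 by (simp add: field_simps)
    ultimately have "(u - inverse u) / 2 / (joukowski u - of_real x) = (u * u - 1) / ((u - w) * (u - inverse w))"
      and "1 / (1 - w * inverse u) + 1 / (1 - inverse w * inverse u) - 1 = u / (u - w) + u / (u - inverse w) - 1"
      using cancel[of "u * u - 1" "(u - w) * (u - inverse w)"] by (simp_all only: divide_divide_eq_right mult_1)
    moreover have "u / (u - w) + u / (u - inverse w) - 1 = (u * u - w * inverse w) / ((u - w) * (u - inverse w))"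
      using ne by (simp add: divide_simps) (simp add: algebra_simps)
    ultimately show ?thesis using w0 by simp
  qed
  ultimately show ?thesis by simp
qed

text \<open>A Laurent coefficient of \<open>h\<close> composed with \<open>joukowski\<close> on the
  circle of radius \<open>r\<close>. For bounded holomorphic \<open>h\<close> it agrees with
  \<open>cheb_coeff\<close> for every admissible \<open>r\<close>, but here the decay in
  \<open>m\<close> is visible.\<close>

definition ellipse_coeff :: "real \<Rightarrow> nat \<Rightarrow> (complex \<Rightarrow> complex) \<Rightarrow> complex" where
  "ellipse_coeff r m h =
     (LINT s|mu1. h (joukowski (of_real r * exp (\<i> * of_real (pi * s)))) * inverse (of_real r * exp (\<i> * of_real (pi * s))) ^ m)"

text \<open>Integrating \<open>h (joukowski u)\<close> against the generating function gives the
  series termwise, and \<open>h x\<close> by Cauchy's formula. The formula is proved by splitting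
  \<open>h\<close> into the constant \<open>h x\<close> and the difference
  \<open>h - h x\<close>.\<close>

lemma ellipse_expansion:
  assumes h: "h holomorphic_on segment_nbhd c" and r: "1 < r" "r < 1 + c"
    and x: "x \<in> {-1..1}"
  shows "(\<lambda>m. of_real (cheb_factor m * poly (cheb m) x) * ellipse_coeff r m h) sums h (of_real x)"
proof -
  define u where "u s = complex_of_real r * exp (\<i> * of_real (pi * s))" for s
  have nu: "norm (u s) = r" for s using r by (simp add: u_def norm_mult)
  have u0: "u s \<noteq> 0" for s using nu[of s] r by auto
  define w where "w = cis (arccos x)"
  have w: "norm w = 1" "of_real x = (w + inverse w) / 2"
    using x by (auto simp: w_def complex_eq_iff)
  have Ju: "joukowski (u s) \<in> segment_nbhd c" for s
    using r by (intro joukowski_mem) (auto simp: nu)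
  have xS: "of_real x \<in> segment_nbhd c" using x r by (intro of_real_mem_segment_nbhd) auto
  define K where "K s = (u s - inverse (u s)) / 2 / (joukowski (u s) - of_real x)" for s
  have Ksums: "(\<lambda>m. of_real (cheb_factor m * poly (cheb m) x) * inverse (u s) ^ m) sums K s" for s
    unfolding K_def using w r by (intro cheb_generating) (auto simp: nu)
  have jne: "joukowski (u s) \<noteq> of_real x" for s
  proof -
    have "joukowski (u s) - of_real x = (u s - w) * (u s - inverse w) / (2 * u s)"
      unfolding joukowski_def w(2) using u0[of s] w(1) by (cases "w = 0") (auto simp: field_simps)
    moreover have "u s \<noteq> w" "u s \<noteq> inverse w" using nu[of s] w(1) r by (auto simp: norm_inverse)
    ultimately show ?thesis using u0[of s] by auto
  qed
  have contu: "continuous_on {-1..1} u" unfolding u_def by (intro continuous_intros)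
  have contJ: "continuous_on {-1..1} (\<lambda>s. joukowski (u s))"
    unfolding joukowski_def using u0 by (intro continuous_intros contu) auto
  have conth: "continuous_on {-1..1} (\<lambda>s. g (joukowski (u s)))" if "g holomorphic_on segment_nbhd c" for g
    using continuous_on_compose2[OF holomorphic_on_imp_continuous_on[OF that] contJ] Ju by auto
  have bd: "\<exists>B. \<forall>s\<in>{-1..1}. norm (g (joukowski (u s))) \<le> B" if "g holomorphic_on segment_nbhd c" for g
    using compact_imp_bounded[OF compact_continuous_image[OF conth[OF that] compact_Icc]]
    by (auto simp: bounded_iff)
  have series: "(\<lambda>m. of_real (cheb_factor m * poly (cheb m) x) * ellipse_coeff r m g) sums (LINT s|mu1. g (joukowski (u s)) * K s)"
    if g: "g holomorphic_on segment_nbhd c" for g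
  proof -
    obtain B where B: "\<And>s. s \<in> {-1..1} \<Longrightarrow> norm (g (joukowski (u s))) \<le> B" using bd[OF g] by blast
    have B0: "0 \<le> B" using B[of 0] norm_ge_zero order_trans by (metis atLeastAtMost_iff le_numeral_extra(1) neg_le_0_iff_le zero_le_one)
    define f where "f m s = g (joukowski (u s)) * (of_real (cheb_factor m * poly (cheb m) x) * inverse (u s) ^ m)" for m s
    have "(\<lambda>m. LINT s|mu1. f m s) sums (LINT s|mu1. (\<Sum>m. f m s))"
    proof (rule sums_LINT[OF prob_space_mu1])
      show "f m \<in> borel_measurable mu1" for m
        unfolding f_def using u0 by (intro borel_measurable_mu1I continuous_intros conth g contu) auto
      show "norm (f m s) \<le> 2 * B * inverse r ^ m" if "s \<in> space mu1" for m s
      proof -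
        have "norm (f m s) = norm (g (joukowski (u s))) * (\<bar>cheb_factor m\<bar> * \<bar>poly (cheb m) x\<bar> * inverse r ^ m)"
          using r by (simp add: f_def norm_mult norm_power norm_inverse nu abs_mult)
        also have "\<dots> \<le> B * (2 * 1 * inverse r ^ m)"
          using that B0 B[of s] abs_cheb_le[OF x] r by (intro mult_mono) (auto simp: cheb_factor_def)
        finally show ?thesis by simp
      qed
      show "summable (\<lambda>m. 2 * B * inverse r ^ m)"
        using r by (intro summable_mult summable_geometric) (auto simp: field_simps)
    qed
    moreover have "(\<Sum>m. f m s) = g (joukowski (u s)) * K s" for s
      unfolding f_def using sums_mult[OF Ksums] sums_unique by metis
    moreover have "(LINT s|mu1. f m s) = of_real (cheb_factor m * poly (cheb m) x) * ellipse_coeff r m g" for m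
      unfolding f_def ellipse_coeff_def u_def[symmetric] by (simp add: mult_ac flip: integral_mult_right_zero)
    ultimately show ?thesis by simp
  qed
  \<comment> \<open>The series for the constant function 1 has a single nonzero coefficient; this
    gives the integral of the kernel without a residue computation.\<close>
  have K1: "(LINT s|mu1. K s) = 1"
  proof -
    have ell: "ellipse_coeff r m (\<lambda>_. 1) = (if m = 0 then 1 else 0)" for m
    proof -
      have "inverse (of_real r * exp (\<i> * of_real (pi * s))) ^ m = inverse (of_real r) ^ m * exp (\<i> * of_real (of_int (- int m) * pi * s))" for s
        by (simp add: power_mult_distrib mult_ac flip: exp_minus exp_of_nat_mult)
      then show ?thesis
        using LINT_mu1_exp[of "- int m"] unfolding ellipse_coeff_def by (auto simp: mu1.prob_space[simplified])
    qed
    have "(\<lambda>m. of_real (cheb_factor m * poly (cheb m) x) * (if m = 0 then 1 else 0)) sums (LINT s|mu1. 1 * K s)"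
      using series[of "\<lambda>_. 1"] by (simp add: ell)
    moreover have "(\<lambda>m. of_real (cheb_factor m * poly (cheb m) x) * (if m = 0 then 1 else 0)) sums (1::complex)"
      using sums_single[of 0 "\<lambda>m. complex_of_real (cheb_factor m * poly (cheb m) x)"]
      by (simp add: cheb_factor_def if_distrib cong: if_cong)
    ultimately show ?thesis using sums_unique2 by fastforce
  qed
  \<comment> \<open>The difference quotient with its removable singularity at \<open>x\<close>
    filled in. Its primitive \<open>P\<close> makes the remaining integrand a total derivative along
    a closed curve.\<close>
  define k where "k z = (if z = of_real x then deriv h (of_real x) else (h z - h (of_real x)) / (z - of_real x))" for z
  have "k holomorphic_on segment_nbhd c"
    unfolding k_def by (rule pole_lemma_open[OF h open_segment_nbhd])
  then obtain P where P: "\<And>z. z \<in> segment_nbhd c \<Longrightarrow> (P has_field_derivative k z) (at z)"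
    using holomorphic_convex_primitive'[OF convex_segment_nbhd open_segment_nbhd, of k]
    by (metis at_within_open open_segment_nbhd)
  have zero: "(LINT s|mu1. (h (joukowski (u s)) - h (of_real x)) * K s) = 0"
  proof -
    define g where "g s = (h (joukowski (u s)) - h (of_real x)) * K s" for s
    have "(LINT s|mu1. g s) = (1/2) *\<^sub>R (P (joukowski (u 1)) / (\<i> * of_real pi) - P (joukowski (u (-1))) / (\<i> * of_real pi))"
    proof (rule LINT_mu1_FTC)
      fix s :: real
      define U where "U z = complex_of_real r * exp (\<i> * (of_real pi * z))" for z
      have Us: "U (of_real s) = u s" by (simp add: U_def u_def)
      have dU: "(U has_field_derivative \<i> * of_real pi * u s) (at (of_real s))"
        unfolding U_def u_def by (auto intro!: derivative_eq_intros)
      have "((\<lambda>z. joukowski (U z)) has_field_derivative (\<i> * of_real pi) * ((u s - inverse (u s)) / 2)) (at (of_real s))"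
        unfolding joukowski_def using u0[of s] dU
        by (auto intro!: derivative_eq_intros dU simp: Us field_simps)
      then have "((\<lambda>z. P (joukowski (U z)) / (\<i> * of_real pi)) has_field_derivative
          k (joukowski (u s)) * ((\<i> * of_real pi) * ((u s - inverse (u s)) / 2)) / (\<i> * of_real pi)) (at (of_real s))"
        using P[OF Ju[of s]] unfolding Us[symmetric]
        by (intro DERIV_cdivide DERIV_chain2[of P])
      moreover have "k (joukowski (u s)) * ((\<i> * of_real pi) * ((u s - inverse (u s)) / 2)) / (\<i> * of_real pi) = g s"
        using jne[of s] by (simp add: k_def g_def K_def)
      ultimately have "((\<lambda>z. P (joukowski (U z)) / (\<i> * of_real pi)) has_field_derivative g s) (at (of_real s))" by simp
      from has_vector_derivative_real_field[OF this]
      show "((\<lambda>s. P (joukowski (u s)) / (\<i> * of_real pi)) has_vector_derivative g s) (at s within {-1..1})"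
        by (simp add: U_def u_def)
      show "continuous_on {-1..1} g"
        unfolding g_def K_def using u0 jne by (intro continuous_intros conth[OF h] contu contJ) auto
    qed
    moreover have "u 1 = u (-1)" by (simp add: u_def exp_minus)
    ultimately show ?thesis by (simp add: g_def)
  qed
  have contK: "continuous_on {-1..1} K" unfolding K_def using u0 jne by (intro continuous_intros contu contJ) auto
  have intI: "integrable mu1 g" if contg: "continuous_on {-1..1} g" for g :: "real \<Rightarrow> complex"
  proof -
    obtain B where "\<And>s. s \<in> {-1..1} \<Longrightarrow> norm (g s) \<le> B"
      using compact_imp_bounded[OF compact_continuous_image[OF contg compact_Icc]] by (force simp: bounded_iff)
    then show ?thesis using contg by (intro integrable_mu1I borel_measurable_mu1I)
  qed
  have "(LINT s|mu1. h (joukowski (u s)) * K s) = (LINT s|mu1. (h (joukowski (u s)) - h (of_real x)) * K s + h (of_real x) * K s)"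
    by (simp add: algebra_simps)
  also have "\<dots> = (LINT s|mu1. (h (joukowski (u s)) - h (of_real x)) * K s) + (LINT s|mu1. h (of_real x) * K s)"
    by (intro Bochner_Integration.integral_add intI continuous_intros conth[OF h] contK)
  also have "\<dots> = h (of_real x)"
    using zero K1 by simp
  finally show ?thesis using series[OF h] by simp
qed

lemma norm_ellipse_coeff_le:
  assumes bd: "\<And>z. z \<in> segment_nbhd c \<Longrightarrow> norm (h z) \<le> B" and r: "1 < r" "r < 1 + c"
  shows "norm (ellipse_coeff r m h) \<le> B * inverse r ^ m"
proof -
  define u where "u s = complex_of_real r * exp (\<i> * of_real (pi * s))" for s
  have nu: "norm (u s) = r" for s using r by (simp add: u_def norm_mult)
  have Ju: "joukowski (u s) \<in> segment_nbhd c" for s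
    using r by (intro joukowski_mem) (auto simp: nu)
  have "0 \<le> B" using bd[OF Ju[of 0]] norm_ge_zero order_trans by blast
  then show ?thesis
    unfolding ellipse_coeff_def u_def[symmetric] using bd[OF Ju] r
    by (intro norm_LINT_le_const prob_space_mu1)
      (auto simp: norm_mult norm_power norm_inverse nu intro!: mult_right_mono)
qed

text \<open>The coefficient samples the interval, where the ellipse expansion converges uniformly;
  in the termwise integral orthogonality keeps a single term. This replaces a deformation of the
  ellipse to the interval.\<close>

lemma cheb_coeff_eq_ellipse_coeff:
  assumes h: "h holomorphic_on segment_nbhd c" and bd: "\<And>z. z \<in> segment_nbhd c \<Longrightarrow> norm (h z) \<le> B"
    and r: "1 < r" "r < 1 + c"
  shows "cheb_coeff n h = ellipse_coeff r n h"
proof -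
  define A where "A m = ellipse_coeff r m h" for m
  define e where "e s = exp (- (\<i> * complex_of_real (real n * pi * s)))" for s
  define f where "f m s = of_real (cheb_factor m * poly (cheb m) (cos (pi * s))) * A m * e s" for m s
  have ne: "norm (e s) = 1" for s unfolding e_def by (simp add: norm_exp_eq_Re)
  have B0: "0 \<le> B"
    using order.trans[OF norm_ge_zero bd[OF of_real_mem_segment_nbhd[of 0 c]]] r by simp
  have fs: "(\<lambda>m. f m s) sums (h (of_real (cos (pi * s))) * e s)" for s
    unfolding f_def A_def using ellipse_expansion[OF h r, of "cos (pi * s)"] by (intro sums_mult2) auto
  have "(\<lambda>m. LINT s|mu1. f m s) sums (LINT s|mu1. (\<Sum>m. f m s))"
  proof (rule sums_LINT[OF prob_space_mu1])
    show "f m \<in> borel_measurable mu1" for m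
      unfolding f_def e_def by (intro borel_measurable_mu1I continuous_intros)
    show "norm (f m s) \<le> 2 * B * inverse r ^ m" for m s
    proof -
      have "norm (f m s) = \<bar>cheb_factor m\<bar> * \<bar>poly (cheb m) (cos (pi * s))\<bar> * norm (A m)"
        by (simp add: f_def norm_mult ne abs_mult)
      also have "\<dots> \<le> 2 * 1 * (B * inverse r ^ m)"
        unfolding A_def using B0 r
        by (intro mult_mono norm_ellipse_coeff_le[OF bd r] abs_cheb_le) (auto simp: cheb_factor_def)
      finally show ?thesis by simp
    qed
    show "summable (\<lambda>m. 2 * B * inverse r ^ m)"
      using r by (intro summable_mult summable_geometric) (auto simp: field_simps)
  qed
  moreover have "(\<Sum>m. f m s) = h (of_real (cos (pi * s))) * e s" for s
    using fs sums_unique by metis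
  moreover have "(LINT s|mu1. f m s) = (if m = n then A n else 0)" for m
  proof -
    have "(LINT s|mu1. f m s) = of_real (cheb_factor m) * A m * cheb_coeff n (\<lambda>z. of_real (poly (cheb m) (Re z)))"
      unfolding f_def cheb_coeff_def e_def by (simp add: mult_ac flip: integral_mult_right_zero)
    then show ?thesis by (auto simp: cheb_coeff_cheb cheb_factor_def)
  qed
  ultimately have "(\<lambda>m. if m = n then A n else 0) sums cheb_coeff n h"
    by (simp add: cheb_coeff_def e_def)
  moreover have "(\<lambda>m. if m = n then A n else 0) sums A n"
    using sums_single[of n "\<lambda>_. A n"] by (simp add: eq_commute)
  ultimately show ?thesis using sums_unique2 by (auto simp: A_def)
qed

lemma norm_cheb_coeff_le:
  assumes h: "h holomorphic_on segment_nbhd c" and bd: "\<And>z. z \<in> segment_nbhd c \<Longrightarrow> norm (h z) \<le> B"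
    and c: "c > 0"
  shows "norm (cheb_coeff m h) \<le> B * inverse (1 + c) ^ m"
proof -
  have "((\<lambda>r. B * inverse r ^ m) \<longlongrightarrow> B * inverse (1 + c) ^ m) (at_left (1 + c))"
    using c by (intro tendsto_intros) auto
  moreover have "eventually (\<lambda>r. norm (cheb_coeff m h) \<le> B * inverse r ^ m) (at_left (1 + c))"
    unfolding eventually_at_left_field
  proof (intro exI[of _ 1] conjI allI impI)
    fix r :: real assume "1 < r" "r < 1 + c"
    then show "norm (cheb_coeff m h) \<le> B * inverse r ^ m"
      using norm_ellipse_coeff_le[where h=h, OF bd] by (simp add: cheb_coeff_eq_ellipse_coeff[OF h bd])
  qed (use c in simp)
  ultimately show ?thesis
    by (intro tendsto_lowerbound[of _ "B * inverse (1 + c) ^ m" "at_left (1 + c)"]) auto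
qed

lemma cheb_expansion:
  assumes h: "h holomorphic_on segment_nbhd c" and bd: "\<And>z. z \<in> segment_nbhd c \<Longrightarrow> norm (h z) \<le> B"
    and c: "c > 0" and x: "x \<in> {-1..1}"
  shows "(\<lambda>m. of_real (cheb_factor m * poly (cheb m) x) * cheb_coeff m h) sums h (of_real x)"
proof -
  obtain r where r: "1 < r" "r < 1 + c" using c by (metis dense less_add_same_cancel1)
  show ?thesis using ellipse_expansion[OF h r x] by (simp add: cheb_coeff_eq_ellipse_coeff[OF h bd r])
qed

section \<open>Chebyshev expansions in several variables\<close>

text \<open>A substitute for holomorphy of functions of several complex variables: holomorphy along all curves with
  holomorphic coordinates is stable under composition and only needs the one-variable theory.\<close>

definition curve_holomorphic_on :: "((nat \<Rightarrow> complex) \<Rightarrow> complex) \<Rightarrow> (nat \<Rightarrow> complex) set \<Rightarrow> bool"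
    (infixl \<open>curve'_holomorphic'_on\<close> 50) where
  "H curve_holomorphic_on A \<longleftrightarrow>
     (\<forall>S w. open S \<longrightarrow> (\<forall>j. (\<lambda>s. w s j) holomorphic_on S) \<longrightarrow> (\<forall>s\<in>S. w s \<in> A) \<longrightarrow>
        (\<lambda>s. H (w s)) holomorphic_on S)"

lemma curve_holomorphic_onI:
  assumes "\<And>S w. open S \<Longrightarrow> (\<And>j. (\<lambda>s. w s j) holomorphic_on S) \<Longrightarrow> (\<And>s. s \<in> S \<Longrightarrow> w s \<in> A) \<Longrightarrow>
     (\<lambda>s. H (w s)) holomorphic_on S"
  shows "H curve_holomorphic_on A"
  using assms unfolding curve_holomorphic_on_def by blast

lemma curve_holomorphic_onD:
  assumes "H curve_holomorphic_on A" "open S" "\<And>j. (\<lambda>s. w s j) holomorphic_on S" "\<And>s. s \<in> S \<Longrightarrow> w s \<in> A"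
  shows "(\<lambda>s. H (w s)) holomorphic_on S"
  using assms unfolding curve_holomorphic_on_def by blast

lemma curve_holomorphic_on_subset:
  "H curve_holomorphic_on A \<Longrightarrow> B \<subseteq> A \<Longrightarrow> H curve_holomorphic_on B"
  unfolding curve_holomorphic_on_def by blast

lemma holomorphic_on_fun_upd:
  assumes "\<And>j. (\<lambda>s. w s j) holomorphic_on S" "f holomorphic_on S"
  shows "(\<lambda>s. ((w s)(i := f s)) j) holomorphic_on S"
  using assms by (cases "j = i") auto

lemma curve_holomorphic_on_section:
  assumes "H curve_holomorphic_on A" "open S" "\<And>s. s \<in> S \<Longrightarrow> z(j := s) \<in> A"
  shows "(\<lambda>s. H (z(j := s))) holomorphic_on S"
  using assms by (intro curve_holomorphic_onD[of H A S "\<lambda>s. z(j := s)"] holomorphic_on_fun_upd) auto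

section \<open>Coefficients and expansions in several variables\<close>

definition poly_nbhd :: "nat \<Rightarrow> (nat \<Rightarrow> real) \<Rightarrow> (nat \<Rightarrow> complex) set" where
  "poly_nbhd n \<zeta> = {z. \<forall>j<n. z j \<in> segment_nbhd (\<zeta> j)}"

definition cheb_coord :: "nat \<Rightarrow> nat \<Rightarrow> ((nat \<Rightarrow> complex) \<Rightarrow> complex) \<Rightarrow> (nat \<Rightarrow> complex) \<Rightarrow> complex" where
  "cheb_coord j m R z = cheb_coeff m (\<lambda>t. R (z(j := t)))"

primrec multi_coeff :: "nat \<Rightarrow> (nat \<Rightarrow> nat) \<Rightarrow> ((nat \<Rightarrow> complex) \<Rightarrow> complex) \<Rightarrow> complex" where
  "multi_coeff 0 \<nu> R = R (\<lambda>_. 0)"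
| "multi_coeff (Suc n) \<nu> R = multi_coeff n \<nu> (cheb_coord n (\<nu> n) R)"

text \<open>Indices are functions on all of \<open>nat\<close>, so that \<open>multi_index k\<close>
  is a subset of \<open>multi_index (Suc k)\<close>; sums in different dimensions can then be
  subtracted from each other.\<close>

definition multi_index :: "nat \<Rightarrow> (nat \<Rightarrow> nat) set" where
  "multi_index n = {\<nu>. \<forall>j\<ge>n. \<nu> j = 0}"

definition cheb_prod :: "nat \<Rightarrow> (nat \<Rightarrow> nat) \<Rightarrow> (nat \<Rightarrow> real) \<Rightarrow> real" where
  "cheb_prod n \<nu> x = (\<Prod>j<n. cheb_factor (\<nu> j) * poly (cheb (\<nu> j)) (x j))"

lemma multi_coeff_cong: "(\<And>j. j < n \<Longrightarrow> \<nu> j = \<nu>' j) \<Longrightarrow> multi_coeff n \<nu> R = multi_coeff n \<nu>' R"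
  by (induction n arbitrary: R) auto

lemma multi_index_0: "multi_index 0 = {\<lambda>_. 0}"
  by (auto simp: multi_index_def)

lemma bij_betw_multi_index_Suc:
  "bij_betw (\<lambda>(m, \<nu>). \<nu>(n := m)) (UNIV \<times> multi_index n) (multi_index (Suc n))"
  by (rule bij_betwI[where g="\<lambda>\<nu>. (\<nu> n, \<nu>(n := 0))"])
     (auto simp: multi_index_def fun_eq_iff le_Suc_eq not_less_eq_eq)

lemma poly_nbhd_upd:
  "z \<in> poly_nbhd n \<zeta> \<Longrightarrow> t \<in> segment_nbhd (\<zeta> n) \<Longrightarrow> z(n := t) \<in> poly_nbhd (Suc n) \<zeta>"
  by (auto simp: poly_nbhd_def less_Suc_eq)

text \<open>A coefficient in coordinate \<open>n\<close> averages \<open>R\<close> over points whose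
  \<open>n\<close>-th coordinate is real. For each value of it the other coordinates still trace a
  holomorphic curve, so the coefficient is a parameter integral of holomorphic functions.\<close>

lemma curve_holomorphic_cheb_coord:
  assumes R: "R curve_holomorphic_on A" and bd: "\<And>z. z \<in> A \<Longrightarrow> norm (R z) \<le> B"
    and upd: "\<And>z t. z \<in> A' \<Longrightarrow> t \<in> segment_nbhd c \<Longrightarrow> z(n := t) \<in> A" and c: "c > 0"
  shows "cheb_coord n m R curve_holomorphic_on A'"
proof (rule curve_holomorphic_onI)
  fix S w assume S: "open S" and w: "\<And>j. (\<lambda>s. w s j) holomorphic_on S" "\<And>s. s \<in> S \<Longrightarrow> w s \<in> A'"
  define e where "e t = exp (- (\<i> * complex_of_real (real m * pi * t)))" for t
  have ne: "norm (e t) = 1" for t unfolding e_def by (simp add: norm_exp_eq_Re)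
  have mem: "(w s)(n := of_real (cos (pi * t))) \<in> A" if "s \<in> S" for s t
    using w(2)[OF that] upd of_real_mem_segment_nbhd[of "cos (pi * t)" c] c by auto
  show "(\<lambda>s. cheb_coord n m R (w s)) holomorphic_on S"
    unfolding cheb_coord_def cheb_coeff_def e_def[symmetric]
  proof (rule holomorphic_on_LINT[OF prob_space_mu1 S, where B=B])
    show "(\<lambda>s. R ((w s)(n := of_real (cos (pi * t)))) * e t) holomorphic_on S" for t
      using mem by (intro holomorphic_intros curve_holomorphic_onD[OF R S] holomorphic_on_fun_upd w) auto
    show "norm (R ((w s)(n := of_real (cos (pi * t)))) * e t) \<le> B" if "s \<in> S" for s t
      using bd[OF mem[OF that]] by (simp add: norm_mult ne)
    show "(\<lambda>t. R ((w s)(n := of_real (cos (pi * t)))) * e t) \<in> borel_measurable mu1" if s: "s \<in> S" for s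
    proof -
      have "(\<lambda>\<tau>. R ((w s)(n := \<tau>))) holomorphic_on segment_nbhd c"
        using upd w(2)[OF s] by (intro curve_holomorphic_on_section[OF R] open_segment_nbhd) auto
      then have "continuous_on (segment_nbhd c) (\<lambda>\<tau>. R ((w s)(n := \<tau>)))"
        by (rule holomorphic_on_imp_continuous_on)
      then have "continuous_on {-1..1} (\<lambda>t. R ((w s)(n := of_real (cos (pi * t)))))"
        by (rule continuous_on_compose2) (use c in \<open>auto intro!: continuous_intros of_real_mem_segment_nbhd\<close>)
      then show ?thesis
        unfolding e_def by (intro borel_measurable_mu1I continuous_intros)
    qed
  qed
qed

lemma norm_cheb_coord_le:
  assumes R: "R curve_holomorphic_on A" and bd: "\<And>z. z \<in> A \<Longrightarrow> norm (R z) \<le> B"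
    and upd: "\<And>t. t \<in> segment_nbhd c \<Longrightarrow> z(n := t) \<in> A" and c: "c > 0"
  shows "norm (cheb_coord n m R z) \<le> B * inverse (1 + c) ^ m"
  unfolding cheb_coord_def using upd bd c
  by (intro norm_cheb_coeff_le curve_holomorphic_on_section[OF R] open_segment_nbhd) auto

text \<open>The one-variable Cauchy bound in the last coordinate is the sup bound that the remaining
  coordinates start from.\<close>

lemma norm_multi_coeff_le:
  assumes "R curve_holomorphic_on poly_nbhd n \<zeta>" "\<And>z. z \<in> poly_nbhd n \<zeta> \<Longrightarrow> norm (R z) \<le> B"
    and "\<And>j. j < n \<Longrightarrow> \<zeta> j > 0"
  shows "norm (multi_coeff n \<nu> R) \<le> B * (\<Prod>j<n. inverse (1 + \<zeta> j) ^ \<nu> j)"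
  using assms
proof (induction n arbitrary: R B)
  case 0
  then show ?case by (simp add: poly_nbhd_def)
next
  case (Suc n)
  have "norm (multi_coeff n \<nu> (cheb_coord n (\<nu> n) R)) \<le> (B * inverse (1 + \<zeta> n) ^ \<nu> n) * (\<Prod>j<n. inverse (1 + \<zeta> j) ^ \<nu> j)"
    using Suc.prems poly_nbhd_upd
    by (intro Suc.IH curve_holomorphic_cheb_coord[of R "poly_nbhd (Suc n) \<zeta>" B _ "\<zeta> n"] norm_cheb_coord_le[of R "poly_nbhd (Suc n) \<zeta>"]) auto
  then show ?case by (simp add: mult_ac)
qed

lemma has_sum_prod_multi_index:
  fixes f :: "nat \<Rightarrow> nat \<Rightarrow> real"
  assumes "\<And>j. j < n \<Longrightarrow> (f j has_sum S j) UNIV" "\<And>j m. j < n \<Longrightarrow> f j m \<ge> 0"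
  shows "((\<lambda>\<nu>. \<Prod>j<n. f j (\<nu> j)) has_sum (\<Prod>j<n. S j)) (multi_index n)"
  using assms
proof (induction n)
  case 0
  then show ?case
    using has_sum_finite[of "{\<lambda>_::nat. 0::nat}" "\<lambda>\<nu>. \<Prod>j<0. f j (\<nu> j)"] by (simp add: multi_index_0)
next
  case (Suc n)
  have IH: "((\<lambda>\<nu>. \<Prod>j<n. f j (\<nu> j)) has_sum (\<Prod>j<n. S j)) (multi_index n)"
    using Suc by auto
  define F where "F = (\<lambda>(m, \<nu>). f n m * (\<Prod>j<n. f j (\<nu> j)))"
  have inner: "((\<lambda>\<nu>. F (m, \<nu>)) has_sum (f n m * (\<Prod>j<n. S j))) (multi_index n)" for m
    unfolding F_def using has_sum_cmult_right[OF IH] by simp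
  have outer: "((\<lambda>m. f n m * (\<Prod>j<n. S j)) has_sum (S n * (\<Prod>j<n. S j))) UNIV"
    using Suc.prems by (intro has_sum_cmult_left) auto
  have "F summable_on (UNIV \<times> multi_index n)"
    by (rule summable_on_SigmaI[OF inner]) (use outer Suc.prems in \<open>auto simp: F_def has_sum_imp_summable intro!: mult_nonneg_nonneg prod_nonneg\<close>)
  then have "(F has_sum (S n * (\<Prod>j<n. S j))) (UNIV \<times> multi_index n)"
    by (intro has_sum_SigmaI[OF inner outer])
  moreover have "F = (\<lambda>z. \<Prod>j<Suc n. f j ((case z of (m, \<nu>) \<Rightarrow> \<nu>(n := m)) j))"
    by (auto simp: F_def fun_eq_iff)
  ultimately have "((\<lambda>z. \<Prod>j<Suc n. f j ((case z of (m, \<nu>) \<Rightarrow> \<nu>(n := m)) j)) has_sum (\<Prod>j<Suc n. S j)) (UNIV \<times> multi_index n)"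
    by (simp only: prod.lessThan_Suc mult.commute)
  then show ?case
    by (rule has_sum_reindex_bij_betw[OF bij_betw_multi_index_Suc, THEN iffD1])
qed

lemma summable_on_geometric_multi_index:
  fixes q :: "nat \<Rightarrow> real"
  assumes "\<And>j. j < n \<Longrightarrow> 0 \<le> q j" "\<And>j. j < n \<Longrightarrow> q j < 1"
  shows "(\<lambda>\<nu>. \<Prod>j<n. c * q j ^ \<nu> j) summable_on multi_index n"
proof -
  have "((\<lambda>\<nu>. \<Prod>j<n. q j ^ \<nu> j) has_sum (\<Prod>j<n. 1 / (1 - q j))) (multi_index n)"
    using assms by (intro has_sum_prod_multi_index sums_nonneg_imp_has_sum geometric_sums) auto
  from has_sum_imp_summable[OF has_sum_cmult_right[OF this, of "c ^ n"]]
  show ?thesis by (simp add: prod.distrib)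
qed

lemma abs_cheb_prod_le:
  assumes "\<And>j. j < n \<Longrightarrow> x j \<in> {-1..1}"
  shows "\<bar>cheb_prod n \<nu> x\<bar> \<le> (\<Prod>j<n. cheb_factor (\<nu> j))"
  unfolding cheb_prod_def abs_prod
proof (rule prod_mono)
  fix j assume "j \<in> {..<n}"
  then show "0 \<le> \<bar>cheb_factor (\<nu> j) * poly (cheb (\<nu> j)) (x j)\<bar> \<and>
        \<bar>cheb_factor (\<nu> j) * poly (cheb (\<nu> j)) (x j)\<bar> \<le> cheb_factor (\<nu> j)"
    using abs_cheb_le[of "x j" "\<nu> j"] assms by (auto simp: abs_mult cheb_factor_def)
qed

text \<open>Induction on the number of variables: the last variable is expanded in one variable,
  each of its coefficient functions by the induction hypothesis. This gives an iterated sum, which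
  absolute summability turns into a sum over multi-indices.\<close>

lemma multi_cheb_expansion:
  assumes "R curve_holomorphic_on poly_nbhd n \<zeta>" "\<And>z. z \<in> poly_nbhd n \<zeta> \<Longrightarrow> norm (R z) \<le> B"
    and "\<And>j. j < n \<Longrightarrow> \<zeta> j > 0" and "\<And>j. j < n \<Longrightarrow> x j \<in> {-1..1}"
    and "\<And>z z'. (\<And>j. j < n \<Longrightarrow> z j = z' j) \<Longrightarrow> R z = R z'"
  shows "((\<lambda>\<nu>. multi_coeff n \<nu> R * of_real (cheb_prod n \<nu> x)) has_sum R (\<lambda>j. of_real (x j))) (multi_index n)"
  using assms
proof (induction n arbitrary: R B)
  case 0
  have "R (\<lambda>_. 0) = R (\<lambda>j. of_real (x j))" using 0(5) by blast
  then show ?case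
    using has_sum_finite[of "{\<lambda>_::nat. 0::nat}" "\<lambda>\<nu>. multi_coeff 0 \<nu> R * of_real (cheb_prod 0 \<nu> x)"]
    by (simp add: multi_index_0 cheb_prod_def)
next
  case (Suc n)
  note R = Suc.prems(1) and bd = Suc.prems(2) and \<zeta> = Suc.prems(3) and x = Suc.prems(4) and dep = Suc.prems(5)
  define X where "X j = complex_of_real (x j)" for j
  have X: "X \<in> poly_nbhd n \<zeta>"
    using x \<zeta> by (auto simp: poly_nbhd_def X_def intro!: of_real_mem_segment_nbhd)
  define a where "a m = complex_of_real (cheb_factor m * poly (cheb m) (x n))" for m
  define F where "F = (\<lambda>(m, \<nu>). a m * (multi_coeff n \<nu> (cheb_coord n m R) * of_real (cheb_prod n \<nu> x)))"
  have B0: "0 \<le> B"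
  proof -
    have "norm (R X) \<le> B" using x \<zeta> by (intro bd) (auto simp: poly_nbhd_def X_def intro!: of_real_mem_segment_nbhd)
    then show ?thesis using norm_ge_zero order_trans by blast
  qed
  have IH: "((\<lambda>\<nu>. multi_coeff n \<nu> (cheb_coord n m R) * of_real (cheb_prod n \<nu> x)) has_sum cheb_coord n m R X) (multi_index n)" for m
    unfolding X_def
  proof (rule Suc.IH)
    show "cheb_coord n m R curve_holomorphic_on poly_nbhd n \<zeta>"
      using R bd \<zeta> poly_nbhd_upd by (intro curve_holomorphic_cheb_coord[of R "poly_nbhd (Suc n) \<zeta>" B _ "\<zeta> n"]) auto
    show "norm (cheb_coord n m R z) \<le> B * inverse (1 + \<zeta> n) ^ m" if "z \<in> poly_nbhd n \<zeta>" for z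
      using R bd \<zeta> poly_nbhd_upd that by (intro norm_cheb_coord_le[of R "poly_nbhd (Suc n) \<zeta>"]) auto
    show "cheb_coord n m R z = cheb_coord n m R z'" if "\<And>j. j < n \<Longrightarrow> z j = z' j" for z z'
    proof -
      have "R (z(n := t)) = R (z'(n := t))" for t
        by (rule dep) (use that in \<open>auto simp: less_Suc_eq\<close>)
      then show ?thesis by (simp add: cheb_coord_def)
    qed
  qed (use \<zeta> x in auto)
  have inner: "((\<lambda>\<nu>. F (m, \<nu>)) has_sum (a m * cheb_coord n m R X)) (multi_index n)" for m
    unfolding F_def using has_sum_cmult_right[OF IH] by simp
  have na: "norm (a m) \<le> 2" for m
    using abs_cheb_le[OF x[of n], of m] by (auto simp: a_def abs_mult cheb_factor_def)
  have outer: "((\<lambda>m. a m * cheb_coord n m R X) has_sum R X) UNIV"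
  proof (rule norm_summable_imp_has_sum)
    have "(\<lambda>m. a m * cheb_coord n m R X) sums R (X(n := of_real (x n)))"
      unfolding a_def cheb_coord_def
      using bd x \<zeta> poly_nbhd_upd[OF X]
      by (intro cheb_expansion[of "\<lambda>t. R (X(n := t))" "\<zeta> n" B] curve_holomorphic_on_section[OF R] open_segment_nbhd) auto
    then show "(\<lambda>m. a m * cheb_coord n m R X) sums R X" by (simp add: X_def fun_upd_idem)
    show "summable (\<lambda>m. norm (a m * cheb_coord n m R X))"
    proof (rule summable_comparison_test')
      show "summable (\<lambda>m. 2 * B * inverse (1 + \<zeta> n) ^ m)"
        using \<zeta>[of n] by (intro summable_mult summable_geometric) (auto simp: field_simps)
      show "norm (norm (a m * cheb_coord n m R X)) \<le> 2 * B * inverse (1 + \<zeta> n) ^ m" if "m \<ge> 0" for m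
      proof -
        have "norm (cheb_coord n m R X) \<le> B * inverse (1 + \<zeta> n) ^ m"
          using R bd \<zeta> poly_nbhd_upd X by (intro norm_cheb_coord_le[of R "poly_nbhd (Suc n) \<zeta>"]) auto
        then have "norm (a m) * norm (cheb_coord n m R X) \<le> 2 * (B * inverse (1 + \<zeta> n) ^ m)"
          using na[of m] by (intro mult_mono) auto
        then show ?thesis by (simp add: norm_mult)
      qed
    qed
  qed
  have Feq: "F = (\<lambda>z. (\<lambda>\<nu>. multi_coeff (Suc n) \<nu> R * of_real (cheb_prod (Suc n) \<nu> x)) (case z of (m, \<nu>) \<Rightarrow> \<nu>(n := m)))"
  proof
    fix z :: "nat \<times> (nat \<Rightarrow> nat)"
    obtain m \<nu> where z: "z = (m, \<nu>)" by (cases z)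
    have "multi_coeff n (\<nu>(n := m)) (cheb_coord n m R) = multi_coeff n \<nu> (cheb_coord n m R)"
      by (rule multi_coeff_cong) auto
    then show "F z = multi_coeff (Suc n) (case z of (m, \<nu>) \<Rightarrow> \<nu>(n := m)) R *
        of_real (cheb_prod (Suc n) (case z of (m, \<nu>) \<Rightarrow> \<nu>(n := m)) x)"
      by (simp add: F_def z cheb_prod_def a_def mult_ac)
  qed
  \<comment> \<open>The majorant is the Cauchy bound times 2 for each normalised Chebyshev factor, a
    product of geometric series with ratios below 1.\<close>
  have "(\<lambda>\<nu>. norm (multi_coeff (Suc n) \<nu> R * of_real (cheb_prod (Suc n) \<nu> x))) summable_on multi_index (Suc n)"
  proof (rule Infinite_Sum.abs_summable_on_comparison_test)
    show "(\<lambda>\<nu>. norm (B * (\<Prod>j<Suc n. 2 * inverse (1 + \<zeta> j) ^ \<nu> j))) summable_on multi_index (Suc n)"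
      using \<zeta> by (subst summable_on_iff_abs_summable_on_real[symmetric], intro summable_on_cmult_right summable_on_geometric_multi_index)
        (auto intro!: inverse_less_1_iff[THEN iffD2] simp: less_imp_le add_pos_pos)
    fix \<nu>
    have "norm (multi_coeff (Suc n) \<nu> R * of_real (cheb_prod (Suc n) \<nu> x))
       \<le> (B * (\<Prod>j<Suc n. inverse (1 + \<zeta> j) ^ \<nu> j)) * (\<Prod>j<Suc n. 2)"
      unfolding norm_mult norm_of_real
    proof (intro mult_mono norm_multi_coeff_le R bd \<zeta>)
      have "\<bar>cheb_prod (Suc n) \<nu> x\<bar> \<le> (\<Prod>j<Suc n. cheb_factor (\<nu> j))" using x by (intro abs_cheb_prod_le) auto
      also have "\<dots> \<le> (\<Prod>j<Suc n. 2)" by (intro prod_mono) (auto simp: cheb_factor_def)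
      finally show "\<bar>cheb_prod (Suc n) \<nu> x\<bar> \<le> (\<Prod>j<Suc n. 2)" .
      show "0 \<le> B * (\<Prod>j<Suc n. inverse (1 + \<zeta> j) ^ \<nu> j)"
        using \<zeta> B0 by (intro mult_nonneg_nonneg prod_nonneg) (auto simp: less_imp_le add_pos_pos)
    qed auto
    also have "\<dots> = B * (\<Prod>j<Suc n. 2 * inverse (1 + \<zeta> j) ^ \<nu> j)"
      by (simp only: prod.distrib mult_ac)
    also have "\<dots> \<le> norm \<dots>" by simp
    finally show "norm (multi_coeff (Suc n) \<nu> R * of_real (cheb_prod (Suc n) \<nu> x)) \<le> norm (B * (\<Prod>j<Suc n. 2 * inverse (1 + \<zeta> j) ^ \<nu> j))" .
  qed
  then have "(\<lambda>\<nu>. multi_coeff (Suc n) \<nu> R * of_real (cheb_prod (Suc n) \<nu> x)) summable_on multi_index (Suc n)"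
    by (rule abs_summable_summable)
  then have "F summable_on (UNIV \<times> multi_index n)"
    unfolding Feq by (rule summable_on_reindex_bij_betw[OF bij_betw_multi_index_Suc, THEN iffD2])
  then have "(F has_sum R X) (UNIV \<times> multi_index n)"
    by (intro has_sum_SigmaI[OF inner outer])
  then show ?case
    unfolding Feq X_def by (rule has_sum_reindex_bij_betw[OF bij_betw_multi_index_Suc, THEN iffD1])
qed

section \<open>Summability of the coefficient bounds\<close>

lemma negative_binomial_sums:
  fixes t :: real
  assumes "0 \<le> t" "t < 1"
  shows "(\<lambda>m. real ((N + m) choose m) * t ^ m) sums (1 / (1 - t) ^ Suc N)"
proof -
  have "(\<lambda>m. ((- real (Suc N)) gchoose m) * (- t) ^ m) sums (1 + (- t)) powr (- real (Suc N))"
    using assms by (intro gen_binomial_real) auto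
  moreover have "((- real (Suc N)) gchoose m) * (- t) ^ m = real ((N + m) choose m) * t ^ m" for m
  proof -
    have "((- real (Suc N)) gchoose m) = (-1) ^ m * real ((N + m) choose m)"
      by (subst gbinomial_minus) (simp add: binomial_gbinomial)
    moreover have "(- t) ^ m = (-1) ^ m * t ^ m" by (rule power_minus)
    moreover have "(-1) ^ m * (-1) ^ m = (1::real)" by (simp flip: power_mult_distrib)
    ultimately show ?thesis by (metis (no_types, opaque_lifting) mult.assoc mult.commute mult_1)
  qed
  moreover have "(1 + (- t)) powr (- real (Suc N)) = 1 / (1 - t) ^ Suc N"
    using assms by (simp add: powr_minus powr_realpow divide_inverse del: of_nat_Suc power_Suc)
  ultimately show ?thesis by simp
qed

definition multinom_weight :: "nat \<Rightarrow> (nat \<Rightarrow> real) \<Rightarrow> nat \<Rightarrow> (nat \<Rightarrow> nat) \<Rightarrow> real" where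
  "multinom_weight J d n \<nu> =
     fact (\<Sum>j\<in>{J..<n}. \<nu> j) / (\<Prod>j\<in>{J..<n}. fact (\<nu> j)) * (\<Prod>j<n. d j ^ \<nu> j)"

lemma multinom_weight_nonneg: "(\<And>j. j < n \<Longrightarrow> d j \<ge> 0) \<Longrightarrow> multinom_weight J d n \<nu> \<ge> 0"
  unfolding multinom_weight_def by (intro mult_nonneg_nonneg divide_nonneg_nonneg prod_nonneg) auto

lemma multinom_weight_Suc_0: "\<nu> n = 0 \<Longrightarrow> multinom_weight J d (Suc n) \<nu> = multinom_weight J d n \<nu>"
  by (cases "J \<le> n") (simp_all add: multinom_weight_def atLeastLessThanSuc)

text \<open>For \<open>J = 0\<close> this is the multinomial series \<open>\<Sum>\<^sub>m (\<Sum>\<^sub>j d j) ^ m\<close>; the first \<open>J\<close> coordinates carry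
  plain geometric series instead, so that no smallness is required of \<open>d 0, \<dots>, d (J - 1)\<close>.\<close>

lemma has_sum_multinom_weight:
  assumes "\<And>j. j < n \<Longrightarrow> 0 \<le> d j" "\<And>j. j < n \<Longrightarrow> j < J \<Longrightarrow> d j < 1" "(\<Sum>j\<in>{J..<n}. d j) < 1"
  shows "(multinom_weight J d n has_sum ((\<Prod>j<min n J. 1 / (1 - d j)) / (1 - (\<Sum>j\<in>{J..<n}. d j)))) (multi_index n)"
  using assms
proof (induction n arbitrary: d)
  case 0
  then show ?case
    using has_sum_finite[of "{\<lambda>_::nat. 0::nat}" "multinom_weight J d 0"]
    by (simp add: multi_index_0) (simp add: multinom_weight_def)
next
  case (Suc n)
  \<comment> \<open>The pair is ordered the other way round than in
    \<open>bij_betw_multi_index_Suc\<close>, because here the inner sum runs over the last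
    entry.\<close>
  have bij: "bij_betw (\<lambda>(\<nu>, m). \<nu>(n := m)) (multi_index n \<times> UNIV) (multi_index (Suc n))"
    by (rule bij_betwI[where g="\<lambda>\<nu>. (\<nu>(n := 0), \<nu> n)"])
       (auto simp: multi_index_def fun_eq_iff le_Suc_eq not_less_eq_eq)
  define G where "G = (\<lambda>z. multinom_weight J d (Suc n) ((\<lambda>(\<nu>, m). \<nu>(n := m)) z))"
  have dn: "0 \<le> d n" using Suc.prems by auto
  have Gpos: "G z \<ge> 0" for z
    unfolding G_def using Suc.prems by (intro multinom_weight_nonneg) auto
  have key: "(G has_sum S) (multi_index n \<times> UNIV) \<Longrightarrow> (multinom_weight J d (Suc n) has_sum S) (multi_index (Suc n))" for S
    unfolding G_def by (rule has_sum_reindex_bij_betw[OF bij, THEN iffD1])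
  show ?case
  proof (cases "n < J")
    case True
    have G: "G (\<nu>, m) = multinom_weight J d n \<nu> * d n ^ m" for \<nu> m
      using True by (simp add: G_def multinom_weight_def)
    have inner: "((\<lambda>m. G (\<nu>, m)) has_sum (multinom_weight J d n \<nu> * (1 / (1 - d n)))) UNIV" for \<nu>
      unfolding G using Suc.prems True dn by (intro has_sum_cmult_right sums_nonneg_imp_has_sum geometric_sums) auto
    have outer: "((\<lambda>\<nu>. multinom_weight J d n \<nu> * (1 / (1 - d n))) has_sum
        (((\<Prod>j<min n J. 1 / (1 - d j)) / (1 - (\<Sum>j\<in>{J..<n}. d j))) * (1 / (1 - d n)))) (multi_index n)"
      using Suc.prems True by (intro has_sum_cmult_left Suc.IH) auto
    have "G summable_on (multi_index n \<times> UNIV)"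
      by (rule summable_on_SigmaI[OF inner]) (use outer Gpos in \<open>auto simp: has_sum_imp_summable\<close>)
    then have "(G has_sum (((\<Prod>j<min n J. 1 / (1 - d j)) / (1 - (\<Sum>j\<in>{J..<n}. d j))) * (1 / (1 - d n)))) (multi_index n \<times> UNIV)"
      by (intro has_sum_SigmaI[OF inner outer])
    from key[OF this] show ?thesis using True by (simp add: min_def mult_ac)
  next
    case False
    define t where "t = d n"
    have sumd: "(\<Sum>j\<in>{J..<Suc n}. d j) = (\<Sum>j\<in>{J..<n}. d j) + t" using False by (simp add: t_def)
    have sum0: "0 \<le> (\<Sum>j\<in>{J..<n}. d j)" using Suc.prems by (intro sum_nonneg) auto
    have t: "0 \<le> t" "t < 1" using dn Suc.prems(3) sum0 unfolding sumd by (auto simp: t_def)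
    \<comment> \<open>Summing over the last entry leaves \<open>1 - t\<close> to the power
      \<open>- (N + 1)\<close>, where \<open>N\<close> is the degree in the other coordinates from
      \<open>J\<close> on. Dividing their weights by \<open>1 - t\<close> absorbs \<open>N\<close>
      of these factors, and the new weights still sum to less than 1.\<close>
    define d' where "d' j = (if j < J then d j else d j / (1 - t))" for j
    have sumd': "(\<Sum>j\<in>{J..<n}. d' j) = (\<Sum>j\<in>{J..<n}. d j) / (1 - t)"
      by (simp add: d'_def sum_divide_distrib)
    have G: "G (\<nu>, m) = multinom_weight J d n \<nu> * (real (((\<Sum>j\<in>{J..<n}. \<nu> j) + m) choose m) * t ^ m)" for \<nu> m
    proof -
      let ?N = "\<Sum>j\<in>{J..<n}. \<nu> j"
      have "fact (?N + m) / (fact m :: real) = real ((?N + m) choose m) * fact ?N"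
        by (subst binomial_fact) auto
      then have *: "fact (?N + m) / (P * fact m :: real) = real ((?N + m) choose m) * (fact ?N / P)" for P
        by (metis divide_divide_eq_left mult.commute times_divide_eq_right)
      have "G (\<nu>, m) = fact (?N + m) / ((\<Prod>j\<in>{J..<n}. fact (\<nu> j)) * fact m) * ((\<Prod>j<n. d j ^ \<nu> j) * t ^ m)"
        using False by (simp add: G_def multinom_weight_def t_def)
      then show ?thesis
        unfolding * by (simp add: multinom_weight_def)
    qed
    have inner: "((\<lambda>m. G (\<nu>, m)) has_sum (multinom_weight J d n \<nu> * (1 / (1 - t) ^ Suc (\<Sum>j\<in>{J..<n}. \<nu> j)))) UNIV" for \<nu>
      unfolding G using t by (intro has_sum_cmult_right sums_nonneg_imp_has_sum negative_binomial_sums) auto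
    have weq: "multinom_weight J d n \<nu> * (1 / (1 - t) ^ Suc (\<Sum>j\<in>{J..<n}. \<nu> j)) = 1 / (1 - t) * multinom_weight J d' n \<nu>" for \<nu>
    proof -
      have "(\<Prod>j<n. d' j ^ \<nu> j) = (\<Prod>j<n. d j ^ \<nu> j) * (\<Prod>j<n. if j < J then 1 else (1 / (1 - t)) ^ \<nu> j)"
        unfolding prod.distrib[symmetric] by (intro prod.cong) (auto simp: d'_def power_divide)
      also have "(\<Prod>j<n. if j < J then 1 else (1 / (1 - t)) ^ \<nu> j) = (\<Prod>j\<in>{J..<n}. (1 / (1 - t)) ^ \<nu> j)"
        by (intro prod.mono_neutral_cong_right) auto
      also have "\<dots> = (1 / (1 - t)) ^ (\<Sum>j\<in>{J..<n}. \<nu> j)" by (simp add: power_sum)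
      finally show ?thesis by (simp add: multinom_weight_def power_one_over)
    qed
    have "((\<lambda>\<nu>. 1 / (1 - t) * multinom_weight J d' n \<nu>) has_sum
        (1 / (1 - t) * ((\<Prod>j<min n J. 1 / (1 - d' j)) / (1 - (\<Sum>j\<in>{J..<n}. d' j))))) (multi_index n)"
    proof (intro has_sum_cmult_right Suc.IH)
      show "(\<Sum>j\<in>{J..<n}. d' j) < 1" unfolding sumd' using t Suc.prems(3) sumd by simp
    qed (use Suc.prems t in \<open>auto simp: d'_def\<close>)
    then have outer: "((\<lambda>\<nu>. multinom_weight J d n \<nu> * (1 / (1 - t) ^ Suc (\<Sum>j\<in>{J..<n}. \<nu> j))) has_sum
        (1 / (1 - t) * ((\<Prod>j<min n J. 1 / (1 - d' j)) / (1 - (\<Sum>j\<in>{J..<n}. d' j))))) (multi_index n)"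
      unfolding weq .
    have "G summable_on (multi_index n \<times> UNIV)"
      by (rule summable_on_SigmaI[OF inner]) (use outer Gpos in \<open>auto simp: has_sum_imp_summable\<close>)
    then have "(G has_sum (1 / (1 - t) * ((\<Prod>j<min n J. 1 / (1 - d' j)) / (1 - (\<Sum>j\<in>{J..<n}. d' j))))) (multi_index n \<times> UNIV)"
      by (intro has_sum_SigmaI[OF inner outer])
    moreover have "1 / (1 - t) * ((\<Prod>j<min n J. 1 / (1 - d' j)) / (1 - (\<Sum>j\<in>{J..<n}. d' j))) =
        (\<Prod>j<min (Suc n) J. 1 / (1 - d j)) / (1 - (\<Sum>j\<in>{J..<Suc n}. d j))"
    proof -
      have "(\<Prod>j<min n J. 1 / (1 - d' j)) = (\<Prod>j<min (Suc n) J. 1 / (1 - d j))"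
        using False by (intro prod.cong) (auto simp: d'_def)
      moreover have "(1 - t) * (1 - (\<Sum>j\<in>{J..<n}. d' j)) = 1 - (\<Sum>j\<in>{J..<Suc n}. d j)"
        unfolding sumd' sumd using t by (simp add: field_simps)
      moreover have "1 / (1 - t) * (A / B) = A / ((1 - t) * B)" for A B by simp
      ultimately show ?thesis by (simp only:)
    qed
    ultimately show ?thesis using key by metis
  qed
qed

section \<open>Factorial bounds and the real form of the weights\<close>

lemma power_le_exp_fact: "real n ^ n \<le> exp (real n) * fact n"
proof -
  have "(\<Sum>k\<in>{n}. inverse (fact k) * real n ^ k) \<le> (\<Sum>k. inverse (fact k) * real n ^ k)"
    by (rule sum_le_suminf[OF summable_exp]) auto
  then show ?thesis by (simp add: exp_def scaleR_conv_of_real field_simps)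
qed

lemma fact_le_self_power: "fact n \<le> real n ^ n"
  using fact_le_power[of n, where 'a=real] by simp

text \<open>The reciprocal of the weight \<open>1 + \<alpha> / b j\<close>; it is \<open>0\<close> for \<open>b j = 0\<close>, as the convention for infinite weights demands.\<close>

definition rel_weight :: "real \<Rightarrow> (nat \<Rightarrow> real) \<Rightarrow> nat \<Rightarrow> real" where
  "rel_weight \<alpha> b j = b j / (b j + \<alpha>)"

lemma rel_weight_bounds: "\<alpha> > 0 \<Longrightarrow> b j \<ge> 0 \<Longrightarrow> 0 \<le> rel_weight \<alpha> b j \<and> rel_weight \<alpha> b j < 1"
  by (auto simp: rel_weight_def field_simps)

lemma prod_powr: "(\<And>j. j \<in> A \<Longrightarrow> (0::real) \<le> f j) \<Longrightarrow> (\<Prod>j\<in>A. f j) powr a = (\<Prod>j\<in>A. f j powr a)"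
  by (induction A rule: infinite_finite_induct) (auto simp: powr_mult prod_nonneg)

lemma power_powr: "(0::real) \<le> x \<Longrightarrow> 0 < a \<Longrightarrow> (x ^ m) powr a = (x powr a) ^ m"
  by (induction m) (simp_all add: powr_mult)

definition rel_gamma :: "real \<Rightarrow> (nat \<Rightarrow> real) \<Rightarrow> nat \<Rightarrow> (nat \<Rightarrow> nat) \<Rightarrow> real" where
  "rel_gamma \<alpha> b k \<nu> = rel_weight \<alpha> b k ^ max 1 (\<nu> k) * (\<Prod>j<k. rel_weight \<alpha> b j ^ \<nu> j)"

lemma rel_gamma_powr:
  assumes "\<alpha> > 0" "\<And>j. b j \<ge> 0" "0 < a"
  shows "rel_gamma \<alpha> b k \<nu> powr a =
     (rel_weight \<alpha> b k powr a) ^ max 1 (\<nu> k) * (\<Prod>j<k. (rel_weight \<alpha> b j powr a) ^ \<nu> j)"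
proof -
  have r: "0 \<le> rel_weight \<alpha> b j" for j using rel_weight_bounds assms by blast
  have "rel_gamma \<alpha> b k \<nu> powr a = (rel_weight \<alpha> b k ^ max 1 (\<nu> k)) powr a * (\<Prod>j<k. rel_weight \<alpha> b j ^ \<nu> j) powr a"
    unfolding rel_gamma_def using r by (intro powr_mult)
  also have "(\<Prod>j<k. rel_weight \<alpha> b j ^ \<nu> j) powr a = (\<Prod>j<k. (rel_weight \<alpha> b j ^ \<nu> j) powr a)"
    using r by (intro prod_powr) auto
  finally show ?thesis using r assms(3) by (simp add: power_powr)
qed

text \<open>The weights factorise, so the sum over \<open>\<nu>\<close> is a product of geometric
  series. The factors \<open>j < k\<close> stay bounded uniformly in \<open>k\<close> because the
  ratios are summable and bounded away from 1; the exponent \<open>max 1 (\<nu> k)\<close> always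
  leaves a factor \<open>\<tau> k\<close>, which makes the bounds summable in
  \<open>k\<close>.\<close>

lemma summable_rel_gamma_powr:
  assumes \<alpha>: "\<alpha> > 0" and b: "\<And>j. b j \<ge> 0" "\<And>j. b j \<le> Bm" and p: "0 < p"
    and sum: "summable (\<lambda>j. b j powr p)"
  shows "\<exists>s. summable s \<and> (\<forall>k. s k \<ge> 0 \<and> (\<lambda>\<nu>. rel_gamma \<alpha> b k \<nu> powr p) summable_on multi_index (Suc k) \<and>
     infsum (\<lambda>\<nu>. rel_gamma \<alpha> b k \<nu> powr p) (multi_index (Suc k)) \<le> s k)"
proof -
  have Bm: "Bm \<ge> 0" using b[of 0] by linarith
  define \<tau> where "\<tau> j = rel_weight \<alpha> b j powr p" for j
  \<comment> \<open>The ratio at the upper bound \<open>Bm\<close> of \<open>b\<close>, a common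
    bound below 1 for all \<open>\<tau> j\<close>.\<close>
  define t where "t = (Bm / (Bm + \<alpha>)) powr p"
  have \<tau>0: "0 \<le> \<tau> j" for j by (simp add: \<tau>_def)
  have \<tau>t: "\<tau> j \<le> t" for j
    unfolding \<tau>_def t_def rel_weight_def
  proof (rule powr_mono2)
    show "b j / (b j + \<alpha>) \<le> Bm / (Bm + \<alpha>)"
      using b[of j] \<alpha> Bm by (simp add: divide_simps) (simp add: algebra_simps add_pos_nonneg mult_right_mono)
  qed (use p b \<alpha> in \<open>auto simp: add_nonneg_pos less_imp_le\<close>)
  have t1: "t < 1"
  proof -
    have "t < 1 powr p" unfolding t_def using p \<alpha> Bm by (intro powr_less_mono2) (auto simp: field_simps)
    then show ?thesis by simp
  qed
  have \<tau>1: "\<tau> j < 1" for j using \<tau>t[of j] t1 by linarith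
  have s\<tau>: "summable \<tau>"
  proof (rule summable_comparison_test')
    show "summable (\<lambda>j. b j powr p * inverse \<alpha> powr p)" using sum by (rule summable_mult2)
    fix j
    have "\<tau> j \<le> (b j * inverse \<alpha>) powr p"
      unfolding \<tau>_def rel_weight_def divide_inverse using b[of j] \<alpha> p
      by (intro powr_mono2 mult_left_mono le_imp_inverse_le) auto
    then show "norm (\<tau> j) \<le> b j powr p * inverse \<alpha> powr p"
      using \<tau>0[of j] b[of j] \<alpha> by (simp add: powr_mult)
  qed
  define E where "E = exp (suminf \<tau> / (1 - t))"
  define s where "s k = \<tau> k * ((1 + 1 / (1 - t)) * E)" for k
  have main: "\<exists>S. ((\<lambda>\<nu>. rel_gamma \<alpha> b k \<nu> powr p) has_sum S) (multi_index (Suc k)) \<and> S \<le> s k" for k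
  proof -
    define f where "f j m = (if j = k then \<tau> k ^ max 1 m else \<tau> j ^ m)" for j m
    \<comment> \<open>For \<open>j = k\<close> the entries 0 and 1 of the index both contribute
      \<open>\<tau> k\<close>, because of \<open>max 1\<close>.\<close>
    define S where "S j = (if j = k then \<tau> k + \<tau> k * (1 / (1 - \<tau> k)) else 1 / (1 - \<tau> j))" for j
    have "((\<lambda>\<nu>. \<Prod>j<Suc k. f j (\<nu> j)) has_sum (\<Prod>j<Suc k. S j)) (multi_index (Suc k))"
    proof (rule has_sum_prod_multi_index)
      fix j assume j: "j < Suc k"
      show "(f j has_sum S j) UNIV"
      proof (cases "j = k")
        case True
        have geo: "(\<lambda>m. \<tau> k * \<tau> k ^ m) sums (\<tau> k * (1 / (1 - \<tau> k)))"
          using \<tau>0 \<tau>1 by (intro sums_mult geometric_sums) auto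
        have "(\<lambda>m. f k (Suc m)) sums (\<tau> k * (1 / (1 - \<tau> k)))"
          using geo by (simp add: f_def)
        then have "(f k) sums (\<tau> k * (1 / (1 - \<tau> k)) + f k 0)" by (simp add: sums_Suc_iff)
        then have "(f k) sums S k" by (simp add: S_def f_def add.commute)
        then show ?thesis using True \<tau>0 by (intro sums_nonneg_imp_has_sum) (auto simp: f_def)
      next
        case False
        then have "f j = (\<lambda>m. \<tau> j ^ m)" "S j = 1 / (1 - \<tau> j)" by (auto simp: f_def S_def)
        then show ?thesis using \<tau>0 \<tau>1 by (auto intro!: sums_nonneg_imp_has_sum geometric_sums)
      qed
    qed (auto simp: f_def \<tau>0)
    moreover have "(\<Prod>j<Suc k. f j (\<nu> j)) = rel_gamma \<alpha> b k \<nu> powr p" for \<nu>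
      using assms by (simp add: rel_gamma_powr f_def \<tau>_def mult.commute)
    moreover have "(\<Prod>j<Suc k. S j) \<le> s k"
    proof -
      have inv: "1 / (1 - \<tau> j) \<le> 1 / (1 - t)" for j
        using \<tau>t[of j] t1 by (intro divide_left_mono) (auto intro!: mult_pos_pos simp: \<tau>1)
      have "1 / (1 - \<tau> j) \<le> exp (\<tau> j / (1 - t))" for j
      proof -
        have "1 / (1 - \<tau> j) = 1 + \<tau> j * (1 / (1 - \<tau> j))" using \<tau>1[of j] by (simp add: field_simps)
        also have "\<dots> \<le> 1 + \<tau> j * (1 / (1 - t))" using inv \<tau>0 by (intro add_left_mono mult_left_mono) auto
        also have "\<dots> \<le> exp (\<tau> j / (1 - t))" by (simp add: exp_ge_add_one_self)
        finally show ?thesis .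
      qed
      then have "(\<Prod>j<k. S j) \<le> (\<Prod>j<k. exp (\<tau> j / (1 - t)))"
        using \<tau>1 by (intro prod_mono) (auto simp: S_def less_imp_le)
      also have "\<dots> = exp ((\<Sum>j<k. \<tau> j) / (1 - t))" by (simp add: exp_sum sum_divide_distrib)
      also have "\<dots> \<le> E"
        unfolding E_def using t1 s\<tau> \<tau>0 by (auto intro!: divide_right_mono sum_le_suminf)
      finally have *: "(\<Prod>j<k. S j) \<le> E" .
      have Sk: "S k = \<tau> k * (1 + 1 / (1 - \<tau> k))" by (simp add: S_def algebra_simps)
      have "S k \<le> \<tau> k * (1 + 1 / (1 - t))" unfolding Sk using \<tau>0 inv by (intro mult_left_mono) auto
      moreover have "0 \<le> (\<Prod>j<k. S j)" using \<tau>1 by (intro prod_nonneg) (auto simp: S_def less_imp_le)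
      ultimately have "S k * (\<Prod>j<k. S j) \<le> (\<tau> k * (1 + 1 / (1 - t))) * E"
        using * t1 \<tau>0 by (intro mult_mono) auto
      then show ?thesis by (simp add: s_def mult_ac)
    qed
    ultimately show ?thesis by auto
  qed
  show ?thesis
  proof (intro exI[of _ s] conjI allI)
    show "summable s" unfolding s_def by (rule summable_mult2[OF s\<tau>])
    fix k
    show "s k \<ge> 0" using \<tau>0 t1 by (auto simp: s_def E_def intro!: mult_nonneg_nonneg add_nonneg_nonneg)
    show "(\<lambda>\<nu>. rel_gamma \<alpha> b k \<nu> powr p) summable_on multi_index (Suc k)"
      using main[of k] has_sum_imp_summable by blast
    show "infsum (\<lambda>\<nu>. rel_gamma \<alpha> b k \<nu> powr p) (multi_index (Suc k)) \<le> s k"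
      using main[of k] infsumI by blast
  qed
qed

text \<open>The choice is \<open>\<zeta> j = \<kappa> + \<delta> * \<nu> j / (2 * N * b j)\<close> for \<open>j \<ge> J\<close>, where \<open>N = (\<Sum>j\<in>{J..<n}. \<nu> j)\<close>: spreading the
  size \<open>\<delta> / 2\<close> in proportion to \<open>\<nu>\<close> produces \<open>N ^ N / (\<Prod>j. \<nu> j ^ \<nu> j)\<close>, a multinomial coefficient up to \<open>exp N\<close>.\<close>

lemma coeff_le_multinom_weight:
  fixes b :: "nat \<Rightarrow> real"
  assumes c: "\<And>\<zeta>. (\<And>j. j < n \<Longrightarrow> \<zeta> j > 0) \<Longrightarrow> (\<Sum>j<n. b j * \<zeta> j) < \<delta> \<Longrightarrow>
        c \<le> C * (\<Prod>j<n. inverse (1 + \<zeta> j) ^ \<nu> j)"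
    and C: "C \<ge> 0" and b: "\<And>j. b j \<ge> 0" and \<delta>: "\<delta> > 0"
    and \<kappa>: "\<kappa> > 0" "\<kappa> * (\<Sum>j<n. b j) \<le> \<delta> / 4"
    and r: "\<And>j. r j \<ge> 0"
    and q0: "q \<ge> 0" and q: "\<And>j. j < J \<Longrightarrow> b j > 0 \<Longrightarrow> inverse (1 + \<kappa>) \<le> q * r j"
    and d: "\<And>j. J \<le> j \<Longrightarrow> d j \<ge> 0" "\<And>j. J \<le> j \<Longrightarrow> 4 * b j / \<delta> \<le> d j / exp 1 * r j"
  shows "(\<Prod>j<n. cheb_factor (\<nu> j)) * c \<le> C * 2 ^ J * (\<Prod>j<n. r j ^ \<nu> j) * multinom_weight J (\<lambda>j. if j < J then q else d j) n \<nu>"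
    (is "?L \<le> ?R")
proof -
  define e where "e j = (if j < J then q else d j)" for j
  have e0: "e j \<ge> 0" for j using q0 d(1)[of j] by (auto simp: e_def)
  have cf: "cheb_factor m \<ge> 1" for m by (simp add: cheb_factor_def)
  have cf0: "(\<Prod>j<n. cheb_factor (\<nu> j)) \<ge> 0" by (intro prod_nonneg) (auto simp: cheb_factor_def)
  have R0: "?R \<ge> 0"
    using C r e0 unfolding e_def[symmetric] by (intro mult_nonneg_nonneg multinom_weight_nonneg prod_nonneg) auto
  show ?thesis
  \<comment> \<open>If \<open>b i = 0\<close> and \<open>\<nu> i > 0\<close>, then
    \<open>\<zeta> i\<close> may grow at no cost in the constraint, which forces
    \<open>c \<le> 0\<close>.\<close>
  proof (cases "\<exists>i<n. \<nu> i > 0 \<and> b i = 0")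
    case True
    then obtain i where i: "i < n" "\<nu> i > 0" "b i = 0" by blast
    have "c \<le> C * inverse (1 + t)" if t: "t > 0" for t
    proof -
      define \<zeta> where "\<zeta> j = (if j = i then t else \<kappa>)" for j
      have "(\<Sum>j<n. b j * \<zeta> j) = (\<Sum>j<n. b j * \<kappa>)"
        using i by (intro sum.cong) (auto simp: \<zeta>_def)
      also have "\<dots> \<le> \<delta> / 4" using \<kappa> by (simp add: mult.commute flip: sum_distrib_left)
      also have "\<dots> < \<delta>" using \<delta> by simp
      finally have "c \<le> C * (\<Prod>j<n. inverse (1 + \<zeta> j) ^ \<nu> j)"
        using t \<kappa> by (intro c) (auto simp: \<zeta>_def)
      also have "(\<Prod>j<n. inverse (1 + \<zeta> j) ^ \<nu> j) \<le> (\<Prod>j<n. if j = i then inverse (1 + t) else 1)"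
      proof (rule prod_mono)
        fix j
        have "inverse (1 + \<zeta> j) ^ \<nu> j \<le> 1" using t \<kappa> by (intro power_le_one) (auto simp: \<zeta>_def inverse_le_1_iff)
        moreover have "inverse (1 + t) ^ \<nu> i \<le> inverse (1 + t) ^ 1"
          using t i(2) by (intro power_decreasing) (auto simp: inverse_le_1_iff)
        ultimately show "0 \<le> inverse (1 + \<zeta> j) ^ \<nu> j \<and> inverse (1 + \<zeta> j) ^ \<nu> j \<le> (if j = i then inverse (1 + t) else 1)"
          using t \<kappa> by (auto simp: \<zeta>_def)
      qed
      also have "(\<Prod>j<n. if j = i then inverse (1 + t) else 1) = inverse (1 + t)"
        using i by (simp add: prod.delta)
      finally show ?thesis using C by (simp add: mult_left_mono)
    qed
    moreover have "((\<lambda>t::real. C * inverse (1 + t)) \<longlongrightarrow> C * 0) at_top"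
      by (intro tendsto_intros tendsto_inverse_0_at_top filterlim_tendsto_add_at_top[OF tendsto_const filterlim_ident])
    ultimately have "c \<le> 0"
      by (intro tendsto_lowerbound[of "\<lambda>t. C * inverse (1 + t)" 0 at_top c])
        (auto intro: eventually_mono[OF eventually_gt_at_top[of "0::real"]])
    then have "?L \<le> 0" using cf0 by (simp add: mult_nonneg_nonpos)
    then show ?thesis using R0 by linarith
  next
    case False
    define N where "N = (\<Sum>j\<in>{J..<n}. \<nu> j)"
    define \<xi> where "\<xi> j = \<delta> * real (\<nu> j) / (2 * real N * b j)" for j
    define \<zeta> where "\<zeta> j = \<kappa> + (if J \<le> j \<and> \<nu> j > 0 then \<xi> j else 0)" for j
    have Npos: "N > 0" if "J \<le> j" "j < n" "\<nu> j > 0" for j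
      unfolding N_def using that by (intro sum_pos2[of _ j]) auto
    have bpos: "b j > 0" if "j < n" "\<nu> j > 0" for j
      using False that b[of j] by (metis less_eq_real_def)
    have \<xi>: "\<xi> j > 0" if "J \<le> j" "j < n" "\<nu> j > 0" for j
      using Npos[OF that] bpos[OF that(2,3)] that \<delta> by (simp add: \<xi>_def)
    have "(\<Sum>j<n. b j * \<zeta> j) = \<kappa> * (\<Sum>j<n. b j) + (\<Sum>j<n. if J \<le> j \<and> \<nu> j > 0 then b j * \<xi> j else 0)"
      unfolding sum_distrib_left sum.distrib[symmetric] by (intro sum.cong) (auto simp: \<zeta>_def algebra_simps)
    also have "(\<Sum>j<n. if J \<le> j \<and> \<nu> j > 0 then b j * \<xi> j else 0) = (\<Sum>j\<in>{J..<n}. \<delta> / (2 * real N) * real (\<nu> j))"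
    proof -
      have "(\<Sum>j<n. if J \<le> j \<and> \<nu> j > 0 then b j * \<xi> j else 0) = (\<Sum>j<n. if J \<le> j then \<delta> / (2 * real N) * real (\<nu> j) else 0)"
        using bpos by (intro sum.cong) (auto simp: \<xi>_def, force)
      also have "\<dots> = (\<Sum>j\<in>{J..<n}. \<delta> / (2 * real N) * real (\<nu> j))"
        by (intro sum.mono_neutral_cong_right) auto
      finally show ?thesis .
    qed
    also have "(\<Sum>j\<in>{J..<n}. \<delta> / (2 * real N) * real (\<nu> j)) = \<delta> / (2 * real N) * real N"
      by (simp only: N_def of_nat_sum sum_distrib_left)
    also have "\<dots> \<le> \<delta> / 2"
      using \<delta> by (cases "N = 0") auto
    finally have "(\<Sum>j<n. b j * \<zeta> j) < \<delta>" using \<kappa>(2) \<delta> by simp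
    then have c': "c \<le> C * (\<Prod>j<n. inverse (1 + \<zeta> j) ^ \<nu> j)"
      using \<kappa> \<xi> by (intro c) (auto simp: \<zeta>_def add_pos_pos)
    \<comment> \<open>What remains of coordinate \<open>j\<close> after splitting off the powers of
      \<open>r j\<close> and \<open>e j\<close>: the Chebyshev factor 2 for \<open>j < J\<close>, a
      share of the multinomial coefficient otherwise.\<close>
    define g where "g j = (if j < J then 2 else (real N / real (\<nu> j)) ^ \<nu> j * inverse (exp 1) ^ \<nu> j)" for j
    have each: "cheb_factor (\<nu> j) * inverse (1 + \<zeta> j) ^ \<nu> j \<le> g j * (r j ^ \<nu> j * e j ^ \<nu> j)" if j: "j < n" for j
    proof (cases "\<nu> j = 0")
      case True then show ?thesis by (simp add: cheb_factor_def g_def)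
    next
      case nz: False
      then have bj: "b j > 0" using bpos j by simp
      show ?thesis
      proof (cases "j < J")
        case True
        have "inverse (1 + \<zeta> j) ^ \<nu> j \<le> (q * r j) ^ \<nu> j"
          using q[OF True bj] True \<kappa> by (intro power_mono) (auto simp: \<zeta>_def)
        then show ?thesis
          using True nz by (simp add: g_def e_def cheb_factor_def power_mult_distrib mult_ac)
      next
        case notJ: False
        have x: "\<xi> j > 0" using \<xi> j notJ nz by simp
        have N: "real N > 0" using Npos[of j] j notJ nz by simp
        \<comment> \<open>The Chebyshev factor 2 is enlarged to \<open>2 ^ \<nu> j\<close>; together
          with the 2 from spreading only \<open>\<delta> / 2\<close> this produces the 4 in
          \<open>4 * b j / \<delta>\<close>.\<close>
        have "cheb_factor (\<nu> j) * inverse (1 + \<zeta> j) ^ \<nu> j \<le> 2 ^ \<nu> j * inverse (\<xi> j) ^ \<nu> j"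
        proof (rule mult_mono)
          have "(2::real) ^ 1 \<le> 2 ^ \<nu> j" using nz by (intro power_increasing) auto
          then show "cheb_factor (\<nu> j) \<le> 2 ^ \<nu> j" using nz by (simp add: cheb_factor_def)
          show "inverse (1 + \<zeta> j) ^ \<nu> j \<le> inverse (\<xi> j) ^ \<nu> j"
            using x nz notJ \<kappa> by (intro power_mono le_imp_inverse_le) (auto simp: \<zeta>_def)
          show "0 \<le> inverse (1 + \<zeta> j) ^ \<nu> j" using x nz notJ \<kappa> by (auto simp: \<zeta>_def)
        qed auto
        also have "\<dots> = ((real N / real (\<nu> j)) * (4 * b j / \<delta>)) ^ \<nu> j"
        proof -
          have "2 * inverse (\<xi> j) = (real N / real (\<nu> j)) * (4 * b j / \<delta>)"
            using N nz bj \<delta> by (simp add: \<xi>_def mult_ac)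
          then show ?thesis by (simp only: power_mult_distrib[symmetric])
        qed
        also have "\<dots> \<le> ((real N / real (\<nu> j)) * (d j / exp 1 * r j)) ^ \<nu> j"
          using d(2)[of j] notJ bj \<delta> by (intro power_mono mult_left_mono) auto
        also have "\<dots> = g j * (r j ^ \<nu> j * e j ^ \<nu> j)"
          using notJ by (simp add: g_def e_def power_mult_distrib divide_inverse mult_ac)
        finally show ?thesis .
      qed
    qed
    have g: "(\<Prod>j<n. g j) \<le> 2 ^ J * (fact N / (\<Prod>j\<in>{J..<n}. fact (\<nu> j)))"
    proof -
      have "(\<Prod>j<n. g j) = (\<Prod>j<min n J. g j) * (\<Prod>j\<in>{J..<n}. g j)"
      proof -
        have "(\<Prod>j\<in>{..<min n J} \<union> {J..<n}. g j) = (\<Prod>j<min n J. g j) * (\<Prod>j\<in>{J..<n}. g j)"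
          by (rule prod.union_disjoint) auto
        moreover have "{..<min n J} \<union> {J..<n} = {..<n}" by auto
        ultimately show ?thesis by metis
      qed
      moreover have "(\<Prod>j<min n J. g j) \<le> 2 ^ J"
      proof -
        have "(\<Prod>j<min n J. g j) = 2 ^ min n J" by (simp add: g_def)
        also have "\<dots> \<le> 2 ^ J" by (intro power_increasing) auto
        finally show ?thesis .
      qed
      moreover have "(\<Prod>j\<in>{J..<n}. g j) \<le> fact N / (\<Prod>j\<in>{J..<n}. fact (\<nu> j))"
      proof -
        have "(\<Prod>j\<in>{J..<n}. g j) = (\<Prod>j\<in>{J..<n}. real N ^ \<nu> j) * (\<Prod>j\<in>{J..<n}. inverse (exp 1) ^ \<nu> j) / (\<Prod>j\<in>{J..<n}. real (\<nu> j) ^ \<nu> j)"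
          unfolding prod.distrib[symmetric] prod_dividef[symmetric] by (intro prod.cong) (auto simp: g_def power_divide)
        also have "\<dots> = real N ^ N * inverse (exp 1) ^ N / (\<Prod>j\<in>{J..<n}. real (\<nu> j) ^ \<nu> j)"
          by (simp add: N_def power_sum)
        \<comment> \<open>The numerator uses \<open>power_le_exp_fact\<close>, whose exponential is
          paid for by the division by \<open>exp 1\<close> in the hypothesis on \<open>d\<close>;
          the denominator uses \<open>fact_le_self_power\<close>.\<close>
        also have "\<dots> \<le> fact N / (\<Prod>j\<in>{J..<n}. fact (\<nu> j))"
        proof (rule frac_le)
          have "inverse (exp 1) ^ N = inverse (exp (real N))" by (simp add: power_inverse flip: exp_of_nat_mult)
          then show "real N ^ N * inverse (exp 1) ^ N \<le> fact N"
            using power_le_exp_fact[of N] by (simp add: field_simps)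
          show "(\<Prod>j\<in>{J..<n}. fact (\<nu> j)) \<le> (\<Prod>j\<in>{J..<n}. real (\<nu> j) ^ \<nu> j)"
            using fact_le_self_power by (intro prod_mono) auto
        qed (auto intro: prod_pos)
        finally show ?thesis .
      qed
      moreover have "0 \<le> (\<Prod>j\<in>{J..<n}. g j)" by (intro prod_nonneg) (auto simp: g_def)
      ultimately show ?thesis by (simp only:) (intro mult_mono, auto)
    qed
    have "?L \<le> (\<Prod>j<n. cheb_factor (\<nu> j)) * (C * (\<Prod>j<n. inverse (1 + \<zeta> j) ^ \<nu> j))"
      using c' cf0 by (intro mult_left_mono)
    also have "\<dots> = C * (\<Prod>j<n. cheb_factor (\<nu> j) * inverse (1 + \<zeta> j) ^ \<nu> j)"
      by (simp add: prod.distrib mult_ac)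
    also have "\<dots> \<le> C * (\<Prod>j<n. g j * (r j ^ \<nu> j * e j ^ \<nu> j))"
    proof (intro mult_left_mono C prod_mono conjI)
      fix j assume "j \<in> {..<n}"
      then show "0 \<le> cheb_factor (\<nu> j) * inverse (1 + \<zeta> j) ^ \<nu> j"
        using \<kappa> \<xi>[of j] by (auto simp: \<zeta>_def cheb_factor_def add_pos_pos less_imp_le)
    qed (use each in auto)
    also have "\<dots> = C * ((\<Prod>j<n. g j) * ((\<Prod>j<n. r j ^ \<nu> j) * (\<Prod>j<n. e j ^ \<nu> j)))"
      by (simp add: prod.distrib)
    also have "\<dots> \<le> C * ((2 ^ J * (fact N / (\<Prod>j\<in>{J..<n}. fact (\<nu> j)))) * ((\<Prod>j<n. r j ^ \<nu> j) * (\<Prod>j<n. e j ^ \<nu> j)))"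
      using C g r e0 by (intro mult_left_mono mult_right_mono mult_nonneg_nonneg prod_nonneg) auto
    also have "\<dots> = ?R"
      by (simp add: multinom_weight_def N_def e_def)
    finally show ?thesis .
  qed
qed

lemma summable_tail_le:
  fixes f :: "nat \<Rightarrow> real"
  assumes "summable f" "\<And>j. f j \<ge> 0" "e > 0"
  shows "\<exists>J. \<forall>n. (\<Sum>j\<in>{J..<n}. f j) \<le> e"
proof -
  obtain J where J: "\<And>m n. m \<ge> J \<Longrightarrow> norm (\<Sum>j\<in>{m..<n}. f j) < e"
    using assms(1,3) unfolding summable_Cauchy by blast
  show ?thesis
    using J[of J] abs_ge_self order.strict_trans1 less_imp_le by (metis order_refl real_norm_def)
qed

text \<open>Turns the two families of Cauchy bounds into \<open>\<gamma> powr (1 - p)\<close> times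
  a family \<open>d\<close> of finite total over all \<open>k\<close> and \<open>\<nu>\<close>,
  while \<open>\<gamma> powr p\<close> has finite total as well: the form that Stechkin's argument
  consumes. The constant \<open>\<alpha>\<close> of the theorem is fixed here.\<close>

lemma sparse_coefficients:
  fixes b :: "nat \<Rightarrow> real" and c :: "nat \<Rightarrow> (nat \<Rightarrow> nat) \<Rightarrow> real"
  assumes p: "0 < p" "p < 1" and b: "\<And>j. b j \<ge> 0" and sum: "summable (\<lambda>j. b j powr p)"
    and \<delta>: "\<delta> > 0" and C: "C \<ge> 0"
    and c1: "\<And>k \<nu> \<zeta>. (\<And>j. j < Suc k \<Longrightarrow> \<zeta> j > 0) \<Longrightarrow> (\<Sum>j<Suc k. b j * \<zeta> j) < \<delta> \<Longrightarrow>
        c k \<nu> \<le> C * (\<Prod>j<Suc k. inverse (1 + \<zeta> j) ^ \<nu> j)"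
    and c2: "\<And>k \<nu> \<zeta>. \<nu> k = 0 \<Longrightarrow> (\<And>j. j < k \<Longrightarrow> \<zeta> j > 0) \<Longrightarrow> (\<Sum>j<k. b j * \<zeta> j) < \<delta> \<Longrightarrow>
        c k \<nu> \<le> (C * b k) * (\<Prod>j<k. inverse (1 + \<zeta> j) ^ \<nu> j)"
  shows "\<exists>\<alpha>>0. \<exists>s d e. summable s \<and> summable e \<and>
     (\<forall>k. s k \<ge> 0 \<and> (\<lambda>\<nu>. rel_gamma \<alpha> b k \<nu> powr p) summable_on multi_index (Suc k) \<and>
       infsum (\<lambda>\<nu>. rel_gamma \<alpha> b k \<nu> powr p) (multi_index (Suc k)) \<le> s k \<and>
       e k \<ge> (0::real) \<and> d k summable_on multi_index (Suc k) \<and> infsum (d k) (multi_index (Suc k)) \<le> e k \<and>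
       (\<forall>\<nu>. d k \<nu> \<ge> (0::real) \<and> (\<Prod>j<Suc k. cheb_factor (\<nu> j)) * c k \<nu> \<le> rel_gamma \<alpha> b k \<nu> powr (1 - p) * d k \<nu>))"
proof -
  \<comment> \<open>The \<open>p\<close>-quasinorm of \<open>b\<close>, an upper bound for every
    \<open>b j\<close>.\<close>
  define Bm where "Bm = suminf (\<lambda>j. b j powr p) powr (1 / p)"
  have Bm: "b j \<le> Bm" for j
  proof -
    have "sum (\<lambda>j. b j powr p) {j} \<le> suminf (\<lambda>j. b j powr p)" by (rule sum_le_suminf[OF sum]) auto
    then have "(b j powr p) powr (1 / p) \<le> Bm" unfolding Bm_def using p by (intro powr_mono2) auto
    then show ?thesis using p b[of j] by (simp add: powr_powr)
  qed
  have Bm0: "Bm \<ge> 0" by (simp add: Bm_def)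
  have b_le: "b j \<le> (1 + Bm) * b j powr p" for j
  proof -
    have "b j = b j powr (1 - p) * b j powr p" using b[of j] by (cases "b j = 0") (auto simp flip: powr_add)
    also have "b j powr (1 - p) \<le> (1 + Bm) powr (1 - p)" using b[of j] Bm[of j] p by (intro powr_mono2) auto
    also have "\<dots> \<le> (1 + Bm) powr 1" using Bm0 p by (intro powr_mono) auto
    finally show ?thesis using Bm0 by (simp add: mult_right_mono)
  qed
  have sb: "summable b"
    by (rule summable_comparison_test'[OF summable_mult[OF sum, of "1 + Bm"]]) (use b_le b in auto)
  define sumb where "sumb = suminf b"
  have sumb: "(\<Sum>j<n. b j) \<le> sumb" for n unfolding sumb_def using b by (intro sum_le_suminf sb) auto
  have sumb0: "sumb \<ge> 0" using sumb[of 0] by simp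
  \<comment> \<open>A base radius, common to all coordinates, that costs at most
    \<open>\<delta> / 4\<close> in every dimension. It provides the decay in the first
    \<open>J\<close> coordinates.\<close>
  define \<kappa> where "\<kappa> = \<delta> / (4 * (sumb + 1))"
  have \<kappa>: "\<kappa> > 0" using \<delta> sumb0 by (simp add: \<kappa>_def)
  have \<kappa>b: "\<kappa> * (\<Sum>j<n. b j) \<le> \<delta> / 4" for n
  proof -
    have "\<kappa> * (\<Sum>j<n. b j) \<le> \<kappa> * (sumb + 1)" using sumb[of n] \<kappa> by (intro mult_left_mono) auto
    also have "\<kappa> * (sumb + 1) = \<delta> / 4" using sumb0 by (simp add: \<kappa>_def field_simps)
    finally show ?thesis .
  qed
  define D where "D = 4 * exp 1 * (1 + Bm) / \<delta>"
  have D0: "D > 0" using Bm0 \<delta> by (simp add: D_def)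
  define dd where "dd j = D * b j powr p" for j
  have dd0: "dd j \<ge> 0" for j using D0 by (simp add: dd_def)
  \<comment> \<open>Beyond \<open>J\<close> the weights sum to at most 1/2, so the multinomial
    series contributes at most a factor 2, whatever the dimension.\<close>
  obtain J where J: "\<And>n. (\<Sum>j\<in>{J..<n}. dd j) \<le> 1/2"
    using summable_tail_le[of dd "1/2"] sum dd0 unfolding dd_def by (metis half_gt_zero summable_mult zero_less_one)
  \<comment> \<open>Solves \<open>q * inverse (1 + \<kappa> / 2) = inverse (1 + \<kappa>)\<close>:
    half of the radius \<open>\<kappa>\<close> is spent on \<open>\<gamma>\<close>, the rest leaves
    a ratio below 1.\<close>
  define q where "q = (1 + \<kappa> / 2) / (1 + \<kappa>)"
  have q: "0 \<le> q" "q < 1" using \<kappa> by (auto simp: q_def)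
  \<comment> \<open>Small enough that \<open>rel_weight \<alpha> b j\<close> is at least
    \<open>inverse (1 + \<kappa> / 2)\<close> for the finitely many \<open>j < J\<close> with
    \<open>b j > 0\<close>; the entry 1 keeps \<open>b j + \<alpha>\<close> at most
    \<open>1 + Bm\<close>.\<close>
  define \<alpha> where "\<alpha> = Min (insert 1 ((\<lambda>j. \<kappa> * b j / 2) ` {j. j < J \<and> b j > 0}))"
  have fin: "finite (insert 1 ((\<lambda>j. \<kappa> * b j / 2) ` {j. j < J \<and> b j > 0}))" by auto
  have \<alpha>: "\<alpha> > 0" unfolding \<alpha>_def using fin \<kappa> by (subst Min_gr_iff) auto
  have \<alpha>1: "\<alpha> \<le> 1" unfolding \<alpha>_def using fin by (intro Min_le) auto
  have \<alpha>J: "\<alpha> \<le> \<kappa> * b j / 2" if "j < J" "b j > 0" for j unfolding \<alpha>_def using fin that by (intro Min_le) auto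
  define r where "r j = rel_weight \<alpha> b j powr (1 - p)" for j
  have r0: "r j \<ge> 0" for j by (simp add: r_def)
  have rq: "inverse (1 + \<kappa>) \<le> q * r j" if j: "j < J" "b j > 0" for j
  proof -
    have w: "0 < rel_weight \<alpha> b j" "rel_weight \<alpha> b j \<le> 1" using j \<alpha> by (auto simp: rel_weight_def field_simps)
    have "inverse (1 + \<kappa> / 2) \<le> rel_weight \<alpha> b j"
      using \<alpha>J[OF j] j \<kappa> \<alpha> by (simp add: rel_weight_def field_simps)
    also have "rel_weight \<alpha> b j = rel_weight \<alpha> b j powr 1" using w by simp
    also have "\<dots> \<le> r j" unfolding r_def using w p by (intro powr_mono') auto
    finally have "inverse (1 + \<kappa> / 2) \<le> r j" .
    then have "q * inverse (1 + \<kappa> / 2) \<le> q * r j" using q by (intro mult_left_mono)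
    moreover have "q * inverse (1 + \<kappa> / 2) = inverse (1 + \<kappa>)"
    proof -
      have "1 + \<kappa> / 2 \<noteq> 0" using \<kappa> by linarith
      then show ?thesis unfolding q_def divide_inverse by (metis mult.assoc mult.commute right_inverse mult_1_right)
    qed
    ultimately show ?thesis by simp
  qed
  \<comment> \<open>The splitting of \<open>b j\<close> into powers \<open>p\<close> and
    \<open>1 - p\<close>, where \<open>b j powr (1 - p)\<close> is \<open>r j\<close> times the
    bounded quantity \<open>(b j + \<alpha>) powr (1 - p)\<close>.\<close>
  have b_r: "b j \<le> (1 + Bm) * (b j powr p * r j)" for j
  proof (cases "b j = 0")
    case False
    then have bj: "b j > 0" using b[of j] by simp
    have "r j = b j powr (1 - p) / (b j + \<alpha>) powr (1 - p)"
      using bj \<alpha> by (simp add: r_def rel_weight_def powr_divide)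
    then have eq: "b j powr p * r j = b j / (b j + \<alpha>) powr (1 - p)"
      using bj by (simp flip: powr_add)
    have "(b j + \<alpha>) powr (1 - p) \<le> 1 + Bm"
    proof -
      have "(b j + \<alpha>) powr (1 - p) \<le> (1 + Bm) powr (1 - p)" using bj Bm[of j] \<alpha> \<alpha>1 p by (intro powr_mono2) auto
      also have "\<dots> \<le> (1 + Bm) powr 1" using Bm0 p by (intro powr_mono) auto
      finally show ?thesis using Bm0 by simp
    qed
    moreover have "0 \<le> b j powr p * r j" using r0 by simp
    ultimately have "(b j + \<alpha>) powr (1 - p) * (b j powr p * r j) \<le> (1 + Bm) * (b j powr p * r j)"
      by (intro mult_right_mono)
    moreover have "(b j + \<alpha>) powr (1 - p) > 0" using bj \<alpha> by simp
    with eq have "(b j + \<alpha>) powr (1 - p) * (b j powr p * r j) = b j" by simp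
    ultimately show ?thesis by linarith
  qed auto
  have dr: "4 * b j / \<delta> \<le> dd j / exp 1 * r j" for j
  proof -
    have "dd j / exp 1 * r j = 4 / \<delta> * ((1 + Bm) * (b j powr p * r j))"
      by (simp add: dd_def D_def)
    moreover have "4 / \<delta> * b j \<le> 4 / \<delta> * ((1 + Bm) * (b j powr p * r j))"
      using \<delta> by (intro mult_left_mono b_r) auto
    ultimately show ?thesis by simp
  qed
  define W where "W = multinom_weight J (\<lambda>j. if j < J then q else dd j)"
  have W0: "W n \<nu> \<ge> 0" for n \<nu> unfolding W_def using q dd0 by (intro multinom_weight_nonneg) auto
  define A where "A n = infsum (W n) (multi_index n)" for n
  define Am where "Am = (1 / (1 - q)) ^ J * 2"
  have WA: "(W n has_sum A n) (multi_index n)" and A_le: "A n \<le> Am" for n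
  proof -
    have sumJ: "(\<Sum>j\<in>{J..<n}. if j < J then q else dd j) = (\<Sum>j\<in>{J..<n}. dd j)" by (intro sum.cong) auto
    have *: "(W n has_sum ((\<Prod>j<min n J. 1 / (1 - (if j < J then q else dd j))) / (1 - (\<Sum>j\<in>{J..<n}. dd j)))) (multi_index n)"
      unfolding W_def using has_sum_multinom_weight[of n "\<lambda>j. if j < J then q else dd j" J] q dd0 J[of n]
      by (simp add: sumJ)
    then show "(W n has_sum A n) (multi_index n)" unfolding A_def by (simp add: infsumI)
    have "A n = (1 / (1 - q)) ^ min n J / (1 - (\<Sum>j\<in>{J..<n}. dd j))"
      using * unfolding A_def by (simp add: infsumI)
    also have "\<dots> \<le> (1 / (1 - q)) ^ J / (1/2)"
      using q J[of n] by (intro frac_le power_increasing) auto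
    finally show "A n \<le> Am" by (simp add: Am_def)
  qed
  have A0: "A n \<ge> 0" for n unfolding A_def using W0 by (intro infsum_nonneg)
  define K where "K = C * 2 ^ J"
  have K0: "K \<ge> 0" using C by (simp add: K_def)
  define d where "d k \<nu> = K * (if \<nu> k = 0 then (1 + Bm) * b k powr p * W k \<nu> else W (Suc k) \<nu>)" for k \<nu>
  \<comment> \<open>Within \<open>multi_index (Suc k)\<close> the indices with
    \<open>\<nu> k \<noteq> 0\<close> are those outside \<open>multi_index k\<close>, and their
    total \<open>A (Suc k) - A k\<close> telescopes over \<open>k\<close>. The other indices
    contribute \<open>A k\<close> for each \<open>k\<close>, but with the summable factor
    \<open>b k powr p\<close>.\<close>
  define e where "e k = K * ((1 + Bm) * b k powr p * A k + (A (Suc k) - A k))" for k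
  have split: "multi_index (Suc k) = multi_index k \<union> (multi_index (Suc k) - multi_index k)" for k
    by (auto simp: multi_index_def)
  have nuk: "\<nu> \<in> multi_index k \<longleftrightarrow> \<nu> k = 0" if "\<nu> \<in> multi_index (Suc k)" for \<nu> k
  proof
    assume "\<nu> k = 0"
    with that show "\<nu> \<in> multi_index k" by (auto simp: multi_index_def) (metis le_antisym not_less_eq_eq)
  qed (auto simp: multi_index_def)
  have de: "(d k has_sum e k) (multi_index (Suc k))" for k
  proof -
    have sub: "multi_index k \<subseteq> multi_index (Suc k)" by (auto simp: multi_index_def)
    have "(W (Suc k) has_sum A k) (multi_index k)"
    proof (rule has_sum_cong[THEN iffD1, OF _ WA[of k]])
      fix \<nu> assume "\<nu> \<in> multi_index k"
      then show "W k \<nu> = W (Suc k) \<nu>" unfolding W_def by (subst multinom_weight_Suc_0) (auto simp: multi_index_def)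
    qed
    then have "(W (Suc k) has_sum (A (Suc k) - A k)) (multi_index (Suc k) - multi_index k)"
      by (intro has_sum_Diff[OF WA]) (use sub in auto)
    then have 1: "(d k has_sum (K * (A (Suc k) - A k))) (multi_index (Suc k) - multi_index k)"
      by (intro has_sum_cong[THEN iffD1, OF _ has_sum_cmult_right]) (auto simp: d_def nuk)
    have 2: "(d k has_sum (K * ((1 + Bm) * b k powr p * A k))) (multi_index k)"
    proof (rule has_sum_cong[THEN iffD1, OF _ has_sum_cmult_right[OF has_sum_cmult_right[OF WA[of k]]]])
      fix \<nu> assume "\<nu> \<in> multi_index k"
      then show "K * ((1 + Bm) * b k powr p * W k \<nu>) = d k \<nu>" by (auto simp: d_def multi_index_def)
    qed
    have "(d k has_sum (K * ((1 + Bm) * b k powr p * A k) + K * (A (Suc k) - A k))) (multi_index k \<union> (multi_index (Suc k) - multi_index k))"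
      by (intro has_sum_Un_disjoint 1 2) auto
    then show ?thesis unfolding split[symmetric] by (simp add: e_def algebra_simps)
  qed
  have d0: "d k \<nu> \<ge> 0" for k \<nu> using W0 Bm0 K0 by (simp add: d_def)
  have e0: "e k \<ge> 0" for k using has_sum_nonneg[OF de] d0 by blast
  have se: "summable e"
  proof (rule bounded_imp_summable)
    fix n
    have tel: "(\<Sum>k<m. A (Suc k) - A k) = A m - A 0" for m by (rule sum_lessThan_telescope)
    have "(\<Sum>k\<le>n. e k) = K * ((\<Sum>k<Suc n. (1 + Bm) * b k powr p * A k) + (\<Sum>k<Suc n. A (Suc k) - A k))"
      unfolding e_def lessThan_Suc_atMost by (simp only: sum_distrib_left[symmetric] sum.distrib)
    also have "\<dots> \<le> K * ((1 + Bm) * Am * suminf (\<lambda>j. b j powr p) + Am)"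
    proof (intro mult_left_mono add_mono K0)
      have "(\<Sum>k<Suc n. (1 + Bm) * b k powr p * A k) \<le> (\<Sum>k<Suc n. (1 + Bm) * b k powr p * Am)"
        using A_le Bm0 by (intro sum_mono mult_left_mono) auto
      also have "\<dots> = (1 + Bm) * Am * (\<Sum>k<Suc n. b k powr p)"
        unfolding sum_distrib_left by (intro sum.cong) (auto simp: mult_ac)
      also have "\<dots> \<le> (1 + Bm) * Am * suminf (\<lambda>j. b j powr p)"
        using Bm0 order.trans[OF A0 A_le] by (intro mult_left_mono sum_le_suminf sum) auto
      finally show "(\<Sum>k<Suc n. (1 + Bm) * b k powr p * A k) \<le> \<dots>" .
      show "(\<Sum>k<Suc n. A (Suc k) - A k) \<le> Am" unfolding tel using A_le[of "Suc n"] A0[of 0] by simp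
    qed
    finally show "(\<Sum>k\<le>n. e k) \<le> K * ((1 + Bm) * Am * suminf (\<lambda>j. b j powr p) + Am)" .
  qed (rule e0)
  have g: "rel_gamma \<alpha> b k \<nu> powr (1 - p) = r k ^ max 1 (\<nu> k) * (\<Prod>j<k. r j ^ \<nu> j)" for k \<nu>
    unfolding r_def using \<alpha> b p by (intro rel_gamma_powr) auto
  have main: "(\<Prod>j<Suc k. cheb_factor (\<nu> j)) * c k \<nu> \<le> rel_gamma \<alpha> b k \<nu> powr (1 - p) * d k \<nu>" for k \<nu>
  proof (cases "\<nu> k = 0")
    case False
    have "(\<Prod>j<Suc k. cheb_factor (\<nu> j)) * c k \<nu> \<le> C * 2 ^ J * (\<Prod>j<Suc k. r j ^ \<nu> j) * W (Suc k) \<nu>"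
      unfolding W_def
      by (intro coeff_le_multinom_weight[where \<delta>=\<delta> and \<kappa>=\<kappa> and b=b] c1 C b \<delta> \<kappa> \<kappa>b r0 q(1) rq dd0 dr)
    also have "(\<Prod>j<Suc k. r j ^ \<nu> j) = rel_gamma \<alpha> b k \<nu> powr (1 - p)"
      using False by (simp add: g max_def mult_ac)
    finally show ?thesis using False by (simp add: d_def K_def mult_ac)
  next
    case True
    have "(\<Prod>j<k. cheb_factor (\<nu> j)) * c k \<nu> \<le> (C * b k) * 2 ^ J * (\<Prod>j<k. r j ^ \<nu> j) * W k \<nu>"
      unfolding W_def
      by (intro coeff_le_multinom_weight[where \<delta>=\<delta> and \<kappa>=\<kappa> and b=b] c2[where \<nu>=\<nu>, OF True] mult_nonneg_nonneg C b \<delta> \<kappa> \<kappa>b r0 q(1) rq dd0 dr)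
    also have "\<dots> = b k * (K * (\<Prod>j<k. r j ^ \<nu> j) * W k \<nu>)" by (simp add: K_def mult_ac)
    \<comment> \<open>The extra \<open>b k\<close> yields both the factor \<open>r k\<close> that
      \<open>max 1 (\<nu> k)\<close> demands and a factor \<open>b k powr p\<close> for the
      summability in \<open>k\<close>.\<close>
    also have "\<dots> \<le> ((1 + Bm) * (b k powr p * r k)) * (K * (\<Prod>j<k. r j ^ \<nu> j) * W k \<nu>)"
      using K0 r0 W0 by (intro mult_right_mono b_r mult_nonneg_nonneg prod_nonneg) auto
    also have "\<dots> = rel_gamma \<alpha> b k \<nu> powr (1 - p) * d k \<nu>"
      using True by (simp add: g d_def mult_ac)
    finally show ?thesis using True by (simp add: cheb_factor_def)
  qed
  obtain s where s: "summable s" "\<And>k. s k \<ge> 0 \<and> (\<lambda>\<nu>. rel_gamma \<alpha> b k \<nu> powr p) summable_on multi_index (Suc k) \<and>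
     infsum (\<lambda>\<nu>. rel_gamma \<alpha> b k \<nu> powr p) (multi_index (Suc k)) \<le> s k"
    using summable_rel_gamma_powr[OF \<alpha> b Bm p(1) sum] by blast
  have dsum: "d k summable_on multi_index (Suc k)" "infsum (d k) (multi_index (Suc k)) \<le> e k" for k
    using de[of k] has_sum_imp_summable infsumI by (blast, metis order_refl)
  show ?thesis
    using \<alpha> s se e0 d0 main dsum by (intro exI[of _ \<alpha>] exI[of _ s] exI[of _ d] exI[of _ e] conjI allI) auto
qed

section \<open>Complex extension of the transport\<close>

text \<open>The given fixed point is the uniform limit of the iterates started at \<open>s0\<close>,
  which are holomorphic in \<open>u\<close>. Holomorphy of \<open>\<Phi>\<close> is stated along
  holomorphic \<open>\<tau>\<close>, the form that curve holomorphy provides.\<close>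

lemma holomorphic_fixed_point:
  fixes \<Phi> :: "complex \<Rightarrow> complex \<Rightarrow> complex"
  assumes N: "open N" and q: "0 \<le> q" "q < 1"
    and hol: "\<And>\<tau>. \<tau> holomorphic_on N \<Longrightarrow> (\<And>u. u \<in> N \<Longrightarrow> \<tau> u \<in> cball s0 r) \<Longrightarrow> (\<lambda>u. \<Phi> u (\<tau> u)) holomorphic_on N"
    and maps: "\<And>u s. u \<in> N \<Longrightarrow> s \<in> cball s0 r \<Longrightarrow> \<Phi> u s \<in> cball s0 r"
    and contr: "\<And>u s s'. u \<in> N \<Longrightarrow> s \<in> cball s0 r \<Longrightarrow> s' \<in> cball s0 r \<Longrightarrow> norm (\<Phi> u s - \<Phi> u s') \<le> q * norm (s - s')"
    and fixed: "\<And>u. u \<in> N \<Longrightarrow> t u \<in> cball s0 r" "\<And>u. u \<in> N \<Longrightarrow> \<Phi> u (t u) = t u"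
  shows "t holomorphic_on N"
proof (cases "r \<ge> 0")
  case False
  then have "N = {}" using fixed(1) by fastforce
  then show ?thesis by (simp add: holomorphic_on_def)
next
  case r: True
  define f where "f n u = (\<Phi> u ^^ n) s0" for n u
  have mem: "f n u \<in> cball s0 r" if "u \<in> N" for n u
    by (induction n) (use maps[OF that] r in \<open>auto simp: f_def\<close>)
  have f_hol: "f n holomorphic_on N" for n
  proof (induction n)
    case (Suc n)
    then have "(\<lambda>u. \<Phi> u (f n u)) holomorphic_on N" using mem by (intro hol)
    moreover have "f (Suc n) = (\<lambda>u. \<Phi> u (f n u))" by (simp add: f_def fun_eq_iff)
    ultimately show ?case by simp
  qed (simp add: f_def)
  have bound: "norm (f n u - t u) \<le> q ^ n * r" if u: "u \<in> N" for n u
  proof (induction n)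
    case 0
    then show ?case using fixed(1)[OF u] by (simp add: f_def dist_norm)
  next
    case (Suc n)
    have "norm (f (Suc n) u - t u) = norm (\<Phi> u (f n u) - \<Phi> u (t u))" by (simp add: f_def fixed(2)[OF u])
    also have "\<dots> \<le> q * norm (f n u - t u)" using u mem fixed by (intro contr) auto
    also have "\<dots> \<le> q * (q ^ n * r)" using Suc q by (intro mult_left_mono) auto
    finally show ?case by simp
  qed
  have lim: "uniform_limit N f t sequentially"
  proof (rule uniform_limitI)
    fix e :: real assume e: "e > 0"
    have "(\<lambda>n. q ^ n * r) \<longlonglongrightarrow> 0 * r" using q by (intro tendsto_intros LIMSEQ_power_zero) auto
    then have "eventually (\<lambda>n. q ^ n * r < e) sequentially" using e by (auto intro: order_tendstoD)
    then show "\<forall>\<^sub>F n in sequentially. \<forall>u\<in>N. dist (f n u) (t u) < e"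
      by eventually_elim (use bound in \<open>auto simp: dist_norm intro: order.strict_trans1\<close>)
  qed
  show ?thesis
  proof (rule holomorphic_uniform_sequence[OF N f_hol])
    fix x assume "x \<in> N"
    then obtain d where "d > 0" "cball x d \<subseteq> N" using N open_contains_cball by blast
    then show "\<exists>d>0. cball x d \<subseteq> N \<and> uniform_limit (cball x d) f t sequentially"
      using lim uniform_limit_on_subset by blast
  qed
qed

text \<open>Only the first \<open>n\<close> coordinates are constrained, and coordinates with \<open>b j = 0\<close> may be arbitrary:
  this is what lets the transport be extended with constants independent of the dimension.\<close>

definition cube_nbhd :: "(nat \<Rightarrow> real) \<Rightarrow> nat \<Rightarrow> real \<Rightarrow> (nat \<Rightarrow> complex) set" where
  "cube_nbhd b n \<delta> =
     {z. \<exists>x. (\<forall>j. x j \<in> {-1..1}) \<and> (\<Sum>j<n. b j * norm (z j - of_real (x j))) < \<delta>}"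

lemma cube_nbhdI: "(\<And>j. x j \<in> {-1..1}) \<Longrightarrow> (\<Sum>j<n. b j * norm (z j - of_real (x j))) < \<delta> \<Longrightarrow> z \<in> cube_nbhd b n \<delta>"
  unfolding cube_nbhd_def by blast

lemma of_real_mem_cube_nbhd: "(\<And>j. x j \<in> {-1..1}) \<Longrightarrow> \<delta> > 0 \<Longrightarrow> (\<lambda>j. of_real (x j)) \<in> cube_nbhd b n \<delta>"
  by (rule cube_nbhdI[of x]) auto

lemma poly_nbhd_subset_cube_nbhd:
  assumes "\<And>j. j < n \<Longrightarrow> b j \<ge> 0" "\<And>j. j < n \<Longrightarrow> \<zeta> j > 0" "(\<Sum>j<n. b j * \<zeta> j) < \<delta>"
  shows "poly_nbhd n \<zeta> \<subseteq> cube_nbhd b n \<delta>"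
proof
  fix z assume z: "z \<in> poly_nbhd n \<zeta>"
  have "\<forall>j. \<exists>x. x \<in> {-1..1} \<and> (j < n \<longrightarrow> norm (z j - of_real x) < \<zeta> j)"
  proof
    fix j
    show "\<exists>x. x \<in> {-1..1} \<and> (j < n \<longrightarrow> norm (z j - of_real x) < \<zeta> j)"
    proof (cases "j < n")
      case True
      then show ?thesis using z by (auto simp: poly_nbhd_def mem_segment_nbhd Bex_def)
    qed (auto intro: exI[of _ 0])
  qed
  then obtain x where x: "\<And>j. x j \<in> {-1..1}" "\<And>j. j < n \<Longrightarrow> norm (z j - of_real (x j)) < \<zeta> j"
    by metis
  have "(\<Sum>j<n. b j * norm (z j - of_real (x j))) \<le> (\<Sum>j<n. b j * \<zeta> j)"
    using assms(1) x(2) by (intro sum_mono mult_left_mono) (auto intro: less_imp_le)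
  then show "z \<in> cube_nbhd b n \<delta>" using x(1) assms(3) by (intro cube_nbhdI[of x]) auto
qed

section \<open>Geometry of the neighbourhoods of the cube\<close>

locale weighted_coords =
  fixes b :: "nat \<Rightarrow> real" and \<delta> :: real
  assumes b_nonneg: "b j \<ge> 0" and \<delta>_pos: "\<delta> > 0"
begin

lemma cube_nbhd_upd_real:
  assumes "z \<in> cube_nbhd b k \<delta>" "t \<in> {-1..1}"
  shows "z(k := of_real t) \<in> cube_nbhd b (Suc k) \<delta>"
proof -
  obtain x where x: "\<And>j. x j \<in> {-1..1}" "(\<Sum>j<k. b j * norm (z j - of_real (x j))) < \<delta>"
    using assms by (auto simp: cube_nbhd_def)
  show ?thesis
    by (rule cube_nbhdI[of "x(k := t)"]) (use x assms in auto)
qed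

lemma cube_nbhd_Suc: "z \<in> cube_nbhd b (Suc k) \<delta>' \<Longrightarrow> z \<in> cube_nbhd b k \<delta>'"
proof -
  assume "z \<in> cube_nbhd b (Suc k) \<delta>'"
  then obtain x where x: "\<And>j. x j \<in> {-1..1}" "(\<Sum>j<Suc k. b j * norm (z j - of_real (x j))) < \<delta>'"
    by (auto simp: cube_nbhd_def)
  moreover have "0 \<le> b k * norm (z k - of_real (x k))" using b_nonneg by simp
  ultimately show ?thesis by (intro cube_nbhdI[of x]) auto
qed

lemma cube_nbhd_cong: "(\<And>j. j < k \<Longrightarrow> z j = z' j) \<Longrightarrow> z \<in> cube_nbhd b k \<delta>' \<longleftrightarrow> z' \<in> cube_nbhd b k \<delta>'"
  unfolding cube_nbhd_def by auto

text \<open>Averaging two points also averages their real witnesses, and the weighted distance is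
  convex. Convexity gives primitives and mean value estimates in the last coordinate.\<close>

lemma convex_section: "convex {t. z(k := t) \<in> cube_nbhd b (Suc k) \<delta>}"
proof (rule convexI)
  fix s t :: complex and u v :: real
  assume st: "s \<in> {t. z(k := t) \<in> cube_nbhd b (Suc k) \<delta>}" "t \<in> {t. z(k := t) \<in> cube_nbhd b (Suc k) \<delta>}"
    and uv: "0 \<le> u" "0 \<le> v" "u + v = 1"
  then obtain x y where x: "\<And>j. x j \<in> {-1..1}" "(\<Sum>j<Suc k. b j * norm ((z(k := s)) j - of_real (x j))) < \<delta>"
    and y: "\<And>j. y j \<in> {-1..1}" "(\<Sum>j<Suc k. b j * norm ((z(k := t)) j - of_real (y j))) < \<delta>"
    by (auto simp: cube_nbhd_def)
  define w where "w j = u * x j + v * y j" for j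
  have "w j \<in> {-1..1}" for j
    using convexD[of "{-1..1::real}" "x j" "y j" u v] x y uv by (simp add: w_def)
  moreover have "(\<Sum>j<Suc k. b j * norm ((z(k := u *\<^sub>R s + v *\<^sub>R t)) j - of_real (w j)))
     \<le> (\<Sum>j<Suc k. u * (b j * norm ((z(k := s)) j - of_real (x j))) + v * (b j * norm ((z(k := t)) j - of_real (y j))))"
  proof (rule sum_mono)
    fix j
    have zz: "z j = of_real u * z j + of_real v * z j"
      using uv by (metis distrib_right mult_1 of_real_1 of_real_add)
    have "(z(k := u *\<^sub>R s + v *\<^sub>R t)) j - of_real (w j)
        = of_real u * ((z(k := s)) j - of_real (x j)) + of_real v * ((z(k := t)) j - of_real (y j))"
    proof (cases "j = k")
      case False
      then show ?thesis by (subst fun_upd_other, simp, subst zz) (simp add: w_def algebra_simps)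
    qed (simp add: w_def scaleR_conv_of_real algebra_simps)
    then have "norm ((z(k := u *\<^sub>R s + v *\<^sub>R t)) j - of_real (w j))
        \<le> u * norm ((z(k := s)) j - of_real (x j)) + v * norm ((z(k := t)) j - of_real (y j))"
      using norm_triangle_ineq[of "of_real u * ((z(k := s)) j - of_real (x j))" "of_real v * ((z(k := t)) j - of_real (y j))"] uv
      by (simp only: norm_mult norm_of_real abs_of_nonneg)
    then have "b j * norm ((z(k := u *\<^sub>R s + v *\<^sub>R t)) j - of_real (w j))
        \<le> b j * (u * norm ((z(k := s)) j - of_real (x j)) + v * norm ((z(k := t)) j - of_real (y j)))"
      by (rule mult_left_mono) (rule b_nonneg)
    then show "b j * norm ((z(k := u *\<^sub>R s + v *\<^sub>R t)) j - of_real (w j))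
        \<le> u * (b j * norm ((z(k := s)) j - of_real (x j))) + v * (b j * norm ((z(k := t)) j - of_real (y j)))"
      by (simp add: algebra_simps)
  qed
  moreover have "(\<Sum>j<Suc k. u * (b j * norm ((z(k := s)) j - of_real (x j))) + v * (b j * norm ((z(k := t)) j - of_real (y j)))) < \<delta>"
    unfolding sum.distrib sum_distrib_left[symmetric] using x(2) y(2) uv by (rule convex_bound_lt)
  ultimately show "u *\<^sub>R s + v *\<^sub>R t \<in> {t. z(k := t) \<in> cube_nbhd b (Suc k) \<delta>}"
    by (intro CollectI cube_nbhdI[of w]) auto
qed

lemma open_section: "open {t. z(k := t) \<in> cube_nbhd b (Suc k) \<delta>}"
  unfolding open_dist
proof
  fix t assume "t \<in> {t. z(k := t) \<in> cube_nbhd b (Suc k) \<delta>}"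
  then obtain x where x: "\<And>j. x j \<in> {-1..1}" "(\<Sum>j<Suc k. b j * norm ((z(k := t)) j - of_real (x j))) < \<delta>"
    by (auto simp: cube_nbhd_def)
  define A where "A = (\<Sum>j<k. b j * norm (z j - of_real (x j)))"
  have A: "A + b k * norm (t - of_real (x k)) < \<delta>" using x(2) by (simp add: A_def)
  define e where "e = (\<delta> - (A + b k * norm (t - of_real (x k)))) / (b k + 1)"
  have bk: "b k + 1 > 0" using b_nonneg[of k] by simp
  show "\<exists>e>0. \<forall>s. dist s t < e \<longrightarrow> s \<in> {t. z(k := t) \<in> cube_nbhd b (Suc k) \<delta>}"
  proof (intro exI[of _ e] conjI allI impI CollectI)
    show "e > 0" using A bk by (simp add: e_def)
    fix s assume s: "dist s t < e"
    have "b k * norm (s - of_real (x k)) \<le> b k * (norm (t - of_real (x k)) + norm (s - t))"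
      using norm_triangle_ineq[of "t - of_real (x k)" "s - t"] b_nonneg by (intro mult_left_mono) auto
    moreover have "b k * norm (s - t) \<le> b k * e" using s b_nonneg by (intro mult_left_mono) (auto simp: dist_norm)
    moreover have "b k * e < (b k + 1) * e" using \<open>e > 0\<close> by simp
    moreover have "(b k + 1) * e = \<delta> - (A + b k * norm (t - of_real (x k)))" using bk by (simp add: e_def)
    ultimately have "A + b k * norm (s - of_real (x k)) < \<delta>" by (simp add: distrib_left)
    then show "z(k := s) \<in> cube_nbhd b (Suc k) \<delta>"
      using x(1) by (intro cube_nbhdI[of x]) (auto simp: A_def)
  qed
qed

lemma minus_one_mem_section:
  "z \<in> cube_nbhd b k \<delta> \<Longrightarrow> - 1 \<in> {t. z(k := t) \<in> cube_nbhd b (Suc k) \<delta>}"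
  using cube_nbhd_upd_real[of z k "-1"] by simp

text \<open>The new coordinate runs through the segment from -1 to \<open>t\<close> as
  \<open>s\<close> runs through the interval: this is the path of integration of
  \<open>cdf\<close>.\<close>

lemma section_contract:
  assumes "z(k := t) \<in> cube_nbhd b (Suc k) \<delta>" "s \<in> {-1..1}"
  shows "z(k := - 1 + of_real ((s + 1) / 2) * (t + 1)) \<in> cube_nbhd b (Suc k) \<delta>"
proof -
  define u where "u = (s + 1) / 2"
  have u: "0 \<le> u" "u \<le> 1" using assms by (auto simp: u_def)
  have "z(k := t) \<in> cube_nbhd b k \<delta>" using assms cube_nbhd_Suc by blast
  then have "z \<in> cube_nbhd b k \<delta>" using cube_nbhd_cong[of k "z(k := t)" z] by auto
  from convexD[OF convex_section minus_one_mem_section[OF this], of t "1 - u" u] assms u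
  have "z(k := (1 - u) *\<^sub>R (- 1) + u *\<^sub>R t) \<in> cube_nbhd b (Suc k) \<delta>" by simp
  moreover have "(1 - u) *\<^sub>R (- 1) + u *\<^sub>R t = - 1 + of_real u * (t + 1)"
    by (simp add: scaleR_conv_of_real algebra_simps)
  ultimately show ?thesis by (simp add: u_def)
qed

end

text \<open>\<open>h k\<close> stands for the extended marginal density of the first
  \<open>k\<close> coordinates. The bound \<open>Lip * \<delta> \<le> M / 16\<close> confines its
  values to within \<open>M / 16\<close> of the real interval from \<open>M\<close> to
  \<open>L\<close>, so that quotients are defined and stay near the positive axis.\<close>

locale holomorphic_marginals = weighted_coords b \<delta> for b \<delta> +
  fixes M L Lip :: real and h :: "nat \<Rightarrow> (nat \<Rightarrow> complex) \<Rightarrow> complex"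
  assumes M: "0 < M" "M \<le> L" and Lip: "Lip \<ge> 0" "Lip * \<delta> \<le> M / 16"
    and h_dep: "(\<And>j. j < k \<Longrightarrow> z j = z' j) \<Longrightarrow> h k z = h k z'"
    and h_0: "h 0 z = 1"
    and h_real: "(\<And>j. x j \<in> {-1..1}) \<Longrightarrow> \<exists>v\<in>{M..L}. h k (\<lambda>j. of_real (x j)) = of_real v"
    and h_lip: "z \<in> cube_nbhd b k \<delta> \<Longrightarrow> z' \<in> cube_nbhd b k \<delta> \<Longrightarrow>
       norm (h k z - h k z') \<le> Lip * (\<Sum>j<k. b j * norm (z j - z' j))"
    and h_hol: "h k curve_holomorphic_on cube_nbhd b k \<delta>"
    and h_tower: "z \<in> cube_nbhd b k \<delta> \<Longrightarrow> h k z = (LINT s|mu1. h (Suc k) (z(k := of_real s)))"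
begin

text \<open>Bounds the extended conditional densities and their reciprocals. At real points
  \<open>L / M\<close> would do; the factor 2 absorbs the perturbation.\<close>

definition B :: real where "B = 2 * L / M"

lemma B_ge_2: "B \<ge> 2" using M by (simp add: B_def field_simps)

lemma h_near_real:
  assumes "z \<in> cube_nbhd b k \<delta>"
  shows "\<exists>v\<in>{M..L}. norm (h k z - of_real v) \<le> M / 16"
proof -
  obtain x where x: "\<And>j. x j \<in> {-1..1}" "(\<Sum>j<k. b j * norm (z j - of_real (x j))) < \<delta>"
    using assms by (auto simp: cube_nbhd_def)
  obtain v where v: "v \<in> {M..L}" "h k (\<lambda>j. of_real (x j)) = of_real v" using h_real[of x k] x(1) by blast
  have "norm (h k z - of_real v) \<le> Lip * (\<Sum>j<k. b j * norm (z j - of_real (x j)))"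
    using h_lip[OF assms of_real_mem_cube_nbhd[of x]] x(1) \<delta>_pos v(2) by auto
  also have "\<dots> \<le> Lip * \<delta>" using x(2) Lip by (intro mult_left_mono) auto
  finally show ?thesis using v Lip by force
qed

lemma h_bounds:
  assumes "z \<in> cube_nbhd b k \<delta>"
  shows "15/16 * M \<le> Re (h k z)" "\<bar>Im (h k z)\<bar> \<le> M / 16" "norm (h k z) \<le> 17/16 * L" "M / 2 \<le> norm (h k z)" "h k z \<noteq> 0"
proof -
  obtain v where v: "v \<in> {M..L}" "norm (h k z - of_real v) \<le> M / 16" using h_near_real[OF assms] by blast
  have "\<bar>Re (h k z) - v\<bar> \<le> M / 16" using abs_Re_le_cmod[of "h k z - of_real v"] v by simp
  then show re: "15/16 * M \<le> Re (h k z)" using v by (simp add: abs_if split: if_splits)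
  show "\<bar>Im (h k z)\<bar> \<le> M / 16" using abs_Im_le_cmod[of "h k z - of_real v"] v by simp
  have "norm (h k z) \<le> norm (complex_of_real v) + M / 16" using v(2) norm_triangle_ineq2[of "h k z" "of_real v"] by linarith
  then show "norm (h k z) \<le> 17/16 * L" using v M by simp
  show "M / 2 \<le> norm (h k z)" using re complex_Re_le_cmod[of "h k z"] M by linarith
  then show "h k z \<noteq> 0" using M by auto
qed

definition cond_quot :: "nat \<Rightarrow> (nat \<Rightarrow> complex) \<Rightarrow> complex" where
  "cond_quot k z = h (Suc k) z / h k z"

lemma cond_quot_dep: "(\<And>j. j \<le> k \<Longrightarrow> z j = z' j) \<Longrightarrow> cond_quot k z = cond_quot k z'"
  unfolding cond_quot_def using h_dep[of "Suc k" z z'] h_dep[of k z z'] by auto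

text \<open>The last estimate keeps the argument of the value at most \<open>arctan (1/2)\<close>,
  less than a quarter of \<open>pi\<close>; a quotient of two such values therefore has positive
  real part.\<close>

lemma cond_quot_bounds:
  assumes z: "z \<in> cube_nbhd b (Suc k) \<delta>"
  shows "norm (cond_quot k z) \<le> B" "1 / B \<le> Re (cond_quot k z)" "\<bar>Im (cond_quot k z)\<bar> \<le> Re (cond_quot k z) / 2"
proof -
  define a c a' c' where "a = Re (h (Suc k) z)" and "c = Im (h (Suc k) z)" and "a' = Re (h k z)" and "c' = Im (h k z)"
  note h1 = h_bounds[OF z] and h0 = h_bounds[OF cube_nbhd_Suc[OF z]]
  have "norm (h (Suc k) z) / norm (h k z) \<le> (17/16 * L) / (15/16 * M)"
    using h1(3) h0(1) complex_Re_le_cmod[of "h k z"] M by (intro frac_le) linarith+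
  also have "\<dots> \<le> B" using M by (simp add: B_def field_simps)
  finally show "norm (cond_quot k z) \<le> B" by (simp add: cond_quot_def norm_divide)
  have a: "a > 0" "a' > 0" using h1(1) h0(1) M by (auto simp: a_def a'_def)
  \<comment> \<open>The factor 1/15 is the ratio of \<open>M / 16\<close> to
    \<open>15/16 * M\<close>.\<close>
  have c: "\<bar>c\<bar> \<le> a / 15" "\<bar>c'\<bar> \<le> a' / 15" using h1(1,2) h0(1,2) by (auto simp: a_def a'_def c_def c'_def)
  have n2: "(cmod (h k z))\<^sup>2 = a'\<^sup>2 + c'\<^sup>2" by (simp add: cmod_power2 a'_def c'_def)
  have n2pos: "a'\<^sup>2 + c'\<^sup>2 > 0" using a by (simp add: add_pos_nonneg)
  have Re: "Re (cond_quot k z) = (a * a' + c * c') / (a'\<^sup>2 + c'\<^sup>2)" and Im: "Im (cond_quot k z) = (c * a' - a * c') / (a'\<^sup>2 + c'\<^sup>2)"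
    unfolding cond_quot_def a_def a'_def c_def c'_def by (simp_all add: Re_divide Im_divide)
  have cc: "\<bar>c * c'\<bar> \<le> a * a' / 225"
    using mult_mono[OF c] a by (simp add: abs_mult)
  have c2: "c'\<^sup>2 \<le> a'\<^sup>2 / 225"
    using mult_mono[OF c(2) c(2)] a by (simp add: power2_eq_square)
  have num: "a * a' * (224/225) \<le> a * a' + c * c'" using cc by linarith
  have ca: "\<bar>c * a'\<bar> \<le> a * a' / 15" "\<bar>a * c'\<bar> \<le> a * a' / 15"
    using mult_right_mono[OF c(1), of a'] mult_left_mono[OF c(2), of a] a by (auto simp: abs_mult)
  have "\<bar>c * a' - a * c'\<bar> \<le> (a * a' + c * c') / 2"
  proof -
    have "\<bar>c * a' - a * c'\<bar> \<le> \<bar>c * a'\<bar> + \<bar>a * c'\<bar>" by (rule abs_triangle_ineq4)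
    also have "\<dots> \<le> (a * a' * (224/225)) / 2" using add_mono[OF ca] mult_pos_pos[OF a] by simp
    also have "\<dots> \<le> (a * a' + c * c') / 2" using num by simp
    finally show ?thesis .
  qed
  then have "\<bar>c * a' - a * c'\<bar> / (a'\<^sup>2 + c'\<^sup>2) \<le> ((a * a' + c * c') / 2) / (a'\<^sup>2 + c'\<^sup>2)"
    using n2pos by (intro divide_right_mono) auto
  then show "\<bar>Im (cond_quot k z)\<bar> \<le> Re (cond_quot k z) / 2"
    unfolding Re Im abs_divide using n2pos by (simp add: mult.commute)
  have "1 / B \<le> (15/16 * M) / (17/16 * L) * (224/226)" using M by (simp add: B_def field_simps)
  also have "\<dots> \<le> a / a' * (224/226)"
    using h1(1) h0(3) complex_Re_le_cmod[of "h k z"] M a unfolding a_def[symmetric] a'_def[symmetric]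
    by (intro mult_right_mono frac_le) linarith+
  also have "\<dots> = (a * a' * (224/225)) / (a'\<^sup>2 * (226/225))" using a by (simp add: power2_eq_square field_simps)
  also have "\<dots> \<le> Re (cond_quot k z)"
    unfolding Re using num c2 n2pos a cc by (intro frac_le) (auto simp: abs_if split: if_splits)
  finally show "1 / B \<le> Re (cond_quot k z)" .
qed

lemma norm_cond_quot_ge: "z \<in> cube_nbhd b (Suc k) \<delta> \<Longrightarrow> 1 / B \<le> norm (cond_quot k z)"
  using cond_quot_bounds(2) complex_Re_le_cmod order_trans by blast

definition Cq :: real where "Cq = 2 * Lip * (1 + B) / M"

lemma Cq_nonneg: "Cq \<ge> 0" using Lip M B_ge_2 by (simp add: Cq_def)

lemma cond_quot_lip:
  assumes z: "z \<in> cube_nbhd b (Suc k) \<delta>" and z': "z' \<in> cube_nbhd b (Suc k) \<delta>"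
  shows "norm (cond_quot k z - cond_quot k z') \<le> Cq * (\<Sum>j<Suc k. b j * norm (z j - z' j))"
proof -
  define S where "S = (\<Sum>j<Suc k. b j * norm (z j - z' j))"
  note h0 = h_bounds[OF cube_nbhd_Suc[OF z]] and h0' = h_bounds[OF cube_nbhd_Suc[OF z']]
  have S': "(\<Sum>j<k. b j * norm (z j - z' j)) \<le> S" unfolding S_def using b_nonneg by simp
  have e1: "norm (h (Suc k) z - h (Suc k) z') \<le> Lip * S" unfolding S_def by (rule h_lip[OF z z'])
  have "norm (h k z' - h k z) \<le> Lip * (\<Sum>j<k. b j * norm (z j - z' j))"
    using h_lip[OF cube_nbhd_Suc[OF z] cube_nbhd_Suc[OF z']] by (simp add: norm_minus_commute)
  also have "\<dots> \<le> Lip * S" using S' Lip by (intro mult_left_mono)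
  finally have e0: "norm (h k z' - h k z) \<le> Lip * S" .
  have "cond_quot k z - cond_quot k z' = ((h (Suc k) z - h (Suc k) z') + cond_quot k z' * (h k z' - h k z)) / h k z"
    using h0(5) h0'(5) by (simp add: cond_quot_def field_simps)
  then have "norm (cond_quot k z - cond_quot k z') = norm ((h (Suc k) z - h (Suc k) z') + cond_quot k z' * (h k z' - h k z)) / norm (h k z)"
    by (simp add: norm_divide)
  also have "\<dots> \<le> (Lip * S + B * (Lip * S)) / (M / 2)"
  proof (rule frac_le)
    have "norm ((h (Suc k) z - h (Suc k) z') + cond_quot k z' * (h k z' - h k z)) \<le> norm (h (Suc k) z - h (Suc k) z') + norm (cond_quot k z') * norm (h k z' - h k z)"
      by (metis norm_triangle_ineq norm_mult)
    also have "\<dots> \<le> Lip * S + B * (Lip * S)"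
      using e1 e0 cond_quot_bounds(1)[OF z'] B_ge_2 by (intro add_mono mult_mono) auto
    finally show "norm ((h (Suc k) z - h (Suc k) z') + cond_quot k z' * (h k z' - h k z)) \<le> Lip * S + B * (Lip * S)" .
  next
    have "S \<ge> 0" unfolding S_def using b_nonneg by (intro sum_nonneg) auto
    then show "0 \<le> Lip * S + B * (Lip * S)" using Lip B_ge_2 by (intro add_nonneg_nonneg mult_nonneg_nonneg) auto
  qed (use h0 M in auto)
  also have "\<dots> = Cq * S" by (simp add: Cq_def field_simps)
  finally show ?thesis by (simp add: S_def)
qed

lemma cond_quot_hol: "cond_quot k curve_holomorphic_on cube_nbhd b (Suc k) \<delta>"
proof (rule curve_holomorphic_onI)
  fix S w assume S: "open S" "\<And>j. (\<lambda>s. w s j) holomorphic_on S" "\<And>s. s \<in> S \<Longrightarrow> w s \<in> cube_nbhd b (Suc k) \<delta>"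
  show "(\<lambda>s. cond_quot k (w s)) holomorphic_on S"
    unfolding cond_quot_def using S h_bounds(5)[OF cube_nbhd_Suc] cube_nbhd_Suc
    by (intro holomorphic_on_divide curve_holomorphic_onD[OF h_hol]) auto
qed

lemma section_hol:
  assumes "H curve_holomorphic_on cube_nbhd b (Suc k) \<delta>"
  shows "(\<lambda>t. H (z(k := t))) holomorphic_on {t. z(k := t) \<in> cube_nbhd b (Suc k) \<delta>}"
  by (intro curve_holomorphic_on_section[OF assms] open_section) auto

lemma section_measurable:
  assumes H: "H curve_holomorphic_on cube_nbhd b (Suc k) \<delta>" and z: "z \<in> cube_nbhd b k \<delta>"
  shows "continuous_on {-1..1} (\<lambda>s. H (z(k := of_real s)))"
  using holomorphic_on_imp_continuous_on[OF section_hol[OF H, of z]]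
  by (rule continuous_on_compose2) (use cube_nbhd_upd_real[OF z] in \<open>auto intro!: continuous_intros\<close>)

text \<open>By the tower property \<open>h k\<close> is the average of \<open>h (Suc k)\<close> over
  the last coordinate, so their difference is an oscillation in that coordinate, of order
  \<open>b k\<close>.\<close>

lemma cond_quot_near_one:
  assumes z: "z \<in> cube_nbhd b (Suc k) \<delta>"
  shows "norm (cond_quot k z - 1) \<le> 2 * Lip / M * b k * (norm (z k) + 1)"
proof -
  have z0: "z \<in> cube_nbhd b k \<delta>" using z by (rule cube_nbhd_Suc)
  have cont: "continuous_on {-1..1} (\<lambda>s. h (Suc k) (z(k := of_real s)))" by (rule section_measurable[OF h_hol z0])
  have int: "integrable mu1 (\<lambda>s. h (Suc k) (z(k := of_real s)))"
    using h_bounds(3)[OF cube_nbhd_upd_real[OF z0]] by (intro integrable_mu1I[of _ "17/16 * L"] borel_measurable_mu1I[OF cont]) auto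
  have "h (Suc k) z - h k z = (LINT s|mu1. h (Suc k) z - h (Suc k) (z(k := of_real s)))"
    unfolding h_tower[OF z0] using int by (simp add: mu1.prob_space[simplified])
  also have "norm \<dots> \<le> Lip * (b k * (norm (z k) + 1))"
  proof (rule norm_LINT_le_const[OF prob_space_mu1])
    fix s assume "s \<in> space mu1"
    then have s: "s \<in> {-1..1}" by simp
    have "norm (h (Suc k) z - h (Suc k) (z(k := of_real s))) \<le> Lip * (\<Sum>j<Suc k. b j * norm (z j - (z(k := of_real s)) j))"
      by (rule h_lip[OF z cube_nbhd_upd_real[OF z0 s]])
    also have "\<dots> = Lip * (b k * norm (z k - of_real s))" by simp
    also have "\<dots> \<le> Lip * (b k * (norm (z k) + 1))"
      using norm_triangle_ineq4[of "z k" "of_real s"] s b_nonneg Lip by (intro mult_left_mono) auto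
    finally show "norm (h (Suc k) z - h (Suc k) (z(k := of_real s))) \<le> Lip * (b k * (norm (z k) + 1))" .
  qed (use Lip b_nonneg in auto)
  finally have "norm (h (Suc k) z - h k z) \<le> Lip * (b k * (norm (z k) + 1))" .
  moreover have "cond_quot k z - 1 = (h (Suc k) z - h k z) / h k z"
    using h_bounds(5)[OF z0] by (simp add: cond_quot_def field_simps)
  moreover have "norm (h (Suc k) z - h k z) / norm (h k z) \<le> (Lip * (b k * (norm (z k) + 1))) / (M / 2)"
    using calculation(1) h_bounds(4)[OF z0] M by (intro frac_le) (auto intro: order_trans[OF norm_ge_zero])
  ultimately show ?thesis by (simp add: norm_divide field_simps)
qed

lemma LINT_cond_quot:
  assumes z: "z \<in> cube_nbhd b k \<delta>"
  shows "(LINT s|mu1. cond_quot k (z(k := of_real s))) = 1"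
proof -
  have "cond_quot k (z(k := of_real s)) = h (Suc k) (z(k := of_real s)) / h k z" for s
    unfolding cond_quot_def using h_dep[of k "z(k := of_real s)" z] by simp
  then show ?thesis using h_bounds(5)[OF z] by (simp flip: h_tower[OF z])
qed

text \<open>The conditional distribution function as an integral along the segment from -1 to
  \<open>z k\<close>, which makes sense for complex \<open>z k\<close>. Pulled back to a fixed
  interval it is a parameter integral, whence its holomorphy in all coordinates.\<close>

definition cdf :: "nat \<Rightarrow> (nat \<Rightarrow> complex) \<Rightarrow> complex" where
  "cdf k z = (z k + 1) / 2 * (LINT s|mu1. cond_quot k (z(k := - 1 + of_real ((s + 1) / 2) * (z k + 1))))"

lemma cdf_dep: "(\<And>j. j \<le> k \<Longrightarrow> z j = z' j) \<Longrightarrow> cdf k z = cdf k z'"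
proof -
  assume eq: "\<And>j. j \<le> k \<Longrightarrow> z j = z' j"
  have "cond_quot k (z(k := t)) = cond_quot k (z'(k := t))" for t
    by (rule cond_quot_dep) (use eq in auto)
  then show ?thesis using eq[of k] by (simp add: cdf_def)
qed

lemma cdf_integrand_measurable:
  assumes "z \<in> cube_nbhd b (Suc k) \<delta>"
  shows "(\<lambda>s. cond_quot k (z(k := - 1 + of_real ((s + 1) / 2) * (z k + 1)))) \<in> borel_measurable mu1"
    and "continuous_on {-1..1} (\<lambda>s. cond_quot k (z(k := - 1 + of_real ((s + 1) / 2) * (z k + 1))))"
proof -
  show cont: "continuous_on {-1..1} (\<lambda>s. cond_quot k (z(k := - 1 + of_real ((s + 1) / 2) * (z k + 1))))"
    using holomorphic_on_imp_continuous_on[OF section_hol[OF cond_quot_hol, where z=z and k=k]]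
    by (rule continuous_on_compose2) (use section_contract[of z k "z k"] assms in \<open>auto intro!: continuous_intros\<close>)
  show "(\<lambda>s. cond_quot k (z(k := - 1 + of_real ((s + 1) / 2) * (z k + 1)))) \<in> borel_measurable mu1"
    by (rule borel_measurable_mu1I[OF cont])
qed

lemma cdf_hol: "cdf k curve_holomorphic_on cube_nbhd b (Suc k) \<delta>"
proof (rule curve_holomorphic_onI)
  fix S w assume S: "open S" and w: "\<And>j. (\<lambda>s. w s j) holomorphic_on S" "\<And>s. s \<in> S \<Longrightarrow> w s \<in> cube_nbhd b (Suc k) \<delta>"
  have mem: "(w u)(k := - 1 + of_real ((s + 1) / 2) * (w u k + 1)) \<in> cube_nbhd b (Suc k) \<delta>" if "u \<in> S" "s \<in> space mu1" for u s
    using section_contract[of "w u" k "w u k" s] w(2)[OF that(1)] that by simp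
  have "(\<lambda>u. LINT s|mu1. cond_quot k ((w u)(k := - 1 + of_real ((s + 1) / 2) * (w u k + 1)))) holomorphic_on S"
  proof (rule holomorphic_on_LINT[OF prob_space_mu1 S, where B=B])
    show "(\<lambda>u. cond_quot k ((w u)(k := - 1 + of_real ((s + 1) / 2) * (w u k + 1)))) holomorphic_on S" if "s \<in> space mu1" for s
      using mem that by (intro curve_holomorphic_onD[OF cond_quot_hol S] holomorphic_on_fun_upd holomorphic_intros w) auto
    show "(\<lambda>s. cond_quot k ((w u)(k := - 1 + of_real ((s + 1) / 2) * (w u k + 1)))) \<in> borel_measurable mu1" if "u \<in> S" for u
      by (rule cdf_integrand_measurable[OF w(2)[OF that]])
  qed (use cond_quot_bounds(1) mem in auto)
  then show "(\<lambda>u. cdf k (w u)) holomorphic_on S"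
    unfolding cdf_def by (auto intro!: holomorphic_intros w)
qed

lemma cdf_primitive:
  assumes z: "z \<in> cube_nbhd b k \<delta>"
  obtains P where "\<And>t. z(k := t) \<in> cube_nbhd b (Suc k) \<delta> \<Longrightarrow> (P has_field_derivative cond_quot k (z(k := t))) (at t)"
    and "\<And>t. z(k := t) \<in> cube_nbhd b (Suc k) \<delta> \<Longrightarrow> cdf k (z(k := t)) = (P t - P (- 1)) / 2"
proof -
  let ?S = "{t. z(k := t) \<in> cube_nbhd b (Suc k) \<delta>}"
  obtain P where "\<And>t. t \<in> ?S \<Longrightarrow> (P has_field_derivative cond_quot k (z(k := t))) (at t within ?S)"
    using holomorphic_convex_primitive'[OF convex_section open_section section_hol[OF cond_quot_hol]] by blast
  then have P: "\<And>t. t \<in> ?S \<Longrightarrow> (P has_field_derivative cond_quot k (z(k := t))) (at t)"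
    using at_within_open[OF _ open_section] by metis
  have "cdf k (z(k := t)) = (P t - P (- 1)) / 2" if t: "t \<in> ?S" for t
  proof -
    define g where "g s = (t + 1) / 2 * cond_quot k (z(k := - 1 + of_real ((s + 1) / 2) * (t + 1)))" for s
    define G where "G s = P (- 1 + of_real ((s + 1) / 2) * (t + 1))" for s
    have "cdf k (z(k := t)) = (LINT s|mu1. g s)" by (simp add: cdf_def g_def)
    also have "\<dots> = (1/2) *\<^sub>R (G 1 - G (-1))"
    proof (rule LINT_mu1_FTC)
      fix s :: real assume s: "s \<in> {-1..1}"
      define l where "l y = - 1 + ((y + 1) / 2) * (t + 1)" for y
      have ls: "l (of_real s) = - 1 + of_real ((s + 1) / 2) * (t + 1)" by (simp add: l_def)
      have "(l has_field_derivative (t + 1) / 2) (at (of_real s))"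
        unfolding l_def by (auto intro!: derivative_eq_intros)
      moreover have "(P has_field_derivative cond_quot k (z(k := l (of_real s)))) (at (l (of_real s)))"
        unfolding ls using section_contract[of z k t s] t s by (intro P) simp
      ultimately have "((\<lambda>y. P (l y)) has_field_derivative cond_quot k (z(k := l (of_real s))) * ((t + 1) / 2)) (at (of_real s))"
        using DERIV_chain2 by blast
      then have "((\<lambda>y. P (l y)) has_field_derivative g s) (at (of_real s))"
        by (simp add: g_def ls mult.commute)
      from has_vector_derivative_real_field[OF this]
      have "((\<lambda>s. P (l (of_real s))) has_vector_derivative g s) (at s within {-1..1})" .
      moreover have "G = (\<lambda>s. P (l (of_real s)))" by (simp add: fun_eq_iff G_def l_def)
      ultimately show "(G has_vector_derivative g s) (at s within {-1..1})" by simp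
    next
      show "continuous_on {-1..1} g"
        unfolding g_def using cdf_integrand_measurable(2)[of "z(k := t)" k] t by (intro continuous_intros) auto
    qed
    finally show ?thesis by (simp add: G_def scaleR_conv_of_real)
  qed
  then show ?thesis using that[of P] P by simp
qed

lemma cdf_deriv:
  assumes "z(k := t) \<in> cube_nbhd b (Suc k) \<delta>"
  shows "((\<lambda>t. cdf k (z(k := t))) has_field_derivative cond_quot k (z(k := t)) / 2) (at t)"
proof -
  have "z(k := t) \<in> cube_nbhd b k \<delta>" using assms cube_nbhd_Suc by blast
  then have z: "z \<in> cube_nbhd b k \<delta>" using cube_nbhd_cong[of k "z(k := t)" z] by auto
  obtain P where P: "\<And>t. z(k := t) \<in> cube_nbhd b (Suc k) \<delta> \<Longrightarrow> (P has_field_derivative cond_quot k (z(k := t))) (at t)"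
    "\<And>t. z(k := t) \<in> cube_nbhd b (Suc k) \<delta> \<Longrightarrow> cdf k (z(k := t)) = (P t - P (- 1)) / 2"
    using cdf_primitive[OF z] by blast
  have "((\<lambda>t. (P t - P (- 1)) / 2) has_field_derivative cond_quot k (z(k := t)) / 2) (at t)"
    using P(1)[OF assms] by (auto intro!: derivative_eq_intros)
  then show ?thesis
    by (rule has_field_derivative_transform_within_open[where S="{t. z(k := t) \<in> cube_nbhd b (Suc k) \<delta>}"])
      (use assms open_section P(2) in auto)
qed

lemma cdf_lip_params:
  assumes z: "z \<in> cube_nbhd b (Suc k) \<delta>" and z': "z' \<in> cube_nbhd b (Suc k) \<delta>"
    and t: "z k = of_real t" "z' k = of_real t" "t \<in> {-1..1}"
  shows "norm (cdf k z - cdf k z') \<le> Cq * (\<Sum>j<k. b j * norm (z j - z' j))"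
proof -
  define p where "p s = - 1 + of_real ((s + 1) / 2) * (of_real t + 1 :: complex)" for s
  define S where "S = (\<Sum>j<k. b j * norm (z j - z' j))"
  have S0: "S \<ge> 0" unfolding S_def using b_nonneg by (intro sum_nonneg) auto
  have mem: "z(k := p s) \<in> cube_nbhd b (Suc k) \<delta>" "z'(k := p s) \<in> cube_nbhd b (Suc k) \<delta>" if "s \<in> {-1..1}" for s
    using section_contract[of z k "of_real t" s] section_contract[of z' k "of_real t" s] z z' that
    unfolding p_def fun_upd_idem[of z k, OF t(1)] fun_upd_idem[of z' k, OF t(2)] by blast+
  have int: "integrable mu1 (\<lambda>s. cond_quot k (z(k := p s)))" "integrable mu1 (\<lambda>s. cond_quot k (z'(k := p s)))"
    using cdf_integrand_measurable(1)[OF z] cdf_integrand_measurable(1)[OF z'] t cond_quot_bounds(1) mem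
    by (auto intro!: integrable_mu1I[of _ B] simp: p_def)
  have "cdf k z = (of_real t + 1) / 2 * (LINT s|mu1. cond_quot k (z(k := p s)))"
    and "cdf k z' = (of_real t + 1) / 2 * (LINT s|mu1. cond_quot k (z'(k := p s)))"
    by (simp_all add: cdf_def t p_def)
  then have "cdf k z - cdf k z' = (of_real t + 1) / 2 * (LINT s|mu1. cond_quot k (z(k := p s)) - cond_quot k (z'(k := p s)))"
    using Bochner_Integration.integral_diff[OF int] by (simp only: right_diff_distrib)
  then have "norm (cdf k z - cdf k z') = \<bar>(t + 1) / 2\<bar> * norm (LINT s|mu1. cond_quot k (z(k := p s)) - cond_quot k (z'(k := p s)))"
  proof -
    have "(of_real t + 1) / 2 = complex_of_real ((t + 1) / 2)" by simp
    then have "norm ((of_real t + 1) / 2 :: complex) = \<bar>(t + 1) / 2\<bar>" by (simp only: norm_of_real)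
    moreover assume "cdf k z - cdf k z' = (of_real t + 1) / 2 * (LINT s|mu1. cond_quot k (z(k := p s)) - cond_quot k (z'(k := p s)))"
    ultimately show ?thesis by (simp only: norm_mult)
  qed
  also have "\<dots> \<le> 1 * (Cq * S)"
  proof (intro mult_mono norm_LINT_le_const prob_space_mu1)
    fix s assume s: "s \<in> space mu1"
    have "norm (cond_quot k (z(k := p s)) - cond_quot k (z'(k := p s))) \<le> Cq * (\<Sum>j<Suc k. b j * norm ((z(k := p s)) j - (z'(k := p s)) j))"
      using s by (intro cond_quot_lip mem) auto
    then show "norm (cond_quot k (z(k := p s)) - cond_quot k (z'(k := p s))) \<le> Cq * S" by (simp add: S_def)
  qed (use t S0 Cq_nonneg in auto)
  finally show ?thesis by (simp add: S_def)
qed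

lemma cdf_lip_last:
  assumes "z(k := t) \<in> cube_nbhd b (Suc k) \<delta>" "z(k := t') \<in> cube_nbhd b (Suc k) \<delta>"
  shows "norm (cdf k (z(k := t)) - cdf k (z(k := t'))) \<le> B / 2 * norm (t - t')"
proof (rule field_differentiable_bound[OF convex_section])
  show "((\<lambda>t. cdf k (z(k := t))) has_field_derivative cond_quot k (z(k := s)) / 2) (at s within {t. z(k := t) \<in> cube_nbhd b (Suc k) \<delta>})"
    if "s \<in> {t. z(k := t) \<in> cube_nbhd b (Suc k) \<delta>}" for s
    using cdf_deriv[of z k s] that by (auto intro: has_field_derivative_at_within)
  show "norm (cond_quot k (z(k := s)) / 2) \<le> B / 2" if "s \<in> {t. z(k := t) \<in> cube_nbhd b (Suc k) \<delta>}" for s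
    using cond_quot_bounds(1)[of "z(k := s)" k] that by (simp add: norm_divide)
qed (use assms in auto)

definition contr :: real where "contr = sqrt (1 - 1 / B ^ 4)"

lemma contr: "0 \<le> contr" "contr < 1"
proof -
  have "1 / B ^ 4 \<le> 1" using B_ge_2 one_le_power[of B 4] by (simp add: field_simps)
  then show "0 \<le> contr" by (simp add: contr_def)
  have "1 / B ^ 4 > 0" using B_ge_2 by simp
  then show "contr < 1" unfolding contr_def by (simp add: real_sqrt_lt_1_iff)
qed

text \<open>\<open>B ^ 3 / 2\<close> is the step size of the simplified Newton iteration that inverts \<open>t \<mapsto> cdf k (z(k := t))\<close>.\<close>

lemma newton_contr:
  assumes "w(k := s) \<in> cube_nbhd b (Suc k) \<delta>" "w(k := s') \<in> cube_nbhd b (Suc k) \<delta>"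
  shows "norm ((s - (cdf k (w(k := s)) - c) / of_real (B ^ 3 / 2)) - (s' - (cdf k (w(k := s')) - c) / of_real (B ^ 3 / 2)))
     \<le> contr * norm (s - s')"
proof (rule field_differentiable_bound[OF convex_section, where f="\<lambda>s. s - (cdf k (w(k := s)) - c) / of_real (B ^ 3 / 2)"])
  let ?S = "{t. w(k := t) \<in> cube_nbhd b (Suc k) \<delta>}"
  have B3: "B ^ 3 > 0" using B_ge_2 by simp
  fix t assume t: "t \<in> ?S"
  define f where "f = cond_quot k (w(k := t))"
  have "((\<lambda>s. s - (cdf k (w(k := s)) - c) / of_real (B ^ 3 / 2)) has_field_derivative 1 - (f / 2 - 0) / of_real (B ^ 3 / 2)) (at t)"
    unfolding f_def using t by (intro DERIV_diff DERIV_ident DERIV_cdivide DERIV_const cdf_deriv) auto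
  then have D: "((\<lambda>s. s - (cdf k (w(k := s)) - c) / of_real (B ^ 3 / 2)) has_field_derivative 1 - (f / 2 - 0) / of_real (B ^ 3 / 2)) (at t within ?S)"
    by (rule has_field_derivative_at_within)
  have eq: "1 - (f / 2 - 0) / of_real (B ^ 3 / 2) = 1 - f / of_real (B ^ 3)" by simp
  show "((\<lambda>s. s - (cdf k (w(k := s)) - c) / of_real (B ^ 3 / 2)) has_field_derivative 1 - f / of_real (B ^ 3)) (at t within ?S)"
    using D unfolding eq .
  have f: "norm f \<le> B" "1 / B \<le> Re f" unfolding f_def using cond_quot_bounds[of "w(k := t)" k] t by auto
  \<comment> \<open>With \<open>Re f \<ge> 1 / B\<close> and \<open>norm f \<le> B\<close>, division
    by \<open>B ^ 3\<close> makes the linear gain \<open>2 / B ^ 4\<close> twice the quadratic loss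
    \<open>1 / B ^ 4\<close>.\<close>
  have "(cmod (1 - f / of_real (B ^ 3)))\<^sup>2 = 1 - 2 * Re f / B ^ 3 + (norm f / B ^ 3)\<^sup>2"
    unfolding cmod_power2 power_divide by (simp add: power2_eq_square algebra_simps add_divide_distrib)
  also have "\<dots> \<le> 1 - 2 * (1 / B) / B ^ 3 + (B / B ^ 3)\<^sup>2"
    using f B3 by (intro add_mono diff_mono power_mono divide_right_mono) auto
  also have "\<dots> = 1 - 1 / B ^ 4" using B_ge_2 by (simp add: field_simps power2_eq_square power3_eq_cube power4_eq_xxxx)
  finally show "norm (1 - f / of_real (B ^ 3)) \<le> contr"
    unfolding contr_def by (rule real_le_rsqrt)
qed (use assms in auto)

text \<open>Equal values would make the contraction shift both points by the same amount and thus
  preserve their distance.\<close>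

lemma cdf_inj:
  assumes "w(k := s) \<in> cube_nbhd b (Suc k) \<delta>" "w(k := s') \<in> cube_nbhd b (Suc k) \<delta>"
    and "cdf k (w(k := s)) = cdf k (w(k := s'))"
  shows "s = s'"
proof (rule ccontr)
  assume "s \<noteq> s'"
  have "norm (s - s') \<le> contr * norm (s - s')"
    using newton_contr[OF assms(1,2), of 0] assms(3) by simp
  then show False using contr \<open>s \<noteq> s'\<close> by (simp add: mult_le_cancel_right1)
qed

end

text \<open>\<open>X\<close> stands for the transport. It is only known through the distribution functions: the conditional
  distribution function of the target at \<open>X\<close> equals that of the reference.\<close>

locale triangular_transport =
  \<rho>: holomorphic_marginals b \<delta> M L Lip h + \<pi>: holomorphic_marginals b \<delta> M L Lip g
  for b \<delta> M L Lip h g +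
  fixes X :: "nat \<Rightarrow> (nat \<Rightarrow> real) \<Rightarrow> real" and sb :: real
  assumes b_sum: "(\<Sum>j<n. b j) \<le> sb"
    and X_range: "(\<And>j. x j \<in> {-1..1}) \<Longrightarrow> X k x \<in> {-1..1}"
    and X_cdf: "(\<And>j. x j \<in> {-1..1}) \<Longrightarrow> \<pi>.cdf k (\<lambda>j. of_real (X j x)) = \<rho>.cdf k (\<lambda>j. of_real (x j))"
begin

abbreviation "nbhd \<equiv> cube_nbhd b"

lemma B: "\<rho>.B > 0" "\<rho>.B \<ge> 2" using \<rho>.B_ge_2 by auto

text \<open>For \<open>z\<close> near a real point \<open>x\<close>, \<open>wdist\<close> measures how far \<open>z\<close> is from \<open>x\<close>, and \<open>rad\<close> bounds the distance of the
  \<open>k\<close>-th component of the extended transport from \<open>X k x\<close>. The perturbation of the \<open>k\<close>-th equation is controlled by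
  the earlier components, and the factor \<open>V k\<close> is the discrete Gronwall bound for the resulting recursion.\<close>

definition C1 :: real where "C1 = (\<rho>.B / 2) / ((\<rho>.B ^ 3 / 2) * (1 - \<rho>.contr))"
definition C2 :: real where "C2 = \<rho>.Cq / ((\<rho>.B ^ 3 / 2) * (1 - \<rho>.contr))"
definition V :: "nat \<Rightarrow> real" where "V k = exp (C2 * (\<Sum>j<k. b j))"
definition Vmax :: real where "Vmax = exp (C2 * sb)"
definition \<delta>' :: real where "\<delta>' = \<delta> / (4 * ((1 + C1) * Vmax))"
definition wdist :: "nat \<Rightarrow> (nat \<Rightarrow> complex) \<Rightarrow> (nat \<Rightarrow> real) \<Rightarrow> real" where
  "wdist k z x = (\<Sum>j<k. b j * norm (z j - of_real (x j)))"
definition rad :: "nat \<Rightarrow> (nat \<Rightarrow> complex) \<Rightarrow> (nat \<Rightarrow> real) \<Rightarrow> real" where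
  "rad k z x = C1 * norm (z k - of_real (x k)) + C2 * ((1 + C1) * V k * wdist k z x)"

lemma C_nonneg: "C1 \<ge> 0" "C2 \<ge> 0"
  using B \<rho>.contr \<rho>.Cq_nonneg by (simp_all add: C1_def C2_def)

lemma wdist_nonneg: "wdist k z x \<ge> 0"
  unfolding wdist_def using \<rho>.b_nonneg by (intro sum_nonneg) auto

lemma V_pos: "V k > 0" by (simp add: V_def)

lemma V_le: "V k \<le> Vmax"
  unfolding V_def Vmax_def using b_sum C_nonneg by (simp add: mult_left_mono)

lemma CV_ge_1: "(1 + C1) * Vmax \<ge> 1"
proof -
  have "sb \<ge> 0" using b_sum[of 0] by simp
  then have "Vmax \<ge> 1" unfolding Vmax_def using C_nonneg by simp
  then show ?thesis using C_nonneg mult_mono[of 1 "1 + C1" 1 Vmax] by simp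
qed

lemma \<delta>'_pos: "\<delta>' > 0" and \<delta>'_le: "\<delta>' \<le> \<delta> / 4" and \<delta>'_eq: "(1 + C1) * Vmax * \<delta>' = \<delta> / 4"
proof -
  have ne: "(1 + C1) * Vmax > 0" using CV_ge_1 by linarith
  have "\<delta> / (4 * K) > 0" if "K > 0" for K :: real using that \<rho>.\<delta>_pos by simp
  from this[OF ne] show "\<delta>' > 0" unfolding \<delta>'_def .
  show "\<delta>' \<le> \<delta> / 4" unfolding \<delta>'_def using CV_ge_1 \<rho>.\<delta>_pos by (intro divide_left_mono) (auto intro: mult_pos_pos ne)
  have "K * (\<delta> / (4 * K)) = \<delta> / 4" if "K > 0" for K :: real using that by simp
  from this[OF ne] show "(1 + C1) * Vmax * \<delta>' = \<delta> / 4" unfolding \<delta>'_def .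
qed

text \<open>The Gronwall step: \<open>V (Suc k)\<close> arises from \<open>V k\<close> by the factor
  \<open>exp (C2 * b k)\<close>, which is at least \<open>1 + C2 * b k\<close>. Adding the distance
  of the last argument to \<open>rad\<close> lets one recursion control arguments and components
  together.\<close>

lemma V_step: "(1 + C1) * V k * wdist k z x + b k * (norm (z k - of_real (x k)) + rad k z x)
    \<le> (1 + C1) * V (Suc k) * wdist (Suc k) z x"
proof -
  define a D where "a = norm (z k - of_real (x k))" and "D = (1 + C1) * wdist k z x"
  have VS: "V (Suc k) = V k * exp (C2 * b k)" by (simp add: V_def distrib_left exp_add)
  have D0: "D \<ge> 0" unfolding D_def using C_nonneg wdist_nonneg by (intro mult_nonneg_nonneg) auto
  have e: "1 + C2 * b k \<le> exp (C2 * b k)" by (rule exp_ge_add_one_self)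
  have V1: "1 \<le> V (Suc k)"
    unfolding V_def using C_nonneg \<rho>.b_nonneg by (simp add: sum_nonneg del: sum.lessThan_Suc)
  have "(1 + C1) * V k * wdist k z x + b k * (a + rad k z x)
      = (1 + C2 * b k) * (V k * D) + (1 + C1) * (b k * a)"
    by (simp add: rad_def a_def D_def algebra_simps)
  also have "\<dots> \<le> exp (C2 * b k) * (V k * D) + V (Suc k) * ((1 + C1) * (b k * a))"
  proof (rule add_mono)
    show "(1 + C2 * b k) * (V k * D) \<le> exp (C2 * b k) * (V k * D)"
      using e V_pos[of k] D0 by (intro mult_right_mono) auto
    have "0 \<le> (1 + C1) * (b k * a)" using C_nonneg \<rho>.b_nonneg by (simp add: a_def)
    then show "(1 + C1) * (b k * a) \<le> V (Suc k) * ((1 + C1) * (b k * a))" using V1 by (simp add: mult_le_cancel_right1)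
  qed
  also have "\<dots> = (1 + C1) * V (Suc k) * wdist (Suc k) z x"
    by (simp add: VS D_def a_def wdist_def algebra_simps)
  finally show ?thesis by (simp add: a_def)
qed

lemma V_wdist_le: "wdist k z x < \<delta>' \<Longrightarrow> (1 + C1) * V k * wdist k z x \<le> \<delta> / 4"
proof -
  assume d: "wdist k z x < \<delta>'"
  have "(1 + C1) * V k * wdist k z x \<le> (1 + C1) * Vmax * \<delta>'"
    using d V_le[of k] V_pos[of k] C_nonneg wdist_nonneg by (intro mult_mono mult_nonneg_nonneg) auto
  then show ?thesis by (simp add: \<delta>'_eq)
qed

definition newton :: "nat \<Rightarrow> (nat \<Rightarrow> complex) \<Rightarrow> complex \<Rightarrow> complex \<Rightarrow> complex" where
  "newton k w c s = s - (\<pi>.cdf k (w(k := s)) - c) / of_real (\<rho>.B ^ 3 / 2)"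

lemma newton_fixed_iff: "newton k w c s = s \<longleftrightarrow> \<pi>.cdf k (w(k := s)) = c"
  using B by (simp add: newton_def)

text \<open>\<open>z\<close> is the complex argument near the real point \<open>x\<close>,
  \<open>w\<close> holds the components found so far, \<open>E\<close> bounds their weighted
  deviation from \<open>X\<close>, and \<open>r\<close> is the radius within which component
  \<open>k\<close> is sought.\<close>

context
  fixes x :: "nat \<Rightarrow> real" and z w :: "nat \<Rightarrow> complex" and k :: nat and r E :: real
  assumes x: "\<And>j. x j \<in> {-1..1}" and z: "wdist (Suc k) z x < \<delta>"
    and E: "(\<Sum>j<k. b j * norm (w j - of_real (X j x))) \<le> E"
    and mem: "E + b k * r < \<delta>"
    and r: "C1 * norm (z k - of_real (x k)) + C2 * (E + wdist k z x) \<le> r"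
begin

lemma r_nonneg: "r \<ge> 0" and E_nonneg: "E \<ge> 0"
proof -
  have "0 \<le> (\<Sum>j<k. b j * norm (w j - of_real (X j x)))" using \<rho>.b_nonneg by (intro sum_nonneg) auto
  then show "E \<ge> 0" using E by linarith
  then have "0 \<le> C1 * norm (z k - of_real (x k)) + C2 * (E + wdist k z x)"
    using C_nonneg wdist_nonneg by (intro add_nonneg_nonneg mult_nonneg_nonneg) auto
  then show "r \<ge> 0" using r by linarith
qed

lemma newton_mem:
  assumes "s \<in> cball (of_real (X k x)) r"
  shows "w(k := s) \<in> nbhd (Suc k) \<delta>"
proof (rule cube_nbhdI[of "\<lambda>j. X j x"])
  have "b k * norm (s - of_real (X k x)) \<le> b k * r"
    using assms \<rho>.b_nonneg by (intro mult_left_mono) (auto simp: dist_norm norm_minus_commute)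
  then show "(\<Sum>j<Suc k. b j * norm ((w(k := s)) j - of_real (X j x))) < \<delta>"
    using E mem by simp
qed (use X_range x in auto)

text \<open>At the real point the equation holds exactly by \<open>X_cdf\<close>. Passing to
  \<open>w\<close> and \<open>z\<close> disturbs it through the earlier components, the earlier
  arguments and the last argument. The hypothesis on \<open>r\<close> makes the first step from
  \<open>X k x\<close> at most \<open>(1 - contr) * r\<close>, and contraction then keeps the ball
  invariant.\<close>

lemma newton_maps:
  assumes s: "s \<in> cball (of_real (X k x)) r"
  shows "newton k w (\<rho>.cdf k z) s \<in> cball (of_real (X k x)) r"
proof -
  define s0 c a where "s0 = complex_of_real (X k x)" and "c = \<rho>.cdf k z" and "a = norm (z k - of_real (x k))"
  define Xv xv where "Xv j = complex_of_real (X j x)" and "xv j = complex_of_real (x j)" for j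
  have s0: "s0 \<in> cball (of_real (X k x)) r" using r_nonneg by (simp add: s0_def)
  have Xv: "Xv \<in> nbhd (Suc k) \<delta>" and xv: "xv \<in> nbhd (Suc k) \<delta>"
    unfolding Xv_def xv_def using X_range x \<rho>.\<delta>_pos by (auto intro!: of_real_mem_cube_nbhd)
  have zm: "z \<in> nbhd (Suc k) \<delta>" using x z by (intro cube_nbhdI[of x]) (auto simp: wdist_def)
  have zm': "z(k := of_real (x k)) \<in> nbhd (Suc k) \<delta>"
    using \<rho>.cube_nbhd_upd_real[OF \<rho>.cube_nbhd_Suc[OF zm] x[of k]] .
  have "norm (\<pi>.cdf k (w(k := s0)) - \<pi>.cdf k Xv) \<le> \<rho>.Cq * (\<Sum>j<k. b j * norm ((w(k := s0)) j - Xv j))"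
    using newton_mem[OF s0] Xv X_range[OF x] by (intro \<pi>.cdf_lip_params) (auto simp: s0_def Xv_def)
  also have "(\<Sum>j<k. b j * norm ((w(k := s0)) j - Xv j)) = (\<Sum>j<k. b j * norm (w j - of_real (X j x)))"
    by (intro sum.cong) (auto simp: Xv_def)
  also have "\<rho>.Cq * \<dots> \<le> \<rho>.Cq * E" using E \<rho>.Cq_nonneg by (intro mult_left_mono)
  finally have e1: "norm (\<pi>.cdf k (w(k := s0)) - \<pi>.cdf k Xv) \<le> \<rho>.Cq * E" .
  have "norm (\<rho>.cdf k xv - \<rho>.cdf k (z(k := of_real (x k)))) \<le> \<rho>.Cq * (\<Sum>j<k. b j * norm (xv j - (z(k := of_real (x k))) j))"
    using x by (intro \<rho>.cdf_lip_params xv zm') (auto simp: xv_def)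
  also have "(\<Sum>j<k. b j * norm (xv j - (z(k := of_real (x k))) j)) = wdist k z x"
    unfolding wdist_def by (intro sum.cong) (auto simp: xv_def norm_minus_commute)
  finally have e2: "norm (\<rho>.cdf k xv - \<rho>.cdf k (z(k := of_real (x k)))) \<le> \<rho>.Cq * wdist k z x" .
  have e3: "norm (\<rho>.cdf k (z(k := of_real (x k))) - c) \<le> \<rho>.B / 2 * a"
    using \<rho>.cdf_lip_last[of z k "of_real (x k)" "z k"] zm zm' by (simp add: c_def a_def norm_minus_commute)
  have eq: "\<pi>.cdf k Xv = \<rho>.cdf k xv" unfolding Xv_def xv_def by (rule X_cdf[OF x])
  have "norm (\<pi>.cdf k (w(k := s0)) - c) \<le> norm (\<pi>.cdf k (w(k := s0)) - \<pi>.cdf k Xv)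
      + norm (\<rho>.cdf k xv - \<rho>.cdf k (z(k := of_real (x k)))) + norm (\<rho>.cdf k (z(k := of_real (x k))) - c)"
  proof -
    have "norm (p - t) \<le> norm (p - q) + norm (q - r) + norm (r - t)" for p q r t :: complex
      using norm_triangle_ineq[of "p - q" "q - t"] norm_triangle_ineq[of "q - r" "r - t"] by simp
    from this[of "\<pi>.cdf k (w(k := s0))" c "\<rho>.cdf k xv" "\<rho>.cdf k (z(k := of_real (x k)))"]
    show ?thesis unfolding eq .
  qed
  also have "\<dots> \<le> \<rho>.Cq * E + \<rho>.Cq * wdist k z x + \<rho>.B / 2 * a" by (intro add_mono e1 e2 e3)
  finally have e: "norm (\<pi>.cdf k (w(k := s0)) - c) \<le> \<rho>.Cq * (E + wdist k z x) + \<rho>.B / 2 * a" by (simp add: algebra_simps)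
  define K where "K = \<rho>.B ^ 3 / 2"
  have K: "K > 0" using B by (simp add: K_def)
  have q: "1 - \<rho>.contr > 0" using \<rho>.contr by simp
  have "norm (newton k w c s0 - s0) = norm (\<pi>.cdf k (w(k := s0)) - c) / K"
    unfolding newton_def K_def[symmetric] using K by (simp add: norm_divide)
  also have "\<dots> \<le> (\<rho>.Cq * (E + wdist k z x) + \<rho>.B / 2 * a) / K" using e K by (intro divide_right_mono) auto
  also have "\<dots> = (1 - \<rho>.contr) * (C1 * a + C2 * (E + wdist k z x))"
  proof -
    have "(p * y + e * a) / K = u * ((e / (K * u)) * a + (p / (K * u)) * y)" if "u > 0" for p e y u
      using that K by (simp add: field_simps)
    from this[OF q] show ?thesis unfolding C1_def C2_def K_def[symmetric] .
  qed
  also have "\<dots> \<le> (1 - \<rho>.contr) * r" using r q by (intro mult_left_mono) (auto simp: a_def)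
  finally have n0: "norm (newton k w c s0 - s0) \<le> (1 - \<rho>.contr) * r" .
  have "norm (newton k w c s - newton k w c s0) \<le> \<rho>.contr * norm (s - s0)"
    unfolding newton_def by (rule \<pi>.newton_contr[OF newton_mem[OF s] newton_mem[OF s0]])
  also have "\<dots> \<le> \<rho>.contr * r"
    using s \<rho>.contr by (intro mult_left_mono) (auto simp: s0_def dist_norm norm_minus_commute)
  finally have "norm (newton k w c s - s0) \<le> r"
    using n0 norm_triangle_ineq[of "newton k w c s - newton k w c s0" "newton k w c s0 - s0"] by (simp add: algebra_simps)
  then show ?thesis by (simp add: s0_def c_def dist_norm norm_minus_commute)
qed

lemma newton_solution: "\<exists>s\<in>cball (of_real (X k x)) r. \<pi>.cdf k (w(k := s)) = \<rho>.cdf k z"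
proof -
  have "\<exists>!s\<in>cball (of_real (X k x)) r. newton k w (\<rho>.cdf k z) s = s"
  proof (rule Banach_fix[OF compact_imp_complete[OF compact_cball], where c="\<rho>.contr"])
    show "cball (complex_of_real (X k x)) r \<noteq> {}" using r_nonneg by auto
    show "dist (newton k w (\<rho>.cdf k z) s) (newton k w (\<rho>.cdf k z) s') \<le> \<rho>.contr * dist s s'"
      if "s \<in> cball (of_real (X k x)) r" "s' \<in> cball (of_real (X k x)) r" for s s'
      unfolding newton_def dist_norm using that by (intro \<pi>.newton_contr newton_mem)
  qed (use newton_maps \<rho>.contr in auto)
  then show ?thesis unfolding newton_fixed_iff by blast
qed

end

text \<open>The choice is unique by injectivity of \<open>cdf\<close> in its last argument. Components from \<open>k\<close> on are junk \<open>0\<close>.\<close>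

primrec ctransport :: "nat \<Rightarrow> (nat \<Rightarrow> complex) \<Rightarrow> nat \<Rightarrow> complex" where
  "ctransport 0 z = (\<lambda>_. 0)"
| "ctransport (Suc k) z = (ctransport k z)(k := (SOME s. (ctransport k z)(k := s) \<in> nbhd (Suc k) \<delta> \<and>
     \<pi>.cdf k ((ctransport k z)(k := s)) = \<rho>.cdf k z))"

lemma ctransport_ge: "j \<ge> k \<Longrightarrow> ctransport k z j = 0"
  by (induction k) auto

lemma ctransport_step:
  assumes x: "\<And>j. x j \<in> {-1..1}" and d: "wdist (Suc k) z x < \<delta>'"
    and H: "(\<Sum>j<k. b j * norm (ctransport k z j - of_real (X j x))) + wdist k z x \<le> (1 + C1) * V k * wdist k z x"
  shows "ctransport (Suc k) z \<in> nbhd (Suc k) \<delta>" "\<pi>.cdf k (ctransport (Suc k) z) = \<rho>.cdf k z"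
    "norm (ctransport (Suc k) z k - of_real (X k x)) \<le> rad k z x"
    "(\<Sum>j<Suc k. b j * norm (ctransport (Suc k) z j - of_real (X j x))) + wdist (Suc k) z x \<le> (1 + C1) * V (Suc k) * wdist (Suc k) z x"
proof -
  \<comment> \<open>What the Gronwall invariant \<open>H\<close> leaves for the components once the
    distance of the arguments is subtracted.\<close>
  define E where "E = (1 + C1) * V k * wdist k z x - wdist k z x"
  have E: "(\<Sum>j<k. b j * norm (ctransport k z j - of_real (X j x))) \<le> E" using H by (simp add: E_def)
  have bk: "0 \<le> b k * norm (z k - of_real (x k))" using \<rho>.b_nonneg by simp
  have EV: "E + b k * rad k z x \<le> (1 + C1) * V (Suc k) * wdist (Suc k) z x"
    using V_step[of k z x] bk wdist_nonneg[of k z x] by (simp add: E_def distrib_left)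
  also have "\<dots> \<le> \<delta> / 4" by (rule V_wdist_le[OF d])
  finally have mem: "E + b k * rad k z x < \<delta>" using \<rho>.\<delta>_pos by simp
  have d\<delta>: "wdist (Suc k) z x < \<delta>" using d \<delta>'_le \<rho>.\<delta>_pos by simp
  have r: "C1 * norm (z k - of_real (x k)) + C2 * (E + wdist k z x) \<le> rad k z x"
    by (simp add: rad_def E_def)
  note ctx = x d\<delta> E mem r
  obtain s where s: "s \<in> cball (of_real (X k x)) (rad k z x)" "\<pi>.cdf k ((ctransport k z)(k := s)) = \<rho>.cdf k z"
    using newton_solution[OF ctx] by blast
  have sm: "(ctransport k z)(k := s) \<in> nbhd (Suc k) \<delta>" by (rule newton_mem[OF ctx s(1)])
  have "(SOME s. (ctransport k z)(k := s) \<in> nbhd (Suc k) \<delta> \<and> \<pi>.cdf k ((ctransport k z)(k := s)) = \<rho>.cdf k z) = s"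
  proof (rule some_equality)
    fix s' assume "(ctransport k z)(k := s') \<in> nbhd (Suc k) \<delta> \<and> \<pi>.cdf k ((ctransport k z)(k := s')) = \<rho>.cdf k z"
    then show "s' = s" using sm s(2) by (intro \<pi>.cdf_inj[of "ctransport k z" k s' s]) auto
  qed (use sm s in auto)
  then have ctransport: "ctransport (Suc k) z = (ctransport k z)(k := s)" by simp
  show "ctransport (Suc k) z \<in> nbhd (Suc k) \<delta>" "\<pi>.cdf k (ctransport (Suc k) z) = \<rho>.cdf k z" using sm s by (simp_all only: ctransport)
  show rk: "norm (ctransport (Suc k) z k - of_real (X k x)) \<le> rad k z x"
    using s(1) by (simp add: ctransport dist_norm norm_minus_commute del: ctransport.simps)
  have "(\<Sum>j<Suc k. b j * norm (ctransport (Suc k) z j - of_real (X j x))) = (\<Sum>j<k. b j * norm (ctransport k z j - of_real (X j x))) + b k * norm (s - of_real (X k x))"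
    unfolding ctransport by simp
  also have "\<dots> \<le> E + b k * rad k z x"
    using E s(1) \<rho>.b_nonneg by (intro add_mono mult_left_mono) (auto simp: dist_norm norm_minus_commute)
  finally show "(\<Sum>j<Suc k. b j * norm (ctransport (Suc k) z j - of_real (X j x))) + wdist (Suc k) z x \<le> (1 + C1) * V (Suc k) * wdist (Suc k) z x"
    using V_step[of k z x] by (simp add: E_def distrib_left wdist_def del: ctransport.simps)
qed

lemma wdist_Suc_le: "wdist k z x \<le> wdist (Suc k) z x"
  unfolding wdist_def using \<rho>.b_nonneg by simp

lemma ctransport_sum:
  assumes x: "\<And>j. x j \<in> {-1..1}" and d: "wdist k z x < \<delta>'"
  shows "(\<Sum>j<k. b j * norm (ctransport k z j - of_real (X j x))) + wdist k z x \<le> (1 + C1) * V k * wdist k z x"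
  using d
proof (induction k)
  case (Suc k)
  have "wdist k z x < \<delta>'" using Suc.prems wdist_Suc_le[of k z x] by linarith
  from ctransport_step(4)[OF x Suc.prems Suc.IH[OF this]] show ?case .
qed (simp add: wdist_def)

lemma ctransport_props:
  assumes x: "\<And>j. x j \<in> {-1..1}" and d: "wdist (Suc k) z x < \<delta>'"
  shows "ctransport (Suc k) z \<in> nbhd (Suc k) \<delta>" "\<pi>.cdf k (ctransport (Suc k) z) = \<rho>.cdf k z"
    "norm (ctransport (Suc k) z k - of_real (X k x)) \<le> rad k z x"
proof -
  have "wdist k z x < \<delta>'" using d wdist_Suc_le[of k z x] by linarith
  from ctransport_step[OF x d ctransport_sum[OF x this]]
  show "ctransport (Suc k) z \<in> nbhd (Suc k) \<delta>" "\<pi>.cdf k (ctransport (Suc k) z) = \<rho>.cdf k z"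
    "norm (ctransport (Suc k) z k - of_real (X k x)) \<le> rad k z x" by auto
qed

text \<open>For a real argument \<open>rad\<close> vanishes, which leaves the component no
  freedom.\<close>

lemma ctransport_real:
  assumes x: "\<And>j. x j \<in> {-1..1}" and j: "j < k"
  shows "ctransport k (\<lambda>j. of_real (x j)) j = of_real (X j x)"
  using j
proof (induction k)
  case (Suc k)
  show ?case
  proof (cases "j = k")
    case True
    have d: "wdist n (\<lambda>j. of_real (x j)) x = 0" for n by (simp add: wdist_def)
    have "norm (ctransport (Suc k) (\<lambda>j. of_real (x j)) k - of_real (X k x)) \<le> 0"
      using ctransport_props(3)[of x k "\<lambda>j. of_real (x j)"] x by (simp add: d rad_def \<delta>'_pos del: ctransport.simps)
    then show ?thesis using True by (simp del: ctransport.simps)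
  qed (use Suc in auto)
qed simp

lemma mem_nbhd'_iff: "z \<in> nbhd k \<delta>' \<longleftrightarrow> (\<exists>x. (\<forall>j. x j \<in> {-1..1}) \<and> wdist k z x < \<delta>')"
  by (simp add: cube_nbhd_def wdist_def)

lemma nbhd'_subset: "nbhd k \<delta>' \<subseteq> nbhd k \<delta>"
proof
  fix z assume "z \<in> nbhd k \<delta>'"
  then obtain x where "\<And>j. x j \<in> {-1..1}" "(\<Sum>j<k. b j * norm (z j - of_real (x j))) < \<delta>'"
    by (auto simp: cube_nbhd_def)
  then show "z \<in> nbhd k \<delta>" using \<delta>'_le \<rho>.\<delta>_pos by (intro cube_nbhdI[of x]) auto
qed

text \<open>Component \<open>k\<close> is the fixed point of a Newton map that depends
  holomorphically on the earlier components. Near a given parameter \<open>u0\<close> one real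
  reference point and one ball serve all parameters, as \<open>holomorphic_fixed_point\<close>
  requires.\<close>

lemma ctransport_hol: "j < k \<Longrightarrow> (\<lambda>z. ctransport k z j) curve_holomorphic_on nbhd k \<delta>'"
proof (induction k arbitrary: j)
  case (Suc k)
  have sub: "nbhd (Suc k) \<delta>' \<subseteq> nbhd k \<delta>'" using \<rho>.cube_nbhd_Suc by blast
  show ?case
  proof (cases "j = k")
    case False
    then have "(\<lambda>z. ctransport k z j) curve_holomorphic_on nbhd (Suc k) \<delta>'"
      using Suc curve_holomorphic_on_subset[OF _ sub] by simp
    then show ?thesis using False by simp
  next
    case True
    have "(\<lambda>z. ctransport (Suc k) z k) curve_holomorphic_on nbhd (Suc k) \<delta>'"
    proof (rule curve_holomorphic_onI)
      fix S :: "complex set" and w :: "complex \<Rightarrow> nat \<Rightarrow> complex"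
      assume S: "open S" and w: "\<And>j. (\<lambda>s. w s j) holomorphic_on S" "\<And>s. s \<in> S \<Longrightarrow> w s \<in> nbhd (Suc k) \<delta>'"
      have TVw: "(\<lambda>u. ctransport k (w u) i) holomorphic_on S" for i
      proof (cases "i < k")
        case True
        have "(\<lambda>z. ctransport k z i) curve_holomorphic_on nbhd k \<delta>'"
          by (rule Suc.IH[OF True])
        then show ?thesis
          by (rule curve_holomorphic_onD[OF _ S w(1)]) (use w(2) sub in blast)
      qed (simp add: ctransport_ge)
      have "(\<lambda>u. ctransport (Suc k) (w u) k) field_differentiable (at u0)" if u0: "u0 \<in> S" for u0
      proof -
        obtain x where x: "\<And>j. x j \<in> {-1..1}" and dx: "wdist (Suc k) (w u0) x < \<delta>'"
          using w(2)[OF u0] unfolding mem_nbhd'_iff by blast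
        \<comment> \<open>The ball is enlarged by \<open>\<eta>\<close> to fit all nearby
          parameters. Its cost \<open>b k * \<eta>\<close> is below \<open>\<delta> / 2\<close>,
          while the earlier components and \<open>rad\<close> each cost at most
          \<open>\<delta> / 4\<close>.\<close>
        define \<eta> where "\<eta> = \<delta> / (2 * (b k + 1))"
        have \<eta>: "\<eta> > 0" using \<rho>.\<delta>_pos \<rho>.b_nonneg[of k] by (simp add: \<eta>_def)
        define r where "r = rad k (w u0) x + \<eta>"
        define N where "N = S \<inter> {u. wdist (Suc k) (w u) x < \<delta>' \<and> rad k (w u) x < r}"
        have cw: "continuous_on S (\<lambda>u. w u j)" for j using w(1) by (rule holomorphic_on_imp_continuous_on)
        have cd: "continuous_on S (\<lambda>u. wdist n (w u) x)" for n
          unfolding wdist_def by (intro continuous_intros cw)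
        have cr: "continuous_on S (\<lambda>u. rad k (w u) x)"
          unfolding rad_def by (intro continuous_intros cw cd)
        have "open N"
        proof -
          have "N = (S \<inter> (\<lambda>u. wdist (Suc k) (w u) x) -` {..<\<delta>'}) \<inter> (S \<inter> (\<lambda>u. rad k (w u) x) -` {..<r})"
            by (auto simp: N_def)
          then show ?thesis
            using continuous_open_preimage[OF cd S open_lessThan] continuous_open_preimage[OF cr S open_lessThan] by auto
        qed
        have u0N: "u0 \<in> N" using u0 dx \<eta> by (simp add: N_def r_def)
        have bkr: "b k * r < \<delta> / 4 + \<delta> / 2"
        proof -
          have "b k * rad k (w u0) x \<le> (1 + C1) * V (Suc k) * wdist (Suc k) (w u0) x"
          proof -
            have "0 \<le> (1 + C1) * V k * wdist k (w u0) x"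
              using C_nonneg V_pos[of k] wdist_nonneg[of k "w u0" x] by (intro mult_nonneg_nonneg) auto
            moreover have "0 \<le> b k * norm (w u0 k - of_real (x k))" using \<rho>.b_nonneg by simp
            ultimately show ?thesis using V_step[of k "w u0" x] by (simp only: distrib_left)
          qed
          also have "\<dots> \<le> \<delta> / 4" by (rule V_wdist_le[OF dx])
          finally have 1: "b k * rad k (w u0) x \<le> \<delta> / 4" .
          have "b k * \<eta> < (b k + 1) * \<eta>" using \<eta> by simp
          also have "(b k + 1) * \<eta> = \<delta> / 2" using \<rho>.b_nonneg[of k] by (simp add: \<eta>_def field_simps)
          finally show ?thesis using 1 by (simp add: r_def distrib_left)
        qed
        have uniform: "wdist (Suc k) (w u) x < \<delta>"
            "(\<Sum>j<k. b j * norm (ctransport k (w u) j - of_real (X j x))) \<le> (1 + C1) * V k * wdist k (w u) x - wdist k (w u) x"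
            "((1 + C1) * V k * wdist k (w u) x - wdist k (w u) x) + b k * r < \<delta>"
            "C1 * norm (w u k - of_real (x k)) + C2 * (((1 + C1) * V k * wdist k (w u) x - wdist k (w u) x) + wdist k (w u) x) \<le> r"
          if u: "u \<in> N" for u
        proof -
          have d: "wdist (Suc k) (w u) x < \<delta>'" "rad k (w u) x < r" using u by (auto simp: N_def)
          then have dk: "wdist k (w u) x < \<delta>'" using wdist_Suc_le[of k "w u" x] by linarith
          show "wdist (Suc k) (w u) x < \<delta>" using d \<delta>'_le \<rho>.\<delta>_pos by linarith
          show "(\<Sum>j<k. b j * norm (ctransport k (w u) j - of_real (X j x))) \<le> (1 + C1) * V k * wdist k (w u) x - wdist k (w u) x"
            using ctransport_sum[OF x dk] by simp
          show "((1 + C1) * V k * wdist k (w u) x - wdist k (w u) x) + b k * r < \<delta>"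
            using V_wdist_le[OF dk] bkr wdist_nonneg[of k "w u" x] \<rho>.\<delta>_pos by linarith
          show "C1 * norm (w u k - of_real (x k)) + C2 * (((1 + C1) * V k * wdist k (w u) x - wdist k (w u) x) + wdist k (w u) x) \<le> r"
            using d(2) by (simp add: rad_def)
        qed
        have "(\<lambda>u. ctransport (Suc k) (w u) k) holomorphic_on N"
        proof (rule holomorphic_fixed_point[where \<Phi>="\<lambda>u. newton k (ctransport k (w u)) (\<rho>.cdf k (w u))" and q="\<rho>.contr" and r=r and ?s0.0="of_real (X k x)"])
          show "open N" by fact
          show "0 \<le> \<rho>.contr" "\<rho>.contr < 1" by (rule \<rho>.contr)+
          fix \<tau> assume \<tau>: "\<tau> holomorphic_on N" "\<And>u. u \<in> N \<Longrightarrow> \<tau> u \<in> cball (of_real (X k x)) r"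
          have NS: "N \<subseteq> S" by (auto simp: N_def)
          have "(\<lambda>u. \<pi>.cdf k ((ctransport k (w u))(k := \<tau> u))) holomorphic_on N"
            using newton_mem[OF x uniform \<tau>(2)] holomorphic_on_subset[OF TVw NS]
            by (intro curve_holomorphic_onD[OF \<pi>.cdf_hol \<open>open N\<close>] holomorphic_on_fun_upd \<tau>(1)) auto
          moreover have "(\<lambda>u. \<rho>.cdf k (w u)) holomorphic_on N"
            using w(2) NS nbhd'_subset[of "Suc k"] holomorphic_on_subset[OF w(1) NS]
            by (intro curve_holomorphic_onD[OF \<rho>.cdf_hol \<open>open N\<close>]) auto
          ultimately show "(\<lambda>u. newton k (ctransport k (w u)) (\<rho>.cdf k (w u)) (\<tau> u)) holomorphic_on N"
            unfolding newton_def using B \<tau>(1) by (auto intro!: holomorphic_intros)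
        next
          fix u s :: complex assume u: "u \<in> N" and s: "s \<in> cball (of_real (X k x)) r"
          show "newton k (ctransport k (w u)) (\<rho>.cdf k (w u)) s \<in> cball (of_real (X k x)) r"
            by (rule newton_maps[OF x uniform[OF u] s])
        next
          fix u s s' :: complex assume u: "u \<in> N" and s: "s \<in> cball (of_real (X k x)) r" "s' \<in> cball (of_real (X k x)) r"
          show "norm (newton k (ctransport k (w u)) (\<rho>.cdf k (w u)) s - newton k (ctransport k (w u)) (\<rho>.cdf k (w u)) s') \<le> \<rho>.contr * norm (s - s')"
            unfolding newton_def by (intro \<pi>.newton_contr newton_mem[OF x uniform[OF u]] s)
        next
          fix u assume u: "u \<in> N"
          then have d: "wdist (Suc k) (w u) x < \<delta>'" "rad k (w u) x < r" by (auto simp: N_def)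
          show "ctransport (Suc k) (w u) k \<in> cball (of_real (X k x)) r"
            using ctransport_props(3)[OF x d(1)] d(2) by (simp add: dist_norm norm_minus_commute del: ctransport.simps)
          have "ctransport (Suc k) (w u) = (ctransport k (w u))(k := ctransport (Suc k) (w u) k)" by simp
          then show "newton k (ctransport k (w u)) (\<rho>.cdf k (w u)) (ctransport (Suc k) (w u) k) = ctransport (Suc k) (w u) k"
            unfolding newton_fixed_iff using ctransport_props(2)[OF x d(1)] by metis
        qed
        then show ?thesis using \<open>open N\<close> u0N holomorphic_on_imp_differentiable_at by blast
      qed
      then show "(\<lambda>u. ctransport (Suc k) (w u) k) holomorphic_on S"
        unfolding holomorphic_on_def using field_differentiable_at_within by blast
    qed
    then show ?thesis using True by simp
  qed
qed simp

section \<open>The partial derivative of the extended transport and its square root\<close>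

lemma ctransport_mem: "z \<in> nbhd (Suc k) \<delta>' \<Longrightarrow> ctransport (Suc k) z \<in> nbhd (Suc k) \<delta>"
  unfolding mem_nbhd'_iff using ctransport_props(1) by blast

text \<open>The derivative of component \<open>k\<close> in its last variable, as implicit
  differentiation of the equation between the distribution functions shows.\<close>

definition ratio :: "nat \<Rightarrow> (nat \<Rightarrow> complex) \<Rightarrow> complex" where
  "ratio k z = \<rho>.cond_quot k z / \<pi>.cond_quot k (ctransport (Suc k) z)"

definition root_deriv :: "nat \<Rightarrow> (nat \<Rightarrow> complex) \<Rightarrow> complex" where
  "root_deriv k z = csqrt (ratio k z) - 1"

text \<open>Both quotients have imaginary part at most half the real part, so the product of the
  imaginary parts cannot cancel that of the real parts. Hence the principal root is holomorphic at
  the ratio.\<close>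

lemma Re_ratio_pos:
  assumes z: "z \<in> nbhd (Suc k) \<delta>'"
  shows "Re (ratio k z) > 0"
proof -
  have z\<delta>: "z \<in> nbhd (Suc k) \<delta>" using z nbhd'_subset by blast
  define u v where "u = \<rho>.cond_quot k z" and "v = \<pi>.cond_quot k (ctransport (Suc k) z)"
  note u = \<rho>.cond_quot_bounds[OF z\<delta>, folded u_def] and v = \<pi>.cond_quot_bounds[OF ctransport_mem[OF z], folded v_def]
  have pos: "Re u > 0" "Re v > 0" using u(2) v(2) B by (auto intro: less_le_trans[rotated])
  have "\<bar>Im u * Im v\<bar> \<le> (Re u / 2) * (Re v / 2)"
    unfolding abs_mult using u(3) v(3) pos by (intro mult_mono) auto
  moreover have "Re u * Re v > 0" using pos by simp
  ultimately have "Re u * Re v + Im u * Im v > 0" by (simp add: abs_if split: if_splits)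
  moreover have "(Re v)\<^sup>2 + (Im v)\<^sup>2 > 0" using pos by (simp add: add_pos_nonneg)
  ultimately show ?thesis by (simp add: ratio_def u_def[symmetric] v_def[symmetric] Re_divide del: ctransport.simps)
qed

lemma norm_ratio_le:
  assumes z: "z \<in> nbhd (Suc k) \<delta>'"
  shows "norm (ratio k z) \<le> \<rho>.B ^ 2"
proof -
  have z\<delta>: "z \<in> nbhd (Suc k) \<delta>" using z nbhd'_subset by blast
  have "norm (ratio k z) \<le> \<rho>.B / (1 / \<rho>.B)"
    unfolding ratio_def norm_divide using \<rho>.cond_quot_bounds(1)[OF z\<delta>] \<pi>.norm_cond_quot_ge[OF ctransport_mem[OF z]] B
    by (intro frac_le) auto
  then show ?thesis using B by (simp add: power2_eq_square)
qed

lemma ratio_hol: "ratio k curve_holomorphic_on nbhd (Suc k) \<delta>'"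
proof (rule curve_holomorphic_onI)
  fix S w assume S: "open S" and w: "\<And>j. (\<lambda>s. w s j) holomorphic_on S" "\<And>s. s \<in> S \<Longrightarrow> w s \<in> nbhd (Suc k) \<delta>'"
  have ctransport: "(\<lambda>s. ctransport (Suc k) (w s) j) holomorphic_on S" for j
  proof (cases "j < Suc k")
    case True
    show ?thesis by (rule curve_holomorphic_onD[OF ctransport_hol[OF True] S w])
  qed (simp add: ctransport_ge del: ctransport.simps)
  have nz: "\<pi>.cond_quot k (ctransport (Suc k) (w s)) \<noteq> 0" if "s \<in> S" for s
    using \<pi>.norm_cond_quot_ge[OF ctransport_mem[OF w(2)[OF that]]] B by (auto simp del: ctransport.simps)
  show "(\<lambda>s. ratio k (w s)) holomorphic_on S"
    unfolding ratio_def
  proof (rule holomorphic_on_divide)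
    show "(\<lambda>s. \<rho>.cond_quot k (w s)) holomorphic_on S"
      using w nbhd'_subset by (intro curve_holomorphic_onD[OF \<rho>.cond_quot_hol S]) auto
    show "(\<lambda>s. \<pi>.cond_quot k (ctransport (Suc k) (w s))) holomorphic_on S"
      using ctransport_mem w by (intro curve_holomorphic_onD[OF \<pi>.cond_quot_hol S] ctransport) auto
  qed (use nz in auto)
qed

lemma root_deriv_hol: "root_deriv k curve_holomorphic_on nbhd (Suc k) \<delta>'"
proof (rule curve_holomorphic_onI)
  fix S w assume S: "open S" and w: "\<And>j. (\<lambda>s. w s j) holomorphic_on S" "\<And>s. s \<in> S \<Longrightarrow> w s \<in> nbhd (Suc k) \<delta>'"
  have "ratio k (w s) \<notin> \<real>\<^sub>\<le>\<^sub>0" if "s \<in> S" for s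
    using Re_ratio_pos[OF w(2)[OF that]] by (auto simp: complex_nonpos_Reals_iff)
  then show "(\<lambda>s. root_deriv k (w s)) holomorphic_on S"
    unfolding root_deriv_def by (intro holomorphic_intros holomorphic_on_csqrt' curve_holomorphic_onD[OF ratio_hol S w]) auto
qed

lemma norm_root_deriv_le: "z \<in> nbhd (Suc k) \<delta>' \<Longrightarrow> norm (root_deriv k z) \<le> \<rho>.B + 1"
proof -
  assume z: "z \<in> nbhd (Suc k) \<delta>'"
  have "norm (csqrt (ratio k z)) = sqrt (norm (ratio k z))" by (metis norm_csqrt)
  also have "\<dots> \<le> sqrt (\<rho>.B ^ 2)" using norm_ratio_le[OF z] by (rule real_sqrt_le_mono)
  also have "\<dots> = \<rho>.B" using B by simp
  finally show ?thesis unfolding root_deriv_def using norm_triangle_ineq4[of "csqrt (ratio k z)" 1] by simp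
qed

definition C3 :: real where "C3 = \<rho>.B * (2 * Lip / M) * (4 + C2 * \<delta>)"

lemma C3_nonneg: "C3 \<ge> 0"
  unfolding C3_def using B \<rho>.Lip \<rho>.M C_nonneg \<rho>.\<delta>_pos by (intro mult_nonneg_nonneg add_nonneg_nonneg divide_nonneg_nonneg) auto

text \<open>The \<open>k\<close>-th variable influences the densities only by \<open>O (b k)\<close>, so the transport of a real last coordinate is
  that close to the identity. This yields the bound for the indices with \<open>\<nu> k = 0\<close>.\<close>

lemma norm_root_deriv_le_b:
  assumes z: "z \<in> nbhd (Suc k) \<delta>'" and t: "z k = of_real t" "t \<in> {-1..1}"
  shows "norm (root_deriv k z) \<le> C3 * b k"
proof -
  obtain x0 where x0: "\<And>j. x0 j \<in> {-1..1}" "wdist (Suc k) z x0 < \<delta>'" using z unfolding mem_nbhd'_iff by blast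
  \<comment> \<open>Moving the last coordinate of the witness to \<open>t\<close> removes its share
    of the distance, so that \<open>rad\<close> retains only the earlier coordinates.\<close>
  define x where "x = x0(k := t)"
  have x: "x j \<in> {-1..1}" for j using x0 t by (auto simp: x_def)
  have "0 \<le> b k * norm (z k - of_real (x0 k))" using \<rho>.b_nonneg by simp
  then have d: "wdist (Suc k) z x < \<delta>'" using x0(2) t by (simp add: wdist_def x_def)
  have dk: "wdist k z x < \<delta>'" using d wdist_Suc_le[of k z x] by linarith
  have "norm (ctransport (Suc k) z k - of_real (X k x)) \<le> rad k z x" by (rule ctransport_props(3)[OF x d])
  also have "\<dots> = C2 * ((1 + C1) * V k * wdist k z x)" by (simp add: rad_def x_def t)
  also have "\<dots> \<le> C2 * (\<delta> / 4)" using V_wdist_le[OF dk] C_nonneg by (intro mult_left_mono)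
  also have "\<dots> \<le> C2 * \<delta>" using C_nonneg \<rho>.\<delta>_pos by (intro mult_left_mono) auto
  finally have "norm (ctransport (Suc k) z k) \<le> C2 * \<delta> + norm (complex_of_real (X k x))"
    using norm_triangle_ineq2[of "ctransport (Suc k) z k" "of_real (X k x)"] by linarith
  also have "norm (complex_of_real (X k x)) \<le> 1" using X_range[of x k] x by auto
  finally have TVk: "norm (ctransport (Suc k) z k) \<le> C2 * \<delta> + 1" by simp
  define u v where "u = \<rho>.cond_quot k z" and "v = \<pi>.cond_quot k (ctransport (Suc k) z)"
  have z\<delta>: "z \<in> nbhd (Suc k) \<delta>" using z nbhd'_subset by blast
  define K where "K = 2 * Lip / M * b k"
  have K: "K \<ge> 0" unfolding K_def using \<rho>.Lip \<rho>.M \<rho>.b_nonneg by (intro mult_nonneg_nonneg divide_nonneg_nonneg) auto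
  have "norm (u - 1) \<le> K * (norm (z k) + 1)" unfolding u_def K_def by (rule \<rho>.cond_quot_near_one[OF z\<delta>])
  also have "\<dots> \<le> K * 2" using K t by (intro mult_left_mono) auto
  finally have u: "norm (u - 1) \<le> K * 2" .
  have "norm (v - 1) \<le> K * (norm (ctransport (Suc k) z k) + 1)" unfolding v_def K_def by (rule \<pi>.cond_quot_near_one[OF ctransport_mem[OF z]])
  also have "\<dots> \<le> K * (C2 * \<delta> + 2)" using K TVk by (intro mult_left_mono) auto
  finally have v: "norm (v - 1) \<le> K * (C2 * \<delta> + 2)" .
  have v1: "1 / \<rho>.B \<le> norm v" unfolding v_def by (rule \<pi>.norm_cond_quot_ge[OF ctransport_mem[OF z]])
  then have v0: "v \<noteq> 0" using B by auto
  have "norm (u - v) \<le> norm (u - 1) + norm (v - 1)"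
    using norm_triangle_ineq4[of "u - 1" "v - 1"] by simp
  also have "\<dots> \<le> K * (4 + C2 * \<delta>)" using u v by (simp add: algebra_simps)
  finally have uv: "norm (u - v) \<le> K * (4 + C2 * \<delta>)" .
  have "ratio k z - 1 = (u - v) / v" using v0 by (simp add: ratio_def u_def v_def field_simps del: ctransport.simps)
  then have "norm (ratio k z - 1) = norm (u - v) / norm v" by (simp add: norm_divide)
  also have "\<dots> \<le> K * (4 + C2 * \<delta>) / (1 / \<rho>.B)" using uv v1 B by (intro frac_le) (auto intro: order_trans[OF norm_ge_zero])
  also have "\<dots> = C3 * b k" using B by (simp add: C3_def K_def)
  finally have r: "norm (ratio k z - 1) \<le> C3 * b k" .
  \<comment> \<open>As \<open>Re s \<ge> 0\<close> gives \<open>norm (s + 1) \<ge> 1\<close>, the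
    root is at least as close to 1 as its square.\<close>
  define s where "s = csqrt (ratio k z)"
  have Re_s: "Re s \<ge> 0" unfolding s_def by (rule Re_csqrt)
  have "ratio k z - 1 = (s - 1) * (s + 1)" by (simp add: s_def algebra_simps flip: power2_eq_square)
  then have "norm (ratio k z - 1) = norm (s - 1) * norm (s + 1)" by (simp add: norm_mult)
  moreover have "1 \<le> norm (s + 1)" using complex_Re_le_cmod[of "s + 1"] Re_s by simp
  then have "norm (s - 1) * 1 \<le> norm (s - 1) * norm (s + 1)" by (intro mult_left_mono) auto
  ultimately show ?thesis using r by (simp add: root_deriv_def s_def)
qed

lemma root_deriv_dep: "(\<And>j. j < Suc k \<Longrightarrow> z j = z' j) \<Longrightarrow> root_deriv k z = root_deriv k z'"
proof -
  assume eq: "\<And>j. j < Suc k \<Longrightarrow> z j = z' j"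
  have "ctransport n z = ctransport n z'" if "n \<le> Suc k" for n
    using that
  proof (induction n)
    case (Suc n)
    have "\<rho>.cdf n z = \<rho>.cdf n z'" using Suc eq by (intro \<rho>.cdf_dep) auto
    then show ?case using Suc by simp
  qed simp
  moreover have "\<rho>.cond_quot k z = \<rho>.cond_quot k z'" using eq by (intro \<rho>.cond_quot_dep) auto
  ultimately show ?thesis by (simp add: root_deriv_def ratio_def del: ctransport.simps)
qed

lemma root_deriv_real:
  assumes x: "\<And>j. x j \<in> {-1..1}"
    and u: "\<rho>.cond_quot k (\<lambda>j. of_real (x j)) = of_real u" "u > 0"
    and v: "\<pi>.cond_quot k (\<lambda>j. of_real (X j x)) = of_real v" "v > 0"
  shows "root_deriv k (\<lambda>j. of_real (x j)) = of_real (sqrt (u / v) - 1)"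
proof -
  have "\<pi>.cond_quot k (ctransport (Suc k) (\<lambda>j. of_real (x j))) = \<pi>.cond_quot k (\<lambda>j. of_real (X j x))"
    by (intro \<pi>.cond_quot_dep ctransport_real x) auto
  then have "ratio k (\<lambda>j. of_real (x j)) = of_real (u / v)" by (simp add: ratio_def u v del: ctransport.simps)
  then show ?thesis using u v by (simp add: root_deriv_def del: of_real_divide)
qed

text \<open>The first bound is Cauchy's estimate. For \<open>\<nu> k = 0\<close> the coefficient in
  coordinate \<open>k\<close> averages over real values of that coordinate, where
  \<open>norm_root_deriv_le_b\<close> supplies the factor \<open>b k\<close>; Cauchy's estimate then
  concerns the first \<open>k\<close> coordinates.\<close>

lemma multi_coeff_root_deriv_bounds:
  fixes \<zeta> :: "nat \<Rightarrow> real"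
  shows "(\<And>j. j < Suc k \<Longrightarrow> \<zeta> j > 0) \<Longrightarrow> (\<Sum>j<Suc k. b j * \<zeta> j) < \<delta>' \<Longrightarrow>
      norm (multi_coeff (Suc k) \<nu> (root_deriv k)) \<le> (\<rho>.B + 1) * (\<Prod>j<Suc k. inverse (1 + \<zeta> j) ^ \<nu> j)"
    and "\<nu> k = 0 \<Longrightarrow> (\<And>j. j < k \<Longrightarrow> \<zeta> j > 0) \<Longrightarrow> (\<Sum>j<k. b j * \<zeta> j) < \<delta>' \<Longrightarrow>
      norm (multi_coeff (Suc k) \<nu> (root_deriv k)) \<le> (C3 * b k) * (\<Prod>j<k. inverse (1 + \<zeta> j) ^ \<nu> j)"
proof -
  assume \<zeta>: "\<And>j. j < Suc k \<Longrightarrow> \<zeta> j > 0" "(\<Sum>j<Suc k. b j * \<zeta> j) < \<delta>'"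
  have sub: "poly_nbhd (Suc k) \<zeta> \<subseteq> nbhd (Suc k) \<delta>'"
    using \<zeta> \<rho>.b_nonneg by (intro poly_nbhd_subset_cube_nbhd) auto
  show "norm (multi_coeff (Suc k) \<nu> (root_deriv k)) \<le> (\<rho>.B + 1) * (\<Prod>j<Suc k. inverse (1 + \<zeta> j) ^ \<nu> j)"
    using sub norm_root_deriv_le \<zeta>(1) by (intro norm_multi_coeff_le curve_holomorphic_on_subset[OF root_deriv_hol sub]) auto
next
  assume \<nu>: "\<nu> k = 0" and \<zeta>: "\<And>j. j < k \<Longrightarrow> \<zeta> j > 0" "(\<Sum>j<k. b j * \<zeta> j) < \<delta>'"
  \<comment> \<open>A positive radius for coordinate \<open>k\<close>, paid from the slack in the
    constraint; holomorphy of the averaged function is derived on the resulting product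
    neighbourhood.\<close>
  define c where "c = (\<delta>' - (\<Sum>j<k. b j * \<zeta> j)) / (b k + 1)"
  have c: "c > 0" unfolding c_def using \<zeta>(2) \<rho>.b_nonneg[of k] by (intro divide_pos_pos) auto
  define \<zeta>' where "\<zeta>' = \<zeta>(k := c)"
  have "b k * c < (b k + 1) * c" using c by simp
  also have "(b k + 1) * c = \<delta>' - (\<Sum>j<k. b j * \<zeta> j)" using \<rho>.b_nonneg[of k] by (simp add: c_def)
  finally have sum': "(\<Sum>j<Suc k. b j * \<zeta>' j) < \<delta>'" by (simp add: \<zeta>'_def)
  have pos': "\<zeta>' j > 0" if "j < Suc k" for j using that c \<zeta>(1) by (auto simp: \<zeta>'_def less_Suc_eq)
  have sub: "poly_nbhd (Suc k) \<zeta>' \<subseteq> nbhd (Suc k) \<delta>'"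
    using sum' pos' \<rho>.b_nonneg by (intro poly_nbhd_subset_cube_nbhd) auto
  have upd: "z(k := t) \<in> poly_nbhd (Suc k) \<zeta>'" if "z \<in> poly_nbhd k \<zeta>" "t \<in> segment_nbhd c" for z t
    using that by (auto simp: poly_nbhd_def \<zeta>'_def less_Suc_eq)
  have "cheb_coord k 0 (root_deriv k) curve_holomorphic_on poly_nbhd k \<zeta>"
    using upd sub norm_root_deriv_le c by (intro curve_holomorphic_cheb_coord[where A="poly_nbhd (Suc k) \<zeta>'" and B="\<rho>.B + 1" and c=c] curve_holomorphic_on_subset[OF root_deriv_hol sub]) auto
  moreover have "norm (cheb_coord k 0 (root_deriv k) z) \<le> C3 * b k" if z: "z \<in> poly_nbhd k \<zeta>" for z
    unfolding cheb_coord_def cheb_coeff_def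
  proof (rule norm_LINT_le_const[OF prob_space_mu1])
    fix s
    have "z(k := of_real (cos (pi * s))) \<in> nbhd (Suc k) \<delta>'"
      using upd[OF z] sub of_real_mem_segment_nbhd[of "cos (pi * s)" c] c by auto
    then have "norm (root_deriv k (z(k := of_real (cos (pi * s))))) \<le> C3 * b k"
      by (intro norm_root_deriv_le_b[of _ _ "cos (pi * s)"]) auto
    then show "norm (root_deriv k (z(k := of_real (cos (pi * s)))) * exp (- (\<i> * of_real (real 0 * pi * s)))) \<le> C3 * b k"
      by simp
  qed (use C3_nonneg \<rho>.b_nonneg in auto)
  ultimately have "norm (multi_coeff k \<nu> (cheb_coord k 0 (root_deriv k))) \<le> (C3 * b k) * (\<Prod>j<k. inverse (1 + \<zeta> j) ^ \<nu> j)"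
    using \<zeta>(1) by (intro norm_multi_coeff_le) auto
  then show "norm (multi_coeff (Suc k) \<nu> (root_deriv k)) \<le> (C3 * b k) * (\<Prod>j<k. inverse (1 + \<zeta> j) ^ \<nu> j)"
    using \<nu> by simp
qed

lemma root_deriv_expansion:
  assumes x: "\<And>j. j < Suc k \<Longrightarrow> x j \<in> {-1..1}"
  shows "((\<lambda>\<nu>. multi_coeff (Suc k) \<nu> (root_deriv k) * of_real (cheb_prod (Suc k) \<nu> x)) has_sum root_deriv k (\<lambda>j. of_real (x j))) (multi_index (Suc k))"
proof -
  define s where "s = (\<Sum>j<Suc k. b j)"
  have s: "s \<ge> 0" unfolding s_def using \<rho>.b_nonneg by (intro sum_nonneg) auto
  define c where "c = \<delta>' / (s + 1)"
  have c: "c > 0" unfolding c_def using \<delta>'_pos s by (intro divide_pos_pos) auto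
  have "(\<Sum>j<Suc k. b j * c) = s * c" by (simp add: s_def sum_distrib_right distrib_right)
  also have "\<dots> < (s + 1) * c" using c by simp
  also have "\<dots> = \<delta>'" using s by (simp add: c_def)
  finally have sub: "poly_nbhd (Suc k) (\<lambda>_. c) \<subseteq> nbhd (Suc k) \<delta>'"
    using c \<rho>.b_nonneg by (intro poly_nbhd_subset_cube_nbhd) auto
  show ?thesis
  proof (rule multi_cheb_expansion[where \<zeta>="\<lambda>_. c" and B="\<rho>.B + 1"])
    show "root_deriv k curve_holomorphic_on poly_nbhd (Suc k) (\<lambda>_. c)" by (rule curve_holomorphic_on_subset[OF root_deriv_hol sub])
    show "norm (root_deriv k z) \<le> \<rho>.B + 1" if "z \<in> poly_nbhd (Suc k) (\<lambda>_. c)" for z using norm_root_deriv_le sub that by blast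
    show "root_deriv k z = root_deriv k z'" if "\<And>j. j < Suc k \<Longrightarrow> z j = z' j" for z z' by (rule root_deriv_dep[OF that])
  qed (use c x in auto)
qed

end

section \<open>Marginals of the density and the Knothe--Rosenblatt map\<close>

lemma space_mu: "space mu = cube_inf"
  by (simp add: mu_def space_PiM cube_inf_def)

lemma prob_space_mu: "prob_space mu"
  unfolding mu_def by (intro prob_space_PiM prob_space_mu1)

interpretation mu: prob_space mu
  by (rule prob_space_mu)

interpretation seq: sequence_space mu1
  by unfold_locales

lemma mem_cube_inf: "y \<in> cube_inf \<longleftrightarrow> (\<forall>j. y j \<in> {-1..1})"
  by (auto simp: cube_inf_def PiE_iff)

lemma compact_cube_inf: "compact cube_inf"
proof -
  have "compactin (product_topology (\<lambda>_. euclidean) UNIV) (Pi\<^sub>E (UNIV::nat set) (\<lambda>_. {-1..1::real}))"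
    by (subst compactin_PiE) auto
  then show ?thesis by (simp add: cube_inf_def euclidean_product_topology)
qed

lemma measurable_mu_continuous:
  fixes g :: "(nat \<Rightarrow> real) \<Rightarrow> 'a::topological_space"
  assumes "continuous_on UNIV g"
  shows "g \<in> borel_measurable mu"
proof -
  have "(\<lambda>x. x) \<in> measurable mu (PiM UNIV (\<lambda>_::nat. borel::real measure))"
  proof (rule measurable_PiM_single')
    fix i :: nat
    have "(\<lambda>x. x i) \<in> measurable mu mu1" unfolding mu_def by measurable
    moreover have "(\<lambda>x. x) \<in> measurable mu1 borel"
      by (intro borel_measurable_mu1I continuous_intros)
    ultimately show "(\<lambda>x. x i) \<in> borel_measurable mu" using measurable_compose by blast
  qed auto
  then have "(\<lambda>x. x) \<in> measurable mu borel"
    using sets_PiM_equal_borel measurable_cong_sets by blast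
  from measurable_compose[OF this borel_measurable_continuous_onI[OF assms]] show ?thesis .
qed

text \<open>Retraction onto the interval. Composed with it, functions on the cube become continuous
  on the whole sequence space, where continuity gives measurability.\<close>

definition clamp1 :: "real \<Rightarrow> real" where "clamp1 t = max (-1) (min 1 t)"

lemma clamp1: "clamp1 t \<in> {-1..1}" "t \<in> {-1..1} \<Longrightarrow> clamp1 t = t" "continuous_on A clamp1"
  by (auto simp: clamp1_def[abs_def] intro!: continuous_intros)

lemma continuous_on_weighted_series:
  fixes \<psi> :: "nat \<Rightarrow> 'a::banach"
  assumes "summable (\<lambda>j. norm (\<psi> j))"
  shows "continuous_on UNIV (\<lambda>t. \<Sum>i. clamp1 (t i) *\<^sub>R \<psi> i)"
proof (rule uniform_limit_theorem)
  show "uniform_limit UNIV (\<lambda>n t. \<Sum>i<n. clamp1 (t i) *\<^sub>R \<psi> i) (\<lambda>t. \<Sum>i. clamp1 (t i) *\<^sub>R \<psi> i) sequentially"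
  proof (rule Weierstrass_m_test[OF _ assms])
    fix n :: nat and t :: "nat \<Rightarrow> real"
    show "norm (clamp1 (t n) *\<^sub>R \<psi> n) \<le> norm (\<psi> n)"
      using clamp1(1)[of "t n"] by (auto simp: abs_le_iff intro!: mult_left_le_one_le)
  qed
  have "continuous_on UNIV (\<lambda>t. clamp1 (t i))" for i :: nat
    using continuous_on_compose2[OF clamp1(3)[of UNIV] continuous_on_product_coordinates[of i]] by auto
  then show "\<forall>\<^sub>F n in sequentially. continuous_on UNIV (\<lambda>t. \<Sum>i<n. clamp1 (t i) *\<^sub>R \<psi> i)"
    by (intro always_eventually allI continuous_intros)
qed auto

text \<open>Prepending a coordinate maps the product of \<open>mu1\<close> and \<open>mu\<close> to
  \<open>mu\<close>; the rest is Fubini. This is the source of the tower property of the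
  marginals.\<close>

lemma LINT_mu_iter:
  fixes G :: "(nat \<Rightarrow> real) \<Rightarrow> complex"
  assumes G: "G \<in> borel_measurable mu" and bd: "\<And>t. t \<in> cube_inf \<Longrightarrow> norm (G t) \<le> B"
  shows "(LINT t|mu. G t) = (LINT s|mu1. LINT \<omega>|mu. G (case_nat s \<omega>))"
proof -
  interpret P: pair_prob_space mu1 mu ..
  have cn: "(\<lambda>(s, \<omega>). case_nat s \<omega>) \<in> measurable (mu1 \<Otimes>\<^sub>M mu) mu"
    unfolding mu_def by measurable
  have "(LINT t|mu. G t) = (LINT t|distr (mu1 \<Otimes>\<^sub>M mu) mu (\<lambda>(s, \<omega>). case_nat s \<omega>). G t)"
    using seq.PiM_iter by (simp add: mu_def)
  also have "\<dots> = (LINT z|(mu1 \<Otimes>\<^sub>M mu). G (case z of (s, \<omega>) \<Rightarrow> case_nat s \<omega>))"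
    by (rule integral_distr[OF cn G])
  also have "\<dots> = (LINT s|mu1. LINT \<omega>|mu. G (case (s, \<omega>) of (s, \<omega>) \<Rightarrow> case_nat s \<omega>))"
  proof (rule P.integral_fst'[symmetric])
    show "integrable (mu1 \<Otimes>\<^sub>M mu) (\<lambda>z. G (case z of (s, \<omega>) \<Rightarrow> case_nat s \<omega>))"
    proof (rule P.integrable_const_bound[of _ B])
      show "(\<lambda>z. G (case z of (s, \<omega>) \<Rightarrow> case_nat s \<omega>)) \<in> borel_measurable (mu1 \<Otimes>\<^sub>M mu)"
        by (rule measurable_compose[OF cn G])
      show "AE z in mu1 \<Otimes>\<^sub>M mu. norm (G (case z of (s, \<omega>) \<Rightarrow> case_nat s \<omega>)) \<le> B"
      proof (rule AE_I2)
        fix z assume "z \<in> space (mu1 \<Otimes>\<^sub>M mu)"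
        from measurable_space[OF cn this] show "norm (G (case z of (s, \<omega>) \<Rightarrow> case_nat s \<omega>)) \<le> B"
          by (intro bd) (simp add: space_mu)
      qed
    qed
  qed
  finally show ?thesis by simp
qed

locale parametric_density =
  fixes p M L :: real and \<psi> :: "nat \<Rightarrow> 'a::banach" and S :: "('a \<times> 'a) set" and F :: "'a \<times> 'a \<Rightarrow> complex"
    and f :: "(nat \<Rightarrow> real) \<Rightarrow> real" and b :: "nat \<Rightarrow> real"
  assumes dens: "density_assumption p M L \<psi> S F f"
    and f_pos: "\<And>y. y \<in> cube_inf \<Longrightarrow> 0 < f y"
    and M: "0 < M" "M \<le> L"
    and \<psi>_le: "\<And>j. norm (\<psi> j) \<le> b j" and b_summable: "summable b"
begin

lemma b_nonneg: "b j \<ge> 0" using \<psi>_le norm_ge_zero order_trans by blast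

lemma \<psi>_summable: "summable (\<lambda>j. norm (\<psi> j))"
  by (rule summable_comparison_test'[OF b_summable, where N=0]) (use \<psi>_le in auto)

lemma open_S: "open S" and F_diff: "cplx_differentiable_on F S"
  and F_bound: "z \<in> S \<Longrightarrow> cmod (F z) \<le> L" and F_ge: "z \<in> S \<Longrightarrow> M \<le> cmod (F z)"
  and int_f: "(LINT y|mu. f y) = 1"
  using dens by (auto simp: density_assumption_def)

lemma F_real:
  assumes "y \<in> cube_inf"
  shows "(\<Sum>j. y j *\<^sub>R \<psi> j, 0) \<in> S" "F (\<Sum>j. y j *\<^sub>R \<psi> j, 0) = of_real (f y)" "f y \<in> {M..L}"
proof -
  show S: "(\<Sum>j. y j *\<^sub>R \<psi> j, 0) \<in> S" using dens assms by (auto simp: density_assumption_def)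
  have "F (\<Sum>j. y j *\<^sub>R \<psi> j, 0) \<in> \<real>" "f y = Re (F (\<Sum>j. y j *\<^sub>R \<psi> j, 0))"
    using dens assms by (auto simp: density_assumption_def)
  then show eq: "F (\<Sum>j. y j *\<^sub>R \<psi> j, 0) = of_real (f y)" by simp
  then have "cmod (F (\<Sum>j. y j *\<^sub>R \<psi> j, 0)) = f y" using f_pos[OF assms] by simp
  then show "f y \<in> {M..L}" using F_bound[OF S] F_ge[OF S] by simp
qed

definition tail :: "nat \<Rightarrow> (nat \<Rightarrow> real) \<Rightarrow> 'a" where
  "tail k t = (\<Sum>i. t i *\<^sub>R \<psi> (i + k))"

text \<open>The series of \<open>z j\<close> times \<open>\<psi> j\<close> in the complexification
  by pairs, complex in the first \<open>k\<close> coordinates and real in the tail that is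
  integrated out.\<close>

definition arg :: "nat \<Rightarrow> (nat \<Rightarrow> complex) \<Rightarrow> (nat \<Rightarrow> real) \<Rightarrow> 'a \<times> 'a" where
  "arg k z t = ((\<Sum>j<k. Re (z j) *\<^sub>R \<psi> j) + tail k t, \<Sum>j<k. Im (z j) *\<^sub>R \<psi> j)"

lemma summable_weighted:
  assumes "t \<in> cube_inf" shows "summable (\<lambda>i. t i *\<^sub>R \<psi> (i + k))"
proof (rule summable_comparison_test'[where N=0])
  show "summable (\<lambda>i. norm (\<psi> (i + k)))" using \<psi>_summable by (rule summable_ignore_initial_segment)
  fix n :: nat
  have "t n \<in> {-1..1}" using assms by (simp add: mem_cube_inf)
  then show "norm (t n *\<^sub>R \<psi> (n + k)) \<le> norm (\<psi> (n + k))"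
    by (auto simp: abs_le_iff intro!: mult_left_le_one_le)
qed

lemma comb_seq_mem:
  assumes "\<And>j. j < k \<Longrightarrow> x j \<in> {-1..1}" "t \<in> cube_inf"
  shows "comb_seq k x t \<in> cube_inf"
  using assms by (auto simp: mem_cube_inf comb_seq_def)

lemma arg_real:
  assumes "\<And>j. j < k \<Longrightarrow> x j \<in> {-1..1}" "t \<in> cube_inf"
  shows "arg k (\<lambda>j. of_real (x j)) t = (\<Sum>j. comb_seq k x t j *\<^sub>R \<psi> j, 0)"
proof -
  have "(\<Sum>j. comb_seq k x t j *\<^sub>R \<psi> j) = (\<Sum>n. comb_seq k x t (n + k) *\<^sub>R \<psi> (n + k)) + (\<Sum>j<k. comb_seq k x t j *\<^sub>R \<psi> j)"
    using summable_weighted[of "comb_seq k x t" 0] comb_seq_mem[of k x t] assms by (intro suminf_split_initial_segment) simp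
  then show ?thesis by (simp add: arg_def tail_def comb_seq_def add.commute)
qed

lemma arg_Suc:
  assumes "s \<in> {-1..1}" "\<omega> \<in> cube_inf"
  shows "arg k z (case_nat s \<omega>) = arg (Suc k) (z(k := of_real s)) \<omega>"
proof -
  have "case_nat s \<omega> \<in> cube_inf" using assms by (auto simp: mem_cube_inf split: nat.splits)
  from summable_weighted[OF this, of k]
  have "tail k (case_nat s \<omega>) = s *\<^sub>R \<psi> k + tail (Suc k) \<omega>"
    unfolding tail_def using suminf_split_head[of "\<lambda>i. case_nat s \<omega> i *\<^sub>R \<psi> (i + k)"] by (simp add: algebra_simps)
  then show ?thesis by (simp add: arg_def)
qed

lemma norm_arg_diff: "norm (arg k z t - arg k z' t) \<le> 2 * (\<Sum>j<k. b j * norm (z j - z' j))"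
proof -
  have "arg k z t - arg k z' t = (\<Sum>j<k. Re (z j - z' j) *\<^sub>R \<psi> j, \<Sum>j<k. Im (z j - z' j) *\<^sub>R \<psi> j)"
    by (simp add: arg_def algebra_simps sum_subtractf)
  also have "norm \<dots> \<le> norm (\<Sum>j<k. Re (z j - z' j) *\<^sub>R \<psi> j) + norm (\<Sum>j<k. Im (z j - z' j) *\<^sub>R \<psi> j)"
    by (rule norm_Pair_le)
  also have "\<dots> \<le> (\<Sum>j<k. b j * norm (z j - z' j)) + (\<Sum>j<k. b j * norm (z j - z' j))"
  proof (intro add_mono sum_norm_le)
    fix j
    have "\<bar>Re (z j - z' j)\<bar> * norm (\<psi> j) \<le> norm (z j - z' j) * b j"
      by (intro mult_mono abs_Re_le_cmod \<psi>_le) auto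
    then show "norm (Re (z j - z' j) *\<^sub>R \<psi> j) \<le> b j * norm (z j - z' j)" by (simp add: mult.commute)
    have "\<bar>Im (z j - z' j)\<bar> * norm (\<psi> j) \<le> norm (z j - z' j) * b j"
      by (intro mult_mono abs_Im_le_cmod \<psi>_le) auto
    then show "norm (Im (z j - z' j) *\<^sub>R \<psi> j) \<le> b j * norm (z j - z' j)" by (simp add: mult.commute)
  qed
  finally show ?thesis by simp
qed

text \<open>Along a holomorphic curve the derivative of the argument is
  \<open>\<lambda>h. cplx_scale h v\<close>, so complex linearity of the derivative of
  \<open>F\<close> makes the chain rule produce a complex derivative.\<close>

lemma arg_hol:
  assumes N: "open N" and w: "\<And>j. (\<lambda>s. w s j) holomorphic_on N" and S: "\<And>s. s \<in> N \<Longrightarrow> arg k (w s) t \<in> S"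
  shows "(\<lambda>s. F (arg k (w s) t)) holomorphic_on N"
  unfolding holomorphic_on_open[OF N]
proof
  fix s0 assume s0: "s0 \<in> N"
  define d where "d j = deriv (\<lambda>s. w s j) s0" for j
  have d: "((\<lambda>s. w s j) has_derivative (\<lambda>h. d j * h)) (at s0)" for j
    using holomorphic_derivI[OF w N s0] by (simp add: d_def has_field_derivative_def)
  obtain D where D: "(F has_derivative D) (at (arg k (w s0) t))" "\<And>c v. D (cplx_scale c v) = c * D v"
    using F_diff S[OF s0] unfolding cplx_differentiable_on_def by blast
  define v where "v = (\<Sum>j<k. Re (d j) *\<^sub>R \<psi> j, \<Sum>j<k. Im (d j) *\<^sub>R \<psi> j)"
  have "((\<lambda>s. arg k (w s) t) has_derivative (\<lambda>h. (\<Sum>j<k. Re (d j * h) *\<^sub>R \<psi> j, \<Sum>j<k. Im (d j * h) *\<^sub>R \<psi> j))) (at s0)"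
    unfolding arg_def by (auto intro!: derivative_eq_intros d)
  also have "(\<lambda>h. (\<Sum>j<k. Re (d j * h) *\<^sub>R \<psi> j, \<Sum>j<k. Im (d j * h) *\<^sub>R \<psi> j)) = (\<lambda>h. cplx_scale h v)"
    by (simp add: fun_eq_iff cplx_scale_def v_def scaleR_sum_right algebra_simps sum_subtractf sum.distrib)
  finally have "((\<lambda>s. F (arg k (w s) t)) has_derivative (\<lambda>h. D (cplx_scale h v))) (at s0)"
    using has_derivative_compose[where f="\<lambda>s. arg k (w s) t" and g=F, OF _ D(1)] by blast
  then have "((\<lambda>s. F (arg k (w s) t)) has_field_derivative D v) (at s0)"
    unfolding D(2) has_field_derivative_def by (simp only: mult.commute[of _ "D v"])
  then show "\<exists>f'. ((\<lambda>s. F (arg k (w s) t)) has_field_derivative f') (at s0)" by blast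
qed

lemma F_continuous: "continuous_on S F"
proof -
  have "isCont F z" if "z \<in> S" for z
    using F_diff that has_derivative_continuous unfolding cplx_differentiable_on_def by blast
  then show ?thesis by (simp add: continuous_at_imp_continuous_on)
qed

lemma arg_measurable:
  assumes "\<And>t. t \<in> cube_inf \<Longrightarrow> arg k z t \<in> S"
  shows "(\<lambda>t. F (arg k z t)) \<in> borel_measurable mu"
proof -
  define cl where "cl t = (\<lambda>i. clamp1 (t i))" for t :: "nat \<Rightarrow> real"
  have cl: "cl t \<in> cube_inf" for t using clamp1(1) by (simp add: cl_def mem_cube_inf)
  have "continuous_on UNIV (\<lambda>t. tail k (cl t))"
    unfolding tail_def cl_def
    using continuous_on_weighted_series[of "\<lambda>i. \<psi> (i + k)"] summable_ignore_initial_segment[OF \<psi>_summable] by auto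
  then have "continuous_on UNIV (\<lambda>t. arg k z (cl t))"
    unfolding arg_def by (intro continuous_intros)
  then have "continuous_on UNIV (\<lambda>t. F (arg k z (cl t)))"
    by (rule continuous_on_compose2[OF F_continuous]) (use assms cl in auto)
  then have "(\<lambda>t. F (arg k z (cl t))) \<in> borel_measurable mu" by (rule measurable_mu_continuous)
  then show ?thesis
  proof (rule measurable_cong[THEN iffD1, rotated])
    fix t assume "t \<in> space mu"
    then have "cl t = t" by (auto simp: cl_def space_mu mem_cube_inf fun_eq_iff intro!: clamp1(2))
    then show "F (arg k z (cl t)) = F (arg k z t)" by simp
  qed
qed

text \<open>The real parameter series map the compact cube onto a compact subset of the open set
  \<open>S\<close>, which has a uniform neighbourhood inside \<open>S\<close>. This gives one radius
  for all \<open>k\<close> and all tails.\<close>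

lemma arg_radius: "\<exists>\<delta>0>0. \<forall>k z t x. (\<forall>j. x j \<in> {-1..1}) \<longrightarrow> (\<Sum>j<k. b j * norm (z j - of_real (x j))) < \<delta>0 \<longrightarrow>
    t \<in> cube_inf \<longrightarrow> arg k z t \<in> S"
proof -
  define K where "K = (\<lambda>y. (\<Sum>j. clamp1 (y j) *\<^sub>R \<psi> j, 0::'a)) ` cube_inf"
  have "continuous_on cube_inf (\<lambda>y. (\<Sum>j. clamp1 (y j) *\<^sub>R \<psi> j, 0::'a))"
    using continuous_on_subset[OF continuous_on_weighted_series[OF \<psi>_summable]] by (intro continuous_intros) auto
  then have "compact K" unfolding K_def by (rule compact_continuous_image[OF _ compact_cube_inf])
  moreover have clid: "(\<Sum>j. clamp1 (y j) *\<^sub>R \<psi> j) = (\<Sum>j. y j *\<^sub>R \<psi> j)" if "y \<in> cube_inf" for y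
  proof -
    have "clamp1 (y j) = y j" for j using that by (intro clamp1(2)) (simp add: mem_cube_inf)
    then show ?thesis by simp
  qed
  then have "K \<subseteq> S" using F_real(1) by (auto simp: K_def)
  ultimately obtain e where e: "e > 0" "(\<Union>y\<in>K. ball y e) \<subseteq> S"
    using compact_subset_open_imp_ball_epsilon_subset[OF _ open_S] by blast
  show ?thesis
  proof (intro exI[of _ "e / 2"] conjI allI impI)
    fix k and z :: "nat \<Rightarrow> complex" and t and x :: "nat \<Rightarrow> real" assume x: "\<forall>j. x j \<in> {-1..1::real}" and d: "(\<Sum>j<k. b j * norm (z j - of_real (x j))) < e / 2" and t: "t \<in> cube_inf"
    have y: "comb_seq k x t \<in> cube_inf" using x t by (intro comb_seq_mem) auto
    have "arg k (\<lambda>j. of_real (x j)) t \<in> K"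
      using arg_real[of k x t] x t y clid[OF y] unfolding K_def by (auto intro!: image_eqI[of _ _ "comb_seq k x t"])
    moreover have "norm (arg k z t - arg k (\<lambda>j. of_real (x j)) t) < e"
      using norm_arg_diff[of k z t "\<lambda>j. of_real (x j)"] d by linarith
    ultimately show "arg k z t \<in> S"
      using e(2) unfolding dist_norm[symmetric] by (metis UN_I dist_commute mem_ball subsetD)
  qed (use e in auto)
qed

definition cmarginal :: "nat \<Rightarrow> (nat \<Rightarrow> complex) \<Rightarrow> complex" where
  "cmarginal k z = (LINT t|mu. F (arg k z t))"

lemma cmarginal_real:
  assumes x: "\<And>j. j < k \<Longrightarrow> x j \<in> {-1..1}"
  shows "cmarginal k (\<lambda>j. of_real (x j)) = of_real (marginal_density f k x)" "marginal_density f k x \<in> {M..L}"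
    "(\<lambda>t. f (comb_seq k x t)) \<in> borel_measurable mu"
proof -
  have Feq: "F (arg k (\<lambda>j. of_real (x j)) t) = of_real (f (comb_seq k x t))" if "t \<in> cube_inf" for t
    using F_real(2)[OF comb_seq_mem[OF x that]] arg_real[OF x that] by simp
  have "(\<lambda>t. F (arg k (\<lambda>j. of_real (x j)) t)) \<in> borel_measurable mu"
    using F_real(1)[OF comb_seq_mem[OF x]] arg_real[OF x] by (intro arg_measurable) auto
  then have "(\<lambda>t. Re (F (arg k (\<lambda>j. of_real (x j)) t))) \<in> borel_measurable mu" by measurable
  then show meas: "(\<lambda>t. f (comb_seq k x t)) \<in> borel_measurable mu"
    by (rule measurable_cong[THEN iffD1, rotated]) (simp add: Feq space_mu)
  have md: "marginal_density f k x = (LINT t|mu. f (comb_seq k x t))"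
    by (simp add: marginal_density_def comb_seq_0 int_f)
  have "cmarginal k (\<lambda>j. of_real (x j)) = (LINT t|mu. complex_of_real (f (comb_seq k x t)))"
    unfolding cmarginal_def by (rule Bochner_Integration.integral_cong) (auto simp: Feq space_mu)
  then show "cmarginal k (\<lambda>j. of_real (x j)) = of_real (marginal_density f k x)" by (simp add: md)
  have bd: "f (comb_seq k x t) \<in> {M..L}" if "t \<in> cube_inf" for t by (rule F_real(3)[OF comb_seq_mem[OF x that]])
  have int: "integrable mu (\<lambda>t. f (comb_seq k x t))"
    using meas by (rule mu.integrable_const_bound[of _ L, rotated]) (use bd M in \<open>auto simp: space_mu intro!: AE_I2\<close>, fastforce)
  have "(LINT t|mu. M) \<le> (LINT t|mu. f (comb_seq k x t))"
    by (rule integral_mono[OF _ int]) (use bd in \<open>auto simp: space_mu\<close>)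
  moreover have "(LINT t|mu. f (comb_seq k x t)) \<le> (LINT t|mu. L)"
    by (rule integral_mono[OF int]) (use bd in \<open>auto simp: space_mu\<close>)
  ultimately show "marginal_density f k x \<in> {M..L}" using mu.prob_space by (simp add: md)
qed

text \<open>\<open>\<delta>0\<close> and \<open>Lip0\<close> are thresholds rather than fixed
  values, so that the two densities can be given common parameters.\<close>

lemma holomorphic_marginals_cmarginal:
  "\<exists>\<delta>0>0. \<exists>Lip0\<ge>0. \<forall>\<delta> Lip. 0 < \<delta> \<longrightarrow> \<delta> \<le> \<delta>0 \<longrightarrow> Lip0 \<le> Lip \<longrightarrow> Lip * \<delta> \<le> M / 16 \<longrightarrow>
     holomorphic_marginals b \<delta> M L Lip cmarginal"
proof -
  obtain e where e: "e > 0" "\<And>k z t x. (\<And>j. x j \<in> {-1..1}) \<Longrightarrow> (\<Sum>j<k. b j * norm (z j - of_real (x j))) < e \<Longrightarrow>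
    t \<in> cube_inf \<Longrightarrow> arg k z t \<in> S"
    using arg_radius by blast
  \<comment> \<open>Half of the admissible radius \<open>e\<close> is kept in reserve: from any
    point of the neighbourhood one may still move by \<open>\<delta>0\<close> inside the domain,
    which the Lipschitz estimate exploits.\<close>
  define \<delta>0 Lip0 where "\<delta>0 = e / 2" and "Lip0 = 4 * L / \<delta>0"
  have \<delta>0: "\<delta>0 > 0" and Lip0: "Lip0 \<ge> 0" using e(1) M by (auto simp: \<delta>0_def Lip0_def)
  have L: "L > 0" using M by simp
  have mem: "arg k z t \<in> S" if z: "z \<in> cube_nbhd b k \<delta>" and \<delta>: "\<delta> \<le> \<delta>0" and t: "t \<in> cube_inf" for k z t \<delta>
  proof -
    obtain x where "\<And>j. x j \<in> {-1..1}" "(\<Sum>j<k. b j * norm (z j - of_real (x j))) < \<delta>"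
      using z by (auto simp: cube_nbhd_def)
    then show ?thesis using t \<delta> e(1) by (intro e(2)[of x]) (auto simp: \<delta>0_def)
  qed
  have meas: "(\<lambda>t. F (arg k z t)) \<in> borel_measurable mu" if "z \<in> cube_nbhd b k \<delta>" "\<delta> \<le> \<delta>0" for k z \<delta>
    using mem that by (intro arg_measurable) auto
  have int: "integrable mu (\<lambda>t. F (arg k z t))" if "z \<in> cube_nbhd b k \<delta>" "\<delta> \<le> \<delta>0" for k z \<delta>
    using mem[OF that] F_bound by (intro mu.integrable_const_bound[OF _ meas[OF that], of L] AE_I2) (simp add: space_mu)
  have lip: "norm (F (arg k z t) - F (arg k z' t)) \<le> Lip0 * (\<Sum>j<k. b j * norm (z j - z' j))"
    if z: "z \<in> cube_nbhd b k \<delta>" and z': "z' \<in> cube_nbhd b k \<delta>" and \<delta>: "\<delta> \<le> \<delta>0" and t: "t \<in> cube_inf" for k z z' \<delta> t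
  proof -
    define D where "D = (\<Sum>j<k. b j * norm (z j - z' j))"
    have D0: "D \<ge> 0" unfolding D_def using b_nonneg by (intro sum_nonneg) auto
    have Fz: "norm (F (arg k z t)) \<le> L" "norm (F (arg k z' t)) \<le> L" using mem z z' \<delta> t F_bound by auto
    consider "D = 0" | "D \<ge> \<delta>0" | "0 < D" "D < \<delta>0" using D0 by linarith
    then show ?thesis
    proof cases
      case 1
      then have "arg k z t = arg k z' t" using norm_arg_diff[of k z t z'] by (simp add: D_def)
      then show ?thesis using 1 by (simp add: D_def)
    next
      case 2
      have "norm (F (arg k z t) - F (arg k z' t)) \<le> 2 * L" using Fz norm_triangle_ineq4[of "F (arg k z t)" "F (arg k z' t)"] by linarith
      also have "\<dots> \<le> Lip0 * \<delta>0" using L \<delta>0 by (simp add: Lip0_def)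
      also have "\<dots> \<le> Lip0 * D" using 2 Lip0 by (intro mult_left_mono)
      finally show ?thesis by (simp add: D_def)
    next
      case 3
      \<comment> \<open>The complex line through \<open>z'\<close> and \<open>z\<close> can be
        followed up to parameters of modulus \<open>R\<close>, which exceeds 1 because
        \<open>D < \<delta>0\<close>.\<close>
      define R where "R = \<delta>0 / D"
      define w where "w s j = z' j + s * (z j - z' j)" for s j
      obtain x where x: "\<And>j. x j \<in> {-1..1}" "(\<Sum>j<k. b j * norm (z' j - of_real (x j))) < \<delta>"
        using z' by (auto simp: cube_nbhd_def)
      have wS: "arg k (w s) t \<in> S" if s: "s \<in> ball 0 R" for s
      proof (rule e(2)[OF x(1) _ t])
        have "(\<Sum>j<k. b j * norm (w s j - of_real (x j))) \<le> (\<Sum>j<k. b j * norm (z' j - of_real (x j)) + norm s * (b j * norm (z j - z' j)))"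
        proof (rule sum_mono)
          fix j
          have "norm (w s j - of_real (x j)) \<le> norm (z' j - of_real (x j)) + norm s * norm (z j - z' j)"
            using norm_triangle_ineq[of "z' j - of_real (x j)" "s * (z j - z' j)"]
            unfolding norm_mult by (simp add: w_def add_diff_eq diff_add_eq)
          from mult_left_mono[OF this b_nonneg[of j]]
          show "b j * norm (w s j - of_real (x j)) \<le> b j * norm (z' j - of_real (x j)) + norm s * (b j * norm (z j - z' j))"
            by (simp add: algebra_simps)
        qed
        also have "\<dots> = (\<Sum>j<k. b j * norm (z' j - of_real (x j))) + norm s * D"
          by (simp add: sum.distrib D_def sum_distrib_left)
        also have "\<dots> < \<delta>0 + R * D" using x(2) \<delta> s 3(1) by (intro add_less_le_mono mult_right_mono) auto
        also have "\<dots> = e" using 3(1) by (simp add: R_def \<delta>0_def)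
        finally show "(\<Sum>j<k. b j * norm (w s j - of_real (x j))) < e" .
      qed
      have "norm (F (arg k (w 1) t) - F (arg k (w 0) t)) \<le> 4 * L / R * norm (1 - 0 :: complex)"
      proof (rule holomorphic_lipschitz[where h="\<lambda>s. F (arg k (w s) t)"])
        show "(\<lambda>s. F (arg k (w s) t)) holomorphic_on ball 0 R"
        proof (rule arg_hol[OF open_ball _ wS])
          show "(\<lambda>s. w s j) holomorphic_on ball 0 R" for j unfolding w_def by (intro holomorphic_intros)
        qed
        show "norm (F (arg k (w s) t)) \<le> L" if "s \<in> ball 0 R" for s using F_bound wS that by blast
      qed (use 3 in \<open>simp add: R_def\<close>)
      moreover have "w 1 = z" "w 0 = z'" by (auto simp: w_def)
      ultimately show ?thesis using 3 by (simp add: Lip0_def R_def D_def)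
    qed
  qed
  have "holomorphic_marginals b \<delta> M L Lip cmarginal" if \<delta>: "0 < \<delta>" "\<delta> \<le> \<delta>0" and Lip: "Lip0 \<le> Lip" "Lip * \<delta> \<le> M / 16" for \<delta> Lip
  proof unfold_locales
    show "b j \<ge> 0" for j by (rule b_nonneg)
    show "0 < \<delta>" "0 < M" "M \<le> L" "Lip * \<delta> \<le> M / 16" using \<delta> M Lip by auto
    show "Lip \<ge> 0" using Lip Lip0 by linarith
    show "cmarginal k z = cmarginal k z'" if "\<And>j. j < k \<Longrightarrow> z j = z' j" for k z z'
    proof -
      have "arg k z = arg k z'" using that by (simp add: arg_def fun_eq_iff)
      then show ?thesis by (simp add: cmarginal_def)
    qed
    show "\<exists>v\<in>{M..L}. cmarginal k (\<lambda>j. of_real (x j)) = of_real v" if "\<And>j. x j \<in> {-1..1}" for k x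
      using cmarginal_real[of k x] that by blast
    show "cmarginal 0 z = 1" for z
    proof -
      have "cmarginal 0 z = cmarginal 0 (\<lambda>j. of_real 0)" by (simp add: cmarginal_def arg_def)
      also have "\<dots> = of_real (marginal_density f 0 (\<lambda>_. 0))" by (rule cmarginal_real(1)) auto
      finally show ?thesis by (simp add: marginal_density_def)
    qed
    show "norm (cmarginal k z - cmarginal k z') \<le> Lip * (\<Sum>j<k. b j * norm (z j - z' j))"
      if z: "z \<in> cube_nbhd b k \<delta>" and z': "z' \<in> cube_nbhd b k \<delta>" for k z z'
    proof -
      have D0: "(\<Sum>j<k. b j * norm (z j - z' j)) \<ge> 0" using b_nonneg by (intro sum_nonneg) auto
      have "cmarginal k z - cmarginal k z' = (LINT t|mu. F (arg k z t) - F (arg k z' t))"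
        unfolding cmarginal_def using int z z' \<delta> by (intro Bochner_Integration.integral_diff[symmetric]) auto
      also have "norm \<dots> \<le> Lip0 * (\<Sum>j<k. b j * norm (z j - z' j))"
        using lip[OF z z' \<delta>(2)] D0 Lip0 by (intro norm_LINT_le_const prob_space_mu) (auto simp: space_mu)
      also have "\<dots> \<le> Lip * (\<Sum>j<k. b j * norm (z j - z' j))" using Lip D0 by (intro mult_right_mono)
      finally show ?thesis .
    qed
    show "cmarginal k curve_holomorphic_on cube_nbhd b k \<delta>" for k
    proof (rule curve_holomorphic_onI)
      fix N w assume N: "open N" "\<And>j. (\<lambda>s. w s j) holomorphic_on N" "\<And>s. s \<in> N \<Longrightarrow> w s \<in> cube_nbhd b k \<delta>"
      show "(\<lambda>s. cmarginal k (w s)) holomorphic_on N"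
        unfolding cmarginal_def
      proof (rule holomorphic_on_LINT[OF prob_space_mu N(1), where B=L])
        show "(\<lambda>s. F (arg k (w s) t)) holomorphic_on N" if "t \<in> space mu" for t
          using mem[OF N(3) \<delta>(2)] that by (intro arg_hol N) (auto simp: space_mu)
        show "norm (F (arg k (w s) t)) \<le> L" if "s \<in> N" "t \<in> space mu" for s t
          using mem[OF N(3)[OF that(1)] \<delta>(2)] that F_bound by (simp add: space_mu)
        show "(\<lambda>t. F (arg k (w s) t)) \<in> borel_measurable mu" if "s \<in> N" for s
          by (rule meas[OF N(3)[OF that] \<delta>(2)])
      qed
    qed
    show "cmarginal k z = (LINT s|mu1. cmarginal (Suc k) (z(k := of_real s)))" if z: "z \<in> cube_nbhd b k \<delta>" for k z
    proof -
      have "cmarginal k z = (LINT s|mu1. LINT \<omega>|mu. F (arg k z (case_nat s \<omega>)))"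
        unfolding cmarginal_def using mem[OF z \<delta>(2)] F_bound by (intro LINT_mu_iter[where B=L] meas[OF z \<delta>(2)]) auto
      also have "\<dots> = (LINT s|mu1. cmarginal (Suc k) (z(k := of_real s)))"
        unfolding cmarginal_def by (intro Bochner_Integration.integral_cong refl) (simp add: arg_Suc space_mu)
      finally show ?thesis .
    qed
  qed
  then show ?thesis using \<delta>0 Lip0 by blast
qed

end

section \<open>Monotone transport on the interval\<close>

lemma borel_measurable_mu1_borel: "g \<in> borel_measurable borel \<Longrightarrow> g \<in> borel_measurable mu1"
  by (simp cong: measurable_cong_sets add: sets_mu1 measurable_restrict_space1)

lemma set_integral_mu1_FTC:
  fixes g :: "real \<Rightarrow> 'a::euclidean_space"
  assumes G: "\<And>s. s \<in> {-1..1} \<Longrightarrow> (G has_vector_derivative g s) (at s within {-1..1})"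
    and g: "continuous_on {-1..1} g" and t: "t \<in> {-1..1}"
  shows "(LINT s:{-1..t}|mu1. g s) = (1/2) *\<^sub>R (G t - G (-1))"
proof -
  have "(\<lambda>s. indicat_real {-1..t} s *\<^sub>R g s) \<in> borel_measurable mu1"
    using g by (intro borel_measurable_scaleR borel_measurable_mu1_borel borel_measurable_mu1I) auto
  then have "(LINT s:{-1..t}|mu1. g s) = (1/2) *\<^sub>R (LBINT s:{-1..1}. indicat_real {-1..t} s *\<^sub>R g s)"
    unfolding set_lebesgue_integral_def[of mu1] by (rule LINT_mu1)
  also have "(LBINT s:{-1..1}. indicat_real {-1..t} s *\<^sub>R g s) = (LBINT s:{-1..t}. g s)"
    unfolding set_lebesgue_integral_def using t by (intro Bochner_Integration.integral_cong) (auto simp: indicator_def)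
  also have "(LBINT s:{-1..t}. g s) = G t - G (-1)"
    unfolding set_lebesgue_integral_def
  proof (rule integral_FTC_atLeastAtMost)
    show "(G has_vector_derivative g s) (at s within {-1..t})" if "-1 \<le> s" "s \<le> t" for s
      using G[of s] that t by (auto intro: has_vector_derivative_within_subset)
    show "continuous_on {-1..t} g" using g t by (auto intro: continuous_on_subset)
  qed (use t in auto)
  finally show ?thesis .
qed

lemma set_integral_mu1_deriv:
  fixes q :: "real \<Rightarrow> real"
  assumes q: "continuous_on {-1..1} q" and t: "t \<in> {-1..1}"
  shows "((\<lambda>t. LINT s:{-1..t}|mu1. q s) has_real_derivative q t / 2) (at t within {-1..1})"
proof -
  have G: "((\<lambda>t. integral {-1..t} q) has_vector_derivative q s) (at s within {-1..1})" if "s \<in> {-1..1}" for s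
    by (rule integral_has_vector_derivative[OF q that])
  have eq: "(LINT s:{-1..t}|mu1. q s) = integral {-1..t} q / 2" if "t \<in> {-1..1}" for t
    using set_integral_mu1_FTC[OF G q that] by simp
  have "((\<lambda>t. integral {-1..t} q / 2) has_real_derivative q t / 2) (at t within {-1..1})"
    using G[OF t] by (auto simp: has_real_derivative_iff_has_vector_derivative[symmetric] intro!: derivative_eq_intros)
  then show ?thesis
    by (rule has_field_derivative_transform_within[OF _ zero_less_one]) (use t eq in auto)
qed

lemma continuous_bounded_Icc:
  fixes q :: "real \<Rightarrow> 'a::real_normed_vector"
  assumes "continuous_on {-1..1} q"
  obtains B where "\<And>s. s \<in> {-1..1} \<Longrightarrow> norm (q s) \<le> B"
  using compact_imp_bounded[OF compact_continuous_image[OF assms compact_Icc]] unfolding bounded_iff by blast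

lemma emeasure_density_mu1:
  assumes q: "continuous_on {-1..1} q" "\<And>s. s \<in> {-1..1} \<Longrightarrow> 0 \<le> q s" and t: "t \<in> {-1..1}"
  shows "emeasure (density mu1 (\<lambda>s. ennreal (q s))) {-1..t} = ennreal (LINT s:{-1..t}|mu1. q s)"
proof -
  obtain B where B: "\<And>s. s \<in> {-1..1} \<Longrightarrow> norm (q s) \<le> B" using continuous_bounded_Icc[OF q(1)] by blast
  have "norm (q 0) \<le> B" by (rule B) simp
  then have B0: "0 \<le> B" by (rule order_trans[OF norm_ge_zero])
  have qm: "q \<in> borel_measurable mu1" by (rule borel_measurable_mu1I[OF q(1)])
  have A: "{-1..t} \<in> sets mu1" using t by (auto simp: sets_mu1 sets_restrict_space intro!: image_eqI[of _ _ "{-1..t}"])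
  have "emeasure (density mu1 (\<lambda>s. ennreal (q s))) {-1..t} = (\<integral>\<^sup>+s. ennreal (q s) * indicator {-1..t} s \<partial>mu1)"
    using qm A by (intro emeasure_density) auto
  also have "\<dots> = (\<integral>\<^sup>+s. ennreal (indicator {-1..t} s *\<^sub>R q s) \<partial>mu1)"
    by (intro nn_integral_cong) (auto simp: indicator_def)
  also have "\<dots> = ennreal (LINT s|mu1. indicator {-1..t} s *\<^sub>R q s)"
  proof (rule nn_integral_eq_integral)
    show "integrable mu1 (\<lambda>s. indicator {-1..t} s *\<^sub>R q s)"
      using qm A B B0 by (intro integrable_mu1I[of _ B] borel_measurable_scaleR borel_measurable_indicator)
        (auto simp: indicator_def)
  qed (use q(2) in \<open>auto simp: indicator_def\<close>)
  finally show ?thesis by (simp add: set_lebesgue_integral_def)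
qed

text \<open>By monotonicity \<open>{-1..t}\<close> lies between the preimages of
  \<open>{-1..<\<tau> t}\<close> and \<open>{-1..\<tau> t}\<close>. These two intervals differ by
  one point, a null set of the target, so both bounds on the mass of \<open>{-1..t}\<close>
  coincide.\<close>

lemma monotone_transport_cdf:
  assumes u: "continuous_on {-1..1} u" "\<And>s. s \<in> {-1..1} \<Longrightarrow> 0 \<le> u s"
    and v: "continuous_on {-1..1} v" "\<And>s. s \<in> {-1..1} \<Longrightarrow> 0 \<le> v s"
    and \<tau>: "\<tau> \<in> {-1..1} \<rightarrow> {-1..1}" "mono_on {-1..1} \<tau>"
    and push: "distr (density mu1 (\<lambda>s. ennreal (u s))) mu1 \<tau> = density mu1 (\<lambda>s. ennreal (v s))"
    and t: "t \<in> {-1..1}"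
  shows "(LINT s:{-1..\<tau> t}|mu1. v s) = (LINT s:{-1..t}|mu1. u s)"
proof -
  define N1 N2 where "N1 = density mu1 (\<lambda>s. ennreal (u s))" and "N2 = density mu1 (\<lambda>s. ennreal (v s))"
  have [simp]: "sets N1 = sets mu1" "sets N2 = sets mu1" "space N1 = {-1..1}" "space N2 = {-1..1}"
    by (auto simp: N1_def N2_def)
  have \<tau>t: "\<tau> t \<in> {-1..1}" using \<tau> t by auto
  have mem: "A \<inter> {-1..1} \<in> sets mu1" if "A \<in> sets borel" for A
    using that by (auto simp: sets_mu1 sets_restrict_space Int_commute)
  have \<tau>m: "\<tau> \<in> measurable mu1 mu1"
  proof -
    have "\<tau> \<in> measurable mu1 (restrict_space borel {-1..1})"
      using \<tau>(1) borel_measurable_mono_on_fnc[OF \<tau>(2)]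
      by (intro measurable_restrict_space2) (auto simp: sets_mu1 cong: measurable_cong_sets)
    then show ?thesis by (simp cong: measurable_cong_sets add: sets_mu1)
  qed
  have N2: "emeasure N2 A = emeasure N1 (\<tau> -` A \<inter> {-1..1})" if "A \<in> sets mu1" for A
  proof -
    have "emeasure N2 A = emeasure (distr N1 mu1 \<tau>) A" using push by (simp add: N1_def N2_def)
    also have "\<dots> = emeasure N1 (\<tau> -` A \<inter> space N1)"
      using \<tau>m that by (intro emeasure_distr) (auto cong: measurable_cong_sets)
    finally show ?thesis by simp
  qed
  have pre: "\<tau> -` A \<inter> {-1..1} \<in> sets N1" if "A \<in> sets mu1" for A
    using measurable_sets[OF \<tau>m that] by simp
  have seg: "{-1..s} \<in> sets mu1" if "s \<in> {-1..1}" for s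
    using mem[of "{-1..s}"] that by (auto simp: Int_absorb2)
  have seg': "{-1..<s} \<in> sets mu1" if "s \<in> {-1..1}" for s
  proof -
    have "{-1..<s} \<inter> {-1..1} = {-1..<s}" using that by auto
    then show ?thesis using mem[of "{-1..<s}"] by simp
  qed
  have le1: "emeasure N1 {-1..t} \<le> emeasure N2 {-1..\<tau> t}"
    unfolding N2[OF seg[OF \<tau>t]]
  proof (rule emeasure_mono[OF _ pre[OF seg[OF \<tau>t]]])
    show "{-1..t} \<subseteq> \<tau> -` {-1..\<tau> t} \<inter> {-1..1}"
      using \<tau> t by (auto simp: mono_on_def Pi_iff)
  qed
  have le2: "emeasure N2 {-1..<\<tau> t} \<le> emeasure N1 {-1..t}"
    unfolding N2[OF seg'[OF \<tau>t]]
  proof (rule emeasure_mono)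
    show "\<tau> -` {-1..<\<tau> t} \<inter> {-1..1} \<subseteq> {-1..t}"
    proof
      fix s assume s: "s \<in> \<tau> -` {-1..<\<tau> t} \<inter> {-1..1}"
      have "\<not> t < s"
      proof
        assume "t < s"
        then have "\<tau> t \<le> \<tau> s" using \<tau>(2) s t by (auto simp: mono_on_def)
        then show False using s by auto
      qed
      then show "s \<in> {-1..t}" using s by auto
    qed
  qed (use seg[OF t] in auto)
  have "{\<tau> t} \<in> null_sets N2"
  proof -
    have "{\<tau> t} \<in> null_sets mu1"
    proof -
      have s: "{\<tau> t} \<in> sets mu1" using mem[of "{\<tau> t}"] \<tau>t by (simp add: Int_absorb2)
      have "emeasure (restrict_space lborel {-1..1}) {\<tau> t} = 0"
        using \<tau>t by (subst emeasure_restrict_space) auto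
      then have "emeasure mu1 {\<tau> t} = 0"
        using s unfolding mu1_def by (subst emeasure_uniform_measure) (auto simp: sets_restrict_space)
      then show ?thesis using s by auto
    qed
    moreover have "(\<lambda>s. ennreal (v s)) \<in> borel_measurable mu1" using borel_measurable_mu1I[OF v(1)] by measurable
    ultimately show ?thesis
    proof -
      assume n: "{\<tau> t} \<in> null_sets mu1" and m: "(\<lambda>s. ennreal (v s)) \<in> borel_measurable mu1"
      have "AE s in mu1. s \<in> {\<tau> t} \<longrightarrow> ennreal (v s) = 0"
        using AE_not_in[OF n] by eventually_elim auto
      then show ?thesis unfolding N2_def null_sets_density_iff[OF m] using n by auto
    qed
  qed
  then have "emeasure N2 ({-1..<\<tau> t} \<union> {\<tau> t}) = emeasure N2 {-1..<\<tau> t}"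
    using seg'[OF \<tau>t] by (intro emeasure_Un_null_set) auto
  moreover have "{-1..<\<tau> t} \<union> {\<tau> t} = {-1..\<tau> t}" using \<tau>t by auto
  ultimately have "emeasure N2 {-1..\<tau> t} = emeasure N1 {-1..t}" using le1 le2 by simp
  then have "ennreal (LINT s:{-1..\<tau> t}|mu1. v s) = ennreal (LINT s:{-1..t}|mu1. u s)"
    unfolding N1_def N2_def using emeasure_density_mu1[OF v \<tau>t] emeasure_density_mu1[OF u t] by simp
  moreover have "0 \<le> (LINT s:{-1..\<tau> t}|mu1. v s)" "0 \<le> (LINT s:{-1..t}|mu1. u s)"
    using u(2) v(2) by (auto simp: set_lebesgue_integral_def indicator_def intro!: integral_nonneg_AE AE_I2)
  ultimately show ?thesis by (simp add: ennreal_inj)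
qed

context holomorphic_marginals
begin

lemma cdf_minus_one: "cdf k (z(k := - 1)) = 0"
  by (simp add: cdf_def)

lemma cdf_one:
  assumes "z \<in> cube_nbhd b k \<delta>"
  shows "cdf k (z(k := 1)) = 1"
proof -
  have "- 1 + of_real ((s + 1) / 2) * (1 + 1) = complex_of_real s" for s by (simp add: field_simps)
  then show ?thesis using LINT_cond_quot[OF assms] by (simp add: cdf_def del: of_real_divide of_real_add)
qed

lemma cdf_real:
  assumes z: "z \<in> cube_nbhd b k \<delta>" and u: "\<And>s. s \<in> {-1..1} \<Longrightarrow> cond_quot k (z(k := of_real s)) = of_real (u s)"
    and t: "t \<in> {-1..1}"
  shows "cdf k (z(k := of_real t)) = of_real (LINT s:{-1..t}|mu1. u s)" "continuous_on {-1..1} u"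
    and "\<And>s. s \<in> {-1..1} \<Longrightarrow> u s \<in> {1 / B..B}"
proof -
  have cont: "continuous_on {-1..1} (\<lambda>s. cond_quot k (z(k := of_real s)))" by (rule section_measurable[OF cond_quot_hol z])
  then have contc: "continuous_on {-1..1} (\<lambda>s. complex_of_real (u s))"
    by (rule continuous_on_eq) (use u in auto)
  show "continuous_on {-1..1} u"
    using continuous_on_Re[OF contc] by simp
  show "u s \<in> {1 / B..B}" if s: "s \<in> {-1..1}" for s
    using cond_quot_bounds(1,2)[OF cube_nbhd_upd_real[OF z s]] B_ge_2 by (auto simp: u[OF s])
  have "(LINT s:{-1..t}|mu1. complex_of_real (u s)) = (1/2) *\<^sub>R (2 * cdf k (z(k := of_real t)) - 2 * cdf k (z(k := of_real (-1))))"
  proof (rule set_integral_mu1_FTC[OF _ contc t])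
    fix s :: real assume s: "s \<in> {-1..1}"
    have "((\<lambda>t. 2 * cdf k (z(k := t))) has_field_derivative 2 * (cond_quot k (z(k := of_real s)) / 2)) (at (of_real s))"
      using cdf_deriv[OF cube_nbhd_upd_real[OF z s]] by (intro DERIV_cmult)
    then have "((\<lambda>t. 2 * cdf k (z(k := t))) has_field_derivative of_real (u s)) (at (of_real s))"
      by (simp add: u[OF s])
    from has_vector_derivative_real_field[OF this]
    show "((\<lambda>t. 2 * cdf k (z(k := of_real t))) has_vector_derivative of_real (u s)) (at s within {-1..1})" .
  qed
  then have "(LINT s:{-1..t}|mu1. complex_of_real (u s)) = cdf k (z(k := of_real t))"
    using cdf_minus_one[of k z] by simp
  then show "cdf k (z(k := of_real t)) = of_real (LINT s:{-1..t}|mu1. u s)"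
    by (simp add: set_integral_complex_of_real)
qed

end

context triangular_transport
begin

text \<open>The derivative exists by \<open>ctransport_hol\<close>; differentiating the equation
  between the distribution functions then determines it.\<close>

lemma ctransport_deriv:
  assumes s: "z(k := s) \<in> nbhd (Suc k) \<delta>'"
  shows "((\<lambda>t. ctransport (Suc k) (z(k := t)) k) has_field_derivative ratio k (z(k := s))) (at s)"
proof -
  interpret W: weighted_coords b \<delta>' by unfold_locales (use \<delta>'_pos \<rho>.b_nonneg in auto)
  define N where "N = {t. z(k := t) \<in> nbhd (Suc k) \<delta>'}"
  have N: "open N" "s \<in> N" unfolding N_def using W.open_section s by auto
  define \<tau> where "\<tau> t = ctransport (Suc k) (z(k := t)) k" for t
  define w where "w = ctransport k z"
  have dep: "ctransport n (z(k := t)) = ctransport n z" if "n \<le> k" for n t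
    using that
  proof (induction n)
    case (Suc n)
    have c: "\<rho>.cdf n (z(k := t)) = \<rho>.cdf n z" using Suc by (intro \<rho>.cdf_dep) auto
    have IH: "ctransport n (z(k := t)) = ctransport n z" by (rule Suc.IH) (use Suc.prems in simp)
    show ?case unfolding ctransport.simps c IH ..
  qed simp
  have ctransport: "ctransport (Suc k) (z(k := t)) = w(k := \<tau> t)" for t
    using dep[of k t] by (auto simp: fun_eq_iff \<tau>_def w_def)
  have "\<tau> holomorphic_on N"
    unfolding \<tau>_def N_def by (intro curve_holomorphic_on_section[OF ctransport_hol] W.open_section) auto
  then obtain D where D: "(\<tau> has_field_derivative D) (at s)"
    using N holomorphic_on_imp_differentiable_at field_differentiable_def by blast
  have sd: "z(k := s) \<in> nbhd (Suc k) \<delta>" using s nbhd'_subset by blast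
  have wmem: "w(k := \<tau> s) \<in> nbhd (Suc k) \<delta>" using ctransport_mem[OF s] by (simp add: ctransport del: ctransport.simps)
  have "((\<lambda>t. \<pi>.cdf k (w(k := \<tau> t))) has_field_derivative \<pi>.cond_quot k (w(k := \<tau> s)) / 2 * D) (at s)"
    by (rule DERIV_chain2[OF \<pi>.cdf_deriv[OF wmem] D])
  moreover have "((\<lambda>t. \<pi>.cdf k (w(k := \<tau> t))) has_field_derivative \<rho>.cond_quot k (z(k := s)) / 2) (at s)"
  proof (rule has_field_derivative_transform_within_open[OF \<rho>.cdf_deriv[OF sd] N])
    fix t assume "t \<in> N"
    then obtain x where "\<And>j. x j \<in> {-1..1}" "wdist (Suc k) (z(k := t)) x < \<delta>'" unfolding N_def mem_nbhd'_iff by blast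
    from ctransport_props(2)[OF this] show "\<rho>.cdf k (z(k := t)) = \<pi>.cdf k (w(k := \<tau> t))" by (simp add: ctransport del: ctransport.simps)
  qed
  ultimately have "\<pi>.cond_quot k (w(k := \<tau> s)) / 2 * D = \<rho>.cond_quot k (z(k := s)) / 2" by (rule DERIV_unique)
  moreover have "\<pi>.cond_quot k (w(k := \<tau> s)) \<noteq> 0" using \<pi>.norm_cond_quot_ge[OF wmem] B by auto
  ultimately have "D = ratio k (z(k := s))" by (simp add: ratio_def ctransport field_simps del: ctransport.simps)
  then show ?thesis using D by (simp add: \<tau>_def[abs_def] del: ctransport.simps)
qed

end

section \<open>From push-forwards to equal distribution functions\<close>

lemma marginal_density_cong: "(\<And>j. j < k \<Longrightarrow> x j = y j) \<Longrightarrow> marginal_density f k x = marginal_density f k y"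
proof -
  assume "\<And>j. j < k \<Longrightarrow> x j = y j"
  then have "comb_seq k x = comb_seq k y" by (auto simp: comb_seq_def fun_eq_iff)
  then show ?thesis by (simp add: marginal_density_def)
qed

locale analytic_density = parametric_density p M L \<psi> S F f b
  for p M L :: real and \<psi> :: "nat \<Rightarrow> 'a::banach" and S F f b +
  fixes \<delta> Lip :: real
  assumes marginals: "holomorphic_marginals b \<delta> M L Lip cmarginal"
begin

sublocale hm: holomorphic_marginals b \<delta> M L Lip cmarginal by (rule marginals)

definition cond_density :: "nat \<Rightarrow> (nat \<Rightarrow> real) \<Rightarrow> real \<Rightarrow> real" where
  "cond_density k x s = marginal_density f (Suc k) (x(k := s)) / marginal_density f k x"

lemma cond_quot_cond_density:
  assumes x: "\<And>j. x j \<in> {-1..1}" and s: "s \<in> {-1..1}"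
  shows "hm.cond_quot k ((\<lambda>j. of_real (x j))(k := of_real s)) = of_real (cond_density k x s)"
proof -
  have upd: "(\<lambda>j. complex_of_real (x j))(k := of_real s) = (\<lambda>j. of_real ((x(k := s)) j))" by auto
  have xs: "(x(k := s)) j \<in> {-1..1}" for j using x s by auto
  have md: "marginal_density f k (x(k := s)) = marginal_density f k x" by (rule marginal_density_cong) auto
  show ?thesis
    unfolding hm.cond_quot_def upd cmarginal_real(1)[OF xs] md cond_density_def of_real_divide ..
qed

lemma real_mem: "(\<And>j. x j \<in> {-1..1}) \<Longrightarrow> (\<lambda>j. of_real (x j)) \<in> cube_nbhd b k \<delta>"
  by (rule of_real_mem_cube_nbhd[OF _ hm.\<delta>_pos])

lemma conditional_measure_eq:
  "(\<And>j. j < k \<Longrightarrow> x j = y j) \<Longrightarrow> conditional_measure f k y = density mu1 (\<lambda>s. ennreal (cond_density k x s))"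
proof -
  assume eq: "\<And>j. j < k \<Longrightarrow> x j = y j"
  have "marginal_density f k y = marginal_density f k x" using eq by (intro marginal_density_cong) auto
  moreover have "marginal_density f (Suc k) (y(k := s)) = marginal_density f (Suc k) (x(k := s))" for s
    using eq by (intro marginal_density_cong) auto
  ultimately show ?thesis by (simp add: conditional_measure_def cond_density_def)
qed

end

lemma mem_cube_restrict: "(\<And>j. x j \<in> {-1..1}) \<Longrightarrow> restrict x {..<k} \<in> cube k"
  by (auto simp: cube_def)

lemma restrict_Suc: "restrict x {..k::nat} = (restrict x {..<k})(k := x k)"
  by (auto simp: fun_eq_iff)

text \<open>Reads the push-forward condition in each coordinate as an equation between the extended
  distribution functions at real points, the form in which the transport enters
  \<open>triangular_transport\<close>.\<close>

lemma knothe_rosenblatt_cdf: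
  assumes A: "analytic_density p M L \<psi> S F f b \<delta> Lip" and A': "analytic_density p M L \<psi>' S' F' g b \<delta> Lip"
    and T: "knothe_rosenblatt f g T" and x: "\<And>j. x j \<in> {-1..1}"
  defines "X \<equiv> \<lambda>j. T j (restrict x {..j})"
  shows "X k \<in> {-1..1}"
    and "holomorphic_marginals.cdf (parametric_density.cmarginal \<psi>' F') k (\<lambda>j. of_real (X j)) =
      holomorphic_marginals.cdf (parametric_density.cmarginal \<psi> F) k (\<lambda>j. of_real (x j))"
proof -
  interpret \<rho>: analytic_density p M L \<psi> S F f b \<delta> Lip by (rule A)
  interpret \<pi>: analytic_density p M L \<psi>' S' F' g b \<delta> Lip by (rule A')
  define y where "y k = restrict x {..<k}" for k
  have y: "y k \<in> cube k" for k unfolding y_def by (rule mem_cube_restrict[OF x])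
  have X_eq: "X k = T k ((y k)(k := x k))" for k unfolding X_def y_def restrict_Suc ..
  have T': "(\<lambda>t. T k ((y k)(k := t))) \<in> {-1..1} \<rightarrow> {-1..1}" "mono_on {-1..1} (\<lambda>t. T k ((y k)(k := t)))"
    "distr (conditional_measure f k (y k)) mu1 (\<lambda>t. T k ((y k)(k := t))) = conditional_measure g k (initial_map T k (y k))" for k
    using T y unfolding knothe_rosenblatt_def by blast+
  show XI: "X k \<in> {-1..1}" for k using T'(1)[of k] x[of k] by (auto simp: X_eq Pi_iff)
  have init: "initial_map T k (y k) j = X j" if "j < k" for j
  proof -
    have "restrict (y k) {..j} = restrict x {..j}" using that by (auto simp: y_def fun_eq_iff)
    then show ?thesis using that by (simp add: initial_map_def X_def)
  qed
  have push: "distr (density mu1 (\<lambda>s. ennreal (\<rho>.cond_density k x s))) mu1 (\<lambda>t. T k ((y k)(k := t)))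
      = density mu1 (\<lambda>s. ennreal (\<pi>.cond_density k X s))"
    using T'(3)[of k] \<rho>.conditional_measure_eq[of k x "y k"] \<pi>.conditional_measure_eq[of k X "initial_map T k (y k)"] init
    by (simp add: y_def)
  note \<rho>r = \<rho>.hm.cdf_real[where z="\<lambda>j. of_real (x j)" and k=k and u="\<rho>.cond_density k x",
      OF \<rho>.real_mem[where x=x, OF x] \<rho>.cond_quot_cond_density[where x=x, OF x]]
  note \<pi>r = \<pi>.hm.cdf_real[where z="\<lambda>j. of_real (X j)" and k=k and u="\<pi>.cond_density k X",
      OF \<pi>.real_mem[where x=X, OF XI] \<pi>.cond_quot_cond_density[where x=X, OF XI]]
  have posB: "1 / \<rho>.hm.B > 0" using \<rho>.hm.B_ge_2 by simp
  have c: "continuous_on {-1..1} (\<rho>.cond_density k x)" "continuous_on {-1..1} (\<pi>.cond_density k X)"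
    using \<rho>r(2)[of 0] \<pi>r(2)[of 0] by simp_all
  have n1: "0 \<le> \<rho>.cond_density k x s" if "s \<in> {-1..1}" for s
  proof -
    have "1 / \<rho>.hm.B \<le> \<rho>.cond_density k x s" using \<rho>r(3)[of 0 s] that by auto
    then show ?thesis using posB by linarith
  qed
  have n2: "0 \<le> \<pi>.cond_density k X s" if "s \<in> {-1..1}" for s
  proof -
    have "1 / \<rho>.hm.B \<le> \<pi>.cond_density k X s" using \<pi>r(3)[of 0 s] that by auto
    then show ?thesis using posB by linarith
  qed
  have "(LINT s:{-1..X k}|mu1. \<pi>.cond_density k X s) = (LINT s:{-1..x k}|mu1. \<rho>.cond_density k x s)"
    unfolding X_eq[of k] using monotone_transport_cdf[OF c(1) n1 c(2) n2 T'(1)[of k] T'(2)[of k] push x[of k]] .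
  moreover have "(\<lambda>j. complex_of_real (x j)) = (\<lambda>j. complex_of_real (x j))(k := of_real (x k))"
    "(\<lambda>j. complex_of_real (X j)) = (\<lambda>j. complex_of_real (X j))(k := of_real (X k))" by auto
  ultimately show "\<pi>.hm.cdf k (\<lambda>j. of_real (X j)) = \<rho>.hm.cdf k (\<lambda>j. of_real (x j))"
    using \<rho>r(1)[OF _ x[of k]] \<pi>r(1)[OF _ XI[of k]] by metis
qed

section \<open>Transports built from roots of densities\<close>

text \<open>In each coordinate the map is a continuous increasing bijection of the interval with
  fixed end points, so preimages are found one coordinate after the other.\<close>

lemma bij_betw_triangular:
  fixes A :: "nat \<Rightarrow> (nat \<Rightarrow> real) \<Rightarrow> real"
  assumes mono: "\<And>k y. y \<in> cube k \<Longrightarrow> strict_mono_on {-1..1} (\<lambda>t. A k (y(k := t)))"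
    and cont: "\<And>k y. y \<in> cube k \<Longrightarrow> continuous_on {-1..1} (\<lambda>t. A k (y(k := t)))"
    and ends: "\<And>k y. y \<in> cube k \<Longrightarrow> A k (y(k := - 1)) = - 1" "\<And>k y. y \<in> cube k \<Longrightarrow> A k (y(k := 1)) = 1"
  shows "bij_betw (full_map A) cube_inf cube_inf" "triangular (full_map A)" "coordinate_monotone (full_map A)"
proof -
  define pre where "pre x k = restrict x {..<k::nat}" for x :: "nat \<Rightarrow> real" and k
  have full: "full_map A x k = A k ((pre x k)(k := x k))" for x k
    by (simp add: full_map_def restrict_Suc pre_def)
  have pre: "pre x k \<in> cube k" if "x \<in> cube_inf" for x k
    unfolding pre_def using that by (intro mem_cube_restrict) (auto simp: mem_cube_inf)
  have pre_upd: "pre (x(k := t)) k = pre x k" for x k t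
    by (auto simp: pre_def fun_eq_iff)
  have range: "A k (y(k := t)) \<in> {-1..1}" if y: "y \<in> cube k" and t: "t \<in> {-1..1}" for y k t
    using strict_mono_onD[OF mono[OF y], of "-1" t] strict_mono_onD[OF mono[OF y], of t 1] ends[OF y] t
    by (cases "t = -1"; cases "t = 1") auto
  have inj: "t = t'" if y: "y \<in> cube k" and "t \<in> {-1..1}" "t' \<in> {-1..1}" "A k (y(k := t)) = A k (y(k := t'))" for y k t t'
    using strict_mono_on_imp_inj_on[OF mono[OF y]] that by (auto dest: inj_onD)
  show "triangular (full_map A)"
    unfolding triangular_def
  proof (intro allI ballI impI)
    fix k and x y :: "nat \<Rightarrow> real" assume "\<forall>j\<le>k. x j = y j"
    then have "restrict x {..k} = restrict y {..k}" by auto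
    then show "full_map A x k = full_map A y k" by (simp add: full_map_def)
  qed
  show "coordinate_monotone (full_map A)"
    unfolding coordinate_monotone_def
  proof (intro allI ballI)
    fix k x assume "x \<in> cube_inf"
    then show "mono_on {-1..1} (\<lambda>t. full_map A (x(k := t)) k)"
      using strict_mono_on_imp_mono_on[OF mono[OF pre]] by (simp add: full pre_upd)
  qed
  show "bij_betw (full_map A) cube_inf cube_inf"
    unfolding bij_betw_def
  proof
    show "inj_on (full_map A) cube_inf"
    proof (rule inj_onI)
      fix x y assume x: "x \<in> cube_inf" and y: "y \<in> cube_inf" and eq: "full_map A x = full_map A y"
      have "x k = y k" for k
      proof (induction k rule: less_induct)
        case (less k)
        then have "pre x k = pre y k" by (auto simp: pre_def fun_eq_iff)
        then have "A k ((pre x k)(k := x k)) = A k ((pre x k)(k := y k))" using fun_cong[OF eq, of k] by (simp add: full)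
        from inj[OF pre[OF x] _ _ this] show ?case using x y by (auto simp: mem_cube_inf)
      qed
      then show "x = y" by auto
    qed
    show "full_map A ` cube_inf = cube_inf"
    proof (intro equalityI subsetI)
      fix w assume "w \<in> full_map A ` cube_inf"
      then obtain x where x: "x \<in> cube_inf" "w = full_map A x" by blast
      have "full_map A x k \<in> {-1..1}" for k
        unfolding full using x by (intro range pre) (auto simp: mem_cube_inf)
      then show "w \<in> cube_inf" by (simp add: x mem_cube_inf)
    next
      fix w assume w: "w \<in> cube_inf"
      \<comment> \<open>\<open>Y k\<close> is the preimage in the first \<open>k\<close>
        coordinates; \<open>undefined\<close> elsewhere makes it a point of
        \<open>cube k\<close>.\<close>
      define Y where "Y = rec_nat (\<lambda>_. undefined) (\<lambda>k y. y(k := (SOME t. t \<in> {-1..1} \<and> A k (y(k := t)) = w k)))"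
      have Y0: "Y 0 = (\<lambda>_. undefined)" and YS: "Y (Suc k) = (Y k)(k := (SOME t. t \<in> {-1..1} \<and> A k ((Y k)(k := t)) = w k))" for k
        by (simp_all add: Y_def)
      have step: "Y (Suc k) k \<in> {-1..1} \<and> A k (Y (Suc k)) = w k" if Yk: "Y k \<in> cube k" for k
      proof -
        have "w k \<in> {-1..1}" using w by (simp add: mem_cube_inf)
        then have "\<exists>t. -1 \<le> t \<and> t \<le> 1 \<and> A k ((Y k)(k := t)) = w k"
          using ends[OF Yk] cont[OF Yk] by (intro IVT') auto
        then have "\<exists>t. t \<in> {-1..1} \<and> A k ((Y k)(k := t)) = w k" by auto
        from someI_ex[OF this] show ?thesis by (simp add: YS)
      qed
      have Yc: "Y k \<in> cube k" for k
      proof (induction k)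
        case (Suc k)
        then show ?case using step[OF Suc] unfolding YS cube_def PiE_iff extensional_def
          by (auto simp: less_Suc_eq)
      qed (simp add: Y0 cube_def)
      define y where "y j = Y (Suc j) j" for j
      have Yy: "Y k = restrict y {..<k}" for k
      proof (induction k)
        case (Suc k)
        have "Y (Suc k) = (Y k)(k := y k)" by (simp add: y_def YS)
        then show ?case using Suc by (auto simp: fun_eq_iff)
      qed (simp add: Y0 restrict_def)
      have "y \<in> cube_inf" using step[OF Yc] by (simp add: mem_cube_inf y_def)
      moreover have "full_map A y k = w k" for k
        using step[OF Yc, of k] Yy[of "Suc k"] by (simp add: full_map_def lessThan_Suc_atMost)
      then have "full_map A y = w" by auto
      ultimately show "w \<in> full_map A ` cube_inf" by blast
    qed
  qed
qed

definition sqmass :: "(nat \<Rightarrow> (nat \<Rightarrow> real) \<Rightarrow> real) \<Rightarrow> nat \<Rightarrow> (nat \<Rightarrow> real) \<Rightarrow> real" where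
  "sqmass Q k y = (LINT s:{-1..1}|mu1. (Q k (y(k := s)) + 1)\<^sup>2)"

context
  fixes Q :: "nat \<Rightarrow> (nat \<Rightarrow> real) \<Rightarrow> real" and k :: nat and y :: "nat \<Rightarrow> real"
  assumes cont: "continuous_on {-1..1} (\<lambda>t. Q k (y(k := t)))"
    and pos: "\<And>t. t \<in> {-1..1} \<Longrightarrow> 0 < Q k (y(k := t)) + 1"
begin

lemma approx_component_upd:
  "approx_component Q k (y(k := t)) = - 1 + 2 * ((LINT s:{-1..t}|mu1. (Q k (y(k := s)) + 1)\<^sup>2) / sqmass Q k y)"
  by (simp add: approx_component_def sqmass_def)

lemma sqcont: "continuous_on {-1..1} (\<lambda>s. (Q k (y(k := s)) + 1)\<^sup>2)"
  by (intro continuous_intros cont)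

lemma sqmass_deriv:
  assumes "t \<in> {-1..1}"
  shows "((\<lambda>t. LINT s:{-1..t}|mu1. (Q k (y(k := s)) + 1)\<^sup>2) has_real_derivative (Q k (y(k := t)) + 1)\<^sup>2 / 2) (at t within {-1..1})"
  by (rule set_integral_mu1_deriv[OF sqcont assms])

lemma sqmass_strict_mono: "strict_mono_on {-1..1} (\<lambda>t. LINT s:{-1..t}|mu1. (Q k (y(k := s)) + 1)\<^sup>2)"
proof (rule strict_mono_onI)
  fix r t :: real assume rt: "r \<in> {-1..1}" "t \<in> {-1..1}" "r < t"
  show "(LINT s:{-1..r}|mu1. (Q k (y(k := s)) + 1)\<^sup>2) < (LINT s:{-1..t}|mu1. (Q k (y(k := s)) + 1)\<^sup>2)"
  proof (rule DERIV_pos_imp_increasing_open[OF rt(3), where f="\<lambda>t. LINT s:{-1..t}|mu1. (Q k (y(k := s)) + 1)\<^sup>2"])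
    fix x assume x: "r < x" "x < t"
    then have "x \<in> {-1<..<1}" "x \<in> {-1..1}" using rt by auto
    then have "at x within {-1..1} = at x" by (intro at_within_interior) auto
    then have "((\<lambda>t. LINT s:{-1..t}|mu1. (Q k (y(k := s)) + 1)\<^sup>2) has_real_derivative (Q k (y(k := x)) + 1)\<^sup>2 / 2) (at x)"
      using sqmass_deriv[OF \<open>x \<in> {-1..1}\<close>] by simp
    moreover have "(Q k (y(k := x)) + 1)\<^sup>2 / 2 > 0" using pos[OF \<open>x \<in> {-1..1}\<close>] by simp
    ultimately show "\<exists>d. ((\<lambda>t. LINT s:{-1..t}|mu1. (Q k (y(k := s)) + 1)\<^sup>2) has_real_derivative d) (at x) \<and> 0 < d" by blast
  next
    have "continuous_on {-1..1} (\<lambda>t. LINT s:{-1..t}|mu1. (Q k (y(k := s)) + 1)\<^sup>2)"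
      using sqmass_deriv by (rule DERIV_continuous_on)
    then show "continuous_on {r..t} (\<lambda>t. LINT s:{-1..t}|mu1. (Q k (y(k := s)) + 1)\<^sup>2)"
      by (rule continuous_on_subset) (use rt in auto)
  qed
qed

lemma sqmass_zero: "(LINT s:{-1..-1}|mu1. (Q k (y(k := s)) + 1)\<^sup>2) = 0"
proof -
  have "((\<lambda>t. integral {-1..t} (\<lambda>s. (Q k (y(k := s)) + 1)\<^sup>2)) has_vector_derivative (Q k (y(k := s)) + 1)\<^sup>2) (at s within {-1..1})"
    if "s \<in> {-1..1}" for s by (rule integral_has_vector_derivative[OF sqcont that])
  from set_integral_mu1_FTC[OF this sqcont, of "-1"] show ?thesis by simp
qed

lemma sqmass_pos: "sqmass Q k y > 0"
  using strict_mono_onD[OF sqmass_strict_mono, of "-1" 1] sqmass_zero by (simp add: sqmass_def)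

lemma approx_component_deriv:
  assumes "t \<in> {-1..1}"
  shows "((\<lambda>t. approx_component Q k (y(k := t))) has_real_derivative (Q k (y(k := t)) + 1)\<^sup>2 / sqmass Q k y) (at t within {-1..1})"
proof -
  have "((\<lambda>t. - 1 + 2 * ((LINT s:{-1..t}|mu1. (Q k (y(k := s)) + 1)\<^sup>2) / sqmass Q k y)) has_real_derivative
      2 * ((Q k (y(k := t)) + 1)\<^sup>2 / 2 / sqmass Q k y)) (at t within {-1..1})"
    using DERIV_add[OF DERIV_const DERIV_cmult[OF DERIV_cdivide[OF sqmass_deriv[OF assms]]], of "-1" 2 "sqmass Q k y"] by simp
  then show ?thesis by (simp add: approx_component_upd)
qed

lemma approx_component_ends:
  "approx_component Q k (y(k := - 1)) = - 1" "approx_component Q k (y(k := 1)) = 1"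
  unfolding approx_component_upd sqmass_zero sqmass_def[symmetric] using sqmass_pos by simp_all

lemma approx_component_strict_mono: "strict_mono_on {-1..1} (\<lambda>t. approx_component Q k (y(k := t)))"
  unfolding approx_component_upd
  using strict_mono_onD[OF sqmass_strict_mono] sqmass_pos by (intro strict_mono_onI) (simp add: divide_strict_right_mono)

lemma approx_component_continuous: "continuous_on {-1..1} (\<lambda>t. approx_component Q k (y(k := t)))"
  using approx_component_deriv by (rule DERIV_continuous_on)

lemma sqmass_eq: "sqmass Q k y = (LINT s|mu1. (Q k (y(k := s)) + 1)\<^sup>2)"
  unfolding sqmass_def set_lebesgue_integral_def by (intro Bochner_Integration.integral_cong) auto

lemma integrable_sq: "integrable mu1 (\<lambda>s. (Q k (y(k := s)) + 1)\<^sup>2)"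
proof -
  obtain B where "\<And>s. s \<in> {-1..1} \<Longrightarrow> norm ((Q k (y(k := s)) + 1)\<^sup>2) \<le> B" using continuous_bounded_Icc[OF sqcont] by blast
  then show ?thesis by (intro integrable_mu1I borel_measurable_mu1I sqcont)
qed

text \<open>Fixed end points force the derivative to have Lebesgue integral 2, hence mass 1 for
  \<open>mu1\<close>; normalisation then changes nothing and integration recovers the
  transport.\<close>

lemma approx_component_exact:
  assumes \<tau>: "\<And>t. t \<in> {-1..1} \<Longrightarrow> (\<tau> has_real_derivative (Q k (y(k := t)) + 1)\<^sup>2) (at t within {-1..1})"
    and ends: "\<tau> (- 1) = - 1" "\<tau> 1 = 1" and t: "t \<in> {-1..1}"
  shows "approx_component Q k (y(k := t)) = \<tau> t" "sqmass Q k y = 1"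
proof -
  have eq: "(LINT s:{-1..t}|mu1. (Q k (y(k := s)) + 1)\<^sup>2) = (\<tau> t + 1) / 2" if "t \<in> {-1..1}" for t
    using set_integral_mu1_FTC[OF _ sqcont that, of \<tau>] \<tau> ends
    by (simp add: has_real_derivative_iff_has_vector_derivative)
  show "sqmass Q k y = 1" unfolding sqmass_def using eq[of 1] ends by simp
  then show "approx_component Q k (y(k := t)) = \<tau> t" using eq[OF t] by (simp add: approx_component_upd)
qed

end

text \<open>For roots up to \<open>B\<close> and \<open>B + 1\<close> at distance \<open>e\<close>,
  the squares differ by at most \<open>3 * B * e\<close>. The same bound for the masses is
  multiplied by \<open>4 * (B + 1)\<^sup>2 * B\<^sup>2\<close>, which bounds the normalised
  square.\<close>

definition transport_const :: "real \<Rightarrow> real" where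
  "transport_const B = 3 * B * (1 + 4 * (B + 1)\<^sup>2 * B\<^sup>2)"

text \<open>A perturbed root changes the square and its normalising mass. The second bound
  integrates the first from the common end point -1; its factor 2 is the length of the
  interval.\<close>

lemma approx_component_error:
  fixes R P :: "nat \<Rightarrow> (nat \<Rightarrow> real) \<Rightarrow> real"
  assumes B: "B \<ge> 2"
    and R: "continuous_on {-1..1} (\<lambda>t. R k (y(k := t)))" "\<And>t. t \<in> {-1..1} \<Longrightarrow> 1 / B \<le> R k (y(k := t)) + 1"
       "\<And>t. t \<in> {-1..1} \<Longrightarrow> R k (y(k := t)) + 1 \<le> B" "sqmass R k y = 1"
    and P: "continuous_on {-1..1} (\<lambda>t. P k (y(k := t)))" "\<And>t. t \<in> {-1..1} \<Longrightarrow> 1 / (2 * B) \<le> P k (y(k := t)) + 1"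
       "\<And>t. t \<in> {-1..1} \<Longrightarrow> P k (y(k := t)) + 1 \<le> B + 1"
    and e: "\<And>t. t \<in> {-1..1} \<Longrightarrow> \<bar>P k (y(k := t)) - R k (y(k := t))\<bar> \<le> e"
    and t: "t \<in> {-1..1}"
  shows "\<bar>(R k (y(k := t)) + 1)\<^sup>2 - (P k (y(k := t)) + 1)\<^sup>2 / sqmass P k y\<bar> \<le> transport_const B * e"
    and "\<bar>approx_component R k (y(k := t)) - approx_component P k (y(k := t))\<bar> \<le> 2 * (transport_const B * e)"
proof -
  have posR: "0 < R k (y(k := t)) + 1" and posP: "0 < P k (y(k := t)) + 1" if "t \<in> {-1..1}" for t
  proof -
    have "0 < 1 / B" "0 < 1 / (2 * B)" using B by auto
    then show "0 < R k (y(k := t)) + 1" "0 < P k (y(k := t)) + 1" using R(2)[OF that] P(2)[OF that] by linarith+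
  qed
  define r p where "r t = R k (y(k := t)) + 1" and "p t = P k (y(k := t)) + 1" for t
  define I where "I = sqmass P k y"
  have I0: "I > 0" unfolding I_def by (rule sqmass_pos[where Q=P and k=k and y=y, OF P(1) posP])
  have e0: "e \<ge> 0" using e[of 0] by (auto intro: order_trans[OF abs_ge_zero])
  have d: "\<bar>(r s)\<^sup>2 - (p s)\<^sup>2\<bar> \<le> 3 * B * e" if s: "s \<in> {-1..1}" for s
  proof -
    have "(r s)\<^sup>2 - (p s)\<^sup>2 = (r s - p s) * (r s + p s)" by (simp add: power2_eq_square algebra_simps)
    then have "\<bar>(r s)\<^sup>2 - (p s)\<^sup>2\<bar> = \<bar>r s - p s\<bar> * \<bar>r s + p s\<bar>" by (simp add: abs_mult)
    also have "\<dots> \<le> e * (3 * B)"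
      using e[OF s] R(3)[OF s] P(3)[OF s] posR[OF s] posP[OF s] B by (intro mult_mono) (auto simp: r_def p_def)
    finally show ?thesis by (simp only: mult_ac)
  qed
  have I1: "\<bar>I - 1\<bar> \<le> 3 * B * e"
  proof -
    have "I - 1 = (LINT s|mu1. (p s)\<^sup>2 - (r s)\<^sup>2)"
      using integrable_sq[where Q=P and k=k and y=y, OF P(1) posP] integrable_sq[where Q=R and k=k and y=y, OF R(1) posR] R(4) sqmass_eq[where Q=P and k=k and y=y, OF P(1) posP] sqmass_eq[where Q=R and k=k and y=y, OF R(1) posR]
      by (simp add: I_def r_def p_def)
    moreover have "norm (LINT s|mu1. (p s)\<^sup>2 - (r s)\<^sup>2) \<le> 3 * B * e"
      using d e0 B by (intro norm_LINT_le_const prob_space_mu1) (auto simp: abs_minus_commute)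
    ultimately show ?thesis by simp
  qed
  have I_ge: "1 / (4 * B\<^sup>2) \<le> I"
  proof -
    have "(LINT s|mu1. 1 / (4 * B\<^sup>2)) \<le> (LINT s|mu1. (P k (y(k := s)) + 1)\<^sup>2)"
    proof (rule integral_mono[OF _ integrable_sq[where Q=P and k=k and y=y, OF P(1) posP]])
      fix s assume "s \<in> space mu1"
      then have "(1 / (2 * B))\<^sup>2 \<le> (P k (y(k := s)) + 1)\<^sup>2" using P(2)[of s] B by (intro power_mono) auto
      then show "1 / (4 * B\<^sup>2) \<le> (P k (y(k := s)) + 1)\<^sup>2" by (simp add: power_divide power_mult_distrib)
    qed auto
    also have "(LINT s|mu1. (P k (y(k := s)) + 1)\<^sup>2) = I"
      unfolding I_def by (rule sqmass_eq[where Q=P and k=k and y=y, OF P(1) posP, symmetric])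
    finally show ?thesis by (simp add: mu1.prob_space[simplified])
  qed
  have pI: "(p s)\<^sup>2 / I \<le> 4 * (B + 1)\<^sup>2 * B\<^sup>2" if s: "s \<in> {-1..1}" for s
  proof -
    have "(p s)\<^sup>2 / I \<le> (B + 1)\<^sup>2 / (1 / (4 * B\<^sup>2))"
      using P(3)[OF s] posP[OF s] I_ge B by (intro frac_le power_mono) (auto simp: p_def)
    then show ?thesis by simp
  qed
  have main: "\<bar>(r s)\<^sup>2 - (p s)\<^sup>2 / I\<bar> \<le> transport_const B * e" if s: "s \<in> {-1..1}" for s
  proof -
    have eq: "(r s)\<^sup>2 - (p s)\<^sup>2 / I = ((r s)\<^sup>2 - (p s)\<^sup>2) + (p s)\<^sup>2 / I * (I - 1)"
      using I0 by (simp add: field_simps)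
    have "\<bar>(p s)\<^sup>2 / I * (I - 1)\<bar> = (p s)\<^sup>2 / I * \<bar>I - 1\<bar>"
      using I0 by (simp add: abs_mult)
    then have "\<bar>(r s)\<^sup>2 - (p s)\<^sup>2 / I\<bar> \<le> \<bar>(r s)\<^sup>2 - (p s)\<^sup>2\<bar> + (p s)\<^sup>2 / I * \<bar>I - 1\<bar>"
      unfolding eq using abs_triangle_ineq[of "(r s)\<^sup>2 - (p s)\<^sup>2" "(p s)\<^sup>2 / I * (I - 1)"] by (simp only:)
    also have "\<dots> \<le> 3 * B * e + (4 * (B + 1)\<^sup>2 * B\<^sup>2) * (3 * B * e)"
      using d[OF s] I1 pI[OF s] I0 by (intro add_mono mult_mono) auto
    finally show ?thesis by (simp add: transport_const_def algebra_simps)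
  qed
  show "\<bar>(R k (y(k := t)) + 1)\<^sup>2 - (P k (y(k := t)) + 1)\<^sup>2 / sqmass P k y\<bar> \<le> transport_const B * e"
    using main[OF t] by (simp add: r_def p_def I_def)
  define D where "D t = approx_component R k (y(k := t)) - approx_component P k (y(k := t))" for t
  have "norm (D t - D (-1)) \<le> (transport_const B * e) * norm (t - (-1))"
  proof (rule field_differentiable_bound[where S="{-1..1}"])
    fix s :: real assume s: "s \<in> {-1..1}"
    show "(D has_field_derivative ((r s)\<^sup>2 - (p s)\<^sup>2 / I)) (at s within {-1..1})"
      unfolding D_def using approx_component_deriv[where Q=R and k=k and y=y, OF R(1) posR s] approx_component_deriv[where Q=P and k=k and y=y, OF P(1) posP s]
      by (auto intro!: derivative_eq_intros simp: R(4) r_def p_def I_def)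
    show "norm ((r s)\<^sup>2 - (p s)\<^sup>2 / I) \<le> transport_const B * e" using main[OF s] by simp
  qed (use t in auto)
  also have "\<dots> \<le> (transport_const B * e) * 2"
    using t e0 B by (intro mult_left_mono) (auto simp: transport_const_def)
  finally show "\<bar>approx_component R k (y(k := t)) - approx_component P k (y(k := t))\<bar> \<le> 2 * (transport_const B * e)"
    using approx_component_ends(1)[where Q=R and k=k and y=y, OF R(1) posR] approx_component_ends(1)[where Q=P and k=k and y=y, OF P(1) posP] by (simp add: D_def)
qed

section \<open>Spans of monomials\<close>

lemma zero_mem_poly_span: "(\<lambda>y. 0) \<in> poly_span k \<Lambda>"
  unfolding poly_span_def by (intro CollectI exI[of _ "{}"] exI[of _ "\<lambda>_. 0"]) auto

lemma poly_span_add: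
  assumes "f \<in> poly_span k \<Lambda>" "g \<in> poly_span k \<Lambda>"
  shows "(\<lambda>y. f y + g y) \<in> poly_span k \<Lambda>"
proof -
  obtain A c where f: "f = (\<lambda>y. \<Sum>\<nu>\<in>A. c \<nu> * (\<Prod>j<k. y j ^ \<nu> j))" "finite A" "A \<subseteq> \<Lambda>"
    using assms(1) unfolding poly_span_def by blast
  obtain A' c' where g: "g = (\<lambda>y. \<Sum>\<nu>\<in>A'. c' \<nu> * (\<Prod>j<k. y j ^ \<nu> j))" "finite A'" "A' \<subseteq> \<Lambda>"
    using assms(2) unfolding poly_span_def by blast
  define d where "d \<nu> = (if \<nu> \<in> A then c \<nu> else 0) + (if \<nu> \<in> A' then c' \<nu> else 0)" for \<nu>
  have "f y + g y = (\<Sum>\<nu>\<in>A \<union> A'. d \<nu> * (\<Prod>j<k. y j ^ \<nu> j))" for y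
  proof -
    have "f y = (\<Sum>\<nu>\<in>A \<union> A'. (if \<nu> \<in> A then c \<nu> else 0) * (\<Prod>j<k. y j ^ \<nu> j))"
      unfolding f(1) using f g by (intro sum.mono_neutral_cong_left) auto
    moreover have "g y = (\<Sum>\<nu>\<in>A \<union> A'. (if \<nu> \<in> A' then c' \<nu> else 0) * (\<Prod>j<k. y j ^ \<nu> j))"
      unfolding g(1) using f g by (intro sum.mono_neutral_cong_left) auto
    ultimately show ?thesis by (simp add: d_def distrib_right sum.distrib)
  qed
  then show ?thesis unfolding poly_span_def using f g by (intro CollectI exI[of _ "A \<union> A'"] exI[of _ d]) auto
qed

lemma poly_span_scale:
  assumes "f \<in> poly_span k \<Lambda>"
  shows "(\<lambda>y. a * f y) \<in> poly_span k \<Lambda>"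
proof -
  obtain A c where f: "f = (\<lambda>y. \<Sum>\<nu>\<in>A. c \<nu> * (\<Prod>j<k. y j ^ \<nu> j))" "finite A" "A \<subseteq> \<Lambda>"
    using assms(1) unfolding poly_span_def by blast
  then show ?thesis
    unfolding poly_span_def by (intro CollectI exI[of _ A] exI[of _ "\<lambda>\<nu>. a * c \<nu>"]) (auto simp: sum_distrib_left mult.assoc)
qed

lemma poly_span_sum:
  assumes "finite A" "\<And>i. i \<in> A \<Longrightarrow> f i \<in> poly_span k \<Lambda>"
  shows "(\<lambda>y. \<Sum>i\<in>A. c i * f i y) \<in> poly_span k \<Lambda>"
  using assms by (induction A rule: finite_induct) (auto intro!: zero_mem_poly_span poly_span_add poly_span_scale)

text \<open>Each Chebyshev factor expands into powers up to its degree, so the product only involves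
  monomials with exponents below \<open>\<nu>\<close> coordinatewise.\<close>

lemma cheb_prod_mem_poly_span:
  assumes down: "\<And>\<nu>'. \<nu>' \<in> multi_index n \<Longrightarrow> (\<And>j. \<nu>' j \<le> \<nu> j) \<Longrightarrow> \<nu>' \<in> \<Lambda>"
  shows "cheb_prod n \<nu> \<in> poly_span n \<Lambda>"
proof -
  define E where "E = PiE {..<n} (\<lambda>j. {..\<nu> j})"
  define ext where "ext g = (\<lambda>j. if j < n then g j else 0)" for g :: "nat \<Rightarrow> nat"
  have finE: "finite E" unfolding E_def by (intro finite_PiE) auto
  have pc: "poly (cheb m) x = (\<Sum>i\<le>m. coeff (cheb m) i * x ^ i)" for m x
    unfolding poly_altdef by (intro sum.mono_neutral_left) (use degree_cheb[of m] in \<open>auto simp: coeff_eq_0\<close>)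
  have "cheb_prod n \<nu> y = (\<Sum>g\<in>E. (\<Prod>j<n. cheb_factor (\<nu> j) * coeff (cheb (\<nu> j)) (g j)) * (\<Prod>j<n. y j ^ ext g j))" for y
  proof -
    have "cheb_prod n \<nu> y = (\<Prod>j<n. \<Sum>i\<in>{..\<nu> j}. cheb_factor (\<nu> j) * coeff (cheb (\<nu> j)) i * y j ^ i)"
      unfolding cheb_prod_def pc by (simp add: sum_distrib_left mult.assoc)
    also have "\<dots> = (\<Sum>g\<in>E. \<Prod>j<n. cheb_factor (\<nu> j) * coeff (cheb (\<nu> j)) (g j) * y j ^ g j)"
      unfolding E_def by (rule prod_sum_PiE) auto
    also have "\<dots> = (\<Sum>g\<in>E. (\<Prod>j<n. cheb_factor (\<nu> j) * coeff (cheb (\<nu> j)) (g j)) * (\<Prod>j<n. y j ^ ext g j))"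
      by (intro sum.cong) (auto simp: prod.distrib ext_def)
    finally show ?thesis .
  qed
  then have "cheb_prod n \<nu> = (\<lambda>y. \<Sum>g\<in>E. (\<Prod>j<n. cheb_factor (\<nu> j) * coeff (cheb (\<nu> j)) (g j)) * (\<Prod>j<n. y j ^ ext g j))" by auto
  also have "\<dots> \<in> poly_span n \<Lambda>"
  proof (rule poly_span_sum[OF finE])
    fix g assume g: "g \<in> E"
    have "ext g \<in> \<Lambda>" using g by (intro down) (auto simp: ext_def multi_index_def E_def PiE_iff)
    then show "(\<lambda>y. \<Prod>j<n. y j ^ ext g j) \<in> poly_span n \<Lambda>"
      unfolding poly_span_def by (intro CollectI exI[of _ "{ext g}"] exI[of _ "\<lambda>_. 1"]) auto
  qed
  finally show ?thesis .
qed

section \<open>Measurability, essential suprema and the index sets\<close>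

lemma space_mu_fin: "space (mu_fin n) = cube n"
  by (simp add: mu_fin_def space_PiM cube_def)

lemma measurable_coord: "j < n \<Longrightarrow> (\<lambda>y. y j) \<in> borel_measurable (mu_fin n)"
proof -
  assume "j < n"
  then have "(\<lambda>y. y j) \<in> measurable (mu_fin n) mu1" unfolding mu_fin_def by (intro measurable_component_singleton) auto
  moreover have "(\<lambda>x. x) \<in> measurable mu1 borel" by (intro borel_measurable_mu1I continuous_intros)
  ultimately show ?thesis using measurable_compose by blast
qed

lemma measurable_cheb_prod: "cheb_prod n \<nu> \<in> borel_measurable (mu_fin n)"
proof -
  have "(\<lambda>y. poly (cheb (\<nu> j)) (y j)) \<in> borel_measurable (mu_fin n)" if "j < n" for j
    by (rule measurable_compose[OF measurable_coord[OF that]]) (intro borel_measurable_continuous_onI continuous_intros)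
  then show ?thesis unfolding cheb_prod_def[abs_def] by (intro borel_measurable_prod borel_measurable_times) auto
qed

lemma measurable_upd_last: "(\<lambda>z. (fst z)(k := snd z)) \<in> measurable (mu_fin (Suc k) \<Otimes>\<^sub>M mu1) (mu_fin (Suc k))"
proof -
  have "insert k {..<Suc k} = {..<Suc k}" by auto
  then show ?thesis
    using measurable_add_dim[of k "{..<Suc k}" "\<lambda>_. mu1"] by (simp add: mu_fin_def case_prod_beta')
qed

lemma measurable_sq_integral:
  fixes Q :: "nat \<Rightarrow> (nat \<Rightarrow> real) \<Rightarrow> real"
  assumes Q: "Q k \<in> borel_measurable (mu_fin (Suc k))" and a: "a \<in> borel_measurable (mu_fin (Suc k))"
  shows "(\<lambda>y. LINT t:{-1..a y}|mu1. (Q k (y(k := t)) + 1)\<^sup>2) \<in> borel_measurable (mu_fin (Suc k))"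
  unfolding set_lebesgue_integral_def
proof (rule mu1.borel_measurable_lebesgue_integral[where f="\<lambda>y t. indicat_real {-1..a y} t *\<^sub>R (Q k (y(k := t)) + 1)\<^sup>2"])
  have 1: "(\<lambda>z. Q k ((fst z)(k := snd z))) \<in> borel_measurable (mu_fin (Suc k) \<Otimes>\<^sub>M mu1)"
    by (rule measurable_compose[OF measurable_upd_last Q])
  have 2: "(\<lambda>z. a (fst z)) \<in> borel_measurable (mu_fin (Suc k) \<Otimes>\<^sub>M mu1)" by (rule measurable_compose[OF measurable_fst a])
  have "(\<lambda>x. x) \<in> measurable mu1 borel" by (intro borel_measurable_mu1I continuous_intros)
  then have 3: "(\<lambda>z. snd z) \<in> borel_measurable (mu_fin (Suc k) \<Otimes>\<^sub>M mu1)" using measurable_compose[OF measurable_snd] by blast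
  have "(\<lambda>z. (if - 1 \<le> snd z \<and> snd z \<le> a (fst z) then 1 else 0) *\<^sub>R (Q k ((fst z)(k := snd z)) + 1)\<^sup>2) \<in> borel_measurable (mu_fin (Suc k) \<Otimes>\<^sub>M mu1)"
    using 1 2 3 by measurable
  also have "(\<lambda>z. (if - 1 \<le> snd z \<and> snd z \<le> a (fst z) then 1 else 0) *\<^sub>R (Q k ((fst z)(k := snd z)) + 1)\<^sup>2) =
     (\<lambda>(y, t). indicat_real {-1..a y} t *\<^sub>R (Q k (y(k := t)) + 1)\<^sup>2)"
    by (auto simp: fun_eq_iff indicator_def)
  finally show "(\<lambda>(y, t). indicat_real {-1..a y} t *\<^sub>R (Q k (y(k := t)) + 1)\<^sup>2) \<in> borel_measurable (mu_fin (Suc k) \<Otimes>\<^sub>M mu1)" .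
qed

lemma measurable_approx_component:
  assumes "Q k \<in> borel_measurable (mu_fin (Suc k))"
  shows "approx_component Q k \<in> borel_measurable (mu_fin (Suc k))"
  unfolding approx_component_def[abs_def]
  using measurable_sq_integral[where Q=Q and k=k and a="\<lambda>y. y k", OF assms measurable_coord]
    measurable_sq_integral[where Q=Q and k=k and a="\<lambda>_. 1", OF assms] by measurable

text \<open>The purpose of the measurability lemmas above: a pointwise bound passes to
  \<open>esssup\<close> for measurable functions.\<close>

lemma Linf_norm_le:
  assumes "g \<in> borel_measurable (mu_fin n)" "\<And>y. y \<in> cube n \<Longrightarrow> \<bar>g y\<bar> \<le> c"
  shows "Linf_norm n g \<le> ennreal c"
  unfolding Linf_norm_def using assms by (intro esssup_I AE_I2) (auto simp: space_mu_fin ennreal_leI)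

lemma gamma_weight_eq:
  assumes "\<alpha> > 0" "\<And>j. b j \<ge> 0"
  shows "gamma_weight (weight \<alpha> b) k \<nu> = ennreal (rel_gamma \<alpha> b k \<nu>)"
proof -
  have r: "0 \<le> rel_weight \<alpha> b j" for j using rel_weight_bounds assms by blast
  have inv: "inverse (weight \<alpha> b j) = ennreal (rel_weight \<alpha> b j)" for j
  proof (cases "b j = 0")
    case True
    then show ?thesis using assms by (simp add: weight_def rel_weight_def ennreal_divide_zero)
  next
    case False
    then have b: "b j > 0" using assms(2)[of j] by simp
    have "weight \<alpha> b j = ennreal (1 + \<alpha> / b j)"
      using b assms by (simp add: weight_def divide_ennreal flip: ennreal_1 ennreal_plus)
    also have "inverse \<dots> = ennreal (inverse (1 + \<alpha> / b j))" using b assms by (intro inverse_ennreal) (auto intro: add_pos_pos)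
    also have "inverse (1 + \<alpha> / b j) = rel_weight \<alpha> b j" using b assms by (simp add: rel_weight_def field_simps)
    finally show ?thesis .
  qed
  have pw: "inverse (weight \<alpha> b j ^ m) = ennreal (rel_weight \<alpha> b j ^ m)" for j m
    using r by (simp add: ennreal_inverse_power inv ennreal_power)
  show ?thesis
    unfolding gamma_weight_def rel_gamma_def pw using r by (simp add: prod_ennreal ennreal_mult prod_nonneg)
qed

lemma Lambda_eq:
  assumes "\<alpha> > 0" "\<And>j. b j \<ge> 0"
  shows "Lambda (weight \<alpha> b) \<epsilon> k = {\<nu> \<in> multi_index (Suc k). \<epsilon> \<le> rel_gamma \<alpha> b k \<nu>}"
proof -
  have "0 \<le> rel_weight \<alpha> b j" for j using rel_weight_bounds assms by blast
  then have "0 \<le> rel_gamma \<alpha> b k \<nu>" for \<nu> by (simp add: rel_gamma_def prod_nonneg)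
  then show ?thesis
    by (auto simp: Lambda_def multi_index_def gamma_weight_eq[OF assms] ennreal_le_iff Suc_le_eq)
qed

lemma cubeD: "y \<in> cube n \<Longrightarrow> j < n \<Longrightarrow> y j \<in> {-1..1}"
  unfolding cube_def by (drule PiE_mem) simp_all

text \<open>Makes the index sets downward closed, so that Chebyshev products with index in the set
  lie in the span of its monomials.\<close>

lemma rel_gamma_antimono:
  assumes "\<alpha> > 0" "\<And>j. b j \<ge> 0" "\<And>j. \<nu>' j \<le> \<nu> j"
  shows "rel_gamma \<alpha> b k \<nu> \<le> rel_gamma \<alpha> b k \<nu>'"
proof -
  have r: "0 \<le> rel_weight \<alpha> b j" "rel_weight \<alpha> b j \<le> 1" for j
    using rel_weight_bounds[of \<alpha> b j] assms(1,2) by (auto intro: less_imp_le)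
  show ?thesis
    unfolding rel_gamma_def
  proof (intro mult_mono prod_mono conjI power_decreasing r prod_nonneg zero_le_power)
    show "max 1 (\<nu>' k) \<le> max 1 (\<nu> k)" using assms(3)[of k] by auto
  qed (use assms(3) in auto)
qed

lemma continuous_on_cheb_prod: "continuous_on A (\<lambda>t. cheb_prod n \<nu> (y(k := t)))"
proof -
  have "continuous_on A (\<lambda>t. poly (cheb m) ((y(k := t)) j))" for m j
    by (cases "j = k") (auto intro!: continuous_intros)
  then show ?thesis unfolding cheb_prod_def by (intro continuous_on_prod continuous_on_mult continuous_on_const)
qed

section \<open>Sparse approximation\<close>

text \<open>Stechkin's argument: on \<open>\<gamma> \<ge> \<epsilon>\<close> the weights \<open>\<gamma> ^ p\<close> count the indices, on \<open>\<gamma> < \<epsilon>\<close> the remaining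
  factor \<open>\<gamma> ^ (1 - p)\<close> of the coefficient bound is at most \<open>\<epsilon> ^ (1 - p)\<close>.\<close>

lemma sparse_transport_approximation:
  fixes b :: "nat \<Rightarrow> real" and R T :: "nat \<Rightarrow> (nat \<Rightarrow> real) \<Rightarrow> real" and c d :: "nat \<Rightarrow> (nat \<Rightarrow> nat) \<Rightarrow> real"
  assumes p: "0 < p" "p < 1" and B: "B \<ge> 2" and \<alpha>: "\<alpha> > 0" and b: "\<And>j. b j \<ge> 0"
    and R_bounds: "\<And>k y. y \<in> cube (Suc k) \<Longrightarrow> 1 / B \<le> R k y + 1 \<and> R k y + 1 \<le> B"
    and R_sum: "\<And>k y. y \<in> cube (Suc k) \<Longrightarrow> ((\<lambda>\<nu>. c k \<nu> * cheb_prod (Suc k) \<nu> y) has_sum R k y) (multi_index (Suc k))"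
    and R_cont: "\<And>k y. y \<in> cube k \<Longrightarrow> continuous_on {-1..1} (\<lambda>t. R k (y(k := t)))"
    and T_deriv: "\<And>k y t. y \<in> cube k \<Longrightarrow> t \<in> {-1..1} \<Longrightarrow>
       ((\<lambda>t. T k (y(k := t))) has_real_derivative (R k (y(k := t)) + 1)\<^sup>2) (at t within {-1..1})"
    and T_ends: "\<And>k y. y \<in> cube k \<Longrightarrow> T k (y(k := - 1)) = - 1" "\<And>k y. y \<in> cube k \<Longrightarrow> T k (y(k := 1)) = 1"
    and s: "summable s" "\<And>k. s k \<ge> 0" "\<And>k. (\<lambda>\<nu>. rel_gamma \<alpha> b k \<nu> powr p) summable_on multi_index (Suc k)"
      "\<And>k. infsum (\<lambda>\<nu>. rel_gamma \<alpha> b k \<nu> powr p) (multi_index (Suc k)) \<le> s k"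
    and e: "summable e" "\<And>k. e k \<ge> 0" and d: "\<And>k. d k summable_on multi_index (Suc k)"
      "\<And>k. infsum (d k) (multi_index (Suc k)) \<le> e k" "\<And>k \<nu>. d k \<nu> \<ge> 0"
      "\<And>k \<nu>. (\<Prod>j<Suc k. cheb_factor (\<nu> j)) * \<bar>c k \<nu>\<bar> \<le> rel_gamma \<alpha> b k \<nu> powr (1 - p) * d k \<nu>"
  shows "\<exists>C>0. \<forall>\<epsilon>>0.
           N_card (weight \<alpha> b) \<epsilon> < \<infinity> \<and>
           (\<exists>P :: nat \<Rightarrow> (nat \<Rightarrow> real) \<Rightarrow> real.
              (\<forall>k. P k \<in> poly_span (Suc k) (Lambda (weight \<alpha> b) \<epsilon> k)) \<and>
              bij_betw (full_map (approx_component P)) cube_inf cube_inf \<and>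
              triangular (full_map (approx_component P)) \<and>
              coordinate_monotone (full_map (approx_component P)) \<and>
              (\<Sum>k. Linf_norm (Suc k) (\<lambda>y. T k y - approx_component P k y))
                \<le> rate C p (N_card (weight \<alpha> b) \<epsilon>) \<and>
              (\<forall>k. has_partial k (T k) \<and> has_partial k (approx_component P k)) \<and>
              (\<Sum>k. Linf_norm (Suc k)
                       (\<lambda>y. partial_deriv k (T k) y - partial_deriv k (approx_component P k) y))
                \<le> rate C p (N_card (weight \<alpha> b) \<epsilon>))"
proof -
  define Lam where "Lam \<epsilon> k = {\<nu> \<in> multi_index (Suc k). \<epsilon> \<le> rel_gamma \<alpha> b k \<nu>}" for \<epsilon> k
  have Lam: "Lambda (weight \<alpha> b) \<epsilon> k = Lam \<epsilon> k" for \<epsilon> k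
    unfolding Lam_def by (rule Lambda_eq[OF \<alpha> b])
  have g0: "0 \<le> rel_gamma \<alpha> b k \<nu>" for k \<nu>
  proof -
    have "0 \<le> rel_weight \<alpha> b j" for j using rel_weight_bounds \<alpha> b by blast
    then show ?thesis by (simp add: rel_gamma_def prod_nonneg)
  qed
  have card_le: "real (card A) * \<epsilon> powr p \<le> s k" if A: "finite A" "A \<subseteq> Lam \<epsilon> k" and \<epsilon>: "\<epsilon> > 0" for A \<epsilon> k
  proof -
    have "real (card A) * \<epsilon> powr p = (\<Sum>\<nu>\<in>A. \<epsilon> powr p)" by simp
    also have "\<dots> \<le> (\<Sum>\<nu>\<in>A. rel_gamma \<alpha> b k \<nu> powr p)"
      using A(2) \<epsilon> p by (intro sum_mono powr_mono2) (auto simp: Lam_def)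
    also have "\<dots> \<le> infsum (\<lambda>\<nu>. rel_gamma \<alpha> b k \<nu> powr p) (multi_index (Suc k))"
      using A by (intro finite_sum_le_infsum s(3)) (auto simp: Lam_def)
    finally show ?thesis using s(4)[of k] by linarith
  qed
  have fin: "finite (Lam \<epsilon> k)" if \<epsilon>: "\<epsilon> > 0" for \<epsilon> k
  proof (rule ccontr)
    assume inf: "infinite (Lam \<epsilon> k)"
    obtain n :: nat where n: "s k / \<epsilon> powr p < real n" using reals_Archimedean2 by blast
    obtain A where "finite A" "card A = n" "A \<subseteq> Lam \<epsilon> k" using infinite_arbitrarily_large[OF inf] by blast
    from card_le[OF this(1,3) \<epsilon>] this(2) n \<epsilon> show False by (simp add: field_simps)
  qed
  define Ssum Esum where "Ssum = suminf s" and "Esum = suminf e"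
  have Ssum0: "Ssum \<ge> 0" unfolding Ssum_def using s by (intro suminf_nonneg) auto
  have Esum0: "Esum \<ge> 0" unfolding Esum_def using e by (intro suminf_nonneg) auto
  have N_le: "N_card (weight \<alpha> b) \<epsilon> \<le> ennreal (Ssum / \<epsilon> powr p)" if \<epsilon>: "\<epsilon> > 0" for \<epsilon>
  proof -
    have "N_card (weight \<alpha> b) \<epsilon> = (\<Sum>k. ennreal (real (card (Lam \<epsilon> k))))"
      unfolding N_card_def Lam using fin[OF \<epsilon>] by (simp add: emeasure_count_space ennreal_of_nat_eq_real_of_nat)
    also have "\<dots> \<le> (\<Sum>k. ennreal (s k / \<epsilon> powr p))"
      using card_le[OF fin[OF \<epsilon>] order_refl \<epsilon>] \<epsilon> by (intro suminf_le ennreal_leI) (auto simp: field_simps)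
    also have "\<dots> = ennreal (\<Sum>k. s k / \<epsilon> powr p)"
      using s by (intro suminf_ennreal2 summable_divide) auto
    also have "(\<Sum>k. s k / \<epsilon> powr p) = Ssum / \<epsilon> powr p" unfolding Ssum_def by (rule suminf_divide[OF s(1)])
    finally show ?thesis .
  qed
  define P0 where "P0 \<epsilon> k y = (\<Sum>\<nu>\<in>Lam \<epsilon> k. c k \<nu> * cheb_prod (Suc k) \<nu> y)" for \<epsilon> k y
  have P0_err: "\<bar>R k y - P0 \<epsilon> k y\<bar> \<le> \<epsilon> powr (1 - p) * e k" if \<epsilon>: "\<epsilon> > 0" and y: "y \<in> cube (Suc k)" for \<epsilon> k y
  proof -
    let ?A = "multi_index (Suc k)" and ?f = "\<lambda>\<nu>. c k \<nu> * cheb_prod (Suc k) \<nu> y"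
    have yI: "y j \<in> {-1..1}" if "j < Suc k" for j by (rule cubeD[OF y that])
    have f: "(?f has_sum (R k y - P0 \<epsilon> k y)) (?A - Lam \<epsilon> k)"
      unfolding P0_def by (rule has_sum_Diff[OF R_sum[OF y] has_sum_finite[OF fin[OF \<epsilon>]]]) (auto simp: Lam_def)
    have sm: "d k summable_on (?A - Lam \<epsilon> k)" by (rule summable_on_subset_banach[OF d(1)]) auto
    define D where "D = infsum (d k) (?A - Lam \<epsilon> k)"
    have g: "((\<lambda>\<nu>. \<epsilon> powr (1 - p) * d k \<nu>) has_sum (\<epsilon> powr (1 - p) * D)) (?A - Lam \<epsilon> k)"
      unfolding D_def by (intro has_sum_cmult_right has_sum_infsum sm)
    have le: "\<bar>?f \<nu>\<bar> \<le> \<epsilon> powr (1 - p) * d k \<nu>" if \<nu>: "\<nu> \<in> ?A - Lam \<epsilon> k" for \<nu>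
    proof -
      have "\<bar>?f \<nu>\<bar> = \<bar>cheb_prod (Suc k) \<nu> y\<bar> * \<bar>c k \<nu>\<bar>" by (simp add: abs_mult)
      also have "\<dots> \<le> (\<Prod>j<Suc k. cheb_factor (\<nu> j)) * \<bar>c k \<nu>\<bar>"
        by (intro mult_right_mono abs_cheb_prod_le yI) auto
      also have "\<dots> \<le> rel_gamma \<alpha> b k \<nu> powr (1 - p) * d k \<nu>" by (rule d(4))
      also have "\<dots> \<le> \<epsilon> powr (1 - p) * d k \<nu>"
        using \<nu> p g0 d(3) by (intro mult_right_mono powr_mono2) (auto simp: Lam_def)
      finally show ?thesis .
    qed
    have "R k y - P0 \<epsilon> k y \<le> \<epsilon> powr (1 - p) * D"
      by (rule has_sum_mono[OF f g]) (use le in \<open>auto simp: abs_le_iff\<close>)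
    moreover have "- (R k y - P0 \<epsilon> k y) \<le> \<epsilon> powr (1 - p) * D"
    proof (rule has_sum_mono[OF _ g])
      show "((\<lambda>\<nu>. - ?f \<nu>) has_sum - (R k y - P0 \<epsilon> k y)) (?A - Lam \<epsilon> k)" using f by (simp only: has_sum_uminus minus_minus)
    qed (use le in \<open>auto simp: abs_le_iff\<close>)
    moreover have "D \<le> e k"
    proof -
      have "D \<le> infsum (d k) ?A" unfolding D_def using d(3) by (intro infsum_mono2 sm d(1)) auto
      then show ?thesis using d(2)[of k] by linarith
    qed
    then have "\<epsilon> powr (1 - p) * D \<le> \<epsilon> powr (1 - p) * e k" by (intro mult_left_mono) auto
    ultimately show ?thesis by linarith
  qed
  have P0_meas: "P0 \<epsilon> k \<in> borel_measurable (mu_fin (Suc k))" for \<epsilon> k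
    unfolding P0_def[abs_def] by (intro borel_measurable_sum borel_measurable_times measurable_cheb_prod) auto
  \<comment> \<open>\<open>R\<close> is the pointwise limit of its truncations for the thresholds
    \<open>1 / (n + 1)\<close>, whose errors tend to 0.\<close>
  have R_meas: "R k \<in> borel_measurable (mu_fin (Suc k))" for k
  proof (rule borel_measurable_LIMSEQ_real[where u="\<lambda>n. P0 (inverse (real (Suc n))) k"])
    fix y assume "y \<in> space (mu_fin (Suc k))"
    then have y: "y \<in> cube (Suc k)" by (simp add: space_mu_fin)
    have "(\<lambda>n. inverse (real (Suc n)) powr (1 - p) * e k) \<longlonglongrightarrow> 0 powr (1 - p) * e k"
      using p by (intro tendsto_intros tendsto_powr' LIMSEQ_inverse_real_of_nat) auto
    then have lim: "(\<lambda>n. inverse (real (Suc n)) powr (1 - p) * e k) \<longlonglongrightarrow> 0" by simp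
    have "norm (R k y - P0 (inverse (real (Suc n))) k y) \<le> inverse (real (Suc n)) powr (1 - p) * e k" for n
      using P0_err[of "inverse (real (Suc n))" y k] y by simp
    then have "(\<lambda>n. R k y - P0 (inverse (real (Suc n))) k y) \<longlonglongrightarrow> 0"
      by (intro Lim_null_comparison[OF always_eventually lim]) blast
    then have "(\<lambda>n. R k y - (R k y - P0 (inverse (real (Suc n))) k y)) \<longlonglongrightarrow> R k y - 0" by (intro tendsto_intros)
    then show "(\<lambda>n. P0 (inverse (real (Suc n))) k y) \<longlonglongrightarrow> R k y" by simp
  qed (rule P0_meas)
  \<comment> \<open>\<open>c0\<close> is half the lower bound \<open>1 / B\<close> of
    \<open>R + 1\<close>, so an error up to \<open>c0\<close> keeps the truncation plus 1 at least
    \<open>1 / (2 * B)\<close>. The factor \<open>2 * B\<^sup>2\<close> in \<open>K\<close> is the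
    loss when the zero polynomial is used, as \<open>B = 2 * B\<^sup>2 * c0\<close>.\<close>
  define c0 K where "c0 = 1 / (2 * B)" and "K = transport_const B * (2 * B\<^sup>2)"
  have c0: "c0 > 0" using B by (simp add: c0_def)
  have K0: "K > 0" using B by (simp add: K_def transport_const_def add_pos_nonneg)
  \<comment> \<open>The 1 secures positivity when the sums vanish.\<close>
  define C where "C = 1 + 2 * K * Esum * Ssum powr ((1 - p) / p)"
  have C: "C > 0" unfolding C_def using K0 Esum0 by (intro add_pos_nonneg mult_nonneg_nonneg) auto
  have split: "\<exists>z\<in>cube k. y = z(k := y k) \<and> y k \<in> {-1..1} \<and> (\<forall>t. y(k := t) = z(k := t))" if "y \<in> cube (Suc k)" for y k
  proof (intro bexI[of _ "restrict y {..<k}"] conjI allI)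
    show "restrict y {..<k} \<in> cube k" using cubeD[OF that] unfolding cube_def by (intro restrict_PiE_iff[THEN iffD2]) auto
    show *: "y(k := t) = (restrict y {..<k})(k := t)" for t
      using that by (auto simp: cube_def PiE_iff extensional_def fun_eq_iff less_Suc_eq)
    from *[of "y k"] show "y = (restrict y {..<k})(k := y k)" by simp
    show "y k \<in> {-1..1}" by (rule cubeD[OF that lessI])
  qed
  have upd_mem: "z(k := t) \<in> cube (Suc k)" if "z \<in> cube k" "t \<in> {-1..1}" for z k t
    using that by (auto simp: cube_def PiE_iff extensional_def less_Suc_eq)
  have posR: "0 < R k (z(k := t)) + 1" if "z \<in> cube k" "t \<in> {-1..1}" for z k t
  proof -
    have "0 < 1 / B" using B by simp
    then show ?thesis using R_bounds[OF upd_mem[OF that]] by linarith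
  qed
  have T_exact: "approx_component R k (z(k := t)) = T k (z(k := t))" "sqmass R k z = 1" if z: "z \<in> cube k" and t: "t \<in> {-1..1}" for z k t
    using approx_component_exact[where Q=R and k=k and y=z and \<tau>="\<lambda>t. T k (z(k := t))", OF R_cont[OF z] posR[OF z] T_deriv[OF z] T_ends(1)[OF z] T_ends(2)[OF z] t]
    by auto
  \<comment> \<open>Raising \<open>\<epsilon> powr p \<le> Ssum / N\<close> to the power
    \<open>(1 - p) / p\<close> trades \<open>\<epsilon> powr (1 - p)\<close> for a power of
    \<open>N\<close>.\<close>
  have rate_le: "ennreal (2 * K * (\<epsilon> powr (1 - p) * Esum)) \<le> rate C p (N_card (weight \<alpha> b) \<epsilon>)" if \<epsilon>: "\<epsilon> > 0" for \<epsilon>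
  proof (cases "N_card (weight \<alpha> b) \<epsilon> = 0")
    case True
    then show ?thesis by (simp add: rate_def)
  next
    case False
    define N where "N = enn2real (N_card (weight \<alpha> b) \<epsilon>)"
    have top: "N_card (weight \<alpha> b) \<epsilon> < \<infinity>" using N_le[OF \<epsilon>] by (simp add: order.strict_trans1)
    have N: "N > 0" unfolding N_def using False top by (simp add: enn2real_positive_iff zero_less_iff_neq_zero)
    have "N \<le> Ssum / \<epsilon> powr p"
      unfolding N_def using N_le[OF \<epsilon>] Ssum0 by (intro enn2real_leI) auto
    then have "\<epsilon> powr p \<le> Ssum / N" using N \<epsilon> by (simp add: field_simps)
    then have "(\<epsilon> powr p) powr ((1 - p) / p) \<le> (Ssum / N) powr ((1 - p) / p)"
      using p by (intro powr_mono2) auto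
    then have "\<epsilon> powr (1 - p) \<le> Ssum powr ((1 - p) / p) * N powr (- ((1 - p) / p))"
      using p N Ssum0 by (simp add: powr_powr powr_divide powr_minus_divide)
    moreover have "- ((1 - p) / p) = - 1 / p + 1" using p by (simp add: field_simps)
    ultimately have "\<epsilon> powr (1 - p) \<le> Ssum powr ((1 - p) / p) * N powr (- 1 / p + 1)" by simp
    then have "2 * K * Esum * \<epsilon> powr (1 - p) \<le> 2 * K * Esum * (Ssum powr ((1 - p) / p) * N powr (- 1 / p + 1))"
      using K0 Esum0 by (intro mult_left_mono) auto
    also have "\<dots> \<le> C * N powr (- 1 / p + 1)" by (simp add: C_def distrib_right)
    finally show ?thesis using False by (simp add: rate_def N_def[symmetric] ennreal_leI mult_ac)
  qed
  show ?thesis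
  proof (intro exI[of _ C] conjI C allI impI)
    fix \<epsilon> :: real assume \<epsilon>: "\<epsilon> > 0"
    show "N_card (weight \<alpha> b) \<epsilon> < \<infinity>" using N_le[OF \<epsilon>] by (simp add: order.strict_trans1)
    define err where "err k = \<epsilon> powr (1 - p) * e k" for k
    have err0: "err k \<ge> 0" for k using e(2) by (simp add: err_def)
    \<comment> \<open>The fallback to 0 is made separately for each \<open>k\<close>, when
      \<open>err k > c0\<close>; there even the trivial error is at most a multiple of
      \<open>err k\<close>, so large \<open>\<epsilon>\<close> obeys the same constant.\<close>
    define P where "P k = (if err k \<le> c0 then P0 \<epsilon> k else (\<lambda>_. 0))" for k
    have P_meas: "P k \<in> borel_measurable (mu_fin (Suc k))" for k using P0_meas by (simp add: P_def)
    have P_cont: "continuous_on {-1..1} (\<lambda>t. P k (z(k := t)))" for k z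
      unfolding P_def P0_def by (auto intro!: continuous_intros continuous_on_cheb_prod)
    have P_bounds: "1 / (2 * B) \<le> P k y + 1 \<and> P k y + 1 \<le> B + 1 \<and> \<bar>P k y - R k y\<bar> \<le> 2 * B\<^sup>2 * err k" if y: "y \<in> cube (Suc k)" for k y
    proof (cases "err k \<le> c0")
      case True
      have PR: "\<bar>R k y - P k y\<bar> \<le> err k" using P0_err[OF \<epsilon> y] True by (simp add: P_def err_def)
      have half: "1 / B = c0 + c0" "c0 \<le> 1" using B by (auto simp: c0_def field_simps)
      have "1 * err k \<le> 2 * B\<^sup>2 * err k" using B err0[of k] mult_mono[of 1 B 1 B] by (intro mult_right_mono) (auto simp: power2_eq_square)
      then show ?thesis
        using PR True R_bounds[OF y] half unfolding c0_def[symmetric] by (auto simp: abs_le_iff)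
    next
      case False
      have "0 < 1 / B" using B by simp
      then have "\<bar>R k y\<bar> \<le> B" using R_bounds[OF y] B unfolding abs_le_iff by linarith
      also have "B = 2 * B\<^sup>2 * c0" using B by (simp add: c0_def power2_eq_square)
      also have "\<dots> \<le> 2 * B\<^sup>2 * err k" using False by (intro mult_left_mono) auto
      finally show ?thesis using False B by (simp add: P_def)
    qed
    have posP: "0 < P k (z(k := t)) + 1" if "z \<in> cube k" "t \<in> {-1..1}" for z k t
      using P_bounds[OF upd_mem[OF that]] c0 unfolding c0_def by linarith
    note A_deriv = approx_component_deriv[where Q=P, OF P_cont posP]
    have pd_T: "partial_deriv k (T k) y = (R k y + 1)\<^sup>2" if y: "y \<in> cube (Suc k)" for k y
    proof -
      obtain z where z: "z \<in> cube k" "y = z(k := y k)" "y k \<in> {-1..1}" "\<And>t. y(k := t) = z(k := t)" using split[OF y] by blast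
      show ?thesis unfolding partial_deriv_def z(4)
        using T_deriv[OF z(1,3)] z(2,3)
        by (intro vector_derivative_within_closed_interval) (auto simp: has_real_derivative_iff_has_vector_derivative)
    qed
    have pd_P: "partial_deriv k (approx_component P k) y = (P k y + 1)\<^sup>2 / sqmass P k y" if y: "y \<in> cube (Suc k)" for k y
    proof -
      obtain z where z: "z \<in> cube k" "y = z(k := y k)" "y k \<in> {-1..1}" "\<And>t. y(k := t) = z(k := t)" using split[OF y] by blast
      have "sqmass P k y = sqmass P k z" unfolding sqmass_def z(4) ..
      then show ?thesis unfolding partial_deriv_def z(4)
        using A_deriv[OF z(1) _ z(3)] z(2,3)
        by (intro vector_derivative_within_closed_interval) (auto simp: has_real_derivative_iff_has_vector_derivative)
    qed
    have errors: "\<bar>T k y - approx_component P k y\<bar> \<le> 2 * K * err k"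
      "\<bar>partial_deriv k (T k) y - partial_deriv k (approx_component P k) y\<bar> \<le> 2 * K * err k" if y: "y \<in> cube (Suc k)" for k y
    proof -
      obtain z where z: "z \<in> cube k" "y = z(k := y k)" "y k \<in> {-1..1}" "\<And>t. y(k := t) = z(k := t)" using split[OF y] by blast
      have sq: "sqmass P k y = sqmass P k z" unfolding sqmass_def z(4) ..
      have "\<bar>(R k (z(k := y k)) + 1)\<^sup>2 - (P k (z(k := y k)) + 1)\<^sup>2 / sqmass P k z\<bar> \<le> transport_const B * (2 * B\<^sup>2 * err k)"
        and "\<bar>approx_component R k (z(k := y k)) - approx_component P k (z(k := y k))\<bar> \<le> 2 * (transport_const B * (2 * B\<^sup>2 * err k))"
        using R_bounds[OF upd_mem[OF z(1)]] P_bounds[OF upd_mem[OF z(1)]] T_exact(2)[OF z(1), of 0]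
        by (intro approx_component_error[where R=R and P=P and k=k and y=z, OF B R_cont[OF z(1)] _ _ _ P_cont _ _ _ z(3)]; simp)+
      then have 1: "\<bar>(R k y + 1)\<^sup>2 - (P k y + 1)\<^sup>2 / sqmass P k y\<bar> \<le> K * err k"
        and 2: "\<bar>approx_component R k y - approx_component P k y\<bar> \<le> 2 * (K * err k)"
        unfolding z(2)[symmetric] sq by (simp_all add: K_def mult.assoc)
      show "\<bar>T k y - approx_component P k y\<bar> \<le> 2 * K * err k"
        using 2 T_exact(1)[OF z(1,3)] unfolding z(2)[symmetric] by (simp add: mult.assoc)
      have "K * err k \<ge> 0" using K0 err0 by simp
      then show "\<bar>partial_deriv k (T k) y - partial_deriv k (approx_component P k) y\<bar> \<le> 2 * K * err k"
        unfolding pd_T[OF y] pd_P[OF y] using 1 by linarith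
    qed
    have T_meas: "T k \<in> borel_measurable (mu_fin (Suc k))" for k
    proof (rule measurable_cong[THEN iffD1, OF _ measurable_approx_component[OF R_meas]])
      fix y assume "y \<in> space (mu_fin (Suc k))"
      then have "y \<in> cube (Suc k)" by (simp add: space_mu_fin)
      then obtain z where z: "z \<in> cube k" "y = z(k := y k)" "y k \<in> {-1..1}" using split by blast
      show "approx_component R k y = T k y" using T_exact(1)[OF z(1,3)] unfolding z(2)[symmetric] .
    qed
    have pdT_meas: "partial_deriv k (T k) \<in> borel_measurable (mu_fin (Suc k))" for k
    proof (rule measurable_cong[THEN iffD1])
      show "(\<lambda>y. (R k y + 1)\<^sup>2) \<in> borel_measurable (mu_fin (Suc k))" using R_meas[of k] by measurable
    qed (use pd_T in \<open>auto simp: space_mu_fin\<close>)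
    have pdP_meas: "partial_deriv k (approx_component P k) \<in> borel_measurable (mu_fin (Suc k))" for k
    proof (rule measurable_cong[THEN iffD1])
      have "(\<lambda>y. sqmass P k y) \<in> borel_measurable (mu_fin (Suc k))"
        unfolding sqmass_def by (rule measurable_sq_integral[where Q=P and k=k and a="\<lambda>_. 1", OF P_meas]) simp
      then show "(\<lambda>y. (P k y + 1)\<^sup>2 / sqmass P k y) \<in> borel_measurable (mu_fin (Suc k))" using P_meas[of k] by measurable
    qed (use pd_P in \<open>auto simp: space_mu_fin\<close>)
    have total: "(\<Sum>k. Linf_norm (Suc k) (g k)) \<le> rate C p (N_card (weight \<alpha> b) \<epsilon>)"
      if g: "\<And>k. Linf_norm (Suc k) (g k) \<le> ennreal (2 * K * err k)" for g
    proof -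
      have "(\<Sum>k. Linf_norm (Suc k) (g k)) \<le> (\<Sum>k. ennreal (2 * K * err k))" by (intro suminf_le g) auto
      also have "\<dots> = ennreal (\<Sum>k. 2 * K * err k)"
        using K0 err0 e(1) by (intro suminf_ennreal2) (auto simp: err_def intro!: summable_mult)
      also have "(\<Sum>k. 2 * K * err k) = 2 * K * (\<epsilon> powr (1 - p) * Esum)"
        unfolding err_def Esum_def using e(1) by (simp add: suminf_mult summable_mult)
      finally show ?thesis using rate_le[OF \<epsilon>] by (rule order_trans)
    qed
    show "\<exists>P. (\<forall>k. P k \<in> poly_span (Suc k) (Lambda (weight \<alpha> b) \<epsilon> k)) \<and>
              bij_betw (full_map (approx_component P)) cube_inf cube_inf \<and>
              triangular (full_map (approx_component P)) \<and>
              coordinate_monotone (full_map (approx_component P)) \<and>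
              (\<Sum>k. Linf_norm (Suc k) (\<lambda>y. T k y - approx_component P k y))
                \<le> rate C p (N_card (weight \<alpha> b) \<epsilon>) \<and>
              (\<forall>k. has_partial k (T k) \<and> has_partial k (approx_component P k)) \<and>
              (\<Sum>k. Linf_norm (Suc k)
                       (\<lambda>y. partial_deriv k (T k) y - partial_deriv k (approx_component P k) y))
                \<le> rate C p (N_card (weight \<alpha> b) \<epsilon>)"
    proof (intro exI[of _ P] conjI allI)
      show "P k \<in> poly_span (Suc k) (Lambda (weight \<alpha> b) \<epsilon> k)" for k
      proof (cases "err k \<le> c0")
        case True
        have "cheb_prod (Suc k) \<nu> \<in> poly_span (Suc k) (Lam \<epsilon> k)" if "\<nu> \<in> Lam \<epsilon> k" for \<nu>
        proof (rule cheb_prod_mem_poly_span)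
          fix \<nu>' assume "\<nu>' \<in> multi_index (Suc k)" "\<And>j. \<nu>' j \<le> \<nu> j"
          then show "\<nu>' \<in> Lam \<epsilon> k" using that rel_gamma_antimono[where b=b and \<nu>'=\<nu>' and \<nu>=\<nu> and k=k, OF \<alpha> b] by (auto simp: Lam_def)
        qed
        then have "P0 \<epsilon> k \<in> poly_span (Suc k) (Lam \<epsilon> k)"
          unfolding P0_def[abs_def] by (intro poly_span_sum fin[OF \<epsilon>])
        then show ?thesis using True by (simp add: P_def Lam)
      qed (simp add: P_def zero_mem_poly_span)
      note bij = bij_betw_triangular[of "approx_component P",
          OF approx_component_strict_mono[where Q=P, OF P_cont posP] approx_component_continuous[where Q=P, OF P_cont posP]
            approx_component_ends(1)[where Q=P, OF P_cont posP] approx_component_ends(2)[where Q=P, OF P_cont posP]]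
      show "bij_betw (full_map (approx_component P)) cube_inf cube_inf" by (rule bij)
      show "triangular (full_map (approx_component P))" by (rule bij)
      show "coordinate_monotone (full_map (approx_component P))" by (rule bij)
      show "(\<Sum>k. Linf_norm (Suc k) (\<lambda>y. T k y - approx_component P k y)) \<le> rate C p (N_card (weight \<alpha> b) \<epsilon>)"
        using errors(1) T_meas measurable_approx_component[where Q=P, OF P_meas]
        by (intro total Linf_norm_le borel_measurable_diff) auto
      show "(\<Sum>k. Linf_norm (Suc k) (\<lambda>y. partial_deriv k (T k) y - partial_deriv k (approx_component P k) y)) \<le> rate C p (N_card (weight \<alpha> b) \<epsilon>)"
        using errors(2) pdT_meas pdP_meas by (intro total Linf_norm_le borel_measurable_diff) auto
      show "has_partial k (T k)" for k
        unfolding has_partial_def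
      proof
        fix y assume "y \<in> cube (Suc k)"
        then obtain z where z: "z \<in> cube k" "y k \<in> {-1..1}" "\<And>t. y(k := t) = z(k := t)" using split by blast
        show "(\<lambda>t. T k (y(k := t))) differentiable at (y k) within {-1..1}"
          unfolding z(3) real_differentiable_def using T_deriv[OF z(1,2)] by blast
      qed
      show "has_partial k (approx_component P k)" for k
        unfolding has_partial_def
      proof
        fix y assume "y \<in> cube (Suc k)"
        then obtain z where z: "z \<in> cube k" "y k \<in> {-1..1}" "\<And>t. y(k := t) = z(k := t)" using split by blast
        show "(\<lambda>t. approx_component P k (y(k := t))) differentiable at (y k) within {-1..1}"
          unfolding z(3) real_differentiable_def using A_deriv[OF z(1) _ z(2)] z(1) by blast
      qed
    qed
  qed
qed

section \<open>Real values, end points and real derivatives of the extended transport\<close>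

lemma (in holomorphic_marginals) cond_quot_real:
  assumes x: "\<And>j. x j \<in> {-1..1}"
  shows "\<exists>u\<in>{1 / B..B}. cond_quot k (\<lambda>j. of_real (x j)) = of_real u"
proof -
  obtain v v' where "h (Suc k) (\<lambda>j. of_real (x j)) = of_real v" "h k (\<lambda>j. of_real (x j)) = of_real v'"
    using h_real[of x "Suc k"] h_real[of x k] x by blast
  then have eq: "cond_quot k (\<lambda>j. of_real (x j)) = of_real (v / v')" by (simp add: cond_quot_def)
  have "(\<lambda>j. of_real (x j)) \<in> cube_nbhd b (Suc k) \<delta>" by (rule of_real_mem_cube_nbhd[OF x \<delta>_pos])
  from cond_quot_bounds(1,2)[OF this] have "\<bar>v / v'\<bar> \<le> B" "1 / B \<le> v / v'"
    unfolding eq norm_of_real Re_complex_of_real by blast+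
  then have "v / v' \<in> {1 / B..B}" using order_trans[OF abs_ge_self] unfolding atLeastAtMost_iff by blast
  then show ?thesis using eq by blast
qed

context triangular_transport
begin

lemma root_deriv_real_bounds:
  assumes x: "\<And>j. x j \<in> {-1..1}"
  shows "\<exists>r. root_deriv k (\<lambda>j. of_real (x j)) = of_real r \<and> 1 / \<rho>.B \<le> r + 1 \<and> r + 1 \<le> \<rho>.B"
proof -
  obtain u where u: "u \<in> {1 / \<rho>.B..\<rho>.B}" "\<rho>.cond_quot k (\<lambda>j. of_real (x j)) = of_real u" using \<rho>.cond_quot_real[of x k] x by blast
  obtain v where v: "v \<in> {1 / \<rho>.B..\<rho>.B}" "\<pi>.cond_quot k (\<lambda>j. of_real (X j x)) = of_real v"
    using \<pi>.cond_quot_real[of "\<lambda>j. X j x" k] X_range[of x] x by blast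
  have Bi: "0 < 1 / \<rho>.B" using B by simp
  have u0: "u > 0" and v0: "v > 0" using less_le_trans[OF Bi] u(1) v(1) by (simp_all only: atLeastAtMost_iff)
  have "u / v \<le> \<rho>.B / (1 / \<rho>.B)" using u(1) v(1) Bi B by (intro frac_le) (auto simp only: atLeastAtMost_iff)
  then have "sqrt (u / v) \<le> sqrt (\<rho>.B\<^sup>2)" by (intro real_sqrt_le_mono) (simp add: power2_eq_square)
  moreover have "(1 / \<rho>.B) / \<rho>.B \<le> u / v" using u(1) v(1) u0 v0 Bi by (intro frac_le) (auto simp only: atLeastAtMost_iff less_imp_le)
  then have "sqrt ((1 / \<rho>.B)\<^sup>2) \<le> sqrt (u / v)" by (intro real_sqrt_le_mono) (simp add: power2_eq_square)
  ultimately have "1 / \<rho>.B \<le> (sqrt (u / v) - 1) + 1" "(sqrt (u / v) - 1) + 1 \<le> \<rho>.B" using B by simp_all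
  moreover have "root_deriv k (\<lambda>j. of_real (x j)) = of_real (sqrt (u / v) - 1)"
    by (rule root_deriv_real[OF x u(2) u0 v(2) v0])
  ultimately show ?thesis by blast
qed

text \<open>Both distribution functions are 0 at -1 and 1 at 1, and that of the target is injective
  in its last coordinate.\<close>

lemma X_ends:
  assumes x: "\<And>j. x j \<in> {-1..1}"
  shows "x k = - 1 \<Longrightarrow> X k x = - 1" "x k = 1 \<Longrightarrow> X k x = 1"
proof -
  define Xv xv where "Xv = (\<lambda>j. complex_of_real (X j x))" and "xv = (\<lambda>j. complex_of_real (x j))"
  have Xm: "Xv \<in> nbhd k \<delta>" and xm: "xv \<in> nbhd k \<delta>"
    unfolding Xv_def xv_def using X_range[of x] x \<rho>.\<delta>_pos by (auto intro!: of_real_mem_cube_nbhd)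
  have Xk: "Xv(k := of_real (X k x)) = Xv" by (auto simp: Xv_def)
  have eq: "\<pi>.cdf k (Xv(k := of_real (X k x))) = \<rho>.cdf k xv"
    unfolding Xk unfolding Xv_def xv_def by (rule X_cdf[OF x])
  have main: "X k x = t" if t: "x k = t" "\<rho>.cdf k (xv(k := of_real t)) = \<pi>.cdf k (Xv(k := of_real t))" for t
  proof -
    have "xv(k := of_real t) = xv" using t by (auto simp: xv_def)
    then have "\<pi>.cdf k (Xv(k := of_real (X k x))) = \<pi>.cdf k (Xv(k := of_real t))" using eq t by simp
    moreover have "Xv(k := of_real (X k x)) \<in> nbhd (Suc k) \<delta>" "Xv(k := of_real t) \<in> nbhd (Suc k) \<delta>"
      using \<rho>.cube_nbhd_upd_real[OF Xm X_range[of x k]] \<rho>.cube_nbhd_upd_real[OF Xm x[of k]] x t by auto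
    ultimately have "complex_of_real (X k x) = of_real t" using \<pi>.cdf_inj by blast
    then show ?thesis by simp
  qed
  show "x k = - 1 \<Longrightarrow> X k x = - 1"
    using main[of "-1"] by (simp add: \<rho>.cdf_minus_one \<pi>.cdf_minus_one)
  show "x k = 1 \<Longrightarrow> X k x = 1"
    using main[of 1] by (simp add: \<rho>.cdf_one[OF xm] \<pi>.cdf_one[OF Xm])
qed

lemma of_real_upd: "(\<lambda>j. complex_of_real ((x(k := t)) j)) = (\<lambda>j. of_real (x j))(k := of_real t)"
  by auto

lemma root_deriv_continuous:
  assumes x: "\<And>j. x j \<in> {-1..1}"
  shows "continuous_on {-1..1} (\<lambda>t. root_deriv k (\<lambda>j. of_real ((x(k := t)) j)))"
proof -
  interpret W: weighted_coords b \<delta>' by unfold_locales (use \<delta>'_pos \<rho>.b_nonneg in auto)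
  let ?z = "\<lambda>j. complex_of_real (x j)"
  have "(\<lambda>t. root_deriv k (?z(k := t))) holomorphic_on {t. ?z(k := t) \<in> nbhd (Suc k) \<delta>'}"
    by (intro curve_holomorphic_on_section[OF root_deriv_hol] W.open_section) auto
  then have "continuous_on {-1..1} (\<lambda>t. root_deriv k (?z(k := of_real t)))"
    by (rule continuous_on_compose2[OF holomorphic_on_imp_continuous_on])
      (use W.cube_nbhd_upd_real[OF of_real_mem_cube_nbhd[OF x \<delta>'_pos]] in \<open>auto intro!: continuous_intros\<close>)
  then show ?thesis by (simp only: of_real_upd)
qed

text \<open>At real points \<open>ratio\<close> is the square of the real number
  \<open>root_deriv + 1\<close>, and the transport is the real trace of
  \<open>ctransport\<close>.\<close>

lemma X_deriv:
  assumes x: "\<And>j. x j \<in> {-1..1}" and t: "t \<in> {-1..1}"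
  shows "((\<lambda>t. X k (x(k := t))) has_real_derivative (Re (root_deriv k (\<lambda>j. of_real ((x(k := t)) j))) + 1)\<^sup>2) (at t within {-1..1})"
proof -
  let ?z = "\<lambda>j. complex_of_real (x j)"
  have xt: "(x(k := s)) j \<in> {-1..1}" if "s \<in> {-1..1}" for s j using x that by auto
  have mem: "?z(k := of_real t) \<in> nbhd (Suc k) \<delta>'"
    unfolding of_real_upd[symmetric] by (rule of_real_mem_cube_nbhd[OF xt[OF t] \<delta>'_pos])
  obtain r where r: "root_deriv k (\<lambda>j. of_real ((x(k := t)) j)) = of_real r" using root_deriv_real_bounds[of "x(k := t)" k] xt[OF t] by blast
  have "ratio k (?z(k := of_real t)) = (root_deriv k (?z(k := of_real t)) + 1)\<^sup>2" by (simp add: root_deriv_def)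
  also have "\<dots> = of_real ((r + 1)\<^sup>2)" using r unfolding of_real_upd by simp
  finally have ratio: "ratio k (?z(k := of_real t)) = of_real ((r + 1)\<^sup>2)" .
  have "((\<lambda>s. ctransport (Suc k) (?z(k := of_real s)) k) has_vector_derivative of_real ((r + 1)\<^sup>2)) (at t within {-1..1})"
    using has_vector_derivative_real_field[OF ctransport_deriv[OF mem]] unfolding ratio .
  then have "((\<lambda>s. Re (ctransport (Suc k) (?z(k := of_real s)) k)) has_vector_derivative Re (of_real ((r + 1)\<^sup>2))) (at t within {-1..1})"
    by (rule bounded_linear.has_vector_derivative[OF bounded_linear_Re])
  then have "((\<lambda>s. Re (ctransport (Suc k) (?z(k := of_real s)) k)) has_real_derivative (r + 1)\<^sup>2) (at t within {-1..1})"
    by (simp add: has_real_derivative_iff_has_vector_derivative del: ctransport.simps of_real_power)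
  then have "((\<lambda>s. X k (x(k := s))) has_real_derivative (r + 1)\<^sup>2) (at t within {-1..1})"
  proof (rule has_field_derivative_transform_within[OF _ zero_less_one t])
    fix s :: real assume "s \<in> {-1..1}"
    from ctransport_real[where x="x(k := s)" and j=k and k="Suc k", OF xt[OF this] lessI]
    show "Re (ctransport (Suc k) (?z(k := of_real s)) k) = X k (x(k := s))"
      unfolding of_real_upd by (simp del: ctransport.simps)
  qed
  then show ?thesis unfolding r by simp
qed

end

lemma summable_of_summable_powr:
  fixes b :: "nat \<Rightarrow> real"
  assumes p: "0 < p" "p < 1" and b: "\<And>j. b j \<ge> 0" and s: "summable (\<lambda>j. b j powr p)"
  shows "summable b"
proof (rule summable_comparison_test_ev[OF _ s])
  have "eventually (\<lambda>j. b j powr p < 1) sequentially"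
    using summable_LIMSEQ_zero[OF s] by (rule order_tendstoD) simp
  then show "eventually (\<lambda>j. norm (b j) \<le> b j powr p) sequentially"
  proof eventually_elim
    case (elim j)
    have "b j < 1"
    proof (rule ccontr)
      assume "\<not> b j < 1"
      then have "1 powr p \<le> b j powr p" using p by (intro powr_mono2) auto
      then show False using elim by simp
    qed
    then have "b j powr 1 \<le> b j powr p" using b[of j] p by (intro powr_mono') auto
    then show ?case using b[of j] by simp
  qed
qed

theorem theorem5p2:
  fixes p M L :: real
    and \<psi>\<^sub>\<rho> :: "nat \<Rightarrow> 'a::banach" and O\<^sub>\<rho> :: "('a \<times> 'a) set" and F\<^sub>\<rho> :: "'a \<times> 'a \<Rightarrow> complex"
    and \<psi>\<^sub>\<pi> :: "nat \<Rightarrow> 'b::banach" and O\<^sub>\<pi> :: "('b \<times> 'b) set" and F\<^sub>\<pi> :: "'b \<times> 'b \<Rightarrow> complex"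
    and f\<^sub>\<rho> f\<^sub>\<pi> :: "(nat \<Rightarrow> real) \<Rightarrow> real"
    and T :: "nat \<Rightarrow> (nat \<Rightarrow> real) \<Rightarrow> real"
    and b :: "nat \<Rightarrow> real"
  assumes p: "0 < p" "p < 1"
    and bounds: "0 < M" "M \<le> L"
    and rho: "density_assumption p M L \<psi>\<^sub>\<rho> O\<^sub>\<rho> F\<^sub>\<rho> f\<^sub>\<rho>"
    and pi: "density_assumption p M L \<psi>\<^sub>\<pi> O\<^sub>\<pi> F\<^sub>\<pi> f\<^sub>\<pi>"
    and pos: "\<And>y. y \<in> cube_inf \<Longrightarrow> 0 < f\<^sub>\<rho> y" "\<And>y. y \<in> cube_inf \<Longrightarrow> 0 < f\<^sub>\<pi> y"
    and T: "knothe_rosenblatt f\<^sub>\<rho> f\<^sub>\<pi> T"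
    and b: "\<And>j. b j = max (norm (\<psi>\<^sub>\<rho> j)) (norm (\<psi>\<^sub>\<pi> j))"
  shows "\<exists>\<alpha>>0. \<exists>C>0. \<forall>\<epsilon>>0.
           N_card (weight \<alpha> b) \<epsilon> < \<infinity> \<and>
           (\<exists>P :: nat \<Rightarrow> (nat \<Rightarrow> real) \<Rightarrow> real.
              (\<forall>k. P k \<in> poly_span (Suc k) (Lambda (weight \<alpha> b) \<epsilon> k)) \<and>
              bij_betw (full_map (approx_component P)) cube_inf cube_inf \<and>
              triangular (full_map (approx_component P)) \<and>
              coordinate_monotone (full_map (approx_component P)) \<and>
              (\<Sum>k. Linf_norm (Suc k) (\<lambda>y. T k y - approx_component P k y))
                \<le> rate C p (N_card (weight \<alpha> b) \<epsilon>) \<and>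
              (\<forall>k. has_partial k (T k) \<and> has_partial k (approx_component P k)) \<and>
              (\<Sum>k. Linf_norm (Suc k)
                       (\<lambda>y. partial_deriv k (T k) y - partial_deriv k (approx_component P k) y))
                \<le> rate C p (N_card (weight \<alpha> b) \<epsilon>))"
proof -
  have b0: "b j \<ge> 0" and \<psi>_le: "norm (\<psi>\<^sub>\<rho> j) \<le> b j" "norm (\<psi>\<^sub>\<pi> j) \<le> b j" for j by (auto simp: b le_max_iff_disj)
  have sbp: "summable (\<lambda>j. b j powr p)"
  proof (rule summable_comparison_test'[where N=0])
    show "summable (\<lambda>j. norm (\<psi>\<^sub>\<rho> j) powr p + norm (\<psi>\<^sub>\<pi> j) powr p)"
      using rho pi by (intro summable_add) (auto simp: density_assumption_def)
  qed (auto simp: b max_def)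
  have sb: "summable b" by (rule summable_of_summable_powr[OF p b0 sbp])
  have pr: "parametric_density p M L \<psi>\<^sub>\<rho> O\<^sub>\<rho> F\<^sub>\<rho> f\<^sub>\<rho> b" and pp: "parametric_density p M L \<psi>\<^sub>\<pi> O\<^sub>\<pi> F\<^sub>\<pi> f\<^sub>\<pi> b"
    using rho pi pos bounds \<psi>_le sb by (unfold_locales; auto)+
  define h g where "h = parametric_density.cmarginal \<psi>\<^sub>\<rho> F\<^sub>\<rho>" and "g = parametric_density.cmarginal \<psi>\<^sub>\<pi> F\<^sub>\<pi>"
  obtain \<delta>1 Lip1 where 1: "\<delta>1 > 0" "Lip1 \<ge> 0" "\<And>\<delta> Lip. 0 < \<delta> \<Longrightarrow> \<delta> \<le> \<delta>1 \<Longrightarrow> Lip1 \<le> Lip \<Longrightarrow> Lip * \<delta> \<le> M / 16 \<Longrightarrow> holomorphic_marginals b \<delta> M L Lip h"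
    using parametric_density.holomorphic_marginals_cmarginal[OF pr] unfolding h_def by blast
  obtain \<delta>2 Lip2 where 2: "\<delta>2 > 0" "Lip2 \<ge> 0" "\<And>\<delta> Lip. 0 < \<delta> \<Longrightarrow> \<delta> \<le> \<delta>2 \<Longrightarrow> Lip2 \<le> Lip \<Longrightarrow> Lip * \<delta> \<le> M / 16 \<Longrightarrow> holomorphic_marginals b \<delta> M L Lip g"
    using parametric_density.holomorphic_marginals_cmarginal[OF pp] unfolding g_def by blast
  \<comment> \<open>Common parameters for both densities; the last entry of the minimum enforces
    \<open>Lip * \<delta> \<le> M / 16\<close>.\<close>
  define Lip \<delta> where "Lip = max Lip1 Lip2" and "\<delta> = min (min \<delta>1 \<delta>2) (M / (16 * (Lip + 1)))"
  have Lip0: "Lip \<ge> 0" using 1(2) by (simp add: Lip_def)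
  have \<delta>0: "\<delta> > 0" using 1(1) 2(1) bounds Lip0 by (simp add: \<delta>_def)
  have "Lip * \<delta> \<le> (Lip + 1) * (M / (16 * (Lip + 1)))"
    using Lip0 \<delta>0 by (intro mult_mono) (auto simp: \<delta>_def)
  also have "\<dots> = M / 16" using Lip0 by (simp add: field_simps)
  finally have Lip\<delta>: "Lip * \<delta> \<le> M / 16" .
  have hr: "holomorphic_marginals b \<delta> M L Lip h" using Lip\<delta> \<delta>0 by (intro 1(3)) (auto simp: \<delta>_def Lip_def)
  have hp: "holomorphic_marginals b \<delta> M L Lip g" using Lip\<delta> \<delta>0 by (intro 2(3)) (auto simp: \<delta>_def Lip_def)
  have ar: "analytic_density p M L \<psi>\<^sub>\<rho> O\<^sub>\<rho> F\<^sub>\<rho> f\<^sub>\<rho> b \<delta> Lip" and ap: "analytic_density p M L \<psi>\<^sub>\<pi> O\<^sub>\<pi> F\<^sub>\<pi> f\<^sub>\<pi> b \<delta> Lip"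
    unfolding analytic_density_def analytic_density_axioms_def using pr pp hr hp by (auto simp: h_def g_def)
  define X where "X k x = T k (restrict x {..k})" for k x
  interpret X: triangular_transport b \<delta> M L Lip h g X "suminf b"
  proof -
    interpret \<rho>: holomorphic_marginals b \<delta> M L Lip h by (rule hr)
    interpret \<pi>: holomorphic_marginals b \<delta> M L Lip g by (rule hp)
    show "triangular_transport b \<delta> M L Lip h g X (suminf b)"
    proof unfold_locales
      show "(\<Sum>j<n. b j) \<le> suminf b" for n using b0 sb by (intro sum_le_suminf) auto
      show "X k x \<in> {-1..1}" if "\<And>j. x j \<in> {-1..1}" for k x
        using knothe_rosenblatt_cdf(1)[OF ar ap T that] by (simp add: X_def)
      show "\<pi>.cdf k (\<lambda>j. of_real (X j x)) = \<rho>.cdf k (\<lambda>j. of_real (x j))" if "\<And>j. x j \<in> {-1..1}" for k x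
        using knothe_rosenblatt_cdf(2)[OF ar ap T that] by (simp add: X_def h_def g_def)
    qed
  qed
  define B where "B = X.\<rho>.B"
  have B: "B \<ge> 2" unfolding B_def by (rule X.\<rho>.B_ge_2)
  define C0 where "C0 = max (B + 1) X.C3"
  have C0: "C0 \<ge> 0" "B + 1 \<le> C0" "X.C3 \<le> C0" using B by (auto simp: C0_def)
  define mc where "mc k \<nu> = multi_coeff (Suc k) \<nu> (X.root_deriv k)" for k \<nu>
  have c1: "norm (mc k \<nu>) \<le> C0 * (\<Prod>j<Suc k. inverse (1 + \<zeta> j) ^ \<nu> j)"
    if "\<And>j. j < Suc k \<Longrightarrow> \<zeta> j > 0" "(\<Sum>j<Suc k. b j * \<zeta> j) < X.\<delta>'" for k \<nu> and \<zeta> :: "nat \<Rightarrow> real"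
  proof -
    have "0 \<le> (\<Prod>j<Suc k. inverse (1 + \<zeta> j) ^ \<nu> j)" using that(1) by (intro prod_nonneg) (auto simp: less_imp_le add_pos_pos)
    then show ?thesis
      using X.multi_coeff_root_deriv_bounds(1)[of k \<zeta> \<nu>, OF that] mult_right_mono[OF C0(2)] unfolding mc_def B_def by (meson order_trans)
  qed
  have c2: "norm (mc k \<nu>) \<le> (C0 * b k) * (\<Prod>j<k. inverse (1 + \<zeta> j) ^ \<nu> j)"
    if "\<nu> k = 0" "\<And>j. j < k \<Longrightarrow> \<zeta> j > 0" "(\<Sum>j<k. b j * \<zeta> j) < X.\<delta>'" for k \<nu> and \<zeta> :: "nat \<Rightarrow> real"
  proof -
    have "0 \<le> (\<Prod>j<k. inverse (1 + \<zeta> j) ^ \<nu> j)" using that(2) by (intro prod_nonneg) (auto simp: less_imp_le add_pos_pos)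
    then show ?thesis
      using X.multi_coeff_root_deriv_bounds(2)[of \<nu> k \<zeta>, OF that] mult_right_mono[OF mult_right_mono[OF C0(3) b0[of k]]] unfolding mc_def by (meson order_trans)
  qed
  obtain \<alpha> s d e where \<alpha>: "\<alpha> > 0" and se: "summable s" "summable e" and sde: "\<And>k. s k \<ge> 0 \<and> (\<lambda>\<nu>. rel_gamma \<alpha> b k \<nu> powr p) summable_on multi_index (Suc k) \<and>
       infsum (\<lambda>\<nu>. rel_gamma \<alpha> b k \<nu> powr p) (multi_index (Suc k)) \<le> s k \<and>
       e k \<ge> (0::real) \<and> d k summable_on multi_index (Suc k) \<and> infsum (d k) (multi_index (Suc k)) \<le> e k \<and>
       (\<forall>\<nu>. d k \<nu> \<ge> (0::real) \<and> (\<Prod>j<Suc k. cheb_factor (\<nu> j)) * norm (mc k \<nu>) \<le> rel_gamma \<alpha> b k \<nu> powr (1 - p) * d k \<nu>)"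
    using sparse_coefficients[where c="\<lambda>k \<nu>. norm (mc k \<nu>)" and b=b and \<delta>="X.\<delta>'" and C=C0 and p=p, OF p b0 sbp X.\<delta>'_pos C0(1) c1 c2] by blast
  define R where "R k y = Re (X.root_deriv k (\<lambda>j. of_real (y j)))" for k and y :: "nat \<Rightarrow> real"
  \<comment> \<open>Points of \<open>cube n\<close> are \<open>undefined\<close> from index
    \<open>n\<close> on, while the analytic lemmas ask for all coordinates in the interval; padding
    with 0 reconciles the two.\<close>
  define ext where "ext n y = (\<lambda>j. if j < n then y j else 0)" for n and y :: "nat \<Rightarrow> real"
  have ext: "ext n y j \<in> {-1..1}" if "y \<in> cube n" for n y j using cubeD[OF that] by (auto simp: ext_def)
  have R_ext: "R k y = Re (X.root_deriv k (\<lambda>j. of_real (ext (Suc k) y j)))" for k y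
    unfolding R_def by (intro arg_cong[where f=Re] X.root_deriv_dep) (auto simp: ext_def)
  have R_upd: "R k (z(k := t)) = Re (X.root_deriv k (\<lambda>j. of_real (((ext k z)(k := t)) j)))" for k z t
    unfolding R_def by (intro arg_cong[where f=Re] X.root_deriv_dep) (auto simp: ext_def less_Suc_eq)
  have T_upd: "T k (z(k := t)) = X k ((ext k z)(k := t))" if "z \<in> cube k" for k z t
  proof -
    have "restrict ((ext k z)(k := t)) {..k} = z(k := t)"
      using that by (auto simp: ext_def cube_def PiE_iff extensional_def fun_eq_iff)
    then show ?thesis by (simp add: X_def)
  qed
  have "\<exists>C>0. \<forall>\<epsilon>>0.
           N_card (weight \<alpha> b) \<epsilon> < \<infinity> \<and>
           (\<exists>P :: nat \<Rightarrow> (nat \<Rightarrow> real) \<Rightarrow> real.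
              (\<forall>k. P k \<in> poly_span (Suc k) (Lambda (weight \<alpha> b) \<epsilon> k)) \<and>
              bij_betw (full_map (approx_component P)) cube_inf cube_inf \<and>
              triangular (full_map (approx_component P)) \<and>
              coordinate_monotone (full_map (approx_component P)) \<and>
              (\<Sum>k. Linf_norm (Suc k) (\<lambda>y. T k y - approx_component P k y))
                \<le> rate C p (N_card (weight \<alpha> b) \<epsilon>) \<and>
              (\<forall>k. has_partial k (T k) \<and> has_partial k (approx_component P k)) \<and>
              (\<Sum>k. Linf_norm (Suc k)
                       (\<lambda>y. partial_deriv k (T k) y - partial_deriv k (approx_component P k) y))
                \<le> rate C p (N_card (weight \<alpha> b) \<epsilon>))"
  proof (rule sparse_transport_approximation[where R=R and c="\<lambda>k \<nu>. Re (mc k \<nu>)" and d=d and s=s and e=e, OF p B \<alpha> b0])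
    show "1 / B \<le> R k y + 1 \<and> R k y + 1 \<le> B" if y: "y \<in> cube (Suc k)" for k y
      using X.root_deriv_real_bounds[of "ext (Suc k) y" k] ext[OF y] unfolding R_ext B_def by auto
    \<comment> \<open>The coefficients are complex numbers; as Chebyshev products are real at real
      points, taking real parts preserves the expansion and does not increase the
      coefficients.\<close>
    show "((\<lambda>\<nu>. Re (mc k \<nu>) * cheb_prod (Suc k) \<nu> y) has_sum R k y) (multi_index (Suc k))" if y: "y \<in> cube (Suc k)" for k y
      using has_sum_Re[OF X.root_deriv_expansion[of k y, OF cubeD[OF y]]] by (simp add: R_def mc_def del: multi_coeff.simps)
    show "continuous_on {-1..1} (\<lambda>t. R k (z(k := t)))" if z: "z \<in> cube k" for k z
      unfolding R_upd by (intro continuous_on_Re X.root_deriv_continuous ext[OF z])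
    show "((\<lambda>t. T k (z(k := t))) has_real_derivative (R k (z(k := t)) + 1)\<^sup>2) (at t within {-1..1})"
      if z: "z \<in> cube k" and t: "t \<in> {-1..1}" for k z t
      unfolding R_upd T_upd[OF z] by (rule X.X_deriv[OF ext[OF z] t])
    show "T k (z(k := - 1)) = - 1" "T k (z(k := 1)) = 1" if z: "z \<in> cube k" for k z
      unfolding T_upd[OF z] using ext[OF z] by (auto intro!: X.X_ends)
    show "(\<Prod>j<Suc k. cheb_factor (\<nu> j)) * \<bar>Re (mc k \<nu>)\<bar> \<le> rel_gamma \<alpha> b k \<nu> powr (1 - p) * d k \<nu>" for k \<nu>
    proof -
      have "(\<Prod>j<Suc k. cheb_factor (\<nu> j)) * \<bar>Re (mc k \<nu>)\<bar> \<le> (\<Prod>j<Suc k. cheb_factor (\<nu> j)) * norm (mc k \<nu>)"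
        by (intro mult_left_mono abs_Re_le_cmod prod_nonneg) (auto simp: cheb_factor_def)
      then show ?thesis using sde[of k] order_trans by blast
    qed
  qed (use sde se in auto)
  then show ?thesis using \<alpha> by blast
qed

end
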